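(* Let $G = \mathrm{Sp}_{2n}(\mathbb{C})$ and let $K$ be a symmetric subgroup of $G$ which is either $K = \mathrm{GL}_n(\mathbb{C})$ (type CI) or $K = \mathrm{Sp}_{2p}(\mathbb{C}) \times \mathrm{Sp}_{2q}(\mathbb{C})$ with $n = p + q$ (type CII). If a pair of parabolic subgroups $P \subset G$ and $Q \subset K$ is among the following list (1)--(3), then there are only finitely many $K$-orbits on $G/P \times K/Q$ (diagonal action). (1) $P = P_{(n,n)}$ is a Siegel parabolic subgroup of $G$, and $Q \subset K$ is an arbitrary parabolic subgroup. (2) $P = P_{(1, 2n-2, 1)}$ is a maximal parabolic subgroup of $G$, and $Q \subset K$ is an arbitrary parabolic subgroup. (3) $K = \mathrm{Sp}_{2p} \times \mathrm{Sp}_{2q}$ is of type CII, $P = P_{(m, 2n-2m, m)}$ with $1 < m < n$ is a maximal parabolic subgroup of $G$, and $Q \subset K$ is a product of Siegel parabolic subgroups in $\mathrm{Sp}_{2p}$ and $\mathrm{Sp}_{2q}$.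
   Context: $\mathrm{Sp}_{2n}$ is the symplectic group of $\mathbb{C}^{2n}$ with a non-degenerate symplectic form. In type CI, $K = \mathrm{GL}_n$ is embedded as the simultaneous stabilizer of two complementary Lagrangian subspaces. In type CII, $K = \mathrm{Sp}_{2p} \times \mathrm{Sp}_{2q}$ ($p,q\ge 1$) is embedded as the stabilizer of an orthogonal decomposition $\mathbb{C}^{2n} = \mathbb{C}^{2p} \oplus \mathbb{C}^{2q}$ into symplectic subspaces. $P_{(n,n)}$ denotes a Siegel parabolic subgroup, i.e. the stabilizer in $\mathrm{Sp}_{2n}$ of a Lagrangian ($n$-dimensional totally isotropic) subspace of $\mathbb{C}^{2n}$; Siegel parabolic subgroups of $\mathrm{Sp}_{2p}$ and $\mathrm{Sp}_{2q}$ are defined in the same way. For $0 < m < n$, $P_{(m, 2n-2m, m)}$ denotes the stabilizer in $\mathrm{Sp}_{2n}$ of an $m$-dimensional isotropic subspace of $\mathbb{C}^{2n}$. *)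

theory Defs
  imports
    "HOL-Analysis.Analysis"
    "HOL-Algebra.Group_Action"
    "HOL-Algebra.Left_Coset"
    "HOL-Algebra.Solvable_Groups"
begin

inductive_set polynomial_funs :: "(complex ^ 'd ^ 'd \<Rightarrow> complex) set" where
  const: "(\<lambda>A. c) \<in> polynomial_funs"
| entry: "(\<lambda>A. A $ i $ j) \<in> polynomial_funs"
| add: "f \<in> polynomial_funs \<Longrightarrow> g \<in> polynomial_funs \<Longrightarrow> (\<lambda>A. f A + g A) \<in> polynomial_funs"
| mult: "f \<in> polynomial_funs \<Longrightarrow> g \<in> polynomial_funs \<Longrightarrow> (\<lambda>A. f A * g A) \<in> polynomial_funs"

definition zero_locus :: "(complex ^ 'd ^ 'd \<Rightarrow> complex) set \<Rightarrow> (complex ^ 'd ^ 'd) set" where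
  "zero_locus F = {A. \<forall>f\<in>F. f A = 0}"

definition zariski :: "(complex ^ 'd ^ 'd) topology" where
  "zariski = topology (\<lambda>U. \<exists>F \<subseteq> polynomial_funs. U = - zero_locus F)"

lemma istopology_zariski:
  "istopology (\<lambda>U :: (complex ^ 'd ^ 'd) set. \<exists>F \<subseteq> polynomial_funs. U = - zero_locus F)"
  unfolding istopology_def
proof (intro conjI allI impI)
  fix S T :: "(complex ^ 'd ^ 'd) set"
  assume "\<exists>F \<subseteq> polynomial_funs. S = - zero_locus F" "\<exists>F \<subseteq> polynomial_funs. T = - zero_locus F"
  then obtain F F' where F: "F \<subseteq> polynomial_funs" "S = - zero_locus F"
    and F': "F' \<subseteq> polynomial_funs" "T = - zero_locus F'"
    by blast
  let ?H = "{\<lambda>A. f A * g A | f g. f \<in> F \<and> g \<in> F'}"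
  have "?H \<subseteq> polynomial_funs"
    using F(1) F'(1) by (auto intro: polynomial_funs.mult)
  moreover have "S \<inter> T = - zero_locus ?H"
    unfolding F(2) F'(2) zero_locus_def by fastforce
  ultimately show "\<exists>F \<subseteq> polynomial_funs. S \<inter> T = - zero_locus F"
    by blast
next
  fix \<K> :: "(complex ^ 'd ^ 'd) set set"
  assume "\<forall>S\<in>\<K>. \<exists>F \<subseteq> polynomial_funs. S = - zero_locus F"
  then obtain F where F: "\<And>S. S \<in> \<K> \<Longrightarrow> F S \<subseteq> polynomial_funs \<and> S = - zero_locus (F S)"
    by metis
  have "zero_locus (\<Union>(F ` \<K>)) = (\<Inter>S\<in>\<K>. zero_locus (F S))"
    unfolding zero_locus_def by blast
  then have "\<Union>\<K> = - zero_locus (\<Union>(F ` \<K>))"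
    using F by auto
  then show "\<exists>F \<subseteq> polynomial_funs. \<Union>\<K> = - zero_locus F"
    using F by (intro exI[of _ "\<Union>(F ` \<K>)"]) blast
qed

lemma closedin_zariski_iff:
  "closedin zariski Z \<longleftrightarrow> (\<exists>F \<subseteq> polynomial_funs. Z = zero_locus F)"
proof -
  have op: "openin zariski U \<longleftrightarrow> (\<exists>F \<subseteq> polynomial_funs. U = - zero_locus F)"
    for U :: "(complex ^ 'd ^ 'd) set"
    unfolding zariski_def by (simp add: topology_inverse'[OF istopology_zariski])
  have "zero_locus {} = (UNIV :: (complex ^ 'd ^ 'd) set)"
    "zero_locus {\<lambda>A. 1} = ({} :: (complex ^ 'd ^ 'd) set)"
    by (auto simp: zero_locus_def)
  then have "openin zariski (UNIV :: (complex ^ 'd ^ 'd) set)"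
    unfolding op by (intro exI[of _ "{\<lambda>A. 1}"]) (auto intro: polynomial_funs.const)
  then have "topspace zariski = (UNIV :: (complex ^ 'd ^ 'd) set)"
    using openin_subset by blast
  then show ?thesis
    unfolding closedin_def op by (auto simp: Compl_eq_Diff_UNIV[symmetric])
qed

text \<open>
  For the Borel and parabolic subgroups below, \<open>G\<close> is a group of invertible matrices under
  matrix multiplication.  Its Zariski topology is the subspace topology; allowing \<open>1 / det\<close> in the equations would not add closed sets.
\<close>

definition zariski_closed_subgroup :: "(complex ^ 'd ^ 'd) set \<Rightarrow> (complex ^ 'd ^ 'd) monoid \<Rightarrow> bool" where
  "zariski_closed_subgroup H G \<longleftrightarrow>
     subgroup H G \<and> closedin (subtopology zariski (carrier G)) H"

definition connected_solvable_subgroup :: "(complex ^ 'd ^ 'd) set \<Rightarrow> (complex ^ 'd ^ 'd) monoid \<Rightarrow> bool" where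
  "connected_solvable_subgroup H G \<longleftrightarrow>
     zariski_closed_subgroup H G \<and> connectedin zariski H \<and> solvable (G\<lparr>carrier := H\<rparr>)"

definition borel_subgroup :: "(complex ^ 'd ^ 'd) set \<Rightarrow> (complex ^ 'd ^ 'd) monoid \<Rightarrow> bool" where
  "borel_subgroup B G \<longleftrightarrow>
     connected_solvable_subgroup B G \<and>
     (\<forall>H. connected_solvable_subgroup H G \<and> B \<subseteq> H \<longrightarrow> H = B)"

definition parabolic_subgroup :: "(complex ^ 'd ^ 'd) set \<Rightarrow> (complex ^ 'd ^ 'd) monoid \<Rightarrow> bool" where
  "parabolic_subgroup Q G \<longleftrightarrow>
     zariski_closed_subgroup Q G \<and> (\<exists>B. borel_subgroup B G \<and> B \<subseteq> Q)"

type_synonym 'd form = "complex ^ 'd \<Rightarrow> complex ^ 'd \<Rightarrow> complex"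

definition nondegenerate_on :: "'d::finite form \<Rightarrow> (complex ^ 'd) set \<Rightarrow> bool" where
  "nondegenerate_on \<omega> V \<longleftrightarrow> (\<forall>x\<in>V. (\<forall>y\<in>V. \<omega> x y = 0) \<longrightarrow> x = 0)"

definition symplectic_form :: "'d::finite form \<Rightarrow> bool" where
  "symplectic_form \<omega> \<longleftrightarrow>
     (\<forall>x. Vector_Spaces.linear (*s) (*) (\<lambda>y. \<omega> x y)) \<and>
     (\<forall>y. Vector_Spaces.linear (*s) (*) (\<lambda>x. \<omega> x y)) \<and>
     (\<forall>x. \<omega> x x = 0) \<and>
     nondegenerate_on \<omega> UNIV"

definition Sp :: "'d::finite form \<Rightarrow> (complex ^ 'd ^ 'd) monoid" where
  "Sp \<omega> = \<lparr>carrier = {A. invertible A \<and> (\<forall>x y. \<omega> (A *v x) (A *v y) = \<omega> x y)},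
          mult = (**), one = mat 1\<rparr>"

abbreviation stab :: "(complex ^ 'd ^ 'd) monoid \<Rightarrow> (complex ^ 'd) set \<Rightarrow> (complex ^ 'd ^ 'd) set" where
  "stab G \<equiv> stabilizer G (\<lambda>A U. (*v) A ` U)"

definition isotropic :: "'d::finite form \<Rightarrow> (complex ^ 'd) set \<Rightarrow> bool" where
  "isotropic \<omega> U \<longleftrightarrow> vec.subspace U \<and> (\<forall>x\<in>U. \<forall>y\<in>U. \<omega> x y = 0)"

definition lagrangian_in :: "'d::finite form \<Rightarrow> (complex ^ 'd) set \<Rightarrow> (complex ^ 'd) set \<Rightarrow> bool" where
  "lagrangian_in \<omega> V L \<longleftrightarrow> isotropic \<omega> L \<and> L \<subseteq> V \<and> 2 * vec.dim L = vec.dim V"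

definition direct_decomposition :: "(complex ^ 'd::finite) set \<Rightarrow> (complex ^ 'd) set \<Rightarrow> bool" where
  "direct_decomposition U W \<longleftrightarrow>
     vec.subspace U \<and> vec.subspace W \<and> U \<inter> W = {0} \<and> (\<forall>v. \<exists>u\<in>U. \<exists>w\<in>W. v = u + w)"

definition type_CI :: "'d::finite form \<Rightarrow> (complex ^ 'd ^ 'd) set \<Rightarrow> bool" where
  "type_CI \<omega> K \<longleftrightarrow>
     (\<exists>U W. lagrangian_in \<omega> UNIV U \<and> lagrangian_in \<omega> UNIV W \<and> direct_decomposition U W \<and>
        K = stab (Sp \<omega>) U \<inter> stab (Sp \<omega>) W)"

definition type_CII ::
  "'d::finite form \<Rightarrow> nat \<Rightarrow> nat \<Rightarrow> (complex ^ 'd) set \<Rightarrow> (complex ^ 'd) set \<Rightarrow> (complex ^ 'd ^ 'd) set \<Rightarrow> bool" where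
  "type_CII \<omega> p q U W K \<longleftrightarrow>
     1 \<le> p \<and> 1 \<le> q \<and> direct_decomposition U W \<and> vec.dim U = 2 * p \<and> vec.dim W = 2 * q \<and>
     (\<forall>u\<in>U. \<forall>w\<in>W. \<omega> u w = 0) \<and> nondegenerate_on \<omega> U \<and> nondegenerate_on \<omega> W \<and>
     K = stab (Sp \<omega>) U \<inter> stab (Sp \<omega>) W"

definition siegel_parabolic :: "'d::finite form \<Rightarrow> (complex ^ 'd ^ 'd) set \<Rightarrow> bool" where
  "siegel_parabolic \<omega> P \<longleftrightarrow> (\<exists>L. lagrangian_in \<omega> UNIV L \<and> P = stab (Sp \<omega>) L)"

text \<open>This is \<open>P_(m, 2n-2m, m)\<close> with \<open>0 < m < n\<close>, where \<open>CARD('d) = 2n\<close>.\<close>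

definition isotropic_parabolic :: "'d::finite form \<Rightarrow> nat \<Rightarrow> (complex ^ 'd ^ 'd) set \<Rightarrow> bool" where
  "isotropic_parabolic \<omega> m P \<longleftrightarrow>
     0 < m \<and> 2 * m < CARD('d) \<and> (\<exists>U. isotropic \<omega> U \<and> vec.dim U = m \<and> P = stab (Sp \<omega>) U)"

text \<open>
  Let \<open>K = Sp(U) \<times> Sp(W)\<close> be realized as the stabilizer of \<open>U\<close> and \<open>W\<close> in the big symplectic group.
  The product of the stabilizers of \<open>L \<subseteq> U\<close> in \<open>Sp(U)\<close> and of \<open>M \<subseteq> W\<close> in \<open>Sp(W)\<close> consists of the
  elements of \<open>K\<close> that stabilize both \<open>L\<close> and \<open>M\<close>.
\<close>

definition siegel_product ::
  "'d::finite form \<Rightarrow> (complex ^ 'd) set \<Rightarrow> (complex ^ 'd) set \<Rightarrow> (complex ^ 'd ^ 'd) set \<Rightarrow> (complex ^ 'd ^ 'd) set \<Rightarrow> bool" where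
  "siegel_product \<omega> U W K Q \<longleftrightarrow>
     (\<exists>L M. lagrangian_in \<omega> U L \<and> lagrangian_in \<omega> W M \<and>
        Q = stab (Sp \<omega>\<lparr>carrier := K\<rparr>) L \<inter> stab (Sp \<omega>\<lparr>carrier := K\<rparr>) M)"

definition double_flag ::
  "('a, 'b) monoid_scheme \<Rightarrow> 'a set \<Rightarrow> 'a set \<Rightarrow> 'a set \<Rightarrow> ('a set \<times> 'a set) set" where
  "double_flag G K P Q = (lcosets\<^bsub>G\<^esub> P) \<times> (lcosets\<^bsub>G\<lparr>carrier := K\<rparr>\<^esub> Q)"

text \<open>Restricted to the double flag variety, as \<^locale>\<open>group_action\<close> uses extensional functions.\<close>

definition diagonal_action ::
  "('a, 'b) monoid_scheme \<Rightarrow> 'a set \<Rightarrow> 'a set \<Rightarrow> 'a set \<Rightarrow> 'a \<Rightarrow> 'a set \<times> 'a set \<Rightarrow> 'a set \<times> 'a set" where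
  "diagonal_action G K P Q k =
     restrict (\<lambda>(X, Y). (k <#\<^bsub>G\<^esub> X, k <#\<^bsub>G\<^esub> Y)) (double_flag G K P Q)"

end

theory Submission
  imports Defs "HOL-Computational_Algebra.Fundamental_Theorem_Algebra"
begin

text \<open>
  Moving the second factor of a pair of cosets to the base coset turns the \<open>K\<close>-orbits on
  \<open>G/P \<times> K/Q\<close> into the \<open>Q\<close>-orbits on \<open>G/P\<close>, that is, on
  the subspaces conjugate under \<open>Sp\<close> to the one that \<open>P\<close> stabilizes. So it
  suffices that these subspaces fall into finitely many classes under the isometries of the whole
  space that lie in \<open>Q\<close> (\<open>finite_orbits_of_types\<close>). Everything else is the
  classification of an isotropic subspace relative to a configuration of subspaces whose common
  stabilizer is contained in \<open>Q\<close>.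

  In the cases (1) and (2) that configuration comes from a Borel subgroup \<open>B\<close> of
  \<open>K\<close> contained in \<open>Q\<close>. The group \<open>K\<close> preserves two subspaces
  \<open>U\<close> and \<open>W\<close>. By the Lie--Kolchin theorem \<open>B\<close> stabilizes a
  complete flag of the Lagrangian subspace \<open>U\<close> (type CI), or complete self-dual flags of
  \<open>U\<close> and of \<open>W\<close> (type CII). The group of all isometries that stabilize
  these flags, and \<open>W\<close> in type CI, is Zariski closed, solvable and connected, hence equal
  to \<open>B\<close> by maximality (\<open>borel_polarized_chain\<close>,
  \<open>borel_orthogonal_chains\<close>).

  The classification uses normal bases. These are bases in which the form has matrix entries in
  \<open>{0, 1, -1}\<close> and in which each subspace of the configuration is spanned by vectors with
  coordinates in \<open>{0, 1, -1}\<close>. Finitely many data determine a configuration with a normal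
  basis up to isomorphism, so there are only finitely many isomorphism types
  (\<open>finite_isomorphism_types\<close>). Normal bases are constructed by induction on the
  dimension: one finds one or two hyperbolic pairs adapted to all subspaces of the configuration and
  passes to their orthogonal complement (\<open>orthogonal_chains_lagrangian\<close>,
  \<open>orthogonal_chains_line\<close>, \<open>polarized_chain_lagrangian\<close>,
  \<open>polarized_chain_line\<close>).

  In the case (3) the subgroup \<open>Q\<close> is the stabilizer of \<open>U\<close>,
  \<open>W\<close> and of Lagrangian subspaces \<open>L\<close> of \<open>U\<close> and
  \<open>M\<close> of \<open>W\<close>. Let \<open>p\<close> and \<open>q\<close> be the projections
  to \<open>U\<close> and \<open>W\<close>. On an isotropic subspace \<open>X\<close> the forms
  \<open>\<omega> (p x) (p y)\<close> and \<open>\<omega> (q x) (q y)\<close> differ only by the sign,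
  so that both \<open>X \<inter> p\<^sup>-\<^sup>1 L\<close> and \<open>X \<inter> q\<^sup>-\<^sup>1
  M\<close> are isotropic for the first form, while \<open>X \<inter> W\<close> and \<open>X \<inter>
  U\<close> lie in its radical. A possibly degenerate space with four such subspaces has a normal
  basis (\<open>isotropic_pair_has_normal_basis\<close>). An isomorphism between two spaces
  \<open>X\<close> and \<open>X'\<close> that respects these data induces isometries from \<open>p
  X\<close> to \<open>p X'\<close> and from \<open>q X\<close> to \<open>q X'\<close>, and by a
  theorem of Witt type (\<open>isometry_extends\<close>) they extend to isometries of \<open>U\<close>
  and \<open>W\<close> that preserve \<open>L\<close> and \<open>M\<close>. Together these form an
  element of \<open>Q\<close> that maps \<open>X\<close> to \<open>X'\<close>.
\<close>

section \<open>Alternating forms\<close>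

locale alternating =
  fixes \<beta> :: "'d::finite form"
  assumes linear_right: "Vector_Spaces.linear (*s) (*) (\<lambda>y. \<beta> x y)"
    and linear_left: "Vector_Spaces.linear (*s) (*) (\<lambda>x. \<beta> x y)"
    and self [simp]: "\<beta> x x = 0"
begin

lemma add_right [simp]: "\<beta> x (y + z) = \<beta> x y + \<beta> x z"
  and diff_right [simp]: "\<beta> x (y - z) = \<beta> x y - \<beta> x z"
  and scale_right [simp]: "\<beta> x (c *s y) = c * \<beta> x y"
  and zero_right [simp]: "\<beta> x 0 = 0"
  and minus_right [simp]: "\<beta> x (- y) = - \<beta> x y"
proof -
  interpret l: Vector_Spaces.linear "(*s)" "(*)" "\<lambda>y. \<beta> x y" by (rule linear_right)
  show "\<beta> x (y + z) = \<beta> x y + \<beta> x z" "\<beta> x (y - z) = \<beta> x y - \<beta> x z" "\<beta> x (c *s y) = c * \<beta> x y"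
    "\<beta> x 0 = 0" "\<beta> x (- y) = - \<beta> x y"
    by (simp_all add: l.add l.diff l.scale l.zero l.neg)
qed

lemma add_left [simp]: "\<beta> (x + y) z = \<beta> x z + \<beta> y z"
  and diff_left [simp]: "\<beta> (x - y) z = \<beta> x z - \<beta> y z"
  and scale_left [simp]: "\<beta> (c *s x) z = c * \<beta> x z"
  and zero_left [simp]: "\<beta> 0 z = 0"
  and minus_left [simp]: "\<beta> (- x) z = - \<beta> x z"
proof -
  interpret l: Vector_Spaces.linear "(*s)" "(*)" "\<lambda>x. \<beta> x z" by (rule linear_left)
  show "\<beta> (x + y) z = \<beta> x z + \<beta> y z" "\<beta> (x - y) z = \<beta> x z - \<beta> y z" "\<beta> (c *s x) z = c * \<beta> x z"
    "\<beta> 0 z = 0" "\<beta> (- x) z = - \<beta> x z"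
    by (simp_all add: l.add l.diff l.scale l.zero l.neg)
qed

lemma skew: "\<beta> x y = - \<beta> y x"
proof -
  have "\<beta> x y + \<beta> y x = \<beta> (x + y) (x + y)" by (simp del: self add: self[of x] self[of y])
  then have "\<beta> x y + \<beta> y x = 0" by (simp only: self)
  then show ?thesis by (rule eq_neg_iff_add_eq_0[THEN iffD2])
qed

lemma subspace_perp: "vec.subspace V \<Longrightarrow> vec.subspace {x \<in> V. \<forall>y\<in>S. \<beta> x y = 0}"
  by (auto simp: vec.subspace_def)

lemma span_perp:
  assumes "\<And>y. y \<in> S \<Longrightarrow> \<beta> x y = 0" "y \<in> vec.span S"
  shows "\<beta> x y = 0"
  using assms(2) by (induction rule: vec.span_induct_alt) (simp_all add: assms(1))

text \<open>
  This is the statement that a functional which vanishes wherever finitely many functionals vanish is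
  a combination of them. The induction shrinks the test space \<open>V\<close> to the kernel of one
  functional at a time, and for this reason \<open>V\<close> is generalized.
\<close>

lemma vanishing_form_in_span:
  assumes "finite S" "vec.subspace V" "S \<subseteq> V" "x \<in> V"
    and "\<And>z. z \<in> V \<Longrightarrow> (\<forall>s\<in>S. \<beta> s z = 0) \<Longrightarrow> \<beta> x z = 0"
  shows "\<exists>s\<in>vec.span S. \<forall>z\<in>V. \<beta> x z = \<beta> s z"
proof -
  have *: "\<exists>s\<in>vec.span S. \<forall>z\<in>V'. \<beta> x z = \<beta> s z"
    if "vec.subspace V'" "\<And>z. z \<in> V' \<Longrightarrow> (\<forall>s\<in>S. \<beta> s z = 0) \<Longrightarrow> \<beta> x z = 0" for V'
    using assms(1) that
  proof (induction S arbitrary: V' rule: finite_induct)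
    case empty
    then show ?case by (intro bexI[of _ 0]) (auto simp: vec.span_zero)
  next
    case (insert t S)
    let ?V = "{z \<in> V'. \<beta> t z = 0}"
    have "vec.subspace ?V" using insert.prems(1) by (auto simp: vec.subspace_def)
    from insert.IH[OF this] insert.prems(2) obtain s where
      s: "s \<in> vec.span S" "\<And>z. z \<in> V' \<Longrightarrow> \<beta> t z = 0 \<Longrightarrow> \<beta> x z = \<beta> s z"
      by auto
    show ?case
    proof (cases "\<exists>v\<in>V'. \<beta> t v \<noteq> 0")
      case False
      then have "\<beta> x z = \<beta> s z" if "z \<in> V'" for z using s(2) that by blast
      moreover have "s \<in> vec.span (insert t S)" using s(1) vec.span_mono[of S "insert t S"] by blast
      ultimately show ?thesis by blast
    next
      case True
      then obtain v where v: "v \<in> V'" "\<beta> t v \<noteq> 0" by blast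
      define c where "c = (\<beta> x v - \<beta> s v) / \<beta> t v"
      have "\<beta> x z = \<beta> (s + c *s t) z" if "z \<in> V'" for z
      proof -
        let ?w = "z - (\<beta> t z / \<beta> t v) *s v"
        have "?w \<in> V'" using insert.prems(1) that v by (simp add: vec.subspace_diff vec.subspace_scale)
        moreover have "\<beta> t ?w = 0" using v by simp
        ultimately have "\<beta> x ?w = \<beta> s ?w" by (rule s(2))
        then show ?thesis using v by (simp add: c_def field_simps)
      qed
      moreover have "s + c *s t \<in> vec.span (insert t S)"
        using s(1) vec.span_mono[of S "insert t S"] vec.span_scale[OF vec.span_base[of t "insert t S"]]
        by (intro vec.span_add) auto
      ultimately show ?thesis by blast
    qed
  qed
  then show ?thesis using assms by blast
qed

text \<open>
  The conclusion gives \<open>s\<close> only modulo the radical of \<open>V\<close>, since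
  \<open>V\<close> may be degenerate.
\<close>

lemma double_perp:
  assumes "vec.subspace S" "vec.subspace V" "S \<subseteq> V" "x \<in> V"
    and "\<And>z. z \<in> V \<Longrightarrow> (\<forall>s\<in>S. \<beta> s z = 0) \<Longrightarrow> \<beta> x z = 0"
  obtains s where "s \<in> S" "\<And>z. z \<in> V \<Longrightarrow> \<beta> x z = \<beta> s z"
proof -
  obtain B where B: "B \<subseteq> S" "vec.independent B" "S \<subseteq> vec.span B" using vec.basis_exists by metis
  have "finite B" using B(2) by (rule vec.finiteI_independent)
  have SB: "vec.span B = S" using B assms(1) by (simp add: subset_antisym vec.span_minimal)
  have "\<forall>s\<in>S. \<beta> s z = 0" if "\<forall>s\<in>B. \<beta> s z = 0" for z
  proof
    fix s assume "s \<in> S"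
    have "\<beta> z b = 0" if "b \<in> B" for b using \<open>\<forall>s\<in>B. \<beta> s z = 0\<close> that skew[of z b] by simp
    then have "\<beta> z s = 0" using span_perp[of B z s] \<open>s \<in> S\<close> SB by blast
    then show "\<beta> s z = 0" using skew[of s z] by simp
  qed
  then have "\<exists>s\<in>vec.span B. \<forall>z\<in>V. \<beta> x z = \<beta> s z"
    using assms B(1) by (intro vanishing_form_in_span[OF \<open>finite B\<close> assms(2)]) auto
  then show ?thesis using that SB by blast
qed

lemma separating_vector:
  assumes "vec.subspace S" "vec.subspace V" "S \<subseteq> V" "nondegenerate_on \<beta> V" "x \<in> V" "x \<notin> S"
  obtains p where "p \<in> V" "\<beta> x p = 1" "\<And>s. s \<in> S \<Longrightarrow> \<beta> s p = 0"
proof -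
  have "\<exists>z\<in>V. (\<forall>s\<in>S. \<beta> s z = 0) \<and> \<beta> x z \<noteq> 0"
  proof (rule ccontr)
    assume "\<not> ?thesis"
    then obtain s where s: "s \<in> S" "\<And>z. z \<in> V \<Longrightarrow> \<beta> x z = \<beta> s z"
      using double_perp[OF assms(1-3,5)] by blast
    then have "x - s \<in> V" "\<forall>z\<in>V. \<beta> (x - s) z = 0"
      using assms(2,3,5) by (auto intro: vec.subspace_diff)
    then have "x - s = 0" using assms(4) unfolding nondegenerate_on_def by blast
    with s assms(6) show False by simp
  qed
  then obtain z where z: "z \<in> V" "\<forall>s\<in>S. \<beta> s z = 0" "\<beta> x z \<noteq> 0" by blast
  show ?thesis
    by (rule that[of "(1 / \<beta> x z) *s z"]) (use z assms(2) in \<open>auto intro: vec.subspace_scale\<close>)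
qed

lemma nondegenerate_pairing:
  assumes "vec.subspace V" "nondegenerate_on \<beta> V" "x \<in> V" "x \<noteq> 0"
  obtains p where "p \<in> V" "\<beta> x p = 1"
  using separating_vector[of "{0}" V x] assms by (auto simp: vec.subspace_0)

end

section \<open>Normal bases\<close>

definition small_combinations :: "(complex ^ 'd::finite) set \<Rightarrow> (complex ^ 'd) set" where
  "small_combinations B = {\<Sum>b\<in>B. c b *s b | c. c ` B \<subseteq> {0, 1, -1}}"

text \<open>
  The coefficients \<open>0, 1, -1\<close> make all data of a configuration of subspaces finite once
  the number of basis vectors is fixed. Only the intersections \<open>V \<inter> Y\<close> count, so
  that a family of subspaces of a big space may be kept unchanged while \<open>V\<close> shrinks.
\<close>

definition normal_basis ::
  "'d::finite form \<Rightarrow> (complex ^ 'd) set \<Rightarrow> (complex ^ 'd) set set \<Rightarrow> (complex ^ 'd) set \<Rightarrow> bool" where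
  "normal_basis \<beta> V \<Y> B \<longleftrightarrow>
     vec.independent B \<and> vec.span B = V \<and> (\<forall>b\<in>B. \<forall>b'\<in>B. \<beta> b b' \<in> {0, 1, -1}) \<and>
     (\<forall>Y\<in>\<Y>. V \<inter> Y \<subseteq> vec.span (V \<inter> Y \<inter> small_combinations B))"

definition has_normal_basis :: "'d::finite form \<Rightarrow> (complex ^ 'd) set \<Rightarrow> (complex ^ 'd) set set \<Rightarrow> bool" where
  "has_normal_basis \<beta> V \<Y> \<longleftrightarrow> (\<exists>B. normal_basis \<beta> V \<Y> B)"

lemma small_combinations_mono:
  assumes "B \<subseteq> C" "finite C"
  shows "small_combinations B \<subseteq> small_combinations C"
proof
  fix x assume "x \<in> small_combinations B"
  then obtain c where c: "x = (\<Sum>b\<in>B. c b *s b)" "c ` B \<subseteq> {0, 1, -1}"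
    unfolding small_combinations_def by blast
  let ?c = "\<lambda>b. if b \<in> B then c b else 0"
  have "x = (\<Sum>b\<in>C. ?c b *s b)"
    unfolding c(1) using assms by (intro sum.mono_neutral_cong_left) auto
  moreover have "?c ` C \<subseteq> {0, 1, -1}" using c(2) by auto
  ultimately show "x \<in> small_combinations C"
    unfolding small_combinations_def by (intro CollectI exI[of _ ?c] conjI)
qed

lemma sum_in_small_combinations:
  assumes "finite B" "A \<subseteq> B"
  shows "\<Sum>A \<in> small_combinations B"
proof -
  let ?c = "\<lambda>b. if b \<in> A then 1 else (0::complex)"
  have "\<Sum>A = (\<Sum>b\<in>B. ?c b *s b)"
    using assms by (intro sum.mono_neutral_cong_left) auto
  moreover have "?c ` B \<subseteq> {0, 1, -1}" by auto
  ultimately show ?thesis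
    unfolding small_combinations_def by (intro CollectI exI[of _ ?c] conjI)
qed

lemma small_combination_base: "finite B \<Longrightarrow> b \<in> B \<Longrightarrow> b \<in> small_combinations B"
  using sum_in_small_combinations[of B "{b}"] by simp

lemma small_combination_add: "finite B \<Longrightarrow> a \<in> B \<Longrightarrow> b \<in> B \<Longrightarrow> a \<noteq> b \<Longrightarrow> a + b \<in> small_combinations B"
  using sum_in_small_combinations[of B "{a, b}"] by simp

lemma small_combination_add3:
  assumes "finite B" "a \<in> B" "b \<in> B" "c \<in> B" "a \<noteq> b" "a \<noteq> c" "b \<noteq> c"
  shows "a + b + c \<in> small_combinations B"
  using sum_in_small_combinations[of B "{a, b, c}"] assms by (simp add: add.assoc)

lemma independent_Un_of_retraction:
  fixes \<pi> :: "complex ^ 'd::finite \<Rightarrow> complex ^ 'd"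
  assumes "Vector_Spaces.linear (*s) (*s) \<pi>" "vec.independent B" "vec.independent C"
    and "\<And>b. b \<in> B \<Longrightarrow> \<pi> b = b" "\<And>c. c \<in> C \<Longrightarrow> \<pi> c = 0"
  shows "vec.independent (B \<union> C)"
proof -
  interpret l: Vector_Spaces.linear "(*s)" "(*s)" \<pi> by fact
  have fin: "finite B" "finite C" using assms(2,3) by (auto intro: vec.finiteI_independent)
  have nz: "0 \<notin> B" using assms(2) vec.dependent_zero by blast
  have disj: "B \<inter> C = {}" using assms(4,5) nz by force
  show ?thesis
  proof (rule vec.independent_if_scalars_zero)
    show "finite (B \<union> C)" using fin by simp
    fix f x assume *: "(\<Sum>x\<in>B \<union> C. f x *s x) = 0" and x: "x \<in> B \<union> C"
    have split: "(\<Sum>x\<in>B. f x *s x) + (\<Sum>x\<in>C. f x *s x) = 0"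
      using * fin disj by (simp add: sum.union_disjoint)
    have "\<pi> ((\<Sum>x\<in>B. f x *s x) + (\<Sum>x\<in>C. f x *s x)) = (\<Sum>x\<in>B. f x *s x)"
      using assms(4,5) by (simp add: l.add l.sum l.scale)
    then have B: "(\<Sum>x\<in>B. f x *s x) = 0" using split by (simp add: l.zero)
    then have C: "(\<Sum>x\<in>C. f x *s x) = 0" using split by simp
    from B C x show "f x = 0"
      using assms(2,3) fin vec.independentD[of B B f x] vec.independentD[of C C f x] by blast
  qed
qed

text \<open>
  This is the induction step of all constructions of normal bases. If the retraction
  \<open>\<pi>\<close> onto the span of \<open>B\<close> has a kernel orthogonal to \<open>B\<close>,
  then a normal basis of the kernel together with \<open>B\<close> is a basis with small Gram matrix.
  A subspace \<open>Y\<close> causes no trouble if \<open>\<pi>\<close> maps it into the part of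
  \<open>Y\<close> that small combinations of \<open>B\<close> span, because then \<open>y - \<pi>
  y\<close> also lies in \<open>Y\<close>. The map \<open>\<pi>\<close> need not be the orthogonal
  projection, and \<open>B\<close> may meet the radical.
\<close>

lemma (in alternating) has_normal_basis_peel:
  assumes V: "vec.subspace V" and B: "B \<subseteq> V" "vec.independent B"
    and gram: "\<And>b b'. b \<in> B \<Longrightarrow> b' \<in> B \<Longrightarrow> \<beta> b b' \<in> {0, 1, -1}"
    and lin: "Vector_Spaces.linear (*s) (*s) \<pi>"
    and ran: "\<And>x. x \<in> V \<Longrightarrow> \<pi> x \<in> vec.span B"
    and idem: "\<And>b. b \<in> B \<Longrightarrow> \<pi> b = b"
    and orth: "\<And>b x. b \<in> B \<Longrightarrow> x \<in> V \<Longrightarrow> \<pi> x = 0 \<Longrightarrow> \<beta> b x = 0"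
    and sub: "\<And>Y. Y \<in> \<Y> \<Longrightarrow> vec.subspace Y"
    and split: "\<And>Y y. Y \<in> \<Y> \<Longrightarrow> y \<in> V \<Longrightarrow> y \<in> Y \<Longrightarrow> \<pi> y \<in> vec.span (Y \<inter> small_combinations B)"
    and rest: "has_normal_basis \<beta> {x \<in> V. \<pi> x = 0} \<Y>"
  shows "has_normal_basis \<beta> V \<Y>"
proof -
  interpret l: Vector_Spaces.linear "(*s)" "(*s)" \<pi> by fact
  let ?V = "{x \<in> V. \<pi> x = 0}"
  obtain C where C: "vec.independent C" "vec.span C = ?V" "\<And>c c'. c \<in> C \<Longrightarrow> c' \<in> C \<Longrightarrow> \<beta> c c' \<in> {0, 1, -1}"
    "\<And>Y. Y \<in> \<Y> \<Longrightarrow> ?V \<inter> Y \<subseteq> vec.span (?V \<inter> Y \<inter> small_combinations C)"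
    using rest unfolding has_normal_basis_def normal_basis_def by blast
  have fin: "finite B" "finite C" using B(2) C(1) by (auto intro: vec.finiteI_independent)
  have CV: "c \<in> V" "\<pi> c = 0" if "c \<in> C" for c
    using that C(2) vec.span_superset[of C] by auto
  have spanB: "vec.span B \<subseteq> V" using B(1) V by (rule vec.span_minimal)
  have pi2: "\<pi> y = y" if "y \<in> vec.span B" for y
    using that by (induction rule: vec.span_induct_alt) (simp_all add: l.zero l.add l.scale idem)
  have rem: "y - \<pi> y \<in> ?V" if "y \<in> V" for y
    using that ran[OF that] spanB V by (auto simp: vec.subspace_diff l.diff pi2)
  have "normal_basis \<beta> V \<Y> (B \<union> C)"
    unfolding normal_basis_def
  proof (intro conjI ballI subset_antisym)
    show "vec.independent (B \<union> C)"
      using lin B(2) C(1) idem CV(2) by (rule independent_Un_of_retraction)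
    show "vec.span (B \<union> C) \<subseteq> V"
      using B(1) CV(1) V by (intro vec.span_minimal) auto
    show "V \<subseteq> vec.span (B \<union> C)"
    proof
      fix y assume y: "y \<in> V"
      have "\<pi> y \<in> vec.span (B \<union> C)" using ran[OF y] vec.span_mono[of B "B \<union> C"] by auto
      moreover have "y - \<pi> y \<in> vec.span (B \<union> C)"
        using rem[OF y] C(2) vec.span_mono[of C "B \<union> C"] by auto
      ultimately have "\<pi> y + (y - \<pi> y) \<in> vec.span (B \<union> C)" by (rule vec.span_add)
      then show "y \<in> vec.span (B \<union> C)" by simp
    qed
    fix b b' assume b: "b \<in> B \<union> C" "b' \<in> B \<union> C"
    have "\<beta> b c = 0" "\<beta> c b = 0" if "b \<in> B" "c \<in> C" for b c
      using orth[OF that(1) CV[OF that(2)]] skew[of c b] by auto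
    then show "\<beta> b b' \<in> {0, 1, -1}" using b gram C(3) by (metis Un_iff insertI1)
  next
    fix Y assume Y: "Y \<in> \<Y>"
    let ?S = "vec.span (V \<inter> Y \<inter> small_combinations (B \<union> C))"
    show "V \<inter> Y \<subseteq> ?S"
    proof
      fix y assume y: "y \<in> V \<inter> Y"
      have "small_combinations B \<subseteq> V"
        using B(1) V unfolding small_combinations_def by (auto intro!: vec.subspace_sum vec.subspace_scale)
      then have "vec.span (Y \<inter> small_combinations B) \<subseteq> ?S"
        using small_combinations_mono[of B "B \<union> C"] fin by (intro vec.span_mono) auto
      with split[OF Y] y have 1: "\<pi> y \<in> ?S" by blast
      have "vec.span (Y \<inter> small_combinations B) \<subseteq> Y"
        using sub[OF Y] by (intro vec.span_minimal) auto
      with split[OF Y] y sub[OF Y] have "y - \<pi> y \<in> Y"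
        by (meson IntD1 IntD2 in_mono vec.subspace_diff)
      with rem y C(4)[OF Y] have "y - \<pi> y \<in> vec.span (?V \<inter> Y \<inter> small_combinations C)" by blast
      moreover have "vec.span (?V \<inter> Y \<inter> small_combinations C) \<subseteq> ?S"
        using small_combinations_mono[of C "B \<union> C"] fin by (intro vec.span_mono) auto
      ultimately have "\<pi> y + (y - \<pi> y) \<in> ?S" using 1 by (meson in_mono vec.span_add)
      then show "y \<in> ?S" by simp
    qed
  qed
  then show ?thesis unfolding has_normal_basis_def by blast
qed

lemma linear_vecI:
  fixes g :: "complex ^ 'a::finite \<Rightarrow> complex ^ 'b::finite"
  assumes "\<And>x y. g (x + y) = g x + g y" "\<And>c x. g (c *s x) = c *s g x"
  shows "Vector_Spaces.linear (*s) (*s) g"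
  using assms by unfold_locales (simp_all add: vec.scale_right_distrib vec.scale_left_distrib)

lemma has_normal_basis_zero: "has_normal_basis \<beta> {0} \<Y>"
  unfolding has_normal_basis_def normal_basis_def
  by (intro exI[of _ "{}"]) (auto simp: vec.independent_empty vec.span_zero)

lemma has_normal_basis_Int:
  "has_normal_basis \<beta> V ((\<lambda>Y. Y \<inter> V) ` \<Y>) \<longleftrightarrow> has_normal_basis \<beta> V \<Y>"
proof -
  have "V \<inter> (Y \<inter> V) = V \<inter> Y" for Y by blast
  then show ?thesis unfolding has_normal_basis_def normal_basis_def by simp
qed

section \<open>Finitely many isomorphism types\<close>

context alternating
begin

lemma isometry_on_span:
  assumes "Vector_Spaces.linear (*s) (*s) g"
    and "\<And>b b'. b \<in> B \<Longrightarrow> b' \<in> B \<Longrightarrow> \<beta> (g b) (g b') = \<beta> b b'"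
    and "x \<in> vec.span B" "y \<in> vec.span B"
  shows "\<beta> (g x) (g y) = \<beta> x y"
proof -
  interpret l: Vector_Spaces.linear "(*s)" "(*s)" g by fact
  have *: "\<beta> (g b) (g y) = \<beta> b y" if "b \<in> B" for b
    using assms(4) by (induction rule: vec.span_induct_alt) (simp_all add: l.zero l.add l.scale assms(2) that)
  show ?thesis
    using assms(3) by (induction rule: vec.span_induct_alt) (simp_all add: l.zero l.add l.scale *)
qed

text \<open>
  The type of a configuration consists of the number of basis vectors, their Gram matrix, and for each
  subspace the set of small coordinate vectors that belong to it. There are finitely many types. If
  two configurations have the same type, the linear map that matches the two normal bases is an
  isomorphism, because each subspace is spanned by its small combinations.
\<close>

lemma finite_isomorphism_types:
  fixes V :: "'s \<Rightarrow> (complex ^ 'd) set" and Y :: "'s \<Rightarrow> 'i \<Rightarrow> (complex ^ 'd) set"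
  assumes I: "finite I"
    and sub: "\<And>s i. s \<in> S \<Longrightarrow> i \<in> I \<Longrightarrow> vec.subspace (Y s i)"
    and nb: "\<And>s. s \<in> S \<Longrightarrow> has_normal_basis \<beta> (V s) (Y s ` I)"
  shows "\<exists>T\<subseteq>S. finite T \<and> (\<forall>s\<in>S. \<exists>t\<in>T. \<exists>g. Vector_Spaces.linear (*s) (*s) g \<and>
    inj_on g (V s) \<and> g ` V s = V t \<and> (\<forall>x\<in>V s. \<forall>y\<in>V s. \<beta> (g x) (g y) = \<beta> x y) \<and>
    (\<forall>i\<in>I. g ` (V s \<inter> Y s i) = V t \<inter> Y t i))"
proof -
  let ?small = "{0, 1, -1 :: complex}"
  obtain B where B: "\<And>s. s \<in> S \<Longrightarrow> normal_basis \<beta> (V s) (Y s ` I) (B s)"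
    using nb unfolding has_normal_basis_def by metis
  have indep: "vec.independent (B s)" "finite (B s)" and spanB: "vec.span (B s) = V s"
    and gram: "\<And>b b'. b \<in> B s \<Longrightarrow> b' \<in> B s \<Longrightarrow> \<beta> b b' \<in> ?small"
    and gen: "\<And>i. i \<in> I \<Longrightarrow> V s \<inter> Y s i \<subseteq> vec.span (V s \<inter> Y s i \<inter> small_combinations (B s))"
    if "s \<in> S" for s
    using B[OF that] unfolding normal_basis_def by (auto intro: vec.finiteI_independent)
  define N where "N s = card (B s)" for s
  have "\<exists>b. bij_betw b {..<N s} (B s)" if "s \<in> S" for s
    using ex_bij_betw_nat_finite[OF indep(2)[OF that]] unfolding N_def lessThan_atLeast0 .
  then obtain b where b: "\<And>s. s \<in> S \<Longrightarrow> bij_betw (b s) {..<N s} (B s)" by metis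
  have bB: "b s k \<in> B s" if "s \<in> S" "k < N s" for s k
    using b[OF that(1)] that(2) by (auto simp: bij_betw_def)
  define comb where "comb s c = (\<Sum>k<N s. c k *s b s k)" for s and c :: "nat \<Rightarrow> complex"
  define gramm where "gramm s = (\<lambda>(k, l) \<in> {..<N s} \<times> {..<N s}. \<beta> (b s k) (b s l))" for s
  define cs where "cs s = (\<lambda>i \<in> I. {c \<in> {..<N s} \<rightarrow>\<^sub>E ?small. comb s c \<in> V s \<inter> Y s i})" for s
  define ty where "ty s = (N s, gramm s, cs s)" for s
  let ?R = "\<lambda>N::nat. {N} \<times> (({..<N} \<times> {..<N}) \<rightarrow>\<^sub>E ?small) \<times> (I \<rightarrow>\<^sub>E Pow ({..<N} \<rightarrow>\<^sub>E ?small))"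
  have "ty ` S \<subseteq> (\<Union>N\<le>CARD('d). ?R N)"
  proof
    fix t assume "t \<in> ty ` S"
    then obtain s where s: "s \<in> S" "t = ty s" by blast
    have "N s \<le> CARD('d)"
      using vec.dim_span_eq_card_independent[OF indep(1)[OF s(1)]] dim_subset_UNIV_cart_gen[of "vec.span (B s)"]
      unfolding N_def by simp
    moreover have "gramm s \<in> ({..<N s} \<times> {..<N s}) \<rightarrow>\<^sub>E ?small"
      unfolding gramm_def using gram[OF s(1)] bB[OF s(1)] by (intro restrict_PiE_iff[THEN iffD2]) auto
    moreover have "cs s \<in> I \<rightarrow>\<^sub>E Pow ({..<N s} \<rightarrow>\<^sub>E ?small)"
      unfolding cs_def by (intro restrict_PiE_iff[THEN iffD2]) auto
    ultimately show "t \<in> (\<Union>N\<le>CARD('d). ?R N)" unfolding s(2) ty_def by blast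
  qed
  moreover have "finite (\<Union>N\<le>CARD('d). ?R N)"
  proof (intro finite_UN_I finite_cartesian_product)
    show "finite (I \<rightarrow>\<^sub>E Pow ({..<N} \<rightarrow>\<^sub>E ?small))" for N :: nat
      using I by (intro finite_PiE finite_Pow_iff[THEN iffD2]) auto
    show "finite (({..<N} \<times> {..<N}) \<rightarrow>\<^sub>E ?small)" for N :: nat
      by (intro finite_PiE) auto
  qed auto
  ultimately have "finite (ty ` S)" by (rule finite_subset)
  from finite_subset_image[OF this subset_refl]
  obtain T where T: "T \<subseteq> S" "finite T" "ty ` S = ty ` T" by (elim exE conjE)
  have main: "\<exists>g. Vector_Spaces.linear (*s) (*s) g \<and>
    inj_on g (V s) \<and> g ` V s = V t \<and> (\<forall>x\<in>V s. \<forall>y\<in>V s. \<beta> (g x) (g y) = \<beta> x y) \<and>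
    (\<forall>i\<in>I. g ` (V s \<inter> Y s i) = V t \<inter> Y t i)" if s: "s \<in> S" and t: "t \<in> S" and ty: "ty s = ty t" for s t
  proof -
    have N: "N s = N t" and gr: "gramm s = gramm t" and cs: "cs s = cs t" using ty by (auto simp: ty_def)
    have inv: "inv_into {..<N s} (b s) (b s k) = k" if "k < N s" for k
      using b[OF s] that by (auto simp: bij_betw_def)
    have "\<exists>g. Vector_Spaces.linear (*s) (*s) g \<and> (\<forall>x\<in>B s. g x = b t (inv_into {..<N s} (b s) x))"
      using indep(1)[OF s] by (rule vec.linear_independent_extend)
    then obtain g where g: "Vector_Spaces.linear (*s) (*s) g"
      "\<And>x. x \<in> B s \<Longrightarrow> g x = b t (inv_into {..<N s} (b s) x)"
      by blast
    interpret l: Vector_Spaces.linear "(*s)" "(*s)" g by fact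
    have gb: "g (b s k) = b t k" if "k < N s" for k
      using g(2)[OF bB[OF s that]] inv[OF that] by simp
    have Bs: "B s = b s ` {..<N s}" and Bt: "B t = b t ` {..<N s}"
      using b[OF s] b[OF t] N by (auto simp: bij_betw_def)
    have gB: "g ` B s = B t" unfolding Bs Bt image_image using gb by (intro image_cong) auto
    have injB: "inj_on g (B s)"
    proof (rule inj_onI)
      fix x y assume xy: "x \<in> B s" "y \<in> B s" "g x = g y"
      then obtain k l where kl: "k < N s" "x = b s k" "l < N s" "y = b s l" unfolding Bs by blast
      then have "b t k = b t l" using xy gb by simp
      then have "k = l" using b[OF t] kl N by (auto simp: bij_betw_def inj_on_def)
      then show "x = y" using kl by simp
    qed
    have gV: "g ` V s = V t"
      unfolding spanB[OF s, symmetric] spanB[OF t, symmetric] gB[symmetric] by (rule l.span_image[symmetric])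
    have inj: "inj_on g (V s)"
      unfolding spanB[OF s, symmetric]
      using indep(1)[OF t] indep(1)[OF s] injB gB g(1) by (intro vec.linear_inj_on_span_iff_independent_image[THEN iffD2]) auto
    have iso: "\<beta> (g x) (g y) = \<beta> x y" if "x \<in> V s" "y \<in> V s" for x y
    proof (rule isometry_on_span[OF g(1), of "B s"])
      fix x y assume "x \<in> B s" "y \<in> B s"
      then obtain k l where kl: "k < N s" "x = b s k" "l < N s" "y = b s l" unfolding Bs by blast
      have "gramm s (k, l) = gramm t (k, l)" using gr by simp
      then show "\<beta> (g x) (g y) = \<beta> x y" using kl N gb by (simp add: gramm_def)
    qed (use that spanB[OF s] in auto)
    have gcomb: "g (comb s c) = comb t c" for c
      unfolding comb_def using gb N by (simp add: l.sum l.scale)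
    have small: "\<exists>c\<in>{..<N r} \<rightarrow>\<^sub>E ?small. x = comb r c" if r: "r \<in> S" and x: "x \<in> small_combinations (B r)" for r x
    proof -
      obtain c where c: "x = (\<Sum>b\<in>B r. c b *s b)" "c ` B r \<subseteq> ?small"
        using x unfolding small_combinations_def by blast
      let ?c = "\<lambda>k\<in>{..<N r}. c (b r k)"
      have "x = comb r ?c" unfolding c(1) comb_def
        using sum.reindex_bij_betw[OF b[OF r], of "\<lambda>b. c b *s b"] by simp
      moreover have "?c \<in> {..<N r} \<rightarrow>\<^sub>E ?small"
        using c(2) bB[OF r] by (intro restrict_PiE_iff[THEN iffD2]) blast
      ultimately show ?thesis by blast
    qed
    have img: "g ` (V s \<inter> Y s i) = V t \<inter> Y t i" if i: "i \<in> I" for i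
    proof -
      have csi: "comb s c \<in> V s \<inter> Y s i \<longleftrightarrow> comb t c \<in> V t \<inter> Y t i" if "c \<in> {..<N s} \<rightarrow>\<^sub>E ?small" for c
      proof -
        have "cs s i = cs t i" using cs by simp
        then have "c \<in> cs s i \<longleftrightarrow> c \<in> cs t i" by simp
        then show ?thesis using that i N by (simp add: cs_def)
      qed
      let ?Ss = "V s \<inter> Y s i \<inter> small_combinations (B s)" and ?St = "V t \<inter> Y t i \<inter> small_combinations (B t)"
      have sp: "vec.subspace (V r \<inter> Y r i)" if "r \<in> S" for r
        using sub[OF that i] spanB[OF that] by (metis vec.subspace_inter vec.subspace_span)
      have "V s \<inter> Y s i = vec.span ?Ss"
        using gen[OF s i] sp[OF s] by (intro subset_antisym vec.span_minimal) auto
      moreover have "V t \<inter> Y t i = vec.span ?St"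
        using gen[OF t i] sp[OF t] by (intro subset_antisym vec.span_minimal) auto
      moreover have "g ` ?Ss \<subseteq> V t \<inter> Y t i"
      proof
        fix z assume "z \<in> g ` ?Ss"
        then obtain x where x: "z = g x" "x \<in> V s \<inter> Y s i" "x \<in> small_combinations (B s)" by blast
        from small[OF s x(3)] obtain c where c: "c \<in> {..<N s} \<rightarrow>\<^sub>E ?small" "x = comb s c" by blast
        show "z \<in> V t \<inter> Y t i" using csi[OF c(1)] x c(2) gcomb by simp
      qed
      moreover have "?St \<subseteq> g ` (V s \<inter> Y s i)"
      proof
        fix z assume z: "z \<in> ?St"
        from small[OF t, of z] z obtain c where c: "c \<in> {..<N s} \<rightarrow>\<^sub>E ?small" "z = comb t c" using N by auto
        show "z \<in> g ` (V s \<inter> Y s i)" using csi[OF c(1)] z c(2) gcomb[of c] by (metis IntD1 imageI)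
      qed
      ultimately show ?thesis
        using l.span_image[of ?Ss] sp[OF t] l.subspace_image[OF sp[OF s]]
        by (metis subset_antisym vec.span_minimal)
    qed
    show ?thesis using g(1) inj gV iso img by blast
  qed
  show ?thesis
  proof (intro exI[of _ T] conjI ballI T(1,2))
    fix s assume s: "s \<in> S"
    then obtain t where t: "t \<in> T" "ty s = ty t" using T(3) by blast
    with main[OF s _ t(2)] T(1) show "\<exists>t\<in>T. \<exists>g. Vector_Spaces.linear (*s) (*s) g \<and>
      inj_on g (V s) \<and> g ` V s = V t \<and> (\<forall>x\<in>V s. \<forall>y\<in>V s. \<beta> (g x) (g y) = \<beta> x y) \<and>
      (\<forall>i\<in>I. g ` (V s \<inter> Y s i) = V t \<inter> Y t i)" by blast
  qed
qed

section \<open>Splitting off hyperbolic planes\<close>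

text \<open>
  The orthogonal projection onto a nondegenerate subspace with a basis \<open>B\<close> that has a
  small Gram matrix. It vanishes exactly on the orthogonal complement of \<open>B\<close>.
\<close>

definition orth_projection :: "(complex ^ 'd) set \<Rightarrow> (complex ^ 'd \<Rightarrow> complex ^ 'd) \<Rightarrow> bool" where
  "orth_projection B \<pi> \<longleftrightarrow>
     vec.independent B \<and> (\<forall>b\<in>B. \<forall>b'\<in>B. \<beta> b b' \<in> {0, 1, -1}) \<and>
     Vector_Spaces.linear (*s) (*s) \<pi> \<and> (\<forall>x. \<pi> x \<in> vec.span B) \<and> (\<forall>b\<in>B. \<pi> b = b) \<and>
     (\<forall>x. \<pi> x = 0 \<longleftrightarrow> (\<forall>b\<in>B. \<beta> b x = 0))"

lemma orth_projection_pair: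
  assumes "\<beta> e f = 1"
  shows "orth_projection {e, f} (\<lambda>x. \<beta> x f *s e + \<beta> e x *s f)"
proof -
  have fe: "\<beta> f e = -1" using skew[of f e] assms by simp
  have ne: "e \<noteq> f" using assms by auto
  have coef: "\<alpha> = 0 \<and> \<gamma> = 0" if "\<alpha> *s e + \<gamma> *s f = 0" for \<alpha> \<gamma>
  proof -
    have "\<beta> (\<alpha> *s e + \<gamma> *s f) f = 0" "\<beta> e (\<alpha> *s e + \<gamma> *s f) = 0" unfolding that by simp_all
    then show ?thesis using assms by simp
  qed
  show ?thesis
    unfolding orth_projection_def
  proof (intro conjI allI ballI)
    show "vec.independent {e, f}"
    proof (rule vec.independent_if_scalars_zero)
      fix c x assume "(\<Sum>x\<in>{e, f}. c x *s x) = 0" "x \<in> {e, f}"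
      then show "c x = 0" using coef[of "c e" "c f"] ne by auto
    qed simp
    show "Vector_Spaces.linear (*s) (*s) (\<lambda>x. \<beta> x f *s e + \<beta> e x *s f)"
      by (intro linear_vecI) (simp_all add: vec.scale_left_distrib vec.scale_right_distrib)
    show "\<beta> x f *s e + \<beta> e x *s f \<in> vec.span {e, f}" for x
      by (intro vec.span_add vec.span_scale) (auto intro: vec.span_base)
    show "\<beta> x f *s e + \<beta> e x *s f = 0 \<longleftrightarrow> (\<forall>b\<in>{e, f}. \<beta> b x = 0)" for x
      using coef[of "\<beta> x f" "\<beta> e x"] skew[of x f] by auto
  qed (use assms fe in auto)
qed

lemma orth_projection_two_pairs:
  assumes "\<beta> e f = 1" "\<beta> u g = 1" "\<beta> e u = 0" "\<beta> e g = 0" "\<beta> f u = 0" "\<beta> f g = 0"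
  shows "orth_projection {e, f, u, g} (\<lambda>x. \<beta> x f *s e + \<beta> e x *s f + \<beta> x g *s u + \<beta> u x *s g)"
proof -
  have sk: "\<beta> f e = -1" "\<beta> g u = -1" "\<beta> u e = 0" "\<beta> g e = 0" "\<beta> u f = 0" "\<beta> g f = 0"
    using skew[of f e] skew[of g u] skew[of u e] skew[of g e] skew[of u f] skew[of g f] assms by simp_all
  have ne: "e \<noteq> f" "e \<noteq> u" "e \<noteq> g" "f \<noteq> u" "f \<noteq> g" "u \<noteq> g"
    using assms sk by auto
  have coef: "\<alpha> = 0 \<and> \<gamma> = 0 \<and> \<delta> = 0 \<and> \<epsilon> = 0" if "\<alpha> *s e + \<gamma> *s f + \<delta> *s u + \<epsilon> *s g = 0" for \<alpha> \<gamma> \<delta> \<epsilon>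
  proof -
    let ?x = "\<alpha> *s e + \<gamma> *s f + \<delta> *s u + \<epsilon> *s g"
    have "\<beta> ?x f = 0" "\<beta> e ?x = 0" "\<beta> ?x g = 0" "\<beta> u ?x = 0" unfolding that by simp_all
    then show ?thesis using assms sk by simp
  qed
  show ?thesis
    unfolding orth_projection_def
  proof (intro conjI allI ballI)
    show "vec.independent {e, f, u, g}"
    proof (rule vec.independent_if_scalars_zero)
      fix c x assume "(\<Sum>x\<in>{e, f, u, g}. c x *s x) = 0" "x \<in> {e, f, u, g}"
      then show "c x = 0" using coef[of "c e" "c f" "c u" "c g"] ne by (auto simp: add.assoc)
    qed simp
    show "Vector_Spaces.linear (*s) (*s) (\<lambda>x. \<beta> x f *s e + \<beta> e x *s f + \<beta> x g *s u + \<beta> u x *s g)"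
      by (intro linear_vecI) (simp_all add: vec.scale_left_distrib vec.scale_right_distrib)
    show "\<beta> x f *s e + \<beta> e x *s f + \<beta> x g *s u + \<beta> u x *s g \<in> vec.span {e, f, u, g}" for x
      by (intro vec.span_add vec.span_scale) (auto intro: vec.span_base)
    show "\<beta> x f *s e + \<beta> e x *s f + \<beta> x g *s u + \<beta> u x *s g = 0 \<longleftrightarrow> (\<forall>b\<in>{e, f, u, g}. \<beta> b x = 0)" for x
      using coef[of "\<beta> x f" "\<beta> e x" "\<beta> x g" "\<beta> u x"] skew[of x f] skew[of x g] by auto
  qed (use assms sk in auto)
qed

lemma has_normal_basis_orth_projection:
  assumes "vec.subspace V" "B \<subseteq> V" "orth_projection B \<pi>"
    and "\<And>Y. Y \<in> \<Y> \<Longrightarrow> vec.subspace Y"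
    and "\<And>Y y. Y \<in> \<Y> \<Longrightarrow> y \<in> V \<Longrightarrow> y \<in> Y \<Longrightarrow> \<pi> y \<in> vec.span (Y \<inter> small_combinations B)"
    and "has_normal_basis \<beta> {x \<in> V. \<pi> x = 0} \<Y>"
  shows "has_normal_basis \<beta> V \<Y>"
  using assms unfolding orth_projection_def
  by (intro has_normal_basis_peel[of V B \<pi> \<Y>]) auto

lemma orth_projection_splits:
  assumes "orth_projection B \<pi>" "\<pi> x = 0"
  shows "\<beta> x (\<pi> y) = 0" "\<beta> x (y - \<pi> y) = \<beta> x y"
proof -
  have "\<beta> x b = 0" if "b \<in> B" for b
    using assms that skew[of x b] unfolding orth_projection_def by auto
  then show "\<beta> x (\<pi> y) = 0"
    using span_perp[of B x "\<pi> y"] assms(1) unfolding orth_projection_def by blast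
  then show "\<beta> x (y - \<pi> y) = \<beta> x y" by simp
qed

lemma orth_projection_idem:
  assumes "orth_projection B \<pi>"
  shows "\<pi> (\<pi> x) = \<pi> x" "\<pi> (x - \<pi> x) = 0"
proof -
  interpret l: Vector_Spaces.linear "(*s)" "(*s)" \<pi> using assms unfolding orth_projection_def by blast
  have "\<pi> y = y" if "y \<in> vec.span B" for y
    using that by (induction rule: vec.span_induct_alt)
      (use assms in \<open>auto simp: l.zero l.add l.scale orth_projection_def\<close>)
  then show "\<pi> (\<pi> x) = \<pi> x" using assms unfolding orth_projection_def by blast
  then show "\<pi> (x - \<pi> x) = 0" by (simp add: l.diff)
qed

end

lemma span_scale_base: "c = 0 \<or> v \<in> S \<Longrightarrow> c *s v \<in> vec.span S"
  by (auto simp: vec.span_zero intro: vec.span_scale vec.span_base)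

lemma chain_mono_le:
  assumes "\<And>i. i < r \<Longrightarrow> F i \<subseteq> F (Suc i)" "i \<le> j" "j \<le> r"
  shows "F i \<subseteq> (F j :: 'x set)"
  using assms(2,3)
proof (induction j)
  case (Suc j)
  then show ?case using assms(1)[of j] by (cases "i = Suc j") auto
qed simp

context alternating
begin

text \<open>
  The orthogonal complement in \<open>V\<close> of the image of an \<open>orth_projection\<close>.
\<close>

definition orth_rest :: "(complex ^ 'd) set \<Rightarrow> (complex ^ 'd \<Rightarrow> complex ^ 'd) \<Rightarrow> (complex ^ 'd) set" where
  "orth_rest V \<pi> = {x \<in> V. \<pi> x = 0}"

text \<open>
  If \<open>A\<close> is stable under the projection, it splits into a part in the image and a part in
  the complement. On vectors of the complement the first part imposes no condition.
\<close>

lemma perp_restrict: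
  assumes "orth_projection B \<pi>" "vec.subspace A" "A \<subseteq> V" "\<And>y. y \<in> A \<Longrightarrow> \<pi> y \<in> A"
  shows "{x \<in> U. \<forall>y\<in>A. \<beta> x y = 0} \<inter> orth_rest V \<pi> =
    {x \<in> U \<inter> orth_rest V \<pi>. \<forall>y\<in>A \<inter> orth_rest V \<pi>. \<beta> x y = 0}"
proof (intro subset_antisym subsetI)
  fix x assume x: "x \<in> {x \<in> U \<inter> orth_rest V \<pi>. \<forall>y\<in>A \<inter> orth_rest V \<pi>. \<beta> x y = 0}"
  have "\<beta> x y = 0" if y: "y \<in> A" for y
  proof -
    have "y - \<pi> y \<in> A \<inter> orth_rest V \<pi>"
      using y assms orth_projection_idem(2)[OF assms(1), of y]
      by (auto simp: orth_rest_def intro: vec.subspace_diff)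
    then have "\<beta> x (y - \<pi> y) = 0" using x by blast
    moreover have "\<pi> x = 0" using x by (simp add: orth_rest_def)
    ultimately show ?thesis using orth_projection_splits(2)[OF assms(1), of x y] by metis
  qed
  then show "x \<in> {x \<in> U. \<forall>y\<in>A. \<beta> x y = 0} \<inter> orth_rest V \<pi>" using x by blast
qed auto

lemma subspace_orth_rest:
  assumes "vec.subspace V" "orth_projection B \<pi>"
  shows "vec.subspace (orth_rest V \<pi>)"
proof -
  interpret l: Vector_Spaces.linear "(*s)" "(*s)" \<pi> using assms unfolding orth_projection_def by blast
  show ?thesis using assms(1) by (auto simp: vec.subspace_def orth_rest_def l.add l.scale l.zero)
qed

lemma nondegenerate_orth_rest:
  assumes "vec.subspace V" "orth_projection B \<pi>" "B \<subseteq> V" "nondegenerate_on \<beta> V"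
  shows "nondegenerate_on \<beta> (orth_rest V \<pi>)"
  unfolding nondegenerate_on_def
proof (intro ballI impI)
  fix x assume x: "x \<in> orth_rest V \<pi>" "\<forall>y\<in>orth_rest V \<pi>. \<beta> x y = 0"
  have "\<pi> y \<in> V" for y
    using assms vec.span_minimal[of B V] unfolding orth_projection_def by blast
  then have "{x \<in> V. \<forall>y\<in>V. \<beta> x y = 0} \<inter> orth_rest V \<pi> =
    {x \<in> V \<inter> orth_rest V \<pi>. \<forall>y\<in>V \<inter> orth_rest V \<pi>. \<beta> x y = 0}"
    using assms by (intro perp_restrict) auto
  moreover have "V \<inter> orth_rest V \<pi> = orth_rest V \<pi>" by (auto simp: orth_rest_def)
  ultimately have "x \<in> V" "\<forall>y\<in>V. \<beta> x y = 0" using x by auto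
  then show "x = 0" using assms(4) unfolding nondegenerate_on_def by blast
qed

lemma dim_orth_rest:
  assumes "vec.subspace V" "orth_projection B \<pi>" "B \<subseteq> V" "B \<noteq> {}"
  shows "vec.dim (orth_rest V \<pi>) < vec.dim V"
proof (rule vec.dim_psubset)
  obtain b where b: "b \<in> B" using assms(4) by blast
  then have "b \<noteq> 0" "\<pi> b = b" using assms(2) vec.dependent_zero unfolding orth_projection_def by auto
  then have "b \<in> V - orth_rest V \<pi>" using b assms(3) by (auto simp: orth_rest_def)
  moreover have "orth_rest V \<pi> \<subseteq> V" by (auto simp: orth_rest_def)
  ultimately have "orth_rest V \<pi> \<subset> V" by blast
  then show "vec.span (orth_rest V \<pi>) \<subset> vec.span V"
    by (simp only: vec.span_eq_iff[THEN iffD2, OF subspace_orth_rest[OF assms(1,2)]]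
      vec.span_eq_iff[THEN iffD2, OF assms(1)])
qed

text \<open>
  The form of the induction step in which the subspaces are cut down to the complement.
\<close>

lemma has_normal_basis_orth_rest:
  assumes "vec.subspace V" "B \<subseteq> V" "orth_projection B \<pi>"
    and "\<And>Y. Y \<in> \<Y> \<Longrightarrow> vec.subspace Y"
    and "\<And>Y y. Y \<in> \<Y> \<Longrightarrow> y \<in> Y \<Longrightarrow> \<pi> y \<in> vec.span (Y \<inter> small_combinations B)"
    and "has_normal_basis \<beta> (orth_rest V \<pi>) ((\<lambda>Y. Y \<inter> orth_rest V \<pi>) ` \<Y>)"
  shows "has_normal_basis \<beta> V \<Y>"
  using assms(6) unfolding has_normal_basis_Int
  unfolding orth_rest_def by (intro has_normal_basis_orth_projection[OF assms(1-3)] assms(4,5))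

lemma span_small_subset: "vec.subspace Y \<Longrightarrow> vec.span (Y \<inter> small_combinations B) \<subseteq> Y"
  by (rule vec.span_minimal) auto

text \<open>
  A Lagrangian subspace characterized by being its own orthogonal complement. Unlike the count of
  dimensions, this passes directly to the orthogonal complement of a hyperbolic pair.
\<close>

definition lagrangian_of :: "(complex ^ 'd) set \<Rightarrow> (complex ^ 'd) set \<Rightarrow> bool" where
  "lagrangian_of V L \<longleftrightarrow> vec.subspace L \<and> L = {x \<in> V. \<forall>y\<in>L. \<beta> x y = 0}"

lemma lagrangian_of_restrict:
  assumes "orth_projection B \<pi>" "lagrangian_of V L" "vec.subspace V" "\<And>y. y \<in> L \<Longrightarrow> \<pi> y \<in> L"
  shows "lagrangian_of (orth_rest V \<pi>) (L \<inter> orth_rest V \<pi>)"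
proof -
  have L: "vec.subspace L" "L = {x \<in> V. \<forall>y\<in>L. \<beta> x y = 0}" using assms(2) by (auto simp: lagrangian_of_def)
  then have LV: "L \<subseteq> V" by blast
  have "{x \<in> V. \<forall>y\<in>L. \<beta> x y = 0} \<inter> orth_rest V \<pi> =
    {x \<in> V \<inter> orth_rest V \<pi>. \<forall>y\<in>L \<inter> orth_rest V \<pi>. \<beta> x y = 0}"
    by (rule perp_restrict[OF assms(1) L(1) LV assms(4)])
  moreover have "V \<inter> orth_rest V \<pi> = orth_rest V \<pi>" by (auto simp: orth_rest_def)
  ultimately show ?thesis
    unfolding lagrangian_of_def using L subspace_orth_rest[OF assms(3,1)] by (auto simp: vec.subspace_inter)
qed

section \<open>Self-dual chains in orthogonal sums\<close>

text \<open>
  A flag of \<open>F r\<close> that taking orthogonal complements in \<open>F r\<close> reverses.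
  Consecutive members may coincide, so the index range can stay \<open>{0..r}\<close> when the flag is
  intersected with a subspace.
\<close>

definition selfdual_chain :: "nat \<Rightarrow> (nat \<Rightarrow> (complex ^ 'd) set) \<Rightarrow> bool" where
  "selfdual_chain r F \<longleftrightarrow> F 0 = {0} \<and> (\<forall>i\<le>r. vec.subspace (F i)) \<and> (\<forall>i<r. F i \<subseteq> F (Suc i)) \<and>
     (\<forall>i\<le>r. F (r - i) = {x \<in> F r. \<forall>y\<in>F i. \<beta> x y = 0})"

lemma selfdual_chain_mono: "selfdual_chain r F \<Longrightarrow> i \<le> j \<Longrightarrow> j \<le> r \<Longrightarrow> F i \<subseteq> F j"
  unfolding selfdual_chain_def by (rule chain_mono_le[of r F]) auto

lemma selfdual_chain_perp:
  assumes "selfdual_chain r F" "1 \<le> i" "i \<le> r"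
  shows "F (i - 1) = {x \<in> F r. \<forall>y\<in>F (r + 1 - i). \<beta> x y = 0}"
proof -
  have le: "r + 1 - i \<le> r" and eq: "r - (r + 1 - i) = i - 1" using assms(2,3) by auto
  have "F (r - (r + 1 - i)) = {x \<in> F r. \<forall>y\<in>F (r + 1 - i). \<beta> x y = 0}"
    using assms(1) le unfolding selfdual_chain_def by blast
  then show ?thesis unfolding eq .
qed

text \<open>
  Take the smallest \<open>i\<close> with \<open>u \<in> F i\<close>. As \<open>u\<close> is not in
  \<open>F (i - 1)\<close>, which is the orthogonal complement of \<open>F (r + 1 - i)\<close> in
  \<open>F r\<close>, some vector of \<open>F (r + 1 - i)\<close> pairs nontrivially with
  \<open>u\<close>.
\<close>

lemma selfdual_chain_partner:
  assumes F: "selfdual_chain r F" and u: "u \<in> F r" "u \<noteq> 0"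
  obtains i f where "1 \<le> i" "i \<le> r" "u \<in> F i" "u \<notin> F (i - 1)" "f \<in> F (r + 1 - i)" "\<beta> u f = 1"
proof -
  define i where "i = (LEAST i. u \<in> F i)"
  have i: "u \<in> F i" "i \<le> r" unfolding i_def using LeastI[of "\<lambda>i. u \<in> F i" r] Least_le[of "\<lambda>i. u \<in> F i" r] u(1) by auto
  have i1: "1 \<le> i" using i(1) u(2) F by (cases i) (auto simp: selfdual_chain_def)
  have ni: "u \<notin> F (i - 1)" using not_less_Least[of "i - 1" "\<lambda>i. u \<in> F i"] i1 by (simp add: i_def)
  obtain y where y: "y \<in> F (r + 1 - i)" "\<beta> u y \<noteq> 0"
    using ni u(1) unfolding selfdual_chain_perp[OF F i1 i(2)] by blast
  show ?thesis
  proof (rule that[OF i1 i(2,1) ni])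
    show "(1 / \<beta> u y) *s y \<in> F (r + 1 - i)"
      using F y(1) i1 unfolding selfdual_chain_def by (intro vec.subspace_scale) auto
  qed (use y in simp)
qed

text \<open>
  A vector \<open>u\<close> and a partner \<open>f\<close> in opposite positions of the flag span a
  plane that is adapted to every member: the component along \<open>u\<close> of a vector of \<open>F
  j\<close> is zero when \<open>F j\<close> is too small to contain \<open>u\<close>.
\<close>

lemma selfdual_chain_split:
  assumes F: "selfdual_chain r F" and i: "1 \<le> i" "i \<le> r" and u: "u \<in> F i" "f \<in> F (r + 1 - i)"
    and y: "j \<le> r" "y \<in> F j"
  shows "\<beta> y f = 0 \<or> u \<in> F j" "\<beta> u y = 0 \<or> f \<in> F j"
proof -
  show "\<beta> y f = 0 \<or> u \<in> F j"
  proof (cases "i \<le> j")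
    case False
    then have "j \<le> i - 1" "i - 1 \<le> r" using i by auto
    then have "y \<in> F (i - 1)" using selfdual_chain_mono[OF F, of j "i - 1"] y by blast
    then show ?thesis using u unfolding selfdual_chain_perp[OF F i] by blast
  qed (use selfdual_chain_mono[OF F, of i j] u y in auto)
  show "\<beta> u y = 0 \<or> f \<in> F j"
  proof (cases "r + 1 - i \<le> j")
    case False
    then have "j \<le> r - i" "r - i \<le> r" using i by auto
    then have "y \<in> F (r - i)" using selfdual_chain_mono[OF F, of j "r - i"] y by blast
    moreover have "F (r - i) = {x \<in> F r. \<forall>y\<in>F i. \<beta> x y = 0}"
      using F i unfolding selfdual_chain_def by auto
    ultimately show ?thesis using u skew[of u y] by auto
  qed (use selfdual_chain_mono[OF F, of "r + 1 - i" j] u y in auto)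
qed

lemma selfdual_chain_restrict:
  assumes "orth_projection B \<pi>" "selfdual_chain r F" "vec.subspace V" "F r \<subseteq> V"
    and "\<And>j y. j \<le> r \<Longrightarrow> y \<in> F j \<Longrightarrow> \<pi> y \<in> F j"
  shows "selfdual_chain r (\<lambda>i. F i \<inter> orth_rest V \<pi>)"
  unfolding selfdual_chain_def
proof (intro conjI allI impI)
  have F: "F 0 = {0}" "\<And>i. i \<le> r \<Longrightarrow> vec.subspace (F i)" "\<And>i. i < r \<Longrightarrow> F i \<subseteq> F (Suc i)"
    "\<And>i. i \<le> r \<Longrightarrow> F (r - i) = {x \<in> F r. \<forall>y\<in>F i. \<beta> x y = 0}"
    using assms(2) unfolding selfdual_chain_def by auto
  show "F 0 \<inter> orth_rest V \<pi> = {0}"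
    using F(1) subspace_orth_rest[OF assms(3,1)] by (auto simp: vec.subspace_0)
  show "vec.subspace (F i \<inter> orth_rest V \<pi>)" if "i \<le> r" for i
    using F(2)[OF that] subspace_orth_rest[OF assms(3,1)] by (rule vec.subspace_inter)
  show "F i \<inter> orth_rest V \<pi> \<subseteq> F (Suc i) \<inter> orth_rest V \<pi>" if "i < r" for i
    using F(3)[OF that] by blast
  fix i assume i: "i \<le> r"
  have "F i \<subseteq> V" using selfdual_chain_mono[OF assms(2), of i r] i assms(4) by auto
  then show "F (r - i) \<inter> orth_rest V \<pi> =
    {x \<in> F r \<inter> orth_rest V \<pi>. \<forall>y\<in>F i \<inter> orth_rest V \<pi>. \<beta> x y = 0}"
    unfolding F(4)[OF i] using F(2)[OF i] assms(1,5) i by (intro perp_restrict) auto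
qed

text \<open>
  The flags fixed by a Borel subgroup of a product of two symplectic groups: \<open>V\<close> is the
  orthogonal sum of the top members, and each carries a self-dual flag.
\<close>

definition orthogonal_chains ::
  "(complex ^ 'd) set \<Rightarrow> nat \<Rightarrow> (nat \<Rightarrow> (complex ^ 'd) set) \<Rightarrow> nat \<Rightarrow> (nat \<Rightarrow> (complex ^ 'd) set) \<Rightarrow> bool" where
  "orthogonal_chains V r F s H \<longleftrightarrow>
     vec.subspace V \<and> nondegenerate_on \<beta> V \<and> selfdual_chain r F \<and> selfdual_chain s H \<and>
     F r \<subseteq> V \<and> H s \<subseteq> V \<and> (\<forall>x\<in>V. \<exists>u\<in>F r. \<exists>w\<in>H s. x = u + w) \<and> (\<forall>u\<in>F r. \<forall>w\<in>H s. \<beta> u w = 0)"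

lemma orthogonal_chains_sym: "orthogonal_chains V r F s H \<Longrightarrow> orthogonal_chains V s H r F"
  unfolding orthogonal_chains_def by (metis add.commute skew neg_0_equal_iff_equal)

lemma orthogonal_chains_restrict:
  assumes C: "orthogonal_chains V r F s H" and pi: "orth_projection B \<pi>" and B: "B \<subseteq> F r \<union> H s"
    and F: "\<And>j y. j \<le> r \<Longrightarrow> y \<in> F j \<Longrightarrow> \<pi> y \<in> F j" and H: "\<And>j y. j \<le> s \<Longrightarrow> y \<in> H j \<Longrightarrow> \<pi> y \<in> H j"
  shows "orthogonal_chains (orth_rest V \<pi>) r (\<lambda>i. F i \<inter> orth_rest V \<pi>) s (\<lambda>i. H i \<inter> orth_rest V \<pi>)"
  unfolding orthogonal_chains_def
proof (intro conjI ballI)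
  have V: "vec.subspace V" "nondegenerate_on \<beta> V" "F r \<subseteq> V" "H s \<subseteq> V"
    and ch: "selfdual_chain r F" "selfdual_chain s H"
    and dec: "\<And>x. x \<in> V \<Longrightarrow> \<exists>u\<in>F r. \<exists>w\<in>H s. x = u + w"
    and orth: "\<And>u w. u \<in> F r \<Longrightarrow> w \<in> H s \<Longrightarrow> \<beta> u w = 0"
    using C unfolding orthogonal_chains_def by auto
  show "vec.subspace (orth_rest V \<pi>)" using V(1) pi by (rule subspace_orth_rest)
  show "nondegenerate_on \<beta> (orth_rest V \<pi>)" using V B pi by (intro nondegenerate_orth_rest[of V B]) auto
  show "selfdual_chain r (\<lambda>i. F i \<inter> orth_rest V \<pi>)" using pi ch(1) V(1,3) F by (rule selfdual_chain_restrict)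
  show "selfdual_chain s (\<lambda>i. H i \<inter> orth_rest V \<pi>)" using pi ch(2) V(1,4) H by (rule selfdual_chain_restrict)
  show "F r \<inter> orth_rest V \<pi> \<subseteq> orth_rest V \<pi>" "H s \<inter> orth_rest V \<pi> \<subseteq> orth_rest V \<pi>" by auto
  show "\<beta> u w = 0" if "u \<in> F r \<inter> orth_rest V \<pi>" "w \<in> H s \<inter> orth_rest V \<pi>" for u w
    using orth that by blast
  fix x assume x: "x \<in> orth_rest V \<pi>"
  then have "x \<in> V" by (simp add: orth_rest_def)
  then obtain u w where uw: "u \<in> F r" "w \<in> H s" "x = u + w" using dec by blast
  have bx: "\<beta> b x = 0" if "b \<in> B" for b using x pi that by (auto simp: orth_rest_def orth_projection_def)
  have "\<beta> b u = 0 \<and> \<beta> b w = 0" if "b \<in> B" for b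
    using bx[OF that] B that orth[of b w] orth[of u b] skew[of b u] uw by auto
  then have "\<pi> u = 0" "\<pi> w = 0" using pi unfolding orth_projection_def by auto
  then show "\<exists>u\<in>F r \<inter> orth_rest V \<pi>. \<exists>w\<in>H s \<inter> orth_rest V \<pi>. x = u + w"
    using uw V by (auto simp: orth_rest_def)
qed

lemma orthogonal_chains_peel:
  assumes C: "orthogonal_chains V r F s H" and pi: "orth_projection B \<pi>" and B: "B \<subseteq> F r \<union> H s" "B \<noteq> {}"
    and F: "\<And>j y. j \<le> r \<Longrightarrow> y \<in> F j \<Longrightarrow> \<pi> y \<in> vec.span (F j \<inter> small_combinations B)"
    and H: "\<And>j y. j \<le> s \<Longrightarrow> y \<in> H j \<Longrightarrow> \<pi> y \<in> vec.span (H j \<inter> small_combinations B)"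
    and X: "vec.subspace X" "\<And>y. y \<in> X \<Longrightarrow> \<pi> y \<in> vec.span (X \<inter> small_combinations B)"
    and IH: "orthogonal_chains (orth_rest V \<pi>) r (\<lambda>i. F i \<inter> orth_rest V \<pi>) s (\<lambda>i. H i \<inter> orth_rest V \<pi>) \<Longrightarrow>
      vec.dim (orth_rest V \<pi>) < vec.dim V \<Longrightarrow>
      has_normal_basis \<beta> (orth_rest V \<pi>) (insert (X \<inter> orth_rest V \<pi>)
        ((\<lambda>i. F i \<inter> orth_rest V \<pi>) ` {..r} \<union> (\<lambda>i. H i \<inter> orth_rest V \<pi>) ` {..s}))"
  shows "has_normal_basis \<beta> V (insert X (F ` {..r} \<union> H ` {..s}))"
proof -
  have V: "vec.subspace V" "F r \<subseteq> V" "H s \<subseteq> V" and ch: "selfdual_chain r F" "selfdual_chain s H"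
    using C unfolding orthogonal_chains_def by auto
  have subF: "vec.subspace (F j)" if "j \<le> r" for j using ch(1) that unfolding selfdual_chain_def by auto
  have subH: "vec.subspace (H j)" if "j \<le> s" for j using ch(2) that unfolding selfdual_chain_def by auto
  have BV: "B \<subseteq> V" using B V by auto
  show ?thesis
  proof (rule has_normal_basis_orth_rest[OF V(1) BV pi])
    have "orthogonal_chains (orth_rest V \<pi>) r (\<lambda>i. F i \<inter> orth_rest V \<pi>) s (\<lambda>i. H i \<inter> orth_rest V \<pi>)"
      using F H span_small_subset[OF subF, of _ B] span_small_subset[OF subH, of _ B]
      by (intro orthogonal_chains_restrict[OF C pi B(1)]) blast+
    from IH[OF this dim_orth_rest[OF V(1) pi BV B(2)]]
    show "has_normal_basis \<beta> (orth_rest V \<pi>)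
      ((\<lambda>Y. Y \<inter> orth_rest V \<pi>) ` (insert X (F ` {..r} \<union> H ` {..s})))"
      by (simp add: image_Un image_image)
  qed (use subF subH X F H in auto)
qed

text \<open>
  Choose \<open>e\<close> in the first nonzero member of the first flag. If \<open>e \<in> L\<close>,
  any partner of \<open>e\<close> gives a hyperbolic plane adapted to \<open>L\<close>. Otherwise some
  \<open>f + w \<in> L\<close> pairs to 1 with \<open>e\<close>, where \<open>w\<close> may be taken
  in the smallest possible member \<open>H j\<close> of the second flag. If \<open>w = 0\<close>, the
  plane of \<open>e\<close> and \<open>f\<close> is adapted to \<open>L\<close>. If not, the
  minimality of \<open>j\<close> yields a partner \<open>g\<close> of \<open>w\<close> in the opposite
  position with \<open>e + g \<in> L\<close>, and \<open>L\<close> meets the sum of the two planes in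
  the span of \<open>e + g\<close> and \<open>f + w\<close>.
\<close>

lemma orthogonal_chains_lagrangian_step:
  assumes C: "orthogonal_chains V r F s H" and L: "lagrangian_of V L" and nz: "F r \<noteq> {0}"
    and IH: "\<And>V2 F2 H2 L2. orthogonal_chains V2 r F2 s H2 \<Longrightarrow> lagrangian_of V2 L2 \<Longrightarrow> vec.dim V2 < vec.dim V \<Longrightarrow>
      has_normal_basis \<beta> V2 (insert L2 (F2 ` {..r} \<union> H2 ` {..s}))"
  shows "has_normal_basis \<beta> V (insert L (F ` {..r} \<union> H ` {..s}))"
proof -
  have V: "vec.subspace V" "nondegenerate_on \<beta> V" "F r \<subseteq> V" "H s \<subseteq> V"
    and ch: "selfdual_chain r F" "selfdual_chain s H"
    and dec: "\<And>x. x \<in> V \<Longrightarrow> \<exists>u\<in>F r. \<exists>w\<in>H s. x = u + w"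
    and orth: "\<And>u w. u \<in> F r \<Longrightarrow> w \<in> H s \<Longrightarrow> \<beta> u w = 0"
    using C unfolding orthogonal_chains_def by auto
  have orth': "\<beta> w u = 0" if "u \<in> F r" "w \<in> H s" for u w using orth[OF that] skew[of w u] by simp
  have F0: "F 0 = {0}" and H0: "H 0 = {0}" using ch by (auto simp: selfdual_chain_def)
  have subF: "vec.subspace (F j)" if "j \<le> r" for j using ch(1) that unfolding selfdual_chain_def by auto
  have subH: "vec.subspace (H j)" if "j \<le> s" for j using ch(2) that unfolding selfdual_chain_def by auto
  have Fr: "F j \<subseteq> F r" if "j \<le> r" for j using selfdual_chain_mono[OF ch(1) that] by simp
  have Hs: "H j \<subseteq> H s" if "j \<le> s" for j using selfdual_chain_mono[OF ch(2) that] by simp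
  have Lsub: "vec.subspace L" and Lperp: "\<And>x. x \<in> L \<longleftrightarrow> x \<in> V \<and> (\<forall>y\<in>L. \<beta> x y = 0)"
    using L unfolding lagrangian_of_def by blast+
  have Liso: "\<beta> x y = 0" if "x \<in> L" "y \<in> L" for x y using Lperp that by blast
  have rest: "has_normal_basis \<beta> V (insert L (F ` {..r} \<union> H ` {..s}))"
    if "orth_projection B \<pi>" "B \<subseteq> F r \<union> H s" "B \<noteq> {}"
      "\<And>j y. j \<le> r \<Longrightarrow> y \<in> F j \<Longrightarrow> \<pi> y \<in> vec.span (F j \<inter> small_combinations B)"
      "\<And>j y. j \<le> s \<Longrightarrow> y \<in> H j \<Longrightarrow> \<pi> y \<in> vec.span (H j \<inter> small_combinations B)"
      "\<And>y. y \<in> L \<Longrightarrow> \<pi> y \<in> vec.span (L \<inter> small_combinations B)" for B \<pi>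
  proof (rule orthogonal_chains_peel[OF C that(1-5) Lsub that(6)])
    have "\<pi> y \<in> L" if "y \<in> L" for y using that(1) \<open>\<And>y. y \<in> L \<Longrightarrow> \<pi> y \<in> _\<close> span_small_subset[OF Lsub, of B] by blast
    from lagrangian_of_restrict[OF that(1) L V(1) this] IH
    show "orthogonal_chains (orth_rest V \<pi>) r (\<lambda>i. F i \<inter> orth_rest V \<pi>) s (\<lambda>i. H i \<inter> orth_rest V \<pi>) \<Longrightarrow>
      vec.dim (orth_rest V \<pi>) < vec.dim V \<Longrightarrow>
      has_normal_basis \<beta> (orth_rest V \<pi>) (insert (L \<inter> orth_rest V \<pi>)
        ((\<lambda>i. F i \<inter> orth_rest V \<pi>) ` {..r} \<union> (\<lambda>i. H i \<inter> orth_rest V \<pi>) ` {..s}))"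
      by blast
  qed
  define i where "i = (LEAST i. F i \<noteq> {0})"
  have i: "F i \<noteq> {0}" "i \<le> r" unfolding i_def using LeastI[of "\<lambda>i. F i \<noteq> {0}" r] Least_le[of "\<lambda>i. F i \<noteq> {0}" r] nz by auto
  have i1: "1 \<le> i" using i(1) F0 by (cases i) auto
  have Fi0: "F j = {0}" if "j < i" for j using not_less_Least[of j "\<lambda>i. F i \<noteq> {0}"] that unfolding i_def by blast
  obtain e where e: "e \<in> F i" "e \<noteq> 0" using i subF[OF i(2)] vec.subspace_0 by blast
  have e_r: "e \<in> F r" "e \<in> V" using e Fr[OF i(2)] V(3) by auto
  have Fi': "F (r + 1 - i) = F r"
  proof -
    have "F (r - (i - 1)) = {x \<in> F r. \<forall>y\<in>F (i - 1). \<beta> x y = 0}"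
      using ch(1) i unfolding selfdual_chain_def by auto
    moreover have "r - (i - 1) = r + 1 - i" using i1 i(2) by auto
    ultimately show ?thesis using Fi0[of "i - 1"] i1 by auto
  qed
  have splitF: "\<beta> y f = 0 \<or> e \<in> F j" "\<beta> e y = 0 \<or> f \<in> F j" if "f \<in> F r" "j \<le> r" "y \<in> F j" for f j y
    using selfdual_chain_split[OF ch(1) i1 i(2) e(1), of f j y] that Fi' by auto
  have pair: ?thesis if f: "f \<in> F r" "\<beta> e f = 1"
    and fL: "\<And>y. y \<in> L \<Longrightarrow> (\<beta> y f = 0 \<or> e \<in> L) \<and> (\<beta> e y = 0 \<or> f \<in> L)" for f
  proof (rule rest[OF orth_projection_pair[OF f(2)]])
    have small: "e \<in> small_combinations {e, f}" "f \<in> small_combinations {e, f}"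
      by (auto intro: small_combination_base)
    show "\<beta> y f *s e + \<beta> e y *s f \<in> vec.span (F j \<inter> small_combinations {e, f})" if "j \<le> r" "y \<in> F j" for j y
      using splitF[OF f(1) that] small by (intro vec.span_add span_scale_base) auto
    show "\<beta> y f *s e + \<beta> e y *s f \<in> vec.span (H j \<inter> small_combinations {e, f})" if "j \<le> s" "y \<in> H j" for j y
      using orth'[OF f(1), of y] orth[OF e_r(1), of y] Hs[OF that(1)] that(2)
      by (intro vec.span_add span_scale_base) auto
    show "\<beta> y f *s e + \<beta> e y *s f \<in> vec.span (L \<inter> small_combinations {e, f})" if "y \<in> L" for y
      using fL[OF that] small by (intro vec.span_add span_scale_base) auto
  qed (use e_r f in auto)
  show ?thesis
  proof (cases "e \<in> L")
    case True
    obtain i' f where f: "f \<in> F (r + 1 - i')" "\<beta> e f = 1" "1 \<le> i'"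
      using selfdual_chain_partner[OF ch(1) e_r(1) e(2)] by metis
    then have "r + 1 - i' \<le> r" by simp
    then have "f \<in> F r" using f(1) Fr by blast
    then show ?thesis using pair[of f] f(2) True Liso by auto
  next
    case False
    then obtain x0 where x0: "x0 \<in> L" "\<beta> e x0 \<noteq> 0" using Lperp e_r by blast
    define P where "P j \<longleftrightarrow> (\<exists>f\<in>F r. \<exists>w\<in>H j. f + w \<in> L \<and> \<beta> e (f + w) = 1)" for j
    have "P s"
    proof -
      have "(1 / \<beta> e x0) *s x0 \<in> L" using Lsub x0 by (intro vec.subspace_scale)
      moreover from this obtain f w where "f \<in> F r" "w \<in> H s" "(1 / \<beta> e x0) *s x0 = f + w"
        using dec Lperp by blast
      moreover have "\<beta> e ((1 / \<beta> e x0) *s x0) = 1" using x0 by simp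
      ultimately show ?thesis unfolding P_def by (intro bexI[of _ f] bexI[of _ w]) auto
    qed
    \<comment> \<open>Choosing \<open>w\<close> as low as possible in its flag forces \<open>e \<in> L + H (s + 1
      - j)\<close> below.\<close>
    define j where "j = (LEAST j. P j)"
    have j: "P j" "j \<le> s" unfolding j_def using LeastI[of P s] Least_le[of P s] \<open>P s\<close> by auto
    obtain f w where fw: "f \<in> F r" "w \<in> H j" "f + w \<in> L" "\<beta> e (f + w) = 1" using j(1) unfolding P_def by blast
    have wH: "w \<in> H s" using fw(2) Hs[OF j(2)] by blast
    have ef: "\<beta> e f = 1" using fw orth[OF e_r(1) wH] by simp
    show ?thesis
    proof (cases "j = 0")
      case True
      then have "f \<in> L" using fw H0 by auto
      then show ?thesis using pair[of f] fw(1) ef Liso by auto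
    next
      case False
      then have j1: "1 \<le> j" by simp
      let ?H = "H (s + 1 - j)"
      have subH': "vec.subspace ?H" "?H \<subseteq> H s" using subH[of "s + 1 - j"] Hs[of "s + 1 - j"] j1 by auto
      let ?S = "{a + b | a b. a \<in> L \<and> b \<in> ?H}"
      \<comment> \<open>Otherwise some \<open>p \<in> L\<close> pairs to 1 with \<open>e\<close> and is orthogonal
        to \<open>H (s + 1 - j)\<close>, so its component in \<open>H s\<close> lies in \<open>H
        (j - 1)\<close>, against the minimality of \<open>j\<close>.\<close>
      have "e \<in> ?S"
      proof (rule ccontr)
        assume ne: "e \<notin> ?S"
        have S: "vec.subspace ?S" using Lsub subH'(1) by (rule vec.subspace_sums)
        have SV: "?S \<subseteq> V"
        proof
          fix x assume "x \<in> ?S"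
          then obtain a b where "x = a + b" "a \<in> L" "b \<in> ?H" by blast
          then show "x \<in> V" using Lperp[of a] subH'(2) V(1,4) vec.subspace_add by blast
        qed
        obtain p where p: "p \<in> V" "\<beta> e p = 1" "\<And>s. s \<in> ?S \<Longrightarrow> \<beta> s p = 0"
          using separating_vector[OF S V(1) SV V(2) e_r(2) ne] by blast
        have pL0: "\<beta> p a = 0" if "a \<in> L" for a
        proof -
          have "a + 0 \<in> ?S" using that vec.subspace_0[OF subH'(1)] by blast
          then show ?thesis using p(3)[of "a + 0"] skew[of p a] by simp
        qed
        then have pL: "p \<in> L" using Lperp[of p] p(1) by blast
        have ph: "\<beta> b p = 0" if "b \<in> ?H" for b
        proof -
          have "0 + b \<in> ?S" using that vec.subspace_0[OF Lsub] by blast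
          then show ?thesis using p(3)[of "0 + b"] by simp
        qed
        obtain pu pw where pp: "pu \<in> F r" "pw \<in> H s" "p = pu + pw" using dec[OF p(1)] by blast
        have "\<beta> pw b = 0" if "b \<in> ?H" for b
          using ph[OF that] orth[OF pp(1), of b] that subH'(2) pp(3) skew[of b p] by auto
        then have "pw \<in> H (s - (s + 1 - j))"
          using ch(2) j1 pp(2) unfolding selfdual_chain_def by auto
        moreover have "s - (s + 1 - j) = j - 1" using j1 j(2) by auto
        ultimately have "P (j - 1)" unfolding P_def using pp pL p(2) by auto
        then show False using not_less_Least[of "j - 1" P] j1 unfolding j_def by auto
      qed
      then obtain a b where ab: "e = a + b" "a \<in> L" "b \<in> ?H" by blast
      define g where "g = - b"
      have g: "g \<in> ?H" "g \<in> H s" "e + g \<in> L"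
        using ab subH' vec.subspace_neg[OF subH'(1)] unfolding g_def by auto
      have "\<beta> (f + w) (e + g) = 0" using Liso fw(3) g(3) by blast
      then have wg: "\<beta> w g = 1"
        using ef skew[of f e] orth[OF fw(1) g(2)] orth'[OF e_r(1) wH] by simp
      have z: "\<beta> e w = 0" "\<beta> e g = 0" "\<beta> f w = 0" "\<beta> f g = 0"
        using orth e_r fw g wH by auto
      let ?B = "{e, f, w, g}"
      have ne: "e \<noteq> g" "f \<noteq> w" using ef wg z skew[of g f] by auto
      have small: "e \<in> small_combinations ?B" "f \<in> small_combinations ?B" "w \<in> small_combinations ?B"
        "g \<in> small_combinations ?B" "e + g \<in> small_combinations ?B" "f + w \<in> small_combinations ?B"
        using ne small_combination_base[of ?B] small_combination_add[of ?B e g] small_combination_add[of ?B f w]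
        by auto
      show ?thesis
      proof (rule rest[OF orth_projection_two_pairs[OF ef wg z]])
        show "\<beta> y f *s e + \<beta> e y *s f + \<beta> y g *s w + \<beta> w y *s g \<in> vec.span (F k \<inter> small_combinations ?B)"
          if "k \<le> r" "y \<in> F k" for k y
        proof -
          have "\<beta> y g = 0" "\<beta> w y = 0" using orth orth' g(2) wH that Fr[OF that(1)] by auto
          then show ?thesis
            using splitF[OF fw(1) that] small by (intro vec.span_add span_scale_base) auto
        qed
        show "\<beta> y f *s e + \<beta> e y *s f + \<beta> y g *s w + \<beta> w y *s g \<in> vec.span (H k \<inter> small_combinations ?B)"
          if "k \<le> s" "y \<in> H k" for k y
        proof -
          have "\<beta> y f = 0" "\<beta> e y = 0" using orth orth' fw(1) e_r that Hs[OF that(1)] by auto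
          then show ?thesis
            using selfdual_chain_split[OF ch(2) j1 j(2) fw(2) g(1) that] small
            by (intro vec.span_add span_scale_base) auto
        qed
        show "\<beta> y f *s e + \<beta> e y *s f + \<beta> y g *s w + \<beta> w y *s g \<in> vec.span (L \<inter> small_combinations ?B)"
          if "y \<in> L" for y
        proof -
          have "\<beta> y (f + w) = 0" "\<beta> y (e + g) = 0"
            by (rule Liso[OF that fw(3)], rule Liso[OF that g(3)])
          then have "\<beta> w y = \<beta> y f" "\<beta> y g = \<beta> e y"
            using skew[of w y] skew[of e y] by (auto simp: add_eq_0_iff)
          then have "\<beta> y f *s e + \<beta> e y *s f + \<beta> y g *s w + \<beta> w y *s g = \<beta> y f *s (e + g) + \<beta> e y *s (f + w)"
            by (simp add: vec.scale_right_distrib)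
          also have "\<dots> \<in> vec.span (L \<inter> small_combinations ?B)"
            using fw(3) g(3) small by (intro vec.span_add span_scale_base) auto
          finally show ?thesis .
        qed
      qed (use e_r fw g wH in auto)
    qed
  qed
qed

lemma orthogonal_chains_lagrangian:
  assumes "orthogonal_chains V r F s H" "lagrangian_of V L"
  shows "has_normal_basis \<beta> V (insert L (F ` {..r} \<union> H ` {..s}))"
  using assms
proof (induction "vec.dim V" arbitrary: V F H L rule: less_induct)
  case less
  note C = less.prems(1) and L = less.prems(2)
  consider "F r \<noteq> {0}" | "H s \<noteq> {0}" | "F r = {0}" "H s = {0}" by blast
  then show ?case
  proof cases
    case 1
    show ?thesis by (rule orthogonal_chains_lagrangian_step[OF C L 1]) (use less.hyps in blast)
  next
    case 2
    have "has_normal_basis \<beta> V (insert L (H ` {..s} \<union> F ` {..r}))"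
    proof (rule orthogonal_chains_lagrangian_step[OF orthogonal_chains_sym[OF C] L 2])
      fix V2 F2 H2 L2
      assume "orthogonal_chains V2 s F2 r H2" "lagrangian_of V2 L2" "vec.dim V2 < vec.dim V"
      with less.hyps[of V2 H2 F2 L2] orthogonal_chains_sym
      show "has_normal_basis \<beta> V2 (insert L2 (F2 ` {..s} \<union> H2 ` {..r}))" by (metis Un_commute)
    qed
    then show ?thesis by (simp add: Un_commute)
  next
    case 3
    then have "V = {0}" using C vec.subspace_0 unfolding orthogonal_chains_def by fastforce
    then show ?thesis by (simp add: has_normal_basis_zero)
  qed
qed

lemma selfdual_chain_partner_top:
  assumes "selfdual_chain r F" "1 \<le> i" "f \<in> F (r + 1 - i)"
  shows "f \<in> F r"
proof -
  have "r + 1 - i \<le> r" using assms(2) by simp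
  then show ?thesis using selfdual_chain_mono[OF assms(1)] assms(3) by blast
qed

text \<open>
  The case \<open>v = 0\<close> keeps the induction going after the line has been used up.
\<close>

lemma orthogonal_chains_line_pair_step:
  assumes C: "orthogonal_chains V r F s H" and u: "u \<in> F r" "u \<noteq> 0" and v: "v = 0 \<or> v = u"
    and IH: "\<And>V2 F2 H2 v2. orthogonal_chains V2 r F2 s H2 \<Longrightarrow> v2 \<in> V2 \<Longrightarrow> vec.dim V2 < vec.dim V \<Longrightarrow>
      has_normal_basis \<beta> V2 (insert (vec.span {v2}) (F2 ` {..r} \<union> H2 ` {..s}))"
  shows "has_normal_basis \<beta> V (insert (vec.span {v}) (F ` {..r} \<union> H ` {..s}))"
proof -
  have V: "vec.subspace V" and ch: "selfdual_chain r F" "selfdual_chain s H"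
    and orth: "\<And>u w. u \<in> F r \<Longrightarrow> w \<in> H s \<Longrightarrow> \<beta> u w = 0"
    using C unfolding orthogonal_chains_def by auto
  obtain i f where i: "1 \<le> i" "i \<le> r" "u \<in> F i" "f \<in> F (r + 1 - i)" and uf: "\<beta> u f = 1"
    using selfdual_chain_partner[OF ch(1) u] by metis
  have fr: "f \<in> F r" by (rule selfdual_chain_partner_top[OF ch(1) i(1,4)])
  have small: "u \<in> small_combinations {u, f}" "f \<in> small_combinations {u, f}"
    by (auto intro: small_combination_base)
  let ?\<pi> = "\<lambda>x. \<beta> x f *s u + \<beta> u x *s f"
  have pi: "orth_projection {u, f} ?\<pi>" by (rule orth_projection_pair[OF uf])
  have piv: "?\<pi> v = v" using v uf by auto
  show ?thesis
  proof (rule orthogonal_chains_peel[OF C pi])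
    show "?\<pi> y \<in> vec.span (F j \<inter> small_combinations {u, f})" if "j \<le> r" "y \<in> F j" for j y
      using selfdual_chain_split[OF ch(1) i that] small by (intro vec.span_add span_scale_base) auto
    show "?\<pi> y \<in> vec.span (H j \<inter> small_combinations {u, f})" if "j \<le> s" "y \<in> H j" for j y
    proof -
      have "y \<in> H s" using selfdual_chain_mono[OF ch(2) that(1)] that(2) by auto
      then have "\<beta> y f = 0" "\<beta> u y = 0" using orth[OF fr, of y] orth[OF u(1), of y] skew[of y f] by auto
      then show ?thesis by (intro vec.span_add span_scale_base) auto
    qed
    show "?\<pi> y \<in> vec.span (vec.span {v} \<inter> small_combinations {u, f})" if y: "y \<in> vec.span {v}" for y
    proof -
      obtain c where "y = c *s v" using y by (auto simp: vec.span_singleton)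
      then have "?\<pi> y = (\<beta> y f) *s u" "u = v \<or> \<beta> y f = 0" using v by auto
      then show ?thesis using small by (simp only:) (intro span_scale_base, auto intro: vec.span_base)
    qed
    assume O: "orthogonal_chains (orth_rest V ?\<pi>) r (\<lambda>i. F i \<inter> orth_rest V ?\<pi>) s (\<lambda>i. H i \<inter> orth_rest V ?\<pi>)"
      and d: "vec.dim (orth_rest V ?\<pi>) < vec.dim V"
    have sub: "vec.subspace (orth_rest V ?\<pi>)" using V pi by (rule subspace_orth_rest)
    have "vec.span {v} \<inter> orth_rest V ?\<pi> = vec.span {0}"
    proof -
      have "?\<pi> (c *s v) = c *s v" for c using v uf by auto
      then have "vec.span {v} \<inter> orth_rest V ?\<pi> \<subseteq> {0}" by (auto simp: vec.span_singleton orth_rest_def)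
      then show ?thesis using vec.subspace_0[OF sub] vec.span_zero by auto
    qed
    then show "has_normal_basis \<beta> (orth_rest V ?\<pi>) (insert (vec.span {v} \<inter> orth_rest V ?\<pi>)
        ((\<lambda>i. F i \<inter> orth_rest V ?\<pi>) ` {..r} \<union> (\<lambda>i. H i \<inter> orth_rest V ?\<pi>) ` {..s}))"
      using IH[OF O vec.subspace_0[OF sub] d] by simp
  qed (use fr u in auto)
qed

text \<open>
  Write \<open>v = u + w\<close> along the orthogonal sum. Each nonzero component has a partner in its
  own flag, and the line then lies in the sum of the resulting hyperbolic planes.
\<close>

lemma orthogonal_chains_line:
  assumes "orthogonal_chains V r F s H" "v \<in> V"
  shows "has_normal_basis \<beta> V (insert (vec.span {v}) (F ` {..r} \<union> H ` {..s}))"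
  using assms
proof (induction "vec.dim V" arbitrary: V F H v rule: less_induct)
  case less
  note C = less.prems(1)
  have V: "vec.subspace V" "F r \<subseteq> V" "H s \<subseteq> V" and ch: "selfdual_chain r F" "selfdual_chain s H"
    and orth: "\<And>u w. u \<in> F r \<Longrightarrow> w \<in> H s \<Longrightarrow> \<beta> u w = 0"
    and dec: "\<And>x. x \<in> V \<Longrightarrow> \<exists>u\<in>F r. \<exists>w\<in>H s. x = u + w"
    using C unfolding orthogonal_chains_def by auto
  have orth': "\<beta> w u = 0" if "u \<in> F r" "w \<in> H s" for u w using orth[OF that] skew[of w u] by simp
  have left: ?case if "u \<in> F r" "u \<noteq> 0" "v = 0 \<or> v = u" for u
    by (rule orthogonal_chains_line_pair_step[OF C that]) (use less.hyps in blast)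
  have right: ?case if "w \<in> H s" "w \<noteq> 0" "v = 0 \<or> v = w" for w
  proof -
    have "has_normal_basis \<beta> V (insert (vec.span {v}) (H ` {..s} \<union> F ` {..r}))"
    proof (rule orthogonal_chains_line_pair_step[OF orthogonal_chains_sym[OF C] that])
      fix V2 F2 H2 v2
      assume "orthogonal_chains V2 s F2 r H2" "v2 \<in> V2" "vec.dim V2 < vec.dim V"
      with less.hyps[of V2 H2 F2 v2] orthogonal_chains_sym
      show "has_normal_basis \<beta> V2 (insert (vec.span {v2}) (F2 ` {..s} \<union> H2 ` {..r}))" by (metis Un_commute)
    qed
    then show ?thesis by (simp add: Un_commute)
  qed
  obtain u w where uw: "u \<in> F r" "w \<in> H s" "v = u + w" using dec less.prems(2) by blast
  consider "u \<noteq> 0" "w \<noteq> 0" | "u \<noteq> 0" "w = 0" | "u = 0" "w \<noteq> 0" | "u = 0" "w = 0" by blast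
  then show ?case
  proof cases
    case 2
    then show ?thesis using left[of u] uw by simp
  next
    case 3
    then show ?thesis using right[of w] uw by simp
  next
    case 4
    then have v0: "v = 0" using uw by simp
    show ?thesis
    proof (cases "V = {0}")
      case True
      then show ?thesis by (simp add: has_normal_basis_zero)
    next
      case False
      then obtain x where "x \<in> V" "x \<noteq> 0" using vec.subspace_0[OF V(1)] by blast
      then obtain u' w' where "u' \<in> F r" "w' \<in> H s" "u' \<noteq> 0 \<or> w' \<noteq> 0" using dec by force
      then show ?thesis using left[of u'] right[of w'] v0 by blast
    qed
  next
    case 1
    obtain i f where i: "1 \<le> i" "i \<le> r" "u \<in> F i" "f \<in> F (r + 1 - i)" and uf: "\<beta> u f = 1"
      using selfdual_chain_partner[OF ch(1) uw(1) 1(1)] by metis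
    obtain j g where j: "1 \<le> j" "j \<le> s" "w \<in> H j" "g \<in> H (s + 1 - j)" and wg: "\<beta> w g = 1"
      using selfdual_chain_partner[OF ch(2) uw(2) 1(2)] by metis
    have fr: "f \<in> F r" by (rule selfdual_chain_partner_top[OF ch(1) i(1,4)])
    have gs: "g \<in> H s" by (rule selfdual_chain_partner_top[OF ch(2) j(1,4)])
    have z: "\<beta> u w = 0" "\<beta> u g = 0" "\<beta> f w = 0" "\<beta> f g = 0" using orth uw fr gs by auto
    let ?B = "{u, f, w, g}"
    let ?\<pi> = "\<lambda>x. \<beta> x f *s u + \<beta> u x *s f + \<beta> x g *s w + \<beta> w x *s g"
    have ne: "u \<noteq> w" using uf z skew[of w f] by auto
    have small: "u \<in> small_combinations ?B" "f \<in> small_combinations ?B" "w \<in> small_combinations ?B"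
      "g \<in> small_combinations ?B" "u + w \<in> small_combinations ?B"
      using ne small_combination_base[of ?B] small_combination_add[of ?B u w] by auto
    have pi: "orth_projection ?B ?\<pi>" by (rule orth_projection_two_pairs[OF uf wg z])
    have wf: "\<beta> w f = 0" and wu: "\<beta> w u = 0" using orth' uw fr by auto
    have piv: "?\<pi> (c *s v) = c *s v" for c
      using uf wg z wf wu by (simp add: uw(3) vec.scale_right_distrib)
    have sub: "vec.subspace (orth_rest V ?\<pi>)" using V(1) pi by (rule subspace_orth_rest)
    show ?thesis
    proof (rule orthogonal_chains_peel[OF C pi])
      show "?\<pi> y \<in> vec.span (F k \<inter> small_combinations ?B)" if "k \<le> r" "y \<in> F k" for k y
      proof -
        have "y \<in> F r" using selfdual_chain_mono[OF ch(1) that(1)] that(2) by auto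
        then have "\<beta> y g = 0" "\<beta> w y = 0" using orth orth' gs uw(2) by auto
        then show ?thesis
          using selfdual_chain_split[OF ch(1) i that] small by (intro vec.span_add span_scale_base) auto
      qed
      show "?\<pi> y \<in> vec.span (H k \<inter> small_combinations ?B)" if "k \<le> s" "y \<in> H k" for k y
      proof -
        have "y \<in> H s" using selfdual_chain_mono[OF ch(2) that(1)] that(2) by auto
        then have "\<beta> y f = 0" "\<beta> u y = 0" using orth orth' fr uw(1) by auto
        then show ?thesis
          using selfdual_chain_split[OF ch(2) j that] small by (intro vec.span_add span_scale_base) auto
      qed
      show "?\<pi> y \<in> vec.span (vec.span {v} \<inter> small_combinations ?B)" if y: "y \<in> vec.span {v}" for y
      proof -
        obtain c where "y = c *s v" using y by (auto simp: vec.span_singleton)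
        then have "?\<pi> y = c *s v" by (simp only: piv)
        moreover have "v \<in> vec.span {v} \<inter> small_combinations ?B"
          using small(5) by (auto simp: uw(3) intro: vec.span_base)
        ultimately show ?thesis by (simp only:) (rule span_scale_base, blast)
      qed
      assume O: "orthogonal_chains (orth_rest V ?\<pi>) r (\<lambda>i. F i \<inter> orth_rest V ?\<pi>) s (\<lambda>i. H i \<inter> orth_rest V ?\<pi>)"
        and d: "vec.dim (orth_rest V ?\<pi>) < vec.dim V"
      have "vec.span {v} \<inter> orth_rest V ?\<pi> \<subseteq> {0}"
        using piv by (auto simp: vec.span_singleton orth_rest_def simp del: scale_left scale_right)
      then have "vec.span {v} \<inter> orth_rest V ?\<pi> = vec.span {0}"
        using vec.subspace_0[OF sub] vec.span_zero by auto
      then show "has_normal_basis \<beta> (orth_rest V ?\<pi>) (insert (vec.span {v} \<inter> orth_rest V ?\<pi>)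
        ((\<lambda>i. F i \<inter> orth_rest V ?\<pi>) ` {..r} \<union> (\<lambda>i. H i \<inter> orth_rest V ?\<pi>) ` {..s}))"
        using less.hyps[OF d O vec.subspace_0[OF sub]] by simp
    qed (use fr gs uw in auto)
  qed
qed

end

section \<open>Chains in one of two complementary Lagrangian subspaces\<close>

text \<open>
  An increasing chain of subspaces in which the dimension grows by at most one in each step.
  Repetitions are allowed in order that intersecting with a subspace again gives such a chain.
\<close>

definition slow_chain :: "nat \<Rightarrow> (nat \<Rightarrow> (complex ^ 'd::finite) set) \<Rightarrow> bool" where
  "slow_chain r F \<longleftrightarrow> (\<forall>i\<le>r. vec.subspace (F i)) \<and> (\<forall>i<r. F i \<subseteq> F (Suc i)) \<and>
     (\<forall>i<r. \<forall>x\<in>F (Suc i). \<forall>y\<in>F (Suc i). x \<notin> F i \<longrightarrow> (\<exists>c. y - c *s x \<in> F i))"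

lemma slow_chain_mono: "slow_chain r F \<Longrightarrow> i \<le> j \<Longrightarrow> j \<le> r \<Longrightarrow> F i \<subseteq> F j"
  unfolding slow_chain_def using chain_mono_le[of r F i j] by blast

lemma slow_chain_step:
  assumes "slow_chain r F" "1 \<le> i" "i \<le> r" "x \<in> F i" "x \<notin> F (i - 1)" "y \<in> F i"
  obtains c where "y - c *s x \<in> F (i - 1)"
proof -
  obtain k where k: "i = Suc k" using assms(2) by (cases i) auto
  have "\<exists>c. y - c *s x \<in> F k" using assms k unfolding slow_chain_def by auto
  then show ?thesis using that k by auto
qed

lemma slow_chain_Int:
  assumes "slow_chain r F" "vec.subspace V"
  shows "slow_chain r (\<lambda>i. F i \<inter> V)"
  unfolding slow_chain_def
proof (intro conjI allI impI ballI)
  show "vec.subspace (F i \<inter> V)" if "i \<le> r" for i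
    using assms that unfolding slow_chain_def by (auto intro: vec.subspace_inter)
  show "F i \<inter> V \<subseteq> F (Suc i) \<inter> V" if "i < r" for i
    using assms that unfolding slow_chain_def by blast
  fix i x y assume "i < r" "x \<in> F (Suc i) \<inter> V" "y \<in> F (Suc i) \<inter> V" "x \<notin> F i \<inter> V"
  with assms(1) obtain c where "y - c *s x \<in> F i" unfolding slow_chain_def by blast
  moreover have "y - c *s x \<in> V"
    using \<open>x \<in> F (Suc i) \<inter> V\<close> \<open>y \<in> F (Suc i) \<inter> V\<close> assms(2)
    by (auto intro: vec.subspace_diff vec.subspace_scale)
  ultimately show "\<exists>c. y - c *s x \<in> F i \<inter> V" by blast
qed

context alternating
begin

text \<open>
  The data fixed by a Borel subgroup of the general linear group, embedded as the stabilizer of two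
  complementary Lagrangian subspaces: one of them is \<open>W\<close> and the other one, \<open>F
  r\<close>, carries a flag.
\<close>

definition polarized_chain ::
  "(complex ^ 'd) set \<Rightarrow> (complex ^ 'd) set \<Rightarrow> nat \<Rightarrow> (nat \<Rightarrow> (complex ^ 'd) set) \<Rightarrow> bool" where
  "polarized_chain V W r F \<longleftrightarrow>
     vec.subspace V \<and> nondegenerate_on \<beta> V \<and> slow_chain r F \<and> F 0 = {0} \<and> vec.subspace W \<and>
     F r \<subseteq> V \<and> W \<subseteq> V \<and> (\<forall>x\<in>V. \<exists>u\<in>F r. \<exists>w\<in>W. x = u + w) \<and>
     (\<forall>u\<in>F r. \<forall>u'\<in>F r. \<beta> u u' = 0) \<and> (\<forall>w\<in>W. \<forall>w'\<in>W. \<beta> w w' = 0)"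

lemma polarized_chainD:
  assumes "polarized_chain V W r F"
  shows "vec.subspace V" "nondegenerate_on \<beta> V" "slow_chain r F" "F 0 = {0}" "vec.subspace W" "F r \<subseteq> V" "W \<subseteq> V"
    "\<And>x. x \<in> V \<Longrightarrow> \<exists>u\<in>F r. \<exists>w\<in>W. x = u + w" "\<And>u u'. u \<in> F r \<Longrightarrow> u' \<in> F r \<Longrightarrow> \<beta> u u' = 0"
    "\<And>w w'. w \<in> W \<Longrightarrow> w' \<in> W \<Longrightarrow> \<beta> w w' = 0" "\<And>i. i \<le> r \<Longrightarrow> vec.subspace (F i)" "\<And>i. i \<le> r \<Longrightarrow> F i \<subseteq> F r"
  using assms slow_chain_mono[of r F _ r] unfolding polarized_chain_def slow_chain_def by auto

lemma polarized_chain_restrict: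
  assumes C: "polarized_chain V W r F" and pi: "orth_projection B \<pi>" and B: "B \<subseteq> F r \<union> W"
  shows "polarized_chain (orth_rest V \<pi>) (W \<inter> orth_rest V \<pi>) r (\<lambda>i. F i \<inter> orth_rest V \<pi>)"
proof -
  note D = polarized_chainD[OF C]
  let ?V = "orth_rest V \<pi>"
  have BV: "B \<subseteq> V" using B D by auto
  have sub: "vec.subspace ?V" using D(1) pi by (rule subspace_orth_rest)
  show ?thesis
    unfolding polarized_chain_def
  proof (intro conjI ballI)
    show "nondegenerate_on \<beta> ?V" using D(1) pi BV D(2) by (rule nondegenerate_orth_rest)
    show "slow_chain r (\<lambda>i. F i \<inter> ?V)" using D(3) sub by (rule slow_chain_Int)
    show "F 0 \<inter> ?V = {0}" using D(4) vec.subspace_0[OF sub] by auto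
    show "vec.subspace (W \<inter> ?V)" using D(5) sub by (rule vec.subspace_inter)
    fix x assume x: "x \<in> ?V"
    then have "x \<in> V" by (simp add: orth_rest_def)
    then obtain u w where uw: "u \<in> F r" "w \<in> W" "x = u + w" using D(8) by blast
    have bx: "\<beta> b x = 0" if "b \<in> B" for b using x pi that by (auto simp: orth_rest_def orth_projection_def)
    have "\<beta> b u = 0 \<and> \<beta> b w = 0" if "b \<in> B" for b
      using bx[OF that] B that D(9)[of b u] D(10)[of b w] uw by auto
    then have "\<pi> u = 0" "\<pi> w = 0" using pi unfolding orth_projection_def by auto
    then show "\<exists>u\<in>F r \<inter> ?V. \<exists>w\<in>W \<inter> ?V. x = u + w"
      using uw D(6,7) by (auto simp: orth_rest_def)
  qed (use sub D in auto)
qed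

lemma polarized_chain_peel:
  assumes C: "polarized_chain V W r F" and pi: "orth_projection B \<pi>" and B: "B \<subseteq> F r \<union> W" "B \<noteq> {}"
    and F: "\<And>j y. j \<le> r \<Longrightarrow> y \<in> F j \<Longrightarrow> \<pi> y \<in> vec.span (F j \<inter> small_combinations B)"
    and W: "\<And>y. y \<in> W \<Longrightarrow> \<pi> y \<in> vec.span (W \<inter> small_combinations B)"
    and X: "vec.subspace X" "\<And>y. y \<in> X \<Longrightarrow> \<pi> y \<in> vec.span (X \<inter> small_combinations B)"
    and IH: "polarized_chain (orth_rest V \<pi>) (W \<inter> orth_rest V \<pi>) r (\<lambda>i. F i \<inter> orth_rest V \<pi>) \<Longrightarrow>
      vec.dim (orth_rest V \<pi>) < vec.dim V \<Longrightarrow>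
      has_normal_basis \<beta> (orth_rest V \<pi>) (insert (X \<inter> orth_rest V \<pi>) (insert (W \<inter> orth_rest V \<pi>)
        ((\<lambda>i. F i \<inter> orth_rest V \<pi>) ` {..r})))"
  shows "has_normal_basis \<beta> V (insert X (insert W (F ` {..r})))"
proof -
  note D = polarized_chainD[OF C]
  let ?V = "orth_rest V \<pi>"
  have BV: "B \<subseteq> V" using B D by auto
  have "polarized_chain ?V (W \<inter> ?V) r (\<lambda>i. F i \<inter> ?V)"
    using C pi B(1) by (rule polarized_chain_restrict)
  from IH[OF this dim_orth_rest[OF D(1) pi BV B(2)]]
  have "has_normal_basis \<beta> ?V ((\<lambda>Y. Y \<inter> ?V) ` (insert X (insert W (F ` {..r}))))"
    by (simp add: image_image)
  then show ?thesis
    by (intro has_normal_basis_orth_rest[OF D(1) BV pi]) (use D X F W in auto)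
qed

text \<open>
  A vector that is orthogonal to \<open>F (i - 1)\<close> but not to \<open>u\<close> exists by
  nondegeneracy. Its component in \<open>F r\<close> is orthogonal to the whole flag, so its component
  in \<open>W\<close> has the same property.
\<close>

lemma polarized_chain_partner_at:
  assumes C: "polarized_chain V W r F" and i: "1 \<le> i" "i \<le> r" "u \<in> F i" "u \<notin> F (i - 1)"
  obtains g where "g \<in> W" "\<beta> u g = 1" "\<And>y. y \<in> F (i - 1) \<Longrightarrow> \<beta> y g = 0"
proof -
  note D = polarized_chainD[OF C]
  have Fi: "F (i - 1) \<subseteq> F r" "vec.subspace (F (i - 1))" using D(11,12)[of "i - 1"] i by auto
  have u: "u \<in> F r" using D(12)[OF i(2)] i(3) by blast
  then have uV: "u \<in> V" using D(6) by blast
  have FV: "F (i - 1) \<subseteq> V" using Fi(1) D(6) by blast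
  obtain p where p: "p \<in> V" "\<beta> u p = 1" "\<And>y. y \<in> F (i - 1) \<Longrightarrow> \<beta> y p = 0"
    using separating_vector[OF Fi(2) D(1) FV D(2) uV i(4)] by blast
  obtain a g where ag: "a \<in> F r" "g \<in> W" "p = a + g" using D(8)[OF p(1)] by blast
  show ?thesis
  proof (rule that[OF ag(2)])
    show "\<beta> u g = 1" using p(2) D(9)[OF u ag(1)] by (simp add: ag(3))
    show "\<beta> y g = 0" if "y \<in> F (i - 1)" for y
      using p(3)[OF that] D(9)[OF _ ag(1), of y] that Fi(1) by (auto simp: ag(3))
  qed
qed

lemma polarized_chain_position:
  assumes C: "polarized_chain V W r F" and u: "u \<in> F r" "u \<noteq> 0"
  obtains i where "1 \<le> i" "i \<le> r" "u \<in> F i" "u \<notin> F (i - 1)"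
proof -
  define i where "i = (LEAST i. u \<in> F i)"
  have i: "u \<in> F i" "i \<le> r"
    unfolding i_def using LeastI[of "\<lambda>i. u \<in> F i" r] Least_le[of "\<lambda>i. u \<in> F i" r] u(1) by auto
  have i1: "1 \<le> i" using i(1) u(2) polarized_chainD(4)[OF C] by (cases i) auto
  have "u \<notin> F (i - 1)" using not_less_Least[of "i - 1" "\<lambda>i. u \<in> F i"] i1 by (simp add: i_def)
  then show ?thesis using that i i1 by blast
qed

text \<open>
  A vector of \<open>W\<close> defines a functional on the flag; \<open>e\<close> comes from the first
  member on which that functional is nonzero.
\<close>

lemma polarized_chain_dual_partner:
  assumes C: "polarized_chain V W r F" and w: "w \<in> W" "w \<noteq> 0"
  obtains j e where "1 \<le> j" "j \<le> r" "e \<in> F j" "\<beta> e w = 1" "\<And>y. y \<in> F (j - 1) \<Longrightarrow> \<beta> y w = 0"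
proof -
  note D = polarized_chainD[OF C]
  have wV: "w \<in> V" using w(1) D(7) by blast
  define P where "P j \<longleftrightarrow> (\<exists>e\<in>F j. \<beta> e w \<noteq> 0)" for j
  obtain p where p: "p \<in> V" "\<beta> w p = 1" using nondegenerate_pairing[OF D(1,2) wV w(2)] by blast
  obtain a b where ab: "a \<in> F r" "b \<in> W" "p = a + b" using D(8)[OF p(1)] by blast
  have "P r" unfolding P_def using ab p(2) D(10)[OF w(1) ab(2)] skew[of a w] by (intro bexI[of _ a]) auto
  define j where "j = (LEAST j. P j)"
  have j: "P j" "j \<le> r" unfolding j_def using LeastI[of P r] Least_le[of P r] \<open>P r\<close> by auto
  have j1: "1 \<le> j" using j(1) D(4) unfolding P_def by (cases j) auto
  have "\<not> P (j - 1)" using not_less_Least[of "j - 1" P] j1 unfolding j_def by auto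
  moreover obtain e where e: "e \<in> F j" "\<beta> e w \<noteq> 0" using j(1) unfolding P_def by blast
  ultimately show ?thesis
    using that[of j "(1 / \<beta> e w) *s e"] j1 j(2) vec.subspace_scale[OF D(11)[OF j(2)]] unfolding P_def by auto
qed

lemma polarized_chain_split:
  assumes C: "polarized_chain V W r F" and i: "1 \<le> i" "i \<le> r" "u \<in> F i" "\<And>y. y \<in> F (i - 1) \<Longrightarrow> \<beta> y g = 0"
    and y: "j \<le> r" "y \<in> F j"
  shows "\<beta> y g = 0 \<or> u \<in> F j"
proof (cases "i \<le> j")
  case True
  then show ?thesis using slow_chain_mono[OF polarized_chainD(3)[OF C], of i j] i y by auto
next
  case False
  then have "j \<le> i - 1" "i - 1 \<le> r" using i by auto
  then show ?thesis using slow_chain_mono[OF polarized_chainD(3)[OF C], of j "i - 1"] i y by blast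
qed

lemma polarized_chain_pair_peel:
  assumes C: "polarized_chain V W r F" and i: "1 \<le> i" "i \<le> r" "e \<in> F i" "\<And>y. y \<in> F (i - 1) \<Longrightarrow> \<beta> y f = 0"
    and f: "f \<in> W" "\<beta> e f = 1"
    and X: "vec.subspace X" "\<And>y. y \<in> X \<Longrightarrow>
      \<beta> y f *s e + \<beta> e y *s f \<in> vec.span (X \<inter> small_combinations {e, f})"
    and IH: "\<And>\<pi>. \<pi> = (\<lambda>x. \<beta> x f *s e + \<beta> e x *s f) \<Longrightarrow> orth_projection {e, f} \<pi> \<Longrightarrow>
      polarized_chain (orth_rest V \<pi>) (W \<inter> orth_rest V \<pi>) r (\<lambda>i. F i \<inter> orth_rest V \<pi>) \<Longrightarrow>
      vec.dim (orth_rest V \<pi>) < vec.dim V \<Longrightarrow>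
      has_normal_basis \<beta> (orth_rest V \<pi>) (insert (X \<inter> orth_rest V \<pi>) (insert (W \<inter> orth_rest V \<pi>)
        ((\<lambda>i. F i \<inter> orth_rest V \<pi>) ` {..r})))"
  shows "has_normal_basis \<beta> V (insert X (insert W (F ` {..r})))"
proof -
  note D = polarized_chainD[OF C]
  have e: "e \<in> F r" using D(12)[OF i(2)] i(3) by blast
  have small: "e \<in> small_combinations {e, f}" "f \<in> small_combinations {e, f}"
    by (auto intro: small_combination_base)
  note pi = orth_projection_pair[OF f(2)]
  show ?thesis
  proof (rule polarized_chain_peel[OF C pi])
    show "\<beta> y f *s e + \<beta> e y *s f \<in> vec.span (F j \<inter> small_combinations {e, f})" if "j \<le> r" "y \<in> F j" for j y
    proof -
      have "\<beta> e y = 0" using D(9)[OF e, of y] D(12)[OF that(1)] that(2) by blast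
      then show ?thesis
        using polarized_chain_split[OF C i that] small by (intro vec.span_add span_scale_base) auto
    qed
    show "\<beta> y f *s e + \<beta> e y *s f \<in> vec.span (W \<inter> small_combinations {e, f})" if "y \<in> W" for y
      using D(10)[OF that f(1)] f(1) small by (intro vec.span_add span_scale_base) auto
  qed (use e f X IH[OF refl pi] in auto)
qed

lemma polarized_chain_two_pair_peel:
  assumes C: "polarized_chain V W r F"
    and i: "1 \<le> i" "i \<le> r" "e \<in> F i" "\<And>y. y \<in> F (i - 1) \<Longrightarrow> \<beta> y f = 0"
    and j: "1 \<le> j" "j \<le> r" "u \<in> F j" "\<And>y. y \<in> F (j - 1) \<Longrightarrow> \<beta> y g = 0"
    and f: "f \<in> W" "\<beta> e f = 1" and g: "g \<in> W" "\<beta> u g = 1" and z: "\<beta> e g = 0" "\<beta> f u = 0"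
    and X: "vec.subspace X" "\<And>y. y \<in> X \<Longrightarrow>
      \<beta> y f *s e + \<beta> e y *s f + \<beta> y g *s u + \<beta> u y *s g \<in> vec.span (X \<inter> small_combinations {e, f, u, g})"
    and IH: "\<And>\<pi>. \<pi> = (\<lambda>x. \<beta> x f *s e + \<beta> e x *s f + \<beta> x g *s u + \<beta> u x *s g) \<Longrightarrow>
      orth_projection {e, f, u, g} \<pi> \<Longrightarrow>
      polarized_chain (orth_rest V \<pi>) (W \<inter> orth_rest V \<pi>) r (\<lambda>i. F i \<inter> orth_rest V \<pi>) \<Longrightarrow>
      vec.dim (orth_rest V \<pi>) < vec.dim V \<Longrightarrow>
      has_normal_basis \<beta> (orth_rest V \<pi>) (insert (X \<inter> orth_rest V \<pi>) (insert (W \<inter> orth_rest V \<pi>)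
        ((\<lambda>i. F i \<inter> orth_rest V \<pi>) ` {..r})))"
  shows "has_normal_basis \<beta> V (insert X (insert W (F ` {..r})))"
proof -
  note D = polarized_chainD[OF C]
  have e: "e \<in> F r" "u \<in> F r" using D(12) i j by blast+
  let ?B = "{e, f, u, g}"
  have small: "e \<in> small_combinations ?B" "f \<in> small_combinations ?B"
    "u \<in> small_combinations ?B" "g \<in> small_combinations ?B"
    using small_combination_base[of ?B] by auto
  have pi: "orth_projection ?B (\<lambda>x. \<beta> x f *s e + \<beta> e x *s f + \<beta> x g *s u + \<beta> u x *s g)"
    by (rule orth_projection_two_pairs) (use f g z D(9)[OF e] D(10)[OF f(1) g(1)] in auto)
  show ?thesis
  proof (rule polarized_chain_peel[OF C pi])
    show "\<beta> y f *s e + \<beta> e y *s f + \<beta> y g *s u + \<beta> u y *s g \<in> vec.span (F k \<inter> small_combinations ?B)"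
      if "k \<le> r" "y \<in> F k" for k y
    proof -
      have "y \<in> F r" using D(12)[OF that(1)] that(2) by blast
      then have "\<beta> e y = 0" "\<beta> u y = 0" using D(9) e by auto
      then show ?thesis
        using polarized_chain_split[OF C i that] polarized_chain_split[OF C j that] small
        by (intro vec.span_add span_scale_base) auto
    qed
    show "\<beta> y f *s e + \<beta> e y *s f + \<beta> y g *s u + \<beta> u y *s g \<in> vec.span (W \<inter> small_combinations ?B)"
      if "y \<in> W" for y
      using D(10)[OF that f(1)] D(10)[OF that g(1)] f(1) g(1) small
      by (intro vec.span_add span_scale_base) auto
  qed (use e f g X IH[OF refl pi] in auto)
qed

lemma polarized_chain_nonzero:
  assumes "polarized_chain V W r F" "V \<noteq> {0}"
  shows "F r \<noteq> {0}"
proof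
  note D = polarized_chainD[OF assms(1)]
  assume "F r = {0}"
  obtain x where x: "x \<in> V" "x \<noteq> 0" using assms(2) vec.subspace_0[OF D(1)] by blast
  obtain p where p: "p \<in> V" "\<beta> x p = 1" using nondegenerate_pairing[OF D(1,2) x] by blast
  have "x \<in> W" "p \<in> W" using D(8)[OF x(1)] D(8)[OF p(1)] \<open>F r = {0}\<close> by auto
  then show False using D(10) p(2) by simp
qed

text \<open>
  The argument follows that for \<open>orthogonal_chains_lagrangian_step\<close>, with
  \<open>e\<close> in the first nonzero member of the flag, hence unique up to a scalar, and with a
  vector \<open>u + w \<in> L\<close> that pairs to 1 with \<open>e\<close> and has \<open>u\<close>
  in the smallest possible member \<open>F j\<close>. Two points are new. If \<open>u\<close> is a
  nonzero multiple of \<open>e\<close>, the factor is normalized by means of a square root. If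
  \<open>u\<close> lies higher in the flag, the two hyperbolic pairs need not be orthogonal at first
  and must be corrected.
\<close>

lemma polarized_chain_lagrangian:
  assumes "polarized_chain V W r F" "lagrangian_of V L"
  shows "has_normal_basis \<beta> V (insert L (insert W (F ` {..r})))"
  using assms
proof (induction "vec.dim V" arbitrary: V W F L rule: less_induct)
  case less
  note C = less.prems(1) and L = less.prems(2)
  note D = polarized_chainD[OF C]
  have Lsub: "vec.subspace L" and Lperp: "\<And>x. x \<in> L \<longleftrightarrow> x \<in> V \<and> (\<forall>y\<in>L. \<beta> x y = 0)"
    using L unfolding lagrangian_of_def by blast+
  have Liso: "\<beta> x y = 0" if "x \<in> L" "y \<in> L" for x y using Lperp that by blast
  have IH: "has_normal_basis \<beta> (orth_rest V \<pi>) (insert (L \<inter> orth_rest V \<pi>) (insert (W \<inter> orth_rest V \<pi>)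
        ((\<lambda>i. F i \<inter> orth_rest V \<pi>) ` {..r})))"
    if "orth_projection B \<pi>"
      "polarized_chain (orth_rest V \<pi>) (W \<inter> orth_rest V \<pi>) r (\<lambda>i. F i \<inter> orth_rest V \<pi>)"
      "vec.dim (orth_rest V \<pi>) < vec.dim V"
      "\<And>y. y \<in> L \<Longrightarrow> \<pi> y \<in> vec.span (L \<inter> small_combinations B)" for B \<pi>
  proof -
    have "\<pi> y \<in> L" if "y \<in> L" for y
      using that \<open>\<And>y. y \<in> L \<Longrightarrow> \<pi> y \<in> _\<close> span_small_subset[OF Lsub, of B] by blast
    from lagrangian_of_restrict[OF that(1) L D(1) this] show ?thesis
      using less.hyps[OF that(3,2)] by blast
  qed
  show ?case
  proof (cases "V = {0}")
    case True
    then show ?thesis by (simp add: has_normal_basis_zero)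
  next
    case False
    have nz: "F r \<noteq> {0}" using C False by (rule polarized_chain_nonzero)
    define i where "i = (LEAST i. F i \<noteq> {0})"
    have i: "F i \<noteq> {0}" "i \<le> r"
      unfolding i_def using LeastI[of "\<lambda>i. F i \<noteq> {0}" r] Least_le[of "\<lambda>i. F i \<noteq> {0}" r] nz by auto
    have i1: "1 \<le> i" using i(1) D(4) by (cases i) auto
    have Fi0: "F j = {0}" if "j < i" for j
      using not_less_Least[of j "\<lambda>i. F i \<noteq> {0}"] that unfolding i_def by blast
    have Fi1: "F (i - 1) = {0}" using Fi0 i1 by auto
    obtain e where e: "e \<in> F i" "e \<noteq> 0" using i D(11)[OF i(2)] vec.subspace_0 by blast
    have e_r: "e \<in> F r" "e \<in> V" using e D(12)[OF i(2)] D(6) by auto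
    have Fie: "\<exists>c. y = c *s e" if "y \<in> F i" for y
      using slow_chain_step[OF D(3) i1 i(2) e(1) _ that] e(2) Fi1 by (metis eq_iff_diff_eq_0 singletonD)
    have pair: ?thesis if f: "f \<in> W" "\<beta> e' f = 1" and e': "e' \<in> F i"
      and fL: "\<And>y. y \<in> L \<Longrightarrow> \<beta> y f *s e' + \<beta> e' y *s f \<in> vec.span (L \<inter> small_combinations {e', f})" for f e'
      by (rule polarized_chain_pair_peel[OF C i1 i(2) e' _ f Lsub fL]) (use Fi1 IH fL in auto)
    show ?thesis
    proof (cases "e \<in> L")
      case True
      have "e \<notin> F (i - 1)" using Fi1 e(2) by simp
      from polarized_chain_partner_at[OF C i1 i(2) e(1) this]
      obtain f where f: "f \<in> W" "\<beta> e f = 1" by blast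
      show ?thesis
      proof (rule pair[OF f e(1)])
        show "\<beta> y f *s e + \<beta> e y *s f \<in> vec.span (L \<inter> small_combinations {e, f})" if "y \<in> L" for y
          using Liso[OF True that] True small_combination_base[of "{e, f}" e]
          by (intro vec.span_add span_scale_base) auto
      qed
    next
      case False
      then obtain x0 where x0: "x0 \<in> L" "\<beta> e x0 \<noteq> 0" using Lperp e_r by blast
      define P where "P j \<longleftrightarrow> (\<exists>u\<in>F j. \<exists>w\<in>W. u + w \<in> L \<and> \<beta> e (u + w) = 1)" for j
      have "P r"
      proof -
        have "(1 / \<beta> e x0) *s x0 \<in> L" using Lsub x0 by (intro vec.subspace_scale)
        moreover from this obtain u w where "u \<in> F r" "w \<in> W" "(1 / \<beta> e x0) *s x0 = u + w"
          using D(8) Lperp by blast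
        moreover have "\<beta> e ((1 / \<beta> e x0) *s x0) = 1" using x0 by simp
        ultimately show ?thesis unfolding P_def by (intro bexI[of _ u] bexI[of _ w]) auto
      qed
      define j where "j = (LEAST j. P j)"
      have j: "P j" "j \<le> r" unfolding j_def using LeastI[of P r] Least_le[of P r] \<open>P r\<close> by auto
      obtain u w where uw: "u \<in> F j" "w \<in> W" "u + w \<in> L" "\<beta> e (u + w) = 1" using j(1) unfolding P_def by blast
      have ur: "u \<in> F r" using uw(1) D(12)[OF j(2)] by blast
      have ew: "\<beta> e w = 1" using uw(4) D(9)[OF e_r(1) ur] by simp
      show ?thesis
      proof (cases "j \<le> i")
        case True
        have "u \<in> F i" using slow_chain_mono[OF D(3) True i(2)] uw(1) by blast
        then obtain c where c: "u = c *s e" using Fie by blast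
        show ?thesis
        proof (cases "c = 0")
          case True
          then have wL: "w \<in> L" using uw(3) c by simp
          show ?thesis
          proof (rule pair[OF uw(2) ew e(1)])
            show "\<beta> y w *s e + \<beta> e y *s w \<in> vec.span (L \<inter> small_combinations {e, w})" if "y \<in> L" for y
              using Liso[OF that wL] wL small_combination_base[of "{e, w}" w]
              by (intro vec.span_add span_scale_base) auto
          qed
        next
          case False
          \<comment> \<open>Here \<open>L\<close> contains \<open>c e + w\<close>. Rescaling \<open>e\<close> by a
            root of \<open>c\<close> and \<open>w\<close> by its inverse keeps the pair hyperbolic
            and makes the coefficients equal.\<close>
          define s where "s = csqrt c"
          have s: "s * s = c" "s \<noteq> 0" using False power2_csqrt[of c] by (auto simp: s_def power2_eq_square)
          let ?e = "s *s e" and ?w = "(1 / s) *s w"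
          have ew': "\<beta> ?e ?w = 1" using ew s by simp
          have "(1 / s) *s (u + w) = ?e + ?w"
            using s by (simp add: c vec.scale_right_distrib field_simps)
          then have L1: "?e + ?w \<in> L" using vec.subspace_scale[OF Lsub uw(3), of "1 / s"] by simp
          have ne: "?e \<noteq> ?w" using ew' by (metis self zero_neq_one)
          show ?thesis
          proof (rule pair[OF _ ew'])
            show "?w \<in> W" using D(5) uw(2) by (rule vec.subspace_scale)
            show "?e \<in> F i" using D(11)[OF i(2)] e(1) by (rule vec.subspace_scale)
            show "\<beta> y ?w *s ?e + \<beta> ?e y *s ?w \<in> vec.span (L \<inter> small_combinations {?e, ?w})" if "y \<in> L" for y
            proof -
              have "\<beta> y (?e + ?w) = 0" by (rule Liso[OF that L1])
              then have "\<beta> y ?w = \<beta> ?e y" using skew[of ?e y] by (simp only: add_right) (simp add: add_eq_0_iff)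
              then have "\<beta> y ?w *s ?e + \<beta> ?e y *s ?w = \<beta> ?e y *s (?e + ?w)"
                by (simp only: vec.scale_right_distrib)
              also have "\<dots> \<in> vec.span (L \<inter> small_combinations {?e, ?w})"
                using L1 small_combination_add[of "{?e, ?w}" ?e ?w] ne by (intro span_scale_base) auto
              finally show ?thesis .
            qed
          qed
        qed
      next
        case False
        then have ij: "i < j" and j1: "1 \<le> j" and j0: "0 < j" by auto
        have Fj: "F (j - 1) \<subseteq> F r" "vec.subspace (F (j - 1))" using D(11,12)[of "j - 1"] j(2) by auto
        let ?H = "{g \<in> W. \<forall>y\<in>F (j - 1). \<beta> g y = 0}"
        have subH: "vec.subspace ?H" using D(5) by (rule subspace_perp)
        let ?S = "{a + b | a b. a \<in> L \<and> b \<in> ?H}"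
        \<comment> \<open>Otherwise some \<open>p \<in> L\<close> pairs to 1 with \<open>e\<close>, and by duality
          its component in the flag lies in \<open>F (j - 1)\<close>, against the minimality of
          \<open>j\<close>.\<close>
        have "e \<in> ?S"
        proof (rule ccontr)
          assume ne: "e \<notin> ?S"
          have S: "vec.subspace ?S" using Lsub subH by (rule vec.subspace_sums)
          have SV: "?S \<subseteq> V"
          proof
            fix x assume "x \<in> ?S"
            then obtain a b where "x = a + b" "a \<in> L" "b \<in> W" by blast
            then show "x \<in> V" using Lperp[of a] D(1,7) vec.subspace_add by blast
          qed
          obtain p where p: "p \<in> V" "\<beta> e p = 1" "\<And>s. s \<in> ?S \<Longrightarrow> \<beta> s p = 0"
            using separating_vector[OF S D(1) SV D(2) e_r(2) ne] by blast
          have "\<beta> p a = 0" if "a \<in> L" for a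
          proof -
            have "a + 0 \<in> ?S" using that vec.subspace_0[OF subH] by blast
            then show ?thesis using p(3)[of "a + 0"] skew[of p a] by simp
          qed
          then have pL: "p \<in> L" using Lperp[of p] p(1) by blast
          have ph: "\<beta> b p = 0" if "b \<in> ?H" for b
          proof -
            have "0 + b \<in> ?S" using that vec.subspace_0[OF Lsub] by blast
            then show ?thesis using p(3)[of "0 + b"] by simp
          qed
          obtain pu pw where pp: "pu \<in> F r" "pw \<in> W" "p = pu + pw" using D(8)[OF p(1)] by blast
          have "pu \<in> F (j - 1)"
          proof (rule ccontr)
            assume npu: "pu \<notin> F (j - 1)"
            have puV: "pu \<in> V" and FV: "F (j - 1) \<subseteq> V" using pp(1) Fj(1) D(6) by auto
            obtain q where q: "q \<in> V" "\<beta> pu q = 1" "\<And>y. y \<in> F (j - 1) \<Longrightarrow> \<beta> y q = 0"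
              using separating_vector[OF Fj(2) D(1) FV D(2) puV npu] by blast
            obtain qu qw where qq: "qu \<in> F r" "qw \<in> W" "q = qu + qw" using D(8)[OF q(1)] by blast
            have "\<beta> qw y = 0" if "y \<in> F (j - 1)" for y
              using q(3)[OF that] D(9)[OF _ qq(1), of y] that Fj(1) skew[of qw y] by (auto simp: qq(3))
            then have "\<beta> qw p = 0" using ph qq(2) by blast
            then have "\<beta> pu qw = 0" using D(10)[OF qq(2) pp(2)] skew[of pu qw] by (simp add: pp(3))
            then show False using q(2) D(9)[OF pp(1) qq(1)] by (simp add: qq(3))
          qed
          then have "P (j - 1)" unfolding P_def using pp pL p(2) by auto
          then show False using not_less_Least[of "j - 1" P] j0 unfolding j_def by auto
        qed
        then obtain a b where ab: "e = a + b" "a \<in> L" "b \<in> ?H" by blast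
        define g where "g = - b"
        have g: "g \<in> W" "e + g \<in> L" and gF: "\<And>y. y \<in> F (j - 1) \<Longrightarrow> \<beta> y g = 0"
          using ab vec.subspace_neg[OF D(5)] skew[of _ b] unfolding g_def by auto
        have "F i \<subseteq> F (j - 1)" using slow_chain_mono[OF D(3), of i "j - 1"] ij j(2) by auto
        then have eg: "\<beta> e g = 0" using gF e(1) by blast
        have "\<beta> (u + w) (e + g) = 0" using Liso[OF uw(3) g(2)] .
        then have ug: "\<beta> u g = 1"
          using ew skew[of w e] D(9)[OF ur e_r(1)] D(10)[OF uw(2) g(1)] by simp
        \<comment> \<open>The vectors \<open>u\<close> and \<open>w\<close> need not be orthogonal. Subtracting
          half of the defect along \<open>e\<close> from \<open>u\<close> and along
          \<open>g\<close> from \<open>w\<close> corrects this and changes \<open>u + w\<close> by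
          a multiple of \<open>e + g\<close> only, which keeps it in \<open>L\<close>.\<close>
        define b' where "b' = \<beta> u w / 2"
        define f where "f = w - b' *s g"
        define v where "v = u - b' *s e"
        have fW: "f \<in> W" unfolding f_def using D(5) uw(2) g(1) by (intro vec.subspace_diff vec.subspace_scale)
        have vF: "v \<in> F j"
          unfolding v_def using D(11)[OF j(2)] uw(1) e(1) slow_chain_mono[OF D(3), of i j] ij j(2)
          by (intro vec.subspace_diff vec.subspace_scale) auto
        have ef: "\<beta> e f = 1" using ew eg by (simp add: f_def)
        have vg: "\<beta> v g = 1" using ug eg by (simp add: v_def)
        have "\<beta> v f = 0" using ew ug eg by (simp add: v_def f_def algebra_simps) (simp add: b'_def)
        then have fv: "\<beta> f v = 0" using skew[of f v] by simp
        have L2: "v + f \<in> L"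
        proof -
          have "v + f = (u + w) - b' *s (e + g)" by (simp add: v_def f_def vec.scale_right_distrib)
          then show ?thesis using Lsub uw(3) g(2) by (metis vec.subspace_diff vec.subspace_scale)
        qed
        let ?B = "{e, f, v, g}"
        have "\<beta> f g = 0" using D(10) fW g(1) by blast
        then have ne: "e \<noteq> g" "v \<noteq> f" using ef vg skew[of g f] fW by auto
        have small: "e + g \<in> small_combinations ?B" "v + f \<in> small_combinations ?B"
          using ne small_combination_add[of ?B e g] small_combination_add[of ?B v f] by auto
        have LB: "\<beta> y f *s e + \<beta> e y *s f + \<beta> y g *s v + \<beta> v y *s g \<in> vec.span (L \<inter> small_combinations ?B)"
          if "y \<in> L" for y
        proof -
          have "\<beta> y (v + f) = 0" "\<beta> y (e + g) = 0"
            by (rule Liso[OF that L2], rule Liso[OF that g(2)])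
          then have "\<beta> v y = \<beta> y f" "\<beta> y g = \<beta> e y"
            using skew[of v y] skew[of e y] by (auto simp: add_eq_0_iff)
          then have "\<beta> y f *s e + \<beta> e y *s f + \<beta> y g *s v + \<beta> v y *s g = \<beta> y f *s (e + g) + \<beta> e y *s (v + f)"
            by (simp add: vec.scale_right_distrib)
          also have "\<dots> \<in> vec.span (L \<inter> small_combinations ?B)"
            using L2 g(2) small by (intro vec.span_add span_scale_base) auto
          finally show ?thesis .
        qed
        show ?thesis
          by (rule polarized_chain_two_pair_peel[OF C i1 i(2) e(1) _ j1 j(2) vF gF fW ef g(1) vg eg fv Lsub LB])
            (use Fi1 IH LB in auto)
      qed
    qed
  qed
qed

lemma span_singleton_orth_rest:
  assumes "vec.subspace V" "orth_projection B \<pi>" "\<pi> v = v"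
  shows "vec.span {v} \<inter> orth_rest V \<pi> = vec.span {0}"
proof -
  interpret l: Vector_Spaces.linear "(*s)" "(*s)" \<pi> using assms unfolding orth_projection_def by blast
  have "vec.span {v} \<inter> orth_rest V \<pi> \<subseteq> {0}"
    using assms(3) by (auto simp: vec.span_singleton orth_rest_def l.scale)
  then show ?thesis
    using vec.subspace_0[OF subspace_orth_rest[OF assms(1,2)]] vec.span_zero by auto
qed

lemma span_singleton_small:
  assumes "orth_projection B \<pi>" "\<pi> v = v" "v = 0 \<or> v \<in> small_combinations B" "y \<in> vec.span {v}"
  shows "\<pi> y \<in> vec.span (vec.span {v} \<inter> small_combinations B)"
proof -
  interpret l: Vector_Spaces.linear "(*s)" "(*s)" \<pi> using assms unfolding orth_projection_def by blast
  obtain c where "y = c *s v" using assms(4) by (auto simp: vec.span_singleton)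
  then have "\<pi> y = c *s v" using assms(2) by (simp add: l.scale)
  moreover have "v \<in> vec.span {v}" by (simp add: vec.span_base)
  ultimately show ?thesis using assms(3) by (auto intro: span_scale_base vec.span_zero)
qed

text \<open>
  Let \<open>v = u + w\<close> with \<open>u\<close> in the flag and \<open>w \<in> W\<close>. If
  \<open>\<beta> u w = 0\<close>, partners of \<open>u\<close> and \<open>w\<close> can be chosen
  orthogonal to each other. If \<open>\<beta> u w \<noteq> 0\<close>, one may rescale to
  \<open>\<beta> u w = 1\<close>. Then \<open>u\<close> and \<open>w\<close> form a hyperbolic pair,
  which is adapted to the flag if \<open>u\<close> appears in the flag where \<open>w\<close> becomes
  nonzero. If \<open>w\<close> is nonzero already on an earlier member, a vector \<open>e\<close> of
  that member is split off from \<open>u\<close>, and \<open>v = e + w + u'\<close> involves two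
  orthogonal pairs.
\<close>

lemma polarized_chain_line:
  assumes "polarized_chain V W r F" "v \<in> V"
  shows "has_normal_basis \<beta> V (insert (vec.span {v}) (insert W (F ` {..r})))"
  using assms
proof (induction "vec.dim V" arbitrary: V W F v rule: less_induct)
  case less
  note C = less.prems(1)
  note D = polarized_chainD[OF C]
  have IH: "has_normal_basis \<beta> (orth_rest V \<pi>) (insert (vec.span {v} \<inter> orth_rest V \<pi>) (insert (W \<inter> orth_rest V \<pi>)
        ((\<lambda>i. F i \<inter> orth_rest V \<pi>) ` {..r})))"
    if "orth_projection B \<pi>" "\<pi> v = v"
      "polarized_chain (orth_rest V \<pi>) (W \<inter> orth_rest V \<pi>) r (\<lambda>i. F i \<inter> orth_rest V \<pi>)"
      "vec.dim (orth_rest V \<pi>) < vec.dim V" for B \<pi> v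
    using less.hyps[OF that(4,3) vec.subspace_0[OF subspace_orth_rest[OF D(1) that(1)]]]
    unfolding span_singleton_orth_rest[OF D(1) that(1,2)] .
  have pair: "has_normal_basis \<beta> V (insert (vec.span {v}) (insert W (F ` {..r})))"
    if "1 \<le> i" "i \<le> r" "e \<in> F i" "\<And>y. y \<in> F (i - 1) \<Longrightarrow> \<beta> y f = 0" "f \<in> W" "\<beta> e f = 1"
      "v = 0 \<or> v \<in> small_combinations {e, f}" "\<beta> v f *s e + \<beta> e v *s f = v" for i e f v
    by (rule polarized_chain_pair_peel[OF C that(1-6)])
      (use span_singleton_small[OF orth_projection_pair[OF that(6)] that(8,7)] IH that(8) in auto)
  have two: "has_normal_basis \<beta> V (insert (vec.span {v}) (insert W (F ` {..r})))"
    if i: "1 \<le> i" "i \<le> r" "e \<in> F i" "\<And>y. y \<in> F (i - 1) \<Longrightarrow> \<beta> y f = 0"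
      and j: "1 \<le> j" "j \<le> r" "u \<in> F j" "\<And>y. y \<in> F (j - 1) \<Longrightarrow> \<beta> y g = 0"
      and f: "f \<in> W" "\<beta> e f = 1" and g: "g \<in> W" "\<beta> u g = 1" and z: "\<beta> e g = 0" "\<beta> f u = 0"
      and v: "v \<in> small_combinations {e, f, u, g}" "\<beta> v f *s e + \<beta> e v *s f + \<beta> v g *s u + \<beta> u v *s g = v"
    for i e f j u g v
  proof -
    have "\<beta> e u = 0" "\<beta> f g = 0" using D(9,10) D(12)[OF i(2)] D(12)[OF j(2)] i(3) j(3) f(1) g(1) by blast+
    then have pi: "orth_projection {e, f, u, g} (\<lambda>x. \<beta> x f *s e + \<beta> e x *s f + \<beta> x g *s u + \<beta> u x *s g)"
      by (intro orth_projection_two_pairs) (use f g z in auto)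
    show ?thesis
      by (rule polarized_chain_two_pair_peel[OF C i j f g z])
        (use span_singleton_small[OF pi v(2)] IH v in auto)
  qed
  show ?case
  proof (cases "V = {0}")
    case True
    then show ?thesis by (simp add: has_normal_basis_zero)
  next
    case False
    obtain u w where uw: "u \<in> F r" "w \<in> W" "v = u + w" using D(8) less.prems(2) by blast
    have left: ?thesis if u': "u' \<in> F r" "u' \<noteq> 0" "v = 0 \<or> v = u'" for u'
    proof -
      obtain i where i: "1 \<le> i" "i \<le> r" "u' \<in> F i" "u' \<notin> F (i - 1)"
        using polarized_chain_position[OF C u'(1,2)] by metis
      obtain g where g: "g \<in> W" "\<beta> u' g = 1" "\<And>y. y \<in> F (i - 1) \<Longrightarrow> \<beta> y g = 0"
        using polarized_chain_partner_at[OF C i] by metis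
      show ?thesis
        by (rule pair[OF i(1-3) g(3,1,2)]) (use u' g(2) small_combination_base[of "{u', g}" u'] in auto)
    qed
    have right: ?thesis if w: "w \<noteq> 0" "v = w"
    proof -
      obtain j e where j: "1 \<le> j" "j \<le> r" "e \<in> F j" "\<beta> e w = 1" "\<And>y. y \<in> F (j - 1) \<Longrightarrow> \<beta> y w = 0"
        using polarized_chain_dual_partner[OF C uw(2) w(1)] by metis
      show ?thesis
        by (rule pair[OF j(1-3,5) uw(2) j(4)]) (use w j(4) small_combination_base[of "{e, w}" w] in auto)
    qed
    have orthogonal: "has_normal_basis \<beta> V (insert (vec.span {u + w}) (insert W (F ` {..r})))"
      if u: "u \<in> F r" "u \<noteq> 0" and w: "w \<in> W" "w \<noteq> 0" and uw: "\<beta> u w = 0" for u w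
    proof -
      obtain i where i: "1 \<le> i" "i \<le> r" "u \<in> F i" "u \<notin> F (i - 1)"
        using polarized_chain_position[OF C u] by metis
      obtain g where g: "g \<in> W" "\<beta> u g = 1" "\<And>y. y \<in> F (i - 1) \<Longrightarrow> \<beta> y g = 0"
        using polarized_chain_partner_at[OF C i] by metis
      obtain j e where j: "1 \<le> j" "j \<le> r" "e \<in> F j" "\<beta> e w = 1" "\<And>y. y \<in> F (j - 1) \<Longrightarrow> \<beta> y w = 0"
        using polarized_chain_dual_partner[OF C w] by metis
      \<comment> \<open>The partner \<open>e\<close> of \<open>w\<close> must be made orthogonal to
        \<open>g\<close>. If \<open>i < j\<close>, subtract a multiple of \<open>u\<close>; if
        \<open>j < i\<close>, there is nothing to do; and \<open>i = j\<close> is impossible.\<close>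
      have "\<exists>e'. e' \<in> F j \<and> \<beta> e' w = 1 \<and> \<beta> e' g = 0"
      proof -
        consider "j < i" | "j = i" | "i < j" by linarith
        then show ?thesis
        proof cases
          case 1
          then have "F j \<subseteq> F (i - 1)" using slow_chain_mono[OF D(3), of j "i - 1"] i(2) by auto
          then show ?thesis using j(3,4) g(3) by blast
        next
          case 2
          obtain c where "e - c *s u \<in> F (i - 1)"
            using slow_chain_step[OF D(3) i(1,2,3,4), of e] j(3) 2 by blast
          then have "\<beta> (e - c *s u) w = 0" using j(5) 2 by blast
          then show ?thesis using j(4) uw by simp
        next
          case 3
          have "u \<in> F j" using slow_chain_mono[OF D(3), of i j] 3 j(2) i(3) by auto
          then have "e - \<beta> e g *s u \<in> F j"
            using D(11)[OF j(2)] j(3) by (auto intro: vec.subspace_diff vec.subspace_scale)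
          then show ?thesis using g(2) j(4) uw by (intro exI[of _ "e - \<beta> e g *s u"]) auto
        qed
      qed
      then obtain e' where e': "e' \<in> F j" "\<beta> e' w = 1" "\<beta> e' g = 0" by blast
      have wu: "\<beta> w u = 0" using uw skew[of w u] by simp
      have er: "e' \<in> F r" using e'(1) D(12)[OF j(2)] by blast
      have ne: "u \<noteq> w" using g(2) D(10)[OF w(1) g(1)] by auto
      show ?thesis
      proof (rule two[OF j(1,2) e'(1) j(5) i(1-3) g(3) w(1) e'(2) g(1,2) e'(3) wu])
        show "u + w \<in> small_combinations {e', w, u, g}"
          using small_combination_add[of "{e', w, u, g}" u w] ne by auto
        show "\<beta> (u + w) w *s e' + \<beta> e' (u + w) *s w + \<beta> (u + w) g *s u + \<beta> u (u + w) *s g = u + w"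
          using uw e' g D(10)[OF w(1) g(1)] D(9)[OF er u(1)] by simp
      qed
    qed
    have paired: "has_normal_basis \<beta> V (insert (vec.span {u + w}) (insert W (F ` {..r})))"
      if u: "u \<in> F r" and w: "w \<in> W" and uw: "\<beta> u w = 1" for u w
    proof -
      have "u \<noteq> 0" "w \<noteq> 0" using uw by auto
      obtain i where i: "1 \<le> i" "i \<le> r" "u \<in> F i" "u \<notin> F (i - 1)"
        using polarized_chain_position[OF C u \<open>u \<noteq> 0\<close>] by metis
      obtain j e where j: "1 \<le> j" "j \<le> r" "e \<in> F j" "\<beta> e w = 1" "\<And>y. y \<in> F (j - 1) \<Longrightarrow> \<beta> y w = 0"
        using polarized_chain_dual_partner[OF C w \<open>w \<noteq> 0\<close>] by metis
      have er: "e \<in> F r" using j(3) D(12)[OF j(2)] by blast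
      consider "i < j" | "i = j" | "j < i" by linarith
      then show ?thesis
      proof cases
        case 1
        then have "F i \<subseteq> F (j - 1)" using slow_chain_mono[OF D(3), of i "j - 1"] j(2) by auto
        then show ?thesis using i(3) j(5) uw by fastforce
      next
        case 2
        have ne: "u \<noteq> w" using uw by auto
        show ?thesis
        proof (rule pair[OF i(1-3) _ w uw])
          show "\<beta> y w = 0" if "y \<in> F (i - 1)" for y using j(5) that 2 by blast
          show "u + w = 0 \<or> u + w \<in> small_combinations {u, w}"
            using small_combination_add[of "{u, w}" u w] ne by auto
        qed (use uw in simp)
      next
        case 3
        \<comment> \<open>The functional of \<open>w\<close> is nonzero already on \<open>F j\<close> with
          \<open>j < i\<close>, and \<open>u - e\<close> is in its kernel.\<close>
        define u' where "u' = u - e"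
        have "j \<le> i - 1" "i - 1 \<le> r" using 3 i(2) by auto
        then have eF: "e \<in> F (i - 1)" using slow_chain_mono[OF D(3), of j "i - 1"] j(3) by blast
        have eFi: "e \<in> F i" using slow_chain_mono[OF D(3), of j i] 3 i(2) j(3) by auto
        have u'F: "u' \<in> F i" unfolding u'_def using D(11)[OF i(2)] i(3) eFi by (rule vec.subspace_diff)
        have "u' \<notin> F (i - 1)"
        proof
          assume "u' \<in> F (i - 1)"
          moreover have "vec.subspace (F (i - 1))" using D(11)[of "i - 1"] i(2) by auto
          ultimately have "u' + e \<in> F (i - 1)" using eF by (intro vec.subspace_add)
          then show False using i(4) by (simp add: u'_def)
        qed
        from polarized_chain_partner_at[OF C i(1,2) u'F this]
        obtain g where g: "g \<in> W" "\<beta> u' g = 1" "\<And>y. y \<in> F (i - 1) \<Longrightarrow> \<beta> y g = 0" by metis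
        have eg: "\<beta> e g = 0" using g(3) eF by blast
        have u'w: "\<beta> u' w = 0" using uw j(4) by (simp add: u'_def)
        then have wu': "\<beta> w u' = 0" using skew[of w u'] by simp
        have v: "u + w = e + w + u'" by (simp add: u'_def)
        have u'r: "u' \<in> F r" using u'F D(12)[OF i(2)] by blast
        have eu: "\<beta> e u' = 0" "\<beta> u' e = 0" using D(9) er u'r by auto
        have wg: "\<beta> w g = 0" using D(10) w g(1) by blast
        have ne: "e \<noteq> w" "e \<noteq> u'" "w \<noteq> u'" using j(4) g(2) eg wg by auto
        show ?thesis
          unfolding v
        proof (rule two[OF j(1-3,5) i(1,2) u'F g(3) w j(4) g(1,2) eg wu'])
          show "e + w + u' \<in> small_combinations {e, w, u', g}"
            using small_combination_add3[of "{e, w, u', g}" e w u'] ne by auto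
          show "\<beta> (e + w + u') w *s e + \<beta> e (e + w + u') *s w + \<beta> (e + w + u') g *s u' + \<beta> u' (e + w + u') *s g = e + w + u'"
            using j(4) g(2) eg u'w eu wg by simp
        qed
      qed
    qed
    consider "w = 0" "u = 0" | "w = 0" "u \<noteq> 0" | "u = 0" "w \<noteq> 0" | "u \<noteq> 0" "w \<noteq> 0" "\<beta> u w = 0" | "\<beta> u w \<noteq> 0"
      by blast
    then show ?thesis
    proof cases
      case 1
      obtain u' where "u' \<in> F r" "u' \<noteq> 0"
        using polarized_chain_nonzero[OF C False] vec.subspace_0[OF D(11)[of r]] by auto
      then show ?thesis using left 1 uw(3) by simp
    next
      case 2
      then show ?thesis using left[of u] uw by simp
    next
      case 3
      then show ?thesis using right uw by simp
    next
      case 4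
      then show ?thesis using orthogonal[of u w] uw by simp
    next
      case 5
      \<comment> \<open>The line determines \<open>v\<close> only up to a scalar, and over
        \<open>\<complex>\<close> a scalar makes \<open>\<beta> u w\<close> equal to 1.\<close>
      define t where "t = 1 / csqrt (\<beta> u w)"
      have t: "t \<noteq> 0" "t * (t * \<beta> u w) = 1"
        using 5 power2_csqrt[of "\<beta> u w"] by (auto simp: t_def power2_eq_square field_simps)
      have "has_normal_basis \<beta> V (insert (vec.span {t *s u + t *s w}) (insert W (F ` {..r})))"
        by (rule paired) (use uw t D(5) D(11)[of r] in \<open>auto intro: vec.subspace_scale\<close>)
      moreover have "vec.span {t *s u + t *s w} = vec.span {v}"
      proof -
        have 1: "t *s u + t *s w = t *s v" by (simp add: uw(3) vec.scale_right_distrib)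
        have "range (\<lambda>k. k *s (t *s v)) = range (\<lambda>k. k *s v)"
        proof (intro subset_antisym image_subsetI)
          show "k *s (t *s v) \<in> range (\<lambda>k. k *s v)" for k by (simp add: image_iff)
          show "k *s v \<in> range (\<lambda>k. k *s (t *s v))" for k
            using t(1) by (intro image_eqI[of _ _ "k / t"]) auto
        qed
        then show ?thesis unfolding 1 vec.span_singleton .
      qed
      ultimately show ?thesis by simp
    qed
  qed
qed

section \<open>Two isotropic subspaces of a possibly degenerate space\<close>

text \<open>
  The version of \<open>separating_vector\<close> for degenerate spaces, where a vector can only be
  separated from \<open>S\<close> enlarged by the radical.
\<close>

lemma separating_vector_mod_radical:
  assumes S: "vec.subspace S" "S \<subseteq> V" and V: "vec.subspace V" and x: "x \<in> V"
    and nx: "\<And>s t. s \<in> S \<Longrightarrow> t \<in> V \<Longrightarrow> (\<forall>z\<in>V. \<beta> t z = 0) \<Longrightarrow> x \<noteq> s + t"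
  obtains z where "z \<in> V" "\<beta> x z = 1" "\<And>s. s \<in> S \<Longrightarrow> \<beta> s z = 0"
proof -
  have "\<exists>z\<in>V. (\<forall>s\<in>S. \<beta> s z = 0) \<and> \<beta> x z \<noteq> 0"
  proof (rule ccontr)
    assume "\<not> ?thesis"
    then obtain s where s: "s \<in> S" "\<And>z. z \<in> V \<Longrightarrow> \<beta> x z = \<beta> s z"
      using double_perp[OF S(1) V S(2) x] by blast
    then have "x - s \<in> V" "\<forall>z\<in>V. \<beta> (x - s) z = 0"
      using V S(2) x by (auto intro: vec.subspace_diff)
    then show False using nx[OF s(1), of "x - s"] by simp
  qed
  then obtain z where z: "z \<in> V" "\<forall>s\<in>S. \<beta> s z = 0" "\<beta> x z \<noteq> 0" by blast
  show ?thesis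
    by (rule that[of "(1 / \<beta> x z) *s z"]) (use z V in \<open>auto intro: vec.subspace_scale\<close>)
qed

end

lemma independent_Un_of_disjoint_spans:
  fixes B C :: "(complex ^ 'd::finite) set"
  assumes "vec.independent B" "vec.independent C" "vec.span B \<inter> vec.span C = {0}"
  shows "vec.independent (B \<union> C)"
proof (rule vec.independent_if_scalars_zero)
  have fin: "finite B" "finite C" using assms(1,2) by (auto intro: vec.finiteI_independent)
  then show "finite (B \<union> C)" by simp
  have disj: "B \<inter> C = {}"
  proof (rule ccontr)
    assume "B \<inter> C \<noteq> {}"
    then obtain x where x: "x \<in> B" "x \<in> C" by blast
    then have "x = 0" using assms(3) vec.span_base[of x B] vec.span_base[of x C] by blast
    then show False using x assms(1) vec.dependent_zero by blast
  qed
  fix f x assume *: "(\<Sum>x\<in>B \<union> C. f x *s x) = 0" and x: "x \<in> B \<union> C"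
  let ?b = "\<Sum>x\<in>B. f x *s x" and ?c = "\<Sum>x\<in>C. f x *s x"
  have bc: "?b + ?c = 0" using * fin disj by (simp add: sum.union_disjoint)
  have b: "?b \<in> vec.span B" by (intro vec.span_sum vec.span_scale vec.span_base)
  have c: "?c \<in> vec.span C" by (intro vec.span_sum vec.span_scale vec.span_base)
  have "?b = - ?c" using bc by (rule eq_neg_iff_add_eq_0[THEN iffD2])
  then have "?b \<in> vec.span C" using vec.span_neg[OF c] by (simp only:)
  then have "?b = 0" using b assms(3) by blast
  moreover from this have "?c = 0" using bc by (simp only: add_0)
  ultimately show "f x = 0"
    using x vec.independentD[OF assms(1) fin(1) subset_refl, of f x]
      vec.independentD[OF assms(2) fin(2) subset_refl, of f x] by blast
qed

lemma ex_linear_projection: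
  fixes S T :: "(complex ^ 'd::finite) set"
  assumes "vec.subspace S" "vec.subspace T" "S \<inter> T = {0}"
  obtains p where "Vector_Spaces.linear (*s) (*s) p" "\<And>x. x \<in> S \<Longrightarrow> p x = x" "\<And>x. x \<in> T \<Longrightarrow> p x = 0"
    "\<And>x. p x \<in> S"
proof -
  obtain B where B: "B \<subseteq> S" "vec.independent B" "S \<subseteq> vec.span B" using vec.basis_exists by metis
  obtain C where C: "C \<subseteq> T" "vec.independent C" "T \<subseteq> vec.span C" using vec.basis_exists by metis
  have sB: "vec.span B = S" using B assms(1) by (simp add: subset_antisym vec.span_minimal)
  have sC: "vec.span C = T" using C assms(2) by (simp add: subset_antisym vec.span_minimal)
  have "vec.independent (B \<union> C)"
    using B(2) C(2) assms(3) by (intro independent_Un_of_disjoint_spans) (simp_all add: sB sC)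
  from vec.linear_independent_extend_subspace[OF this, of "\<lambda>x. if x \<in> B then x else 0"]
  obtain p where p: "Vector_Spaces.linear (*s) (*s) p"
    "\<And>x. x \<in> B \<union> C \<Longrightarrow> p x = (if x \<in> B then x else 0)"
    "range p = vec.span ((\<lambda>x. if x \<in> B then x else 0) ` (B \<union> C))" by blast
  interpret l: Vector_Spaces.linear "(*s)" "(*s)" p by fact
  have BC: "x \<notin> B" if "x \<in> C" for x
  proof
    assume "x \<in> B"
    then have "x = 0" using that B(1) C(1) assms(3) by blast
    then show False using \<open>x \<in> B\<close> B(2) vec.dependent_zero by blast
  qed
  show ?thesis
  proof (rule that[OF p(1)])
    show "p x = x" if "x \<in> S" for x
      using that unfolding sB[symmetric]
      by (induction rule: vec.span_induct_alt) (simp_all add: l.zero l.add l.scale p(2))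
    show "p x = 0" if "x \<in> T" for x
      using that unfolding sC[symmetric]
      by (induction rule: vec.span_induct_alt) (simp_all add: l.zero l.add l.scale p(2) BC)
    have "vec.span ((\<lambda>x. if x \<in> B then x else 0) ` (B \<union> C)) \<subseteq> S"
      using B(1) assms(1) vec.subspace_0[OF assms(1)] by (intro vec.span_minimal) auto
    then show "p x \<in> S" for x using p(3) by blast
  qed
qed

context alternating
begin

text \<open>
  For a radical vector \<open>a\<close> every complement is orthogonal, so one can be chosen that
  contains all members of the family without \<open>a\<close>.
\<close>

lemma has_normal_basis_peel_radical:
  assumes V: "vec.subspace V" "a \<in> V" and rad: "\<And>z. z \<in> V \<Longrightarrow> \<beta> a z = 0"
    and Z: "vec.subspace Z" "a \<notin> Z"
    and Y: "\<And>Y. Y \<in> \<Y> \<Longrightarrow> vec.subspace Y \<and> (a \<in> Y \<or> Y \<subseteq> Z)"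
    and IH: "\<And>V2. vec.subspace V2 \<Longrightarrow> V2 \<subset> V \<Longrightarrow> has_normal_basis \<beta> V2 \<Y>"
  shows "has_normal_basis \<beta> V \<Y>"
proof -
  have a0: "a \<noteq> 0" using Z vec.subspace_0 by blast
  have "vec.span {a} \<inter> Z = {0}"
  proof (intro subset_antisym subsetI)
    fix x assume "x \<in> vec.span {a} \<inter> Z"
    then obtain c where c: "x = c *s a" "c *s a \<in> Z" by (auto simp: vec.span_singleton)
    have "c = 0"
    proof (rule ccontr)
      assume "c \<noteq> 0"
      then have "(1 / c) *s (c *s a) = a" by simp
      then show False using vec.subspace_scale[OF Z(1) c(2), of "1 / c"] Z(2) by simp
    qed
    then show "x \<in> {0}" using c by simp
  qed (use vec.subspace_0[OF Z(1)] vec.span_zero in auto)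
  then obtain p where p: "Vector_Spaces.linear (*s) (*s) p" "\<And>x. x \<in> vec.span {a} \<Longrightarrow> p x = x"
    "\<And>x. x \<in> Z \<Longrightarrow> p x = 0" "\<And>x. p x \<in> vec.span {a}"
    using ex_linear_projection[OF vec.subspace_span Z(1)] by metis
  interpret l: Vector_Spaces.linear "(*s)" "(*s)" p by fact
  have pa: "p a = a" using p(2) by (simp add: vec.span_base)
  show ?thesis
  proof (rule has_normal_basis_peel[OF V(1), of "{a}" p])
    show "vec.independent {a}" using a0 by simp
    show "p y \<in> vec.span (Y \<inter> small_combinations {a})" if "Y \<in> \<Y>" "y \<in> V" "y \<in> Y" for Y y
    proof (cases "a \<in> Y")
      case True
      obtain c where "p y = c *s a" using p(4)[of y] by (auto simp: vec.span_singleton)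
      then show ?thesis using True small_combination_base[of "{a}" a] by (simp add: span_scale_base)
    next
      case False
      then have "y \<in> Z" using Y[OF that(1)] that(3) by blast
      then show ?thesis using p(3) vec.span_zero by simp
    qed
    have "a \<notin> {x \<in> V. p x = 0}" using pa a0 by simp
    then have "{x \<in> V. p x = 0} \<subset> V" using V(2) by blast
    moreover have "vec.subspace {x \<in> V. p x = 0}"
      using V(1) by (auto simp: vec.subspace_def l.add l.scale l.zero)
    ultimately show "has_normal_basis \<beta> {x \<in> V. p x = 0} \<Y>" using IH by blast
  qed (use V(2) rad p pa Y in auto)
qed

lemma has_normal_basis_peel_pair:
  assumes V: "vec.subspace V" "a \<in> V" "b \<in> V" and ab: "\<beta> a b = 1"
    and Y: "\<And>Y. Y \<in> \<Y> \<Longrightarrow> vec.subspace Y"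
      "\<And>Y y. Y \<in> \<Y> \<Longrightarrow> y \<in> V \<Longrightarrow> y \<in> Y \<Longrightarrow> (\<beta> y b = 0 \<or> a \<in> Y) \<and> (\<beta> a y = 0 \<or> b \<in> Y)"
    and IH: "\<And>V2. vec.subspace V2 \<Longrightarrow> V2 \<subset> V \<Longrightarrow> has_normal_basis \<beta> V2 \<Y>"
  shows "has_normal_basis \<beta> V \<Y>"
proof (rule has_normal_basis_orth_projection[OF V(1) _ orth_projection_pair[OF ab] Y(1)])
  have small: "a \<in> small_combinations {a, b}" "b \<in> small_combinations {a, b}"
    by (auto intro: small_combination_base)
  show "\<beta> y b *s a + \<beta> a y *s b \<in> vec.span (Y \<inter> small_combinations {a, b})" if "Y \<in> \<Y>" "y \<in> V" "y \<in> Y" for Y y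
    using Y(2)[OF that] small by (intro vec.span_add span_scale_base) auto
  have rest: "{x \<in> V. \<beta> x b *s a + \<beta> a x *s b = 0} = orth_rest V (\<lambda>x. \<beta> x b *s a + \<beta> a x *s b)"
    by (simp add: orth_rest_def)
  have "a \<noteq> 0" using ab by auto
  then have "a \<notin> orth_rest V (\<lambda>x. \<beta> x b *s a + \<beta> a x *s b)" using ab by (auto simp: orth_rest_def)
  moreover have "orth_rest V (\<lambda>x. \<beta> x b *s a + \<beta> a x *s b) \<subseteq> V" by (auto simp: orth_rest_def)
  ultimately have "orth_rest V (\<lambda>x. \<beta> x b *s a + \<beta> a x *s b) \<subset> V" using V(2) by blast
  then show "has_normal_basis \<beta> {x \<in> V. \<beta> x b *s a + \<beta> a x *s b = 0} \<Y>"
    unfolding rest using IH subspace_orth_rest[OF V(1) orth_projection_pair[OF ab]] by blast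
qed (use V in auto)

text \<open>
  The indecomposable block that is neither a hyperbolic plane nor a line in the radical: isotropic
  vectors \<open>a1 \<in> S1\<close> and \<open>a2 \<in> S2\<close> whose sum is in the radical, and a
  common partner \<open>z\<close>. The form is degenerate on the span of \<open>a1\<close>,
  \<open>a2\<close>, \<open>z\<close>, so there is no orthogonal projection. A retraction that
  respects \<open>S1\<close> and \<open>S2\<close> is written down with the help of a projection
  \<open>p\<close> onto \<open>S1\<close> along \<open>S2\<close> and \<open>z\<close>.
\<close>

lemma has_normal_basis_peel_triple:
  assumes V: "vec.subspace V" "S1 \<subseteq> V" "S2 \<subseteq> V" "z \<in> V" and S: "vec.subspace S1" "vec.subspace S2" "S1 \<inter> S2 = {0}"
    and iso: "\<And>x y. x \<in> S1 \<Longrightarrow> y \<in> S1 \<Longrightarrow> \<beta> x y = 0"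
      "\<And>x y. x \<in> S2 \<Longrightarrow> y \<in> S2 \<Longrightarrow> \<beta> x y = 0" "\<And>x y. x \<in> S1 \<Longrightarrow> y \<in> S2 \<Longrightarrow> \<beta> x y = 0"
    and a: "a1 \<in> S1" "a2 \<in> S2" "\<And>x. x \<in> V \<Longrightarrow> \<beta> (a1 + a2) x = 0" "\<beta> a1 z = 1"
    and Y: "\<Y> \<subseteq> {S1, S2, {0}}"
    and IH: "\<And>V2. vec.subspace V2 \<Longrightarrow> V2 \<subset> V \<Longrightarrow> has_normal_basis \<beta> V2 \<Y>"
  shows "has_normal_basis \<beta> V \<Y>"
proof -
  have aV: "a1 \<in> V" "a2 \<in> V" using a V by auto
  have a2: "\<beta> a2 x = - \<beta> a1 x" if "x \<in> V" for x
    using a(3)[OF that] by (simp add: add_eq_0_iff)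
  let ?T = "{s + t | s t. s \<in> S2 \<and> t \<in> vec.span {z}}"
  have T: "vec.subspace ?T" using S(2) by (intro vec.subspace_sums) simp_all
  have ST: "S1 \<inter> ?T = {0}"
  proof (intro subset_antisym subsetI)
    fix x assume "x \<in> S1 \<inter> ?T"
    then obtain s c where x: "x \<in> S1" "x = s + c *s z" "s \<in> S2" by (auto simp: vec.span_singleton)
    have "\<beta> a1 x = 0" "\<beta> a1 s = 0" by (rule iso(1)[OF a(1) x(1)], rule iso(3)[OF a(1) x(3)])
    then have "c = 0" using a(4) x(2) by simp
    then show "x \<in> {0}" using x S(3) by auto
  qed (use vec.subspace_0[OF T] vec.subspace_0[OF S(1)] in blast)
  obtain p where p: "Vector_Spaces.linear (*s) (*s) p" "\<And>x. x \<in> S1 \<Longrightarrow> p x = x" "\<And>x. x \<in> ?T \<Longrightarrow> p x = 0"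
    "\<And>x. p x \<in> S1"
    by (rule ex_linear_projection[OF S(1) T ST]) (rule that)
  interpret p: Vector_Spaces.linear "(*s)" "(*s)" p by fact
  have pS2: "p x = 0" if "x \<in> S2" for x
  proof -
    have "x + 0 \<in> ?T" using that vec.span_zero by blast
    then show ?thesis using p(3)[of "x + 0"] by simp
  qed
  have pz: "p z = 0"
  proof -
    have "0 + z \<in> ?T" using vec.subspace_0[OF S(2)] vec.span_base[of z "{z}"] by blast
    then show ?thesis using p(3)[of "0 + z"] by simp
  qed
  \<comment> \<open>The coefficients make \<open>\<pi>\<close> the identity on the three vectors. For \<open>\<pi>
    x = 0\<close> they give \<open>\<beta> a1 x = 0\<close> and \<open>\<beta> x z = 0\<close>,
    which is orthogonality to the block.\<close>
  define \<pi> where "\<pi> x = \<beta> (p x) z *s a1 + (\<beta> (p x) z - \<beta> x z) *s a2 + \<beta> a1 x *s z" for x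
  have lin: "Vector_Spaces.linear (*s) (*s) \<pi>"
    unfolding \<pi>_def
    by (intro linear_vecI) (simp_all add: p.add p.scale vec.scale_left_distrib vec.scale_right_distrib
        vec.scale_left_diff_distrib vec.scale_right_diff_distrib algebra_simps)
  interpret l: Vector_Spaces.linear "(*s)" "(*s)" \<pi> by (rule lin)
  let ?B = "{a1, a2, z}"
  have b: "\<beta> a2 z = -1" "\<beta> a1 a2 = 0" "\<beta> a2 a1 = 0" "\<beta> z a1 = -1" "\<beta> z a2 = 1"
    using a2[OF V(4)] a(4) iso(3)[OF a(1,2)] skew[of a2 a1] skew[of z a1] skew[of z a2] by auto
  have pib: "\<pi> a1 = a1" "\<pi> a2 = a2" "\<pi> z = z"
    using p(2)[OF a(1)] pS2[OF a(2)] pz a(4) b by (simp_all add: \<pi>_def)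
  have z0: "a1 \<noteq> 0" using a(4) by auto
  have ne: "a1 \<noteq> a2" "a1 \<noteq> z" "a2 \<noteq> z" using b a(4) by auto
  have coef: "\<alpha> = 0 \<and> \<gamma> = 0 \<and> \<delta> = 0" if "\<alpha> *s a1 + \<gamma> *s a2 + \<delta> *s z = 0" for \<alpha> \<gamma> \<delta>
  proof -
    have "\<beta> a1 (\<alpha> *s a1 + \<gamma> *s a2 + \<delta> *s z) = 0" using that by simp
    then have d: "\<delta> = 0" using b a(4) by simp
    have "p (\<alpha> *s a1 + \<gamma> *s a2 + \<delta> *s z) = 0" using that by (simp add: p.zero)
    then have "\<alpha> *s a1 = 0" using d p(2)[OF a(1)] pS2[OF a(2)] by (simp add: p.add p.scale)
    then have "\<alpha> = 0" using z0 by simp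
    moreover have "a2 \<noteq> 0" using b by auto
    ultimately show ?thesis using d that by simp
  qed
  show ?thesis
  proof (rule has_normal_basis_peel[OF V(1), of ?B \<pi>])
    show "vec.independent ?B"
    proof (rule vec.independent_if_scalars_zero)
      fix c x assume "(\<Sum>x\<in>?B. c x *s x) = 0" "x \<in> ?B"
      then show "c x = 0" using coef[of "c a1" "c a2" "c z"] ne by (auto simp: add.assoc)
    qed simp
    show "\<pi> x \<in> vec.span ?B" for x
      unfolding \<pi>_def by (intro vec.span_add vec.span_scale) (auto intro: vec.span_base)
    show "\<beta> b' x = 0" if "b' \<in> ?B" "x \<in> V" "\<pi> x = 0" for b' x
    proof -
      have "\<beta> (p x) z = 0" "\<beta> (p x) z - \<beta> x z = 0" "\<beta> a1 x = 0"
        using coef[OF that(3)[unfolded \<pi>_def]] by auto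
      then show ?thesis using that(1) a2[OF that(2)] skew[of z x] by auto
    qed
    have small: "a1 \<in> small_combinations ?B" "a2 \<in> small_combinations ?B"
      using small_combination_base[of ?B] by auto
    show "\<pi> y \<in> vec.span (Y \<inter> small_combinations ?B)" if "Y \<in> \<Y>" "y \<in> V" "y \<in> Y" for Y y
    proof -
      have "Y = S1 \<or> Y = S2 \<or> Y = {0}" using Y that(1) by blast
      then consider "Y = S1" | "Y = S2" | "Y = {0}" by blast
      then show ?thesis
      proof cases
        case 1
        then have "\<pi> y = \<beta> y z *s a1" using p(2) that(3) iso(1)[OF a(1)] by (simp add: \<pi>_def)
        then show ?thesis using 1 a(1) small by (simp add: span_scale_base)
      next
        case 2
        then have "\<pi> y = (- \<beta> y z) *s a2" using pS2 that(3) iso(3)[OF a(1)] by (simp add: \<pi>_def)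
        moreover have "(- \<beta> y z) *s a2 \<in> vec.span (Y \<inter> small_combinations ?B)"
          using 2 a(2) small by (intro span_scale_base) auto
        ultimately show ?thesis by simp
      next
        case 3
        then show ?thesis using that(3) by (simp add: l.zero vec.span_zero)
      qed
    qed
    have "a1 \<notin> {x \<in> V. \<pi> x = 0}" using pib(1) z0 by simp
    then have "{x \<in> V. \<pi> x = 0} \<subset> V" using aV(1) by blast
    moreover have "vec.subspace {x \<in> V. \<pi> x = 0}"
      using V(1) by (auto simp: vec.subspace_def l.add l.scale l.zero)
    ultimately show "has_normal_basis \<beta> {x \<in> V. \<pi> x = 0} \<Y>" using IH by blast
  qed (use aV V(4) lin pib b a(4) Y S(1,2) in auto)
qed

text \<open>
  The induction splits off one block at a time. As long as \<open>R1\<close> or \<open>R2\<close> is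
  nonzero, a radical vector can be removed. After that, one removes a vector of \<open>S1 \<inter>
  S2\<close>, together with a partner if it is not radical, and next a hyperbolic pair between
  \<open>S1\<close> and \<open>S2\<close>. What is left has \<open>S1\<close> orthogonal to
  \<open>S2\<close> and \<open>S1 \<inter> S2 = {0}\<close>. Radical vectors in \<open>S1\<close>, in
  \<open>S2\<close> or outside of the sum can be removed, and so can a vector of one of the two
  subspaces that is not congruent to a vector of the other modulo the radical, with a partner
  orthogonal to the other one. In the remaining case \<open>S1\<close> and \<open>S2\<close> are
  congruent modulo the radical, and the triple block applies unless both are zero.
\<close>

lemma isotropic_pair_has_normal_basis:
  assumes "vec.subspace V" "vec.subspace S1" "vec.subspace S2" "vec.subspace R1" "vec.subspace R2"
    and "S1 \<subseteq> V" "S2 \<subseteq> V" "R1 \<subseteq> S1" "R2 \<subseteq> S2" "R1 \<inter> R2 = {0}"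
    and "\<And>x y. x \<in> S1 \<Longrightarrow> y \<in> S1 \<Longrightarrow> \<beta> x y = 0" "\<And>x y. x \<in> S2 \<Longrightarrow> y \<in> S2 \<Longrightarrow> \<beta> x y = 0"
    and "\<And>x y. x \<in> R1 \<Longrightarrow> y \<in> V \<Longrightarrow> \<beta> x y = 0" "\<And>x y. x \<in> R2 \<Longrightarrow> y \<in> V \<Longrightarrow> \<beta> x y = 0"
  shows "has_normal_basis \<beta> V {S1, S2, R1, R2}"
  using assms
proof (induction "vec.dim V" arbitrary: V S1 S2 R1 R2 rule: less_induct)
  case less
  note V = less.prems(1) and sub = less.prems(2-5) and SV = less.prems(6,7) and RS = less.prems(8,9)
    and R12 = less.prems(10) and iso = less.prems(11,12) and rad = less.prems(13,14)
  let ?Y = "{S1, S2, R1, R2}"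
  have IH: "has_normal_basis \<beta> V2 ?Y" if V2: "vec.subspace V2" "V2 \<subset> V" for V2
  proof -
    have "vec.span V2 \<subset> vec.span V"
      using V2(2) by (simp only: vec.span_eq_iff[THEN iffD2, OF V2(1)] vec.span_eq_iff[THEN iffD2, OF V])
    then have d: "vec.dim V2 < vec.dim V" by (rule vec.dim_psubset)
    have "has_normal_basis \<beta> V2 {S1 \<inter> V2, S2 \<inter> V2, R1 \<inter> V2, R2 \<inter> V2}"
    proof (rule less.hyps[OF d V2(1)])
      show "R1 \<inter> V2 \<inter> (R2 \<inter> V2) = {0}" using R12 vec.subspace_0[OF V2(1)] by blast
      show "\<beta> x y = 0" if "x \<in> R1 \<inter> V2" "y \<in> V2" for x y using rad(1)[of x y] that V2(2) by blast
      show "\<beta> x y = 0" if "x \<in> R2 \<inter> V2" "y \<in> V2" for x y using rad(2)[of x y] that V2(2) by blast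
    qed (use sub V2 RS iso in \<open>auto intro: vec.subspace_inter\<close>)
    then have "has_normal_basis \<beta> V2 ((\<lambda>Y. Y \<inter> V2) ` ?Y)" by simp
    then show ?thesis unfolding has_normal_basis_Int .
  qed
  have zero: "0 \<in> S1" "0 \<in> S2" "0 \<in> R1" "0 \<in> R2" using sub vec.subspace_0 by auto
  have sub0: "vec.subspace {0 :: complex ^ 'd}" by (simp add: vec.subspace_def)
  let ?rad = "{x \<in> V. \<forall>z\<in>V. \<beta> x z = 0}"
  have subrad: "vec.subspace ?rad" using V by (rule subspace_perp)
  let ?S12 = "{x + y | x y. x \<in> S1 \<and> y \<in> S2}"
  have sub12: "vec.subspace ?S12" using sub(1,2) by (rule vec.subspace_sums)
  have S12: "S1 \<subseteq> ?S12" "S2 \<subseteq> ?S12" using zero by force+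
  have subsum: "vec.subspace {x + y | x y. x \<in> S \<and> y \<in> ?rad}" if "vec.subspace S" for S
    using that subrad by (rule vec.subspace_sums)
  have radical: ?case if "a \<in> V" "\<And>z. z \<in> V \<Longrightarrow> \<beta> a z = 0" "vec.subspace Z" "a \<notin> Z"
    "\<And>Y. Y \<in> ?Y \<Longrightarrow> a \<in> Y \<or> Y \<subseteq> Z" for a Z
    by (rule has_normal_basis_peel_radical[OF V that(1-4)]) (use sub that(5) IH in auto)
  have pair: ?case if ab: "a \<in> V" "b \<in> V" "\<beta> a b = 1"
    and Y: "\<And>Y y. Y \<in> ?Y \<Longrightarrow> y \<in> V \<Longrightarrow> y \<in> Y \<Longrightarrow> (\<beta> y b = 0 \<or> a \<in> Y) \<and> (\<beta> a y = 0 \<or> b \<in> Y)" for a b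
    by (rule has_normal_basis_peel_pair[OF V ab _ Y]) (use sub IH in auto)
  have radr: "\<beta> y x = 0" if "x \<in> R1 \<or> x \<in> R2" "y \<in> V" for x y
    using that rad skew[of y x] by auto
  show ?case
  proof (cases "R1 = {0} \<and> R2 = {0}")
    case False
    then consider "R1 \<inter> S2 \<noteq> {0}" | "R2 \<inter> S1 \<noteq> {0}" | "R1 \<noteq> {0}" "R1 \<inter> S2 = {0}" | "R2 \<noteq> {0}" "R2 \<inter> S1 = {0}"
      by blast
    then show ?thesis
    proof cases
      case 1
      then obtain a where a: "a \<in> R1" "a \<in> S2" "a \<noteq> 0" using zero by blast
      show ?thesis by (rule radical[of a R2]) (use a R12 RS SV rad sub in auto)
    next
      case 2
      then obtain a where a: "a \<in> R2" "a \<in> S1" "a \<noteq> 0" using zero by blast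
      show ?thesis by (rule radical[of a R1]) (use a R12 RS SV rad sub in auto)
    next
      case 3
      then obtain a where a: "a \<in> R1" "a \<notin> S2" using zero by blast
      show ?thesis by (rule radical[of a S2]) (use a RS SV rad sub in auto)
    next
      case 4
      then obtain a where a: "a \<in> R2" "a \<notin> S1" using zero by blast
      show ?thesis by (rule radical[of a S1]) (use a RS SV rad sub in auto)
    qed
  next
    case True
    then have R0: "R1 = {0}" "R2 = {0}" by auto
    show ?thesis
    proof (cases "S1 \<inter> S2 = {0}")
      case False
      then obtain a where a: "a \<in> S1" "a \<in> S2" "a \<noteq> 0" using zero by blast
      show ?thesis
      proof (cases "a \<in> ?rad")
        case True
        show ?thesis by (rule radical[of a "{0}"]) (use a SV True R0 sub0 in auto)
      next
        case False
        then obtain z0 where z0: "z0 \<in> V" "\<beta> a z0 \<noteq> 0" using a SV by blast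
        show ?thesis
        proof (rule pair[of a "(1 / \<beta> a z0) *s z0"])
          show "(1 / \<beta> a z0) *s z0 \<in> V" using V z0(1) by (rule vec.subspace_scale)
        qed (use a SV z0 R0 iso in auto)
      qed
    next
      case S0: True
      show ?thesis
      proof (cases "\<forall>x\<in>S1. \<forall>y\<in>S2. \<beta> x y = 0")
        case False
        then obtain a b where ab: "a \<in> S1" "b \<in> S2" "\<beta> a b \<noteq> 0" by blast
        have b: "(1 / \<beta> a b) *s b \<in> S2" using sub(2) ab(2) by (rule vec.subspace_scale)
        show ?thesis by (rule pair[of a "(1 / \<beta> a b) *s b"]) (use ab b SV iso R0 in auto)
      next
        case orth: True
        then have orth': "\<beta> y x = 0" if "x \<in> S1" "y \<in> S2" for x y using that skew[of y x] by simp
        define Rad S12 T1 T2 where defs: "Rad = ?rad" "S12 = ?S12"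
          "T1 = {x + y | x y. x \<in> S1 \<and> y \<in> ?rad}" "T2 = {x + y | x y. x \<in> S2 \<and> y \<in> ?rad}"
        consider a where "a \<in> S1" "a \<noteq> 0" "a \<in> Rad" | a where "a \<in> S2" "a \<noteq> 0" "a \<in> Rad"
          | a where "a \<in> Rad" "a \<notin> S12" | a where "a \<in> S1" "a \<notin> T2" | a where "a \<in> S2" "a \<notin> T1"
          | "S1 \<inter> Rad \<subseteq> {0}" "S2 \<inter> Rad \<subseteq> {0}" "Rad \<subseteq> S12" "S1 \<subseteq> T2" "S2 \<subseteq> T1"
          by blast
        then show ?thesis
          unfolding defs
        proof cases
          case (1 a)
          then show ?thesis by (intro radical[of a S2]) (use S0 SV sub R0 zero in auto)
        next
          case (2 a)
          then show ?thesis by (intro radical[of a S1]) (use S0 SV sub R0 zero in auto)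
        next
          case (3 a)
          show ?thesis
          proof (rule radical[of a ?S12])
            show "a \<in> Y \<or> Y \<subseteq> ?S12" if "Y \<in> ?Y" for Y
              using that S12 R0 vec.subspace_0[OF sub12] by blast
          qed (use 3 sub12 in auto)
        next
          case (4 a)
          have aV: "a \<in> V" using 4 SV by blast
          obtain z where z: "z \<in> V" "\<beta> a z = 1" "\<And>s. s \<in> S2 \<Longrightarrow> \<beta> s z = 0"
            by (rule separating_vector_mod_radical[OF sub(2) SV(2) V aV]) (use 4(2) in blast, rule that)
          show ?thesis
            by (rule pair[OF aV z(1,2)]) (use 4 z(3) iso orth R0 in auto)
        next
          case (5 a)
          have aV: "a \<in> V" using 5 SV by blast
          obtain z where z: "z \<in> V" "\<beta> a z = 1" "\<And>s. s \<in> S1 \<Longrightarrow> \<beta> s z = 0"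
            by (rule separating_vector_mod_radical[OF sub(1) SV(1) V aV]) (use 5(2) in blast, rule that)
          show ?thesis
            by (rule pair[OF aV z(1,2)]) (use 5 z(3) iso orth' R0 in auto)
        next
          case 6
          show ?thesis
          proof (cases "S1 = {0}")
            case False
            then obtain a1 where a1: "a1 \<in> S1" "a1 \<noteq> 0" using zero by blast
            then obtain b \<rho> where b: "a1 = b + \<rho>" "b \<in> S2" "\<rho> \<in> ?rad" using 6(4) by blast
            have "a1 \<notin> ?rad" using 6(1) a1 by blast
            then obtain z0 where z0: "z0 \<in> V" "\<beta> a1 z0 \<noteq> 0" using a1 SV by blast
            have z: "(1 / \<beta> a1 z0) *s z0 \<in> V" using V z0(1) by (rule vec.subspace_scale)
            have nb: "- b \<in> S2" using sub(2) b(2) by (rule vec.subspace_neg)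
            \<comment> \<open>The second vector of the block is \<open>- b\<close>, where \<open>b \<in>
              S2\<close> is congruent to \<open>a1\<close> modulo the radical.\<close>
            show ?thesis
              by (rule has_normal_basis_peel_triple[OF V SV z sub(1,2) S0 iso _ a1(1) nb _ _ _ IH])
                (use orth b z0 R0 in auto)
          next
            case True
            have S2: "S2 = {0}"
            proof (intro subset_antisym subsetI)
              fix x assume x: "x \<in> S2"
              with 6(5) obtain y t where yt: "x = y + t" "y \<in> S1" "t \<in> ?rad" by blast
              then have "x \<in> ?rad" using True by simp
              then show "x \<in> {0}" using 6(2) x by blast
            qed (use zero in simp)
            have rad0: "?rad \<subseteq> {0}"
            proof
              fix x assume "x \<in> ?rad"
              with 6(3) obtain y t where "x = y + t" "y \<in> S1" "t \<in> S2" by blast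
              then show "x \<in> {0}" using True S2 by simp
            qed
            show ?thesis
            proof (cases "V = {0}")
              case True
              then show ?thesis by (simp add: has_normal_basis_zero)
            next
              case False
              then obtain a where a: "a \<in> V" "a \<noteq> 0" using vec.subspace_0[OF V] by blast
              then obtain z0 where z0: "z0 \<in> V" "\<beta> a z0 \<noteq> 0" using rad0 by blast
              have z: "(1 / \<beta> a z0) *s z0 \<in> V" using V z0(1) by (rule vec.subspace_scale)
              show ?thesis by (rule pair[OF a(1) z]) (use z0 True S2 R0 in auto)
            qed
          qed
        qed
      qed
    qed
  qed
qed

section \<open>Extending isometries that respect a Lagrangian subspace\<close>

lemma dim_perp_independent:
  assumes V: "vec.subspace V" "nondegenerate_on \<beta> V" and "finite B" "vec.independent B" "B \<subseteq> V"
  shows "card B + vec.dim {x \<in> V. \<forall>b\<in>B. \<beta> x b = 0} = vec.dim V"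
  using assms(3-5)
proof (induction B rule: finite_induct)
  case (insert b B)
  let ?P = "{x \<in> V. \<forall>b\<in>B. \<beta> x b = 0}" and ?P' = "{x \<in> V. \<forall>b'\<in>insert b B. \<beta> x b' = 0}"
  have ind: "vec.independent B" "b \<notin> vec.span B"
    using insert.prems(1) insert.hyps(2) by (auto simp: vec.independent_insert)
  have spanV: "vec.span B \<subseteq> V" using insert.prems(2) V(1) by (intro vec.span_minimal) auto
  have bV: "b \<in> V" using insert.prems(2) by blast
  obtain p where p: "p \<in> V" "\<beta> b p = 1" "\<And>s. s \<in> vec.span B \<Longrightarrow> \<beta> s p = 0"
    using separating_vector[OF vec.subspace_span V(1) spanV V(2) bV ind(2)] by blast
  have pP: "p \<in> ?P" using p skew[of p] by (auto simp: vec.span_base)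
  have pb: "\<beta> p b = -1" using p(2) skew[of p b] by simp
  have sub: "vec.subspace ?P" "vec.subspace ?P'" using V(1) by (rule subspace_perp)+
  have span': "vec.span ?P' = ?P'" using sub(2) by (simp add: vec.span_eq_iff)
  have "vec.span (insert p ?P') = ?P"
  proof (intro subset_antisym)
    show "vec.span (insert p ?P') \<subseteq> ?P" using pP sub(1) by (intro vec.span_minimal) auto
    show "?P \<subseteq> vec.span (insert p ?P')"
    proof
      fix x assume x: "x \<in> ?P"
      have "x + \<beta> x b *s p \<in> ?P'"
        using x pP pb V(1) by (auto intro: vec.subspace_add vec.subspace_scale)
      then have "(x + \<beta> x b *s p) - \<beta> x b *s p \<in> vec.span (insert p ?P')"
        by (intro vec.span_diff vec.span_scale vec.span_base) auto
      then show "x \<in> vec.span (insert p ?P')" by simp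
    qed
  qed
  then have "vec.dim ?P = vec.dim (vec.span (insert p ?P'))" by (rule arg_cong[where f = vec.dim, OF sym])
  also have "\<dots> = vec.dim (insert p ?P')" by (rule vec.dim_span)
  also have "\<dots> = vec.dim ?P' + 1"
    unfolding vec.dim_insert span' using pb by simp
  finally show ?case using insert.IH ind(1) insert.prems(2) insert.hyps by simp
qed simp

lemma dim_perp:
  assumes V: "vec.subspace V" "nondegenerate_on \<beta> V" and S: "vec.subspace S" "S \<subseteq> V"
  shows "vec.dim S + vec.dim {x \<in> V. \<forall>y\<in>S. \<beta> x y = 0} = vec.dim V"
proof -
  obtain B where B: "B \<subseteq> S" "vec.independent B" "S \<subseteq> vec.span B" "card B = vec.dim S"
    using vec.basis_exists by metis
  have "{x \<in> V. \<forall>y\<in>S. \<beta> x y = 0} = {x \<in> V. \<forall>b\<in>B. \<beta> x b = 0}"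
  proof (intro Collect_cong conj_cong refl iffI ballI)
    fix x y assume "\<forall>b\<in>B. \<beta> x b = 0" "y \<in> S"
    then show "\<beta> x y = 0" using span_perp[of B x y] B(3) by blast
  qed (use B(1) in blast)
  then show ?thesis
    using dim_perp_independent[OF V vec.finiteI_independent[OF B(2)] B(2)] B S(2) by simp
qed

text \<open>
  Nondegeneracy represents every functional: the values on a basis can be prescribed.
\<close>

lemma ex_dual_values:
  assumes V: "vec.subspace V" "nondegenerate_on \<beta> V" and "finite B" "vec.independent B" "B \<subseteq> V"
  shows "\<exists>p\<in>V. \<forall>b\<in>B. \<beta> b p = c b"
  using assms(3-5)
proof (induction B rule: finite_induct)
  case empty
  then show ?case using vec.subspace_0[OF V(1)] by auto
next
  case (insert b B)
  have ind: "vec.independent B" "b \<notin> vec.span B"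
    using insert.prems(1) insert.hyps(2) by (auto simp: vec.independent_insert)
  have spanV: "vec.span B \<subseteq> V" using insert.prems(2) V(1) by (intro vec.span_minimal) auto
  have bV: "b \<in> V" using insert.prems(2) by blast
  obtain p0 where p0: "p0 \<in> V" "\<forall>b\<in>B. \<beta> b p0 = c b" using insert.IH ind(1) insert.prems(2) by blast
  obtain q where q: "q \<in> V" "\<beta> b q = 1" "\<And>s. s \<in> vec.span B \<Longrightarrow> \<beta> s q = 0"
    using separating_vector[OF vec.subspace_span V(1) spanV V(2) bV ind(2)] by blast
  show ?case
  proof (intro bexI[of _ "p0 + (c b - \<beta> b p0) *s q"] ballI)
    fix b' assume "b' \<in> insert b B"
    then show "\<beta> b' (p0 + (c b - \<beta> b p0) *s q) = c b'" using p0 q by (auto simp: vec.span_base)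
  next
    show "p0 + (c b - \<beta> b p0) *s q \<in> V"
      using p0(1) q(1) V(1) by (intro vec.subspace_add vec.subspace_scale)
  qed
qed

text \<open>
  The vector \<open>l'\<close> represents the functional \<open>s \<mapsto> \<beta> (\<psi> s)
  l\<close>, in other words it is the value at \<open>l\<close> of the adjoint of
  \<open>\<psi>\<close>.
\<close>

lemma ex_adjoint_vector:
  assumes V: "vec.subspace V" "nondegenerate_on \<beta> V" and lin: "Vector_Spaces.linear (*s) (*s) \<psi>"
  obtains l' where "l' \<in> V" "\<And>s. s \<in> V \<Longrightarrow> \<beta> s l' = \<beta> (\<psi> s) l"
proof -
  interpret l: Vector_Spaces.linear "(*s)" "(*s)" \<psi> by (rule lin)
  obtain B where B: "B \<subseteq> V" "vec.independent B" "V \<subseteq> vec.span B" using vec.basis_exists by metis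
  obtain p where p: "p \<in> V" "\<forall>b\<in>B. \<beta> b p = \<beta> (\<psi> b) l"
    using ex_dual_values[OF V vec.finiteI_independent[OF B(2)] B(2,1), of "\<lambda>b. \<beta> (\<psi> b) l"] by blast
  have "\<beta> s p = \<beta> (\<psi> s) l" if "s \<in> vec.span B" for s
    using that by (induction rule: vec.span_induct_alt) (simp_all add: l.zero l.add l.scale p(2))
  then show ?thesis using that p(1) B(3) by blast
qed

text \<open>
  The space on the left is the orthogonal complement of \<open>L + A\<close>, so the formula follows
  from the dimension of a sum. It shows that the dimension depends only on those of \<open>A\<close>
  and \<open>L \<inter> A\<close>, which an isometry preserves.
\<close>

lemma dim_lagrangian_perp:
  assumes U: "vec.subspace U" "nondegenerate_on \<beta> U" and L: "lagrangian_of U L"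
    and A: "vec.subspace A" "A \<subseteq> U"
  shows "vec.dim {x \<in> L. \<forall>a\<in>A. \<beta> x a = 0} + vec.dim L + vec.dim A = vec.dim U + vec.dim (L \<inter> A)"
proof -
  have Ls: "vec.subspace L" and Lp: "L = {x \<in> U. \<forall>y\<in>L. \<beta> x y = 0}" using L by (auto simp: lagrangian_of_def)
  have LU: "L \<subseteq> U" using Lp by blast
  let ?S = "{x + y | x y. x \<in> L \<and> y \<in> A}"
  have S: "vec.subspace ?S" using Ls A(1) by (rule vec.subspace_sums)
  have SU: "?S \<subseteq> U" using LU A(2) U(1) vec.subspace_add by blast
  have "{x \<in> U. \<forall>y\<in>?S. \<beta> x y = 0} = {x \<in> L. \<forall>a\<in>A. \<beta> x a = 0}"
  proof (intro subset_antisym subsetI)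
    fix x assume x: "x \<in> {x \<in> U. \<forall>y\<in>?S. \<beta> x y = 0}"
    have "\<beta> x y = 0" if "y \<in> L" for y
    proof -
      have "y + 0 \<in> ?S" using that vec.subspace_0[OF A(1)] by blast
      then have "\<beta> x (y + 0) = 0" using x by blast
      then show ?thesis by simp
    qed
    then have "x \<in> L" using x Lp by blast
    moreover have "\<beta> x y = 0" if "y \<in> A" for y
    proof -
      have "0 + y \<in> ?S" using that vec.subspace_0[OF Ls] by blast
      then have "\<beta> x (0 + y) = 0" using x by blast
      then show ?thesis by simp
    qed
    ultimately show "x \<in> {x \<in> L. \<forall>a\<in>A. \<beta> x a = 0}" by blast
  next
    fix x assume x: "x \<in> {x \<in> L. \<forall>a\<in>A. \<beta> x a = 0}"
    have "\<beta> x y = 0" if "y \<in> L" for y using x Lp that by blast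
    then show "x \<in> {x \<in> U. \<forall>y\<in>?S. \<beta> x y = 0}" using x LU by auto
  qed
  with dim_perp[OF U S SU] have "vec.dim ?S + vec.dim {x \<in> L. \<forall>a\<in>A. \<beta> x a = 0} = vec.dim U" by simp
  moreover have "vec.dim ?S + vec.dim (L \<inter> A) = vec.dim L + vec.dim A"
    using Ls A(1) by (rule vec.dim_sums_Int)
  ultimately show ?thesis by linarith
qed

text \<open>
  Witt's theorem relative to a Lagrangian subspace \<open>L\<close>, proved by enlarging the domain
  \<open>A\<close> by one vector \<open>l\<close> at a time. The image \<open>l'\<close> has to have
  the prescribed products with \<open>\<phi> ` A\<close>, must lie outside of \<open>\<phi> `
  A\<close>, and must keep the correspondence with \<open>L\<close>. While \<open>A\<close> does not
  contain \<open>L\<close>, the new vectors \<open>l\<close> and \<open>l'\<close> are taken in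
  \<open>L\<close>. If \<open>L\<close> has vectors orthogonal to \<open>A\<close> outside of
  \<open>A\<close>, a count of dimensions gives such vectors for \<open>\<phi> ` A\<close> too, and no
  products have to be matched. Otherwise \<open>l'\<close> is automatically new. When \<open>A\<close>
  contains \<open>L\<close>, any \<open>l\<close> outside of \<open>A\<close> works, since then no
  vector outside of \<open>A\<close> or of \<open>\<phi> ` A\<close> is in \<open>L\<close>.
\<close>

lemma isometry_extends:
  assumes U: "vec.subspace U" "nondegenerate_on \<beta> U" and L: "lagrangian_of U L"
    and "vec.subspace A" "A \<subseteq> U" "Vector_Spaces.linear (*s) (*s) \<phi>" "\<And>a. a \<in> A \<Longrightarrow> \<phi> a \<in> U"
    and "\<And>a. a \<in> A \<Longrightarrow> \<phi> a = 0 \<Longrightarrow> a = 0" "\<And>a b. a \<in> A \<Longrightarrow> b \<in> A \<Longrightarrow> \<beta> (\<phi> a) (\<phi> b) = \<beta> a b"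
    and "\<And>a. a \<in> A \<Longrightarrow> \<phi> a \<in> L \<longleftrightarrow> a \<in> L"
  shows "\<exists>g. Vector_Spaces.linear (*s) (*s) g \<and> (\<forall>x\<in>U. g x \<in> U \<and> (g x \<in> L \<longleftrightarrow> x \<in> L)) \<and>
    (\<forall>x\<in>U. \<forall>y\<in>U. \<beta> (g x) (g y) = \<beta> x y) \<and> (\<forall>a\<in>A. g a = \<phi> a)"
  using assms(4-10)
proof (induction "vec.dim U - vec.dim A" arbitrary: A \<phi> rule: less_induct)
  case less
  note A = less.prems(1,2) and lin = less.prems(3) and ran = less.prems(4) and ker = less.prems(5)
    and iso = less.prems(6) and phiL = less.prems(7)
  interpret \<phi>: Vector_Spaces.linear "(*s)" "(*s)" \<phi> by (rule lin)
  have Ls: "vec.subspace L" and Lp: "\<And>x. x \<in> L \<longleftrightarrow> x \<in> U \<and> (\<forall>y\<in>L. \<beta> x y = 0)"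
    using L unfolding lagrangian_of_def by blast+
  have LU: "L \<subseteq> U" using Lp by blast
  have inj: "inj_on \<phi> A"
    using A(1) ker by (intro inj_onI) (metis \<phi>.diff eq_iff_diff_eq_0 vec.subspace_diff)
  have dim_img: "vec.dim (\<phi> ` S) = vec.dim S" if "vec.subspace S" "S \<subseteq> A" for S
    using lin inj that by (intro vec.dim_image_eq) (simp_all add: vec.span_eq_iff[THEN iffD2] inj_on_subset)
  have subA': "vec.subspace (\<phi> ` A)" using A(1) by (rule \<phi>.subspace_image)
  \<comment> \<open>Adding the pair \<open>l\<close>, \<open>l'\<close> to the map. The vector \<open>q\<close>
    reads off the coefficient of \<open>l\<close>, which keeps the extension linear on the whole
    space.\<close>
  have extend: ?case
    if l: "l \<in> U" "l \<notin> A" "l' \<in> U" "l' \<notin> \<phi> ` A" and b: "\<And>a. a \<in> A \<Longrightarrow> \<beta> (\<phi> a) l' = \<beta> a l"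
      and lL: "\<And>a k. a \<in> A \<Longrightarrow> \<phi> a + k *s l' \<in> L \<longleftrightarrow> a + k *s l \<in> L" for l l'
  proof -
    obtain q where q: "q \<in> U" "\<beta> l q = 1" "\<And>a. a \<in> A \<Longrightarrow> \<beta> a q = 0"
      using separating_vector[OF A(1) U(1) A(2) U(2) l(1,2)] by blast
    define \<phi>' where "\<phi>' x = \<phi> x + \<beta> x q *s (l' - \<phi> l)" for x
    have lin': "Vector_Spaces.linear (*s) (*s) \<phi>'"
      unfolding \<phi>'_def by (intro linear_vecI)
        (simp_all add: \<phi>.add \<phi>.scale vec.scale_left_distrib vec.scale_right_distrib algebra_simps)
    let ?A = "vec.span (insert l A)"
    have A': "\<exists>a\<in>A. \<exists>k. x = a + k *s l" if "x \<in> ?A" for x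
      using that A(1) unfolding vec.span_insert by (auto simp: vec.span_eq_iff[THEN iffD2]) (metis diff_add_cancel)
    have phi': "\<phi>' (a + k *s l) = \<phi> a + k *s l'" if "a \<in> A" for a k
      using q that by (simp add: \<phi>'_def \<phi>.add \<phi>.scale vec.scale_right_diff_distrib)
    have nz: "k = 0" if "\<phi> a + k *s l' \<in> \<phi> ` A" "a \<in> A" for a k
    proof (rule ccontr)
      assume "k \<noteq> 0"
      have "(\<phi> a + k *s l') - \<phi> a \<in> \<phi> ` A" using subA' that by (intro vec.subspace_diff) auto
      then have kl: "k *s l' \<in> \<phi> ` A" by simp
      show False using vec.subspace_scale[OF subA' kl, of "1 / k"] l(4) \<open>k \<noteq> 0\<close> by simp
    qed
    have dimA: "vec.dim U - vec.dim ?A < vec.dim U - vec.dim A"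
    proof -
      have "vec.dim ?A = vec.dim A + 1"
        using l(2) A(1) by (simp add: vec.dim_insert vec.span_eq_iff[THEN iffD2])
      moreover have "?A \<subseteq> U" using l(1) A(2) U(1) by (intro vec.span_minimal) auto
      then have "vec.dim ?A \<le> vec.dim U" by (rule vec.dim_subset)
      ultimately show ?thesis by simp
    qed
    have "\<exists>g. Vector_Spaces.linear (*s) (*s) g \<and> (\<forall>x\<in>U. g x \<in> U \<and> (g x \<in> L \<longleftrightarrow> x \<in> L)) \<and>
      (\<forall>x\<in>U. \<forall>y\<in>U. \<beta> (g x) (g y) = \<beta> x y) \<and> (\<forall>a\<in>?A. g a = \<phi>' a)"
    proof (rule less.hyps[OF dimA vec.subspace_span _ lin'])
      show "?A \<subseteq> U" using l(1) A(2) U(1) by (intro vec.span_minimal) auto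
      fix x assume "x \<in> ?A"
      then obtain a k where x: "a \<in> A" "x = a + k *s l" using A' by blast
      show "\<phi>' x \<in> U" unfolding x(2) phi'[OF x(1)]
        using U(1) ran[OF x(1)] l(3) by (intro vec.subspace_add vec.subspace_scale)
      show "x = 0" if "\<phi>' x = 0"
      proof -
        have "\<phi> a + k *s l' = 0" using that unfolding x(2) phi'[OF x(1)] .
        moreover from this have "k = 0" using nz[of a k] x(1) vec.subspace_0[OF subA'] by simp
        ultimately show ?thesis using ker[OF x(1)] x(2) by simp
      qed
      show "\<phi>' x \<in> L \<longleftrightarrow> x \<in> L" unfolding x(2) phi'[OF x(1)] by (rule lL[OF x(1)])
      fix y assume "y \<in> ?A"
      then obtain c m where y: "c \<in> A" "y = c + m *s l" using A' by blast
      show "\<beta> (\<phi>' x) (\<phi>' y) = \<beta> x y"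
        unfolding x(2) y(2) phi'[OF x(1)] phi'[OF y(1)]
        using iso[OF x(1) y(1)] b[OF x(1)] b[OF y(1)] skew[of l' "\<phi> c"] skew[of l c] by simp
    qed
    moreover have "\<phi>' a = \<phi> a" "a \<in> ?A" if "a \<in> A" for a
      using that q(3)[OF that] by (auto simp: \<phi>'_def vec.span_base)
    ultimately show ?thesis by auto
  qed
  show ?case
  proof (cases "A = U")
    case True
    then show ?thesis using lin ran phiL iso by (intro exI[of _ \<phi>]) auto
  next
    case AU: False
    obtain \<theta> where \<theta>: "Vector_Spaces.linear (*s) (*s) \<theta>" "\<And>a. a \<in> A \<Longrightarrow> \<theta> (\<phi> a) = a"
      using vec.linear_exists_left_inverse_on[OF lin A(1) inj] by blast
    interpret \<theta>: Vector_Spaces.linear "(*s)" "(*s)" \<theta> by (rule \<theta>(1))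
    show ?thesis
    proof (cases "L \<subseteq> A")
      case True
      obtain l where l: "l \<in> U" "l \<notin> A" using AU A(2) by blast
      obtain l' where l': "l' \<in> U" "\<And>s. s \<in> U \<Longrightarrow> \<beta> s l' = \<beta> (\<theta> s) l"
        using ex_adjoint_vector[OF U \<theta>(1), where l = l] by blast
      have b: "\<beta> (\<phi> a) l' = \<beta> a l" if "a \<in> A" for a using l'(2)[OF ran[OF that]] \<theta>(2)[OF that] by simp
      have "\<phi> ` L \<subseteq> L" using phiL True by blast
      then have phiL': "\<phi> ` L = L"
        using dim_img[OF Ls True] Ls \<phi>.subspace_image[OF Ls] by (intro vec.subspace_dim_equal) auto
      have nl': "l' \<notin> \<phi> ` A"
      proof
        assume "l' \<in> \<phi> ` A"
        then obtain c where c: "c \<in> A" "l' = \<phi> c" by blast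
        have "\<beta> (l - c) y = 0" if "y \<in> L" for y
        proof -
          have "y \<in> A" using True that by blast
          then have "\<beta> y l = \<beta> y c" using b[of y] iso[of y c] c by simp
          then show ?thesis using skew[of l y] skew[of c y] by simp
        qed
        moreover have "l - c \<in> U" using U(1) l(1) c(1) A(2) by (auto intro: vec.subspace_diff)
        ultimately have "l - c \<in> A" using Lp True by blast
        then have "(l - c) + c \<in> A" using A(1) c(1) by (intro vec.subspace_add)
        then show False using l(2) by simp
      qed
      show ?thesis
      proof (rule extend[OF l l'(1) nl' b])
        fix a k assume a: "a \<in> A"
        show "\<phi> a + k *s l' \<in> L \<longleftrightarrow> a + k *s l \<in> L"
        proof (cases "k = 0")
          case True
          then show ?thesis using phiL[OF a] by simp
        next
          case False
          have "a + k *s l \<notin> L"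
          proof
            assume "a + k *s l \<in> L"
            then have "(a + k *s l) - a \<in> A" using True A(1) a by (intro vec.subspace_diff) auto
            then have kl: "k *s l \<in> A" by simp
            show False using vec.subspace_scale[OF A(1) kl, of "1 / k"] False l(2) by simp
          qed
          moreover have "\<phi> a + k *s l' \<notin> L"
          proof
            assume "\<phi> a + k *s l' \<in> L"
            then have "\<phi> a + k *s l' \<in> \<phi> ` A" using phiL' True by blast
            then have "(\<phi> a + k *s l') - \<phi> a \<in> \<phi> ` A" using subA' a by (intro vec.subspace_diff) auto
            then have kl: "k *s l' \<in> \<phi> ` A" by simp
            show False using vec.subspace_scale[OF subA' kl, of "1 / k"] False nl' by simp
          qed
          ultimately show ?thesis by simp
        qed
      qed
    next
      case nLA: False
      have inL: ?thesis if "l \<in> L" "l \<notin> A" "l' \<in> L" "l' \<notin> \<phi> ` A" "\<And>a. a \<in> A \<Longrightarrow> \<beta> (\<phi> a) l' = \<beta> a l" for l l'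
      proof (rule extend[of l l'])
        fix a k assume a: "a \<in> A"
        have *: "x + k *s y \<in> L \<longleftrightarrow> x \<in> L" if "y \<in> L" for x y
        proof
          assume "x + k *s y \<in> L"
          then have "(x + k *s y) - k *s y \<in> L" using Ls that by (intro vec.subspace_diff vec.subspace_scale)
          then show "x \<in> L" by simp
        qed (use Ls that in \<open>auto intro: vec.subspace_add vec.subspace_scale\<close>)
        show "\<phi> a + k *s l' \<in> L \<longleftrightarrow> a + k *s l \<in> L"
          using *[OF that(1), of a] *[OF that(3), of "\<phi> a"] phiL[OF a] by simp
      qed (use that LU in auto)
      let ?P = "{x \<in> L. \<forall>a\<in>A. \<beta> x a = 0}" and ?P' = "{x \<in> L. \<forall>a\<in>\<phi> ` A. \<beta> x a = 0}"
      have subP: "vec.subspace ?P" "vec.subspace ?P'" using Ls by (rule subspace_perp)+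
      show ?thesis
      proof (cases "?P \<subseteq> A")
        case False
        \<comment> \<open>The complements of \<open>A\<close> and of \<open>\<phi> ` A\<close> in \<open>L\<close>
          have the same dimension, and so have their traces on \<open>A\<close> and on
          \<open>\<phi> ` A\<close>.\<close>
        have "\<not> ?P' \<subseteq> \<phi> ` A"
        proof
          assume P': "?P' \<subseteq> \<phi> ` A"
          have LA: "\<phi> ` (L \<inter> A) = L \<inter> \<phi> ` A" using phiL by blast
          have d: "vec.dim (L \<inter> \<phi> ` A) = vec.dim (L \<inter> A)"
            unfolding LA[symmetric] using Ls A(1) by (intro dim_img vec.subspace_inter) auto
          have "\<phi> ` A \<subseteq> U" using ran by blast
          then have "vec.dim ?P = vec.dim ?P'"
            using dim_lagrangian_perp[OF U L A] dim_lagrangian_perp[OF U L subA'] d dim_img[OF A(1)] by simp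
          also have "?P' = \<phi> ` (?P \<inter> A)"
          proof (intro subset_antisym subsetI)
            fix x assume x: "x \<in> ?P'"
            then obtain a where a: "a \<in> A" "x = \<phi> a" using P' by blast
            then have "a \<in> ?P" using x phiL[OF a(1)] iso[OF a(1)] by auto
            then show "x \<in> \<phi> ` (?P \<inter> A)" using a by blast
          qed (use phiL iso in auto)
          also have "vec.dim (\<phi> ` (?P \<inter> A)) = vec.dim (?P \<inter> A)"
            using subP(1) A(1) by (intro dim_img vec.subspace_inter) auto
          finally have "vec.dim ?P = vec.dim (?P \<inter> A)" .
          then have "?P \<inter> A = ?P"
            using subP(1) A(1) by (intro vec.subspace_dim_equal vec.subspace_inter) auto
          then show False using False by blast
        qed
        then obtain l' where l': "l' \<in> ?P'" "l' \<notin> \<phi> ` A" by blast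
        obtain l where l: "l \<in> ?P" "l \<notin> A" using False by blast
        show ?thesis
        proof (rule inL[of l l'])
          show "\<beta> (\<phi> a) l' = \<beta> a l" if "a \<in> A" for a
            using l(1) l'(1) that skew[of "\<phi> a" l'] skew[of a l] by auto
        qed (use l l' in auto)
      next
        case True
        obtain l where l: "l \<in> L" "l \<notin> A" using nLA by blast
        have subLA: "vec.subspace (L \<inter> A)" using Ls A(1) by (rule vec.subspace_inter)
        have sub0: "vec.subspace {0 :: complex ^ 'd}" by (simp add: vec.subspace_def)
        obtain p where p: "Vector_Spaces.linear (*s) (*s) p" "\<And>x. x \<in> L \<inter> A \<Longrightarrow> p x = x"
          "\<And>x. x \<in> {0} \<Longrightarrow> p x = 0" "\<And>x. p x \<in> L \<inter> A"
          by (rule ex_linear_projection[OF subLA sub0]) (use vec.subspace_0[OF subLA] in blast, rule that)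
        interpret p: Vector_Spaces.linear "(*s)" "(*s)" p by (rule p(1))
        \<comment> \<open>To get \<open>l' \<in> L\<close>, the functional that \<open>l'\<close> represents has
          to vanish on \<open>L\<close>. It is defined on the image of a complement
          \<open>C\<close> of \<open>L \<inter> A\<close> in \<open>A\<close>, which meets
          \<open>L\<close> trivially, and extended by zero on \<open>L\<close>; on \<open>L
          \<inter> A\<close> the prescribed products with \<open>l \<in> L\<close> are zero
          anyway.\<close>
        let ?C = "{a \<in> A. p a = 0}"
        have subC: "vec.subspace ?C" using A(1) by (auto simp: vec.subspace_def p.add p.scale p.zero)
        have subC': "vec.subspace (\<phi> ` ?C)" using subC by (rule \<phi>.subspace_image)
        have "\<phi> ` ?C \<inter> L = {0}"
        proof (intro subset_antisym subsetI)
          fix x assume "x \<in> \<phi> ` ?C \<inter> L"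
          then obtain c where c: "c \<in> A" "p c = 0" "x = \<phi> c" "\<phi> c \<in> L" by blast
          then have "c = 0" using p(2)[of c] phiL by auto
          then show "x \<in> {0}" using c by (simp add: \<phi>.zero)
        qed (use vec.subspace_0[OF subC'] vec.subspace_0[OF Ls] in auto)
        then obtain q where q: "Vector_Spaces.linear (*s) (*s) q" "\<And>x. x \<in> \<phi> ` ?C \<Longrightarrow> q x = x"
          "\<And>x. x \<in> L \<Longrightarrow> q x = 0" "\<And>x. q x \<in> \<phi> ` ?C"
          by (rule ex_linear_projection[OF subC' Ls]) (rule that)
        interpret q: Vector_Spaces.linear "(*s)" "(*s)" q by (rule q(1))
        have lin_psi: "Vector_Spaces.linear (*s) (*s) (\<lambda>x. \<theta> (q x))"
          by (intro linear_vecI) (simp_all add: q.add q.scale \<theta>.add \<theta>.scale)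
        obtain l' where l': "l' \<in> U" "\<And>s. s \<in> U \<Longrightarrow> \<beta> s l' = \<beta> (\<theta> (q s)) l"
          using ex_adjoint_vector[OF U lin_psi, where l = l] by blast
        have "\<beta> l' y = 0" if "y \<in> L" for y
          using l'(2)[of y] q(3)[OF that] that LU skew[of l' y] by (auto simp: \<theta>.zero)
        then have l'L: "l' \<in> L" using Lp l'(1) by blast
        have b: "\<beta> (\<phi> a) l' = \<beta> a l" if a: "a \<in> A" for a
        proof -
          have pa: "p a \<in> L" "p a \<in> A" using p(4)[of a] by auto
          have "p (a - p a) = 0" using p(2)[OF p(4)[of a]] by (simp add: p.diff)
          moreover have "a - p a \<in> A" using A(1) a pa(2) by (rule vec.subspace_diff)
          ultimately have ap: "a - p a \<in> ?C" by blast
          have "\<phi> (p a) \<in> L" using phiL[OF pa(2)] pa(1) by simp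
          moreover have "q (\<phi> (a - p a)) = \<phi> (a - p a)" by (rule q(2)[OF imageI[OF ap]])
          ultimately have "q (\<phi> a) = \<phi> (a - p a)" using q(3)[of "\<phi> (p a)"] by (simp add: \<phi>.diff q.diff)
          moreover have "\<theta> (\<phi> (a - p a)) = a - p a" using \<theta>(2) ap by blast
          ultimately have "\<beta> (\<phi> a) l' = \<beta> (a - p a) l" using l'(2)[OF ran[OF a]] by simp
          moreover have "\<beta> (p a) l = 0" using Lp[of "p a"] pa(1) l(1) by blast
          ultimately have "\<beta> (\<phi> a) l' = \<beta> a l" by simp
          then show ?thesis .
        qed
        have nl': "l' \<notin> \<phi> ` A"
        proof
          assume "l' \<in> \<phi> ` A"
          then obtain c where c: "c \<in> A" "l' = \<phi> c" by blast
          have cL: "c \<in> L" using phiL[OF c(1)] l'L c(2) by simp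
          have "\<beta> (l - c) a = 0" if "a \<in> A" for a
            using b[OF that] iso[OF that c(1)] c(2) skew[of l a] skew[of c a] by simp
          then have "l - c \<in> A" using True Ls l(1) cL by (auto intro: vec.subspace_diff)
          then have "(l - c) + c \<in> A" using A(1) c(1) by (intro vec.subspace_add)
          then show False using l(2) by simp
        qed
        show ?thesis by (rule inL[OF l l'L nl' b])
      qed
    qed
  qed
qed

text \<open>
  The map \<open>p x \<mapsto> p (h x)\<close> is well defined on \<open>p ` X\<close> by the
  hypothesis on the kernels. It is realized by a linear map by composing with a section of
  \<open>p\<close>.
\<close>

lemma isometry_extends_along_projection:
  assumes U: "vec.subspace U" "nondegenerate_on \<beta> U" and L: "lagrangian_of U L"
    and X: "vec.subspace X" and p: "Vector_Spaces.linear (*s) (*s) p" "\<And>x. p x \<in> U"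
    and h: "Vector_Spaces.linear (*s) (*s) h" "\<And>x. x \<in> X \<Longrightarrow> p (h x) = 0 \<longleftrightarrow> p x = 0"
    and iso: "\<And>x y. x \<in> X \<Longrightarrow> y \<in> X \<Longrightarrow> \<beta> (p (h x)) (p (h y)) = \<beta> (p x) (p y)"
    and hL: "\<And>x. x \<in> X \<Longrightarrow> p (h x) \<in> L \<longleftrightarrow> p x \<in> L"
  obtains g where "Vector_Spaces.linear (*s) (*s) g" "\<And>x. x \<in> U \<Longrightarrow> g x \<in> U" "\<And>x. x \<in> L \<Longrightarrow> g x \<in> L"
    "\<And>x y. x \<in> U \<Longrightarrow> y \<in> U \<Longrightarrow> \<beta> (g x) (g y) = \<beta> x y" "\<And>x. x \<in> X \<Longrightarrow> g (p x) = p (h x)"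
proof -
  interpret p: Vector_Spaces.linear "(*s)" "(*s)" p by (rule p(1))
  interpret h: Vector_Spaces.linear "(*s)" "(*s)" h by (rule h(1))
  obtain \<sigma> where \<sigma>: "\<sigma> ` UNIV \<subseteq> X" "Vector_Spaces.linear (*s) (*s) \<sigma>" "\<And>v. v \<in> p ` X \<Longrightarrow> p (\<sigma> v) = v"
    using vec.linear_exists_right_inverse_on[OF p(1) X] by blast
  interpret \<sigma>: Vector_Spaces.linear "(*s)" "(*s)" \<sigma> by (rule \<sigma>(2))
  let ?\<phi> = "\<lambda>a. p (h (\<sigma> a))"
  have key: "?\<phi> (p x) = p (h x)" if x: "x \<in> X" for x
  proof -
    have sx: "\<sigma> (p x) \<in> X" using \<sigma>(1) by blast
    then have d: "\<sigma> (p x) - x \<in> X" using X x by (intro vec.subspace_diff)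
    have "p (\<sigma> (p x) - x) = 0" using \<sigma>(3)[of "p x"] x by (simp add: p.diff)
    then have "p (h (\<sigma> (p x) - x)) = 0" using h(2)[OF d] by simp
    then show ?thesis by (simp add: h.diff p.diff)
  qed
  have "\<exists>g. Vector_Spaces.linear (*s) (*s) g \<and> (\<forall>x\<in>U. g x \<in> U \<and> (g x \<in> L \<longleftrightarrow> x \<in> L)) \<and>
    (\<forall>x\<in>U. \<forall>y\<in>U. \<beta> (g x) (g y) = \<beta> x y) \<and> (\<forall>a\<in>p ` X. g a = ?\<phi> a)"
  proof (rule isometry_extends[OF U L])
    show "vec.subspace (p ` X)" using X by (rule p.subspace_image)
    show "Vector_Spaces.linear (*s) (*s) ?\<phi>"
      by (intro linear_vecI) (simp_all add: p.add p.scale h.add h.scale \<sigma>.add \<sigma>.scale)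
    show "a = 0" if "a \<in> p ` X" "?\<phi> a = 0" for a using that key h(2) by auto
    show "\<beta> (?\<phi> a) (?\<phi> b) = \<beta> a b" if "a \<in> p ` X" "b \<in> p ` X" for a b using that key iso by auto
    show "?\<phi> a \<in> L \<longleftrightarrow> a \<in> L" if "a \<in> p ` X" for a using that key hL by auto
  qed (use p(2) in auto)
  then obtain g where g: "Vector_Spaces.linear (*s) (*s) g" "\<forall>x\<in>U. g x \<in> U \<and> (g x \<in> L \<longleftrightarrow> x \<in> L)"
    "\<forall>x\<in>U. \<forall>y\<in>U. \<beta> (g x) (g y) = \<beta> x y" "\<forall>a\<in>p ` X. g a = ?\<phi> a" by blast
  have LU: "L \<subseteq> U" using L unfolding lagrangian_of_def by blast
  show ?thesis
  proof (rule that[OF g(1)])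
    show "g x \<in> L" if "x \<in> L" for x using g(2) that LU by blast
  qed (use g key in auto)
qed

section \<open>Isotropic subspaces relative to two Lagrangian subspaces\<close>

text \<open>
  The isometries only have to map each \<open>Z\<close> into itself; by the finite dimension this
  suffices for a stabilizer.
\<close>

definition finitely_many_types :: "(complex ^ 'd) set set \<Rightarrow> (complex ^ 'd) set set \<Rightarrow> bool" where
  "finitely_many_types \<Z> S \<longleftrightarrow> (\<exists>T. finite T \<and> (\<forall>X\<in>S. \<exists>X'\<in>T. \<exists>g. Vector_Spaces.linear (*s) (*s) g \<and>
     (\<forall>x y. \<beta> (g x) (g y) = \<beta> x y) \<and> (\<forall>Z\<in>\<Z>. g ` Z \<subseteq> Z) \<and> g ` X = X'))"

text \<open>
  An isomorphism between two configurations that share the fixed family \<open>\<Z>\<close> is an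
  isometry that stabilizes all members of \<open>\<Z>\<close>.
\<close>

lemma finitely_many_types_from_normal_bases:
  assumes "finite \<Z>" "\<And>Z. Z \<in> \<Z> \<Longrightarrow> vec.subspace Z" "\<And>X. X \<in> S \<Longrightarrow> vec.subspace X"
    and nb: "\<And>X. X \<in> S \<Longrightarrow> has_normal_basis \<beta> UNIV (insert X \<Z>)"
  shows "finitely_many_types \<Z> S"
proof -
  let ?I = "insert None (Some ` \<Z>)"
  let ?Y = "\<lambda>X i. case i of None \<Rightarrow> X | Some Z \<Rightarrow> Z"
  have img: "?Y X ` ?I = insert X \<Z>" for X by (auto simp: image_image)
  have "\<exists>T\<subseteq>S. finite T \<and> (\<forall>s\<in>S. \<exists>t\<in>T. \<exists>g. Vector_Spaces.linear (*s) (*s) g \<and>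
    inj_on g UNIV \<and> g ` UNIV = UNIV \<and> (\<forall>x\<in>UNIV. \<forall>y\<in>UNIV. \<beta> (g x) (g y) = \<beta> x y) \<and>
    (\<forall>i\<in>?I. g ` (UNIV \<inter> ?Y s i) = UNIV \<inter> ?Y t i))"
    by (rule finite_isomorphism_types) (use assms img in \<open>auto split: option.splits\<close>)
  then obtain T where T: "finite T" "\<forall>s\<in>S. \<exists>t\<in>T. \<exists>g. Vector_Spaces.linear (*s) (*s) g \<and>
    inj_on g UNIV \<and> g ` UNIV = UNIV \<and> (\<forall>x\<in>UNIV. \<forall>y\<in>UNIV. \<beta> (g x) (g y) = \<beta> x y) \<and>
    (\<forall>i\<in>?I. g ` (UNIV \<inter> ?Y s i) = UNIV \<inter> ?Y t i)" by blast
  show ?thesis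
    unfolding finitely_many_types_def
  proof (intro exI[of _ T] conjI ballI T(1))
    fix X assume "X \<in> S"
    with T(2) obtain t g where t: "t \<in> T" and g: "Vector_Spaces.linear (*s) (*s) g"
      "\<forall>x\<in>UNIV. \<forall>y\<in>UNIV. \<beta> (g x) (g y) = \<beta> x y"
      "\<forall>i\<in>?I. g ` (UNIV \<inter> ?Y X i) = UNIV \<inter> ?Y t i" by blast
    have "g ` X = t" using g(3)[rule_format, of None] by simp
    moreover have "g ` Z \<subseteq> Z" if "Z \<in> \<Z>" for Z using g(3)[rule_format, of "Some Z"] that by simp
    ultimately show "\<exists>X'\<in>T. \<exists>g. Vector_Spaces.linear (*s) (*s) g \<and> (\<forall>x y. \<beta> (g x) (g y) = \<beta> x y) \<and>
      (\<forall>Z\<in>\<Z>. g ` Z \<subseteq> Z) \<and> g ` X = X'" using t g(1,2) by blast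
  qed
qed

text \<open>
  The form \<open>\<gamma>\<close> is the restriction of \<open>\<beta>\<close> to the components in
  \<open>U\<close>. On an isotropic subspace \<open>X\<close> it is the negative of the restriction to
  the components in \<open>W\<close>, and therefore treats \<open>U\<close> and \<open>W\<close>
  alike. Isomorphisms of the spaces \<open>X\<close> with \<open>\<gamma>\<close> and the traces of
  \<open>L\<close>, \<open>M\<close>, \<open>U\<close>, \<open>W\<close> are extended separately on
  \<open>U\<close> and on \<open>W\<close>.
\<close>

lemma finitely_many_types_lagrangian_pair:
  assumes dec: "direct_decomposition U W" and orth: "\<And>u w. u \<in> U \<Longrightarrow> w \<in> W \<Longrightarrow> \<beta> u w = 0"
    and nd: "nondegenerate_on \<beta> U" "nondegenerate_on \<beta> W"
    and L: "lagrangian_of U L" and M: "lagrangian_of W M"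
  shows "finitely_many_types {U, W, L, M} {X. isotropic \<beta> X}"
proof -
  have U: "vec.subspace U" and W: "vec.subspace W" and UW: "U \<inter> W = {0}"
    and sum: "\<And>v. \<exists>u\<in>U. \<exists>w\<in>W. v = u + w"
    using dec unfolding direct_decomposition_def by auto
  have Ls: "vec.subspace L" "L \<subseteq> U" "\<And>x y. x \<in> L \<Longrightarrow> y \<in> L \<Longrightarrow> \<beta> x y = 0"
    using L unfolding lagrangian_of_def by blast+
  have Ms: "vec.subspace M" "M \<subseteq> W" "\<And>x y. x \<in> M \<Longrightarrow> y \<in> M \<Longrightarrow> \<beta> x y = 0"
    using M unfolding lagrangian_of_def by blast+
  obtain p where p: "Vector_Spaces.linear (*s) (*s) p" "\<And>x. x \<in> U \<Longrightarrow> p x = x" "\<And>x. x \<in> W \<Longrightarrow> p x = 0"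
    "\<And>x. p x \<in> U"
    by (rule ex_linear_projection[OF U W UW]) (rule that)
  interpret p: Vector_Spaces.linear "(*s)" "(*s)" p by (rule p(1))
  define q where "q x = x - p x" for x
  have lin_q: "Vector_Spaces.linear (*s) (*s) q"
    unfolding q_def by (intro linear_vecI) (simp_all add: p.add p.scale vec.scale_right_diff_distrib)
  interpret q: Vector_Spaces.linear "(*s)" "(*s)" q by (rule lin_q)
  have q: "q x = 0" if "x \<in> U" for x using p(2)[OF that] by (simp add: q_def)
  have q': "q x = x" if "x \<in> W" for x using p(3)[OF that] by (simp add: q_def)
  have qW: "q x \<in> W" for x
  proof -
    obtain u w where "u \<in> U" "w \<in> W" "x = u + w" using sum by blast
    then show ?thesis using q[of u] q'[of w] by (simp add: q.add)
  qed
  have pq: "p x + q x = x" for x by (simp add: q_def)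
  have orth': "\<beta> w u = 0" if "u \<in> U" "w \<in> W" for u w using orth[OF that] skew[of w u] by simp
  have split: "\<beta> x y = \<beta> (p x) (p y) + \<beta> (q x) (q y)" for x y
  proof -
    have "\<beta> x y = \<beta> (p x + q x) (p y + q y)" by (simp only: pq)
    also have "\<dots> = \<beta> (p x) (p y) + \<beta> (q x) (q y)" using orth[OF p(4) qW] orth'[OF p(4) qW] by simp
    finally show ?thesis .
  qed
  have px0: "p x = 0 \<longleftrightarrow> x \<in> W" for x using p(3)[of x] qW[of x] by (auto simp: q_def)
  have qx0: "q x = 0 \<longleftrightarrow> x \<in> U" for x using q[of x] p(4)[of x] by (auto simp: q_def)
  define \<gamma> where "\<gamma> x y = \<beta> (p x) (p y)" for x y
  interpret \<gamma>: alternating \<gamma>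
    unfolding \<gamma>_def
    by unfold_locales (simp_all add: p.add p.scale vec.scale_right_distrib vec.scale_left_distrib algebra_simps)
  define L' where "L' = {x. p x \<in> L}"
  define M' where "M' = {x. q x \<in> M}"
  have sub': "vec.subspace L'" "vec.subspace M'"
    unfolding L'_def M'_def using Ls(1) Ms(1)
    by (auto simp: vec.subspace_def p.add p.scale p.zero q.add q.scale q.zero)
  let ?S = "{X. isotropic \<beta> X}" and ?I = "{L', M', W, U}"
  have "\<exists>T\<subseteq>?S. finite T \<and> (\<forall>X\<in>?S. \<exists>X'\<in>T. \<exists>h. Vector_Spaces.linear (*s) (*s) h \<and>
    inj_on h X \<and> h ` X = X' \<and> (\<forall>x\<in>X. \<forall>y\<in>X. \<gamma> (h x) (h y) = \<gamma> x y) \<and>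
    (\<forall>i\<in>?I. h ` (X \<inter> i) = X' \<inter> i))"
  proof (rule \<gamma>.finite_isomorphism_types[of ?I ?S "\<lambda>X i. i" "\<lambda>X. X"])
    show "vec.subspace Z" if "Z \<in> ?I" for Z using that sub' U W by blast
    fix X assume "X \<in> ?S"
    then have X: "vec.subspace X" "\<And>x y. x \<in> X \<Longrightarrow> y \<in> X \<Longrightarrow> \<beta> x y = 0" unfolding isotropic_def by auto
    have flip: "\<gamma> x y = - \<beta> (q x) (q y)" if "x \<in> X" "y \<in> X" for x y
      using split[of x y] X(2)[OF that] unfolding \<gamma>_def by (simp add: eq_neg_iff_add_eq_0)
    have "has_normal_basis \<gamma> X {X \<inter> L', X \<inter> M', X \<inter> W, X \<inter> U}"
    proof (rule \<gamma>.isotropic_pair_has_normal_basis[OF X(1)])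
      show "X \<inter> W \<subseteq> X \<inter> L'"
      proof
        fix x assume x: "x \<in> X \<inter> W"
        then have "p x = 0" using px0 by blast
        then show "x \<in> X \<inter> L'" using x vec.subspace_0[OF Ls(1)] by (simp add: L'_def)
      qed
      show "X \<inter> U \<subseteq> X \<inter> M'"
      proof
        fix x assume x: "x \<in> X \<inter> U"
        then have "q x = 0" using qx0 by blast
        then show "x \<in> X \<inter> M'" using x vec.subspace_0[OF Ms(1)] by (simp add: M'_def)
      qed
      show "X \<inter> W \<inter> (X \<inter> U) = {0}" using UW vec.subspace_0[OF X(1)] by blast
      show "\<gamma> x y = 0" if "x \<in> X \<inter> L'" "y \<in> X \<inter> L'" for x y
        using that Ls(3) by (auto simp: \<gamma>_def L'_def)
      show "\<gamma> x y = 0" if "x \<in> X \<inter> M'" "y \<in> X \<inter> M'" for x y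
        using that Ms(3) flip[of x y] by (auto simp: M'_def)
      show "\<gamma> x y = 0" if "x \<in> X \<inter> W" "y \<in> X" for x y
        using that px0[of x] by (auto simp: \<gamma>_def)
      show "\<gamma> x y = 0" if "x \<in> X \<inter> U" "y \<in> X" for x y
        using that qx0[of x] flip[of x y] by auto
    qed (use X(1) sub' U W in \<open>auto intro: vec.subspace_inter\<close>)
    then have "has_normal_basis \<gamma> X ((\<lambda>Y. Y \<inter> X) ` ?I)" by (simp add: Int_commute)
    then show "has_normal_basis \<gamma> X ((\<lambda>i. i) ` ?I)" unfolding has_normal_basis_Int by simp
  qed simp
  then obtain T where TS: "T \<subseteq> ?S" and T: "finite T" and iso: "\<forall>X\<in>?S. \<exists>X'\<in>T. \<exists>h. Vector_Spaces.linear (*s) (*s) h \<and>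
    inj_on h X \<and> h ` X = X' \<and> (\<forall>x\<in>X. \<forall>y\<in>X. \<gamma> (h x) (h y) = \<gamma> x y) \<and> (\<forall>i\<in>?I. h ` (X \<inter> i) = X' \<inter> i)"
    by (elim exE conjE)
  show ?thesis
    unfolding finitely_many_types_def
  proof (intro exI[of _ T] conjI ballI T)
    fix X assume XS: "X \<in> ?S"
    then have X: "vec.subspace X" "\<And>x y. x \<in> X \<Longrightarrow> y \<in> X \<Longrightarrow> \<beta> x y = 0" unfolding isotropic_def by auto
    from iso[rule_format, OF XS] obtain X' h where X': "X' \<in> T" and h: "Vector_Spaces.linear (*s) (*s) h" "inj_on h X" "h ` X = X'"
      and h_iso: "\<forall>x\<in>X. \<forall>y\<in>X. \<gamma> (h x) (h y) = \<gamma> x y" and h_int: "\<forall>i\<in>?I. h ` (X \<inter> i) = X' \<inter> i"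
      by (elim bexE exE conjE)
    have X'iso: "\<And>x y. x \<in> X' \<Longrightarrow> y \<in> X' \<Longrightarrow> \<beta> x y = 0" using X' TS unfolding isotropic_def by auto
    have mem: "h x \<in> i \<longleftrightarrow> x \<in> i" if "x \<in> X" "i \<in> ?I" for x i
    proof -
      have "h x \<in> i \<longleftrightarrow> h x \<in> h ` (X \<inter> i)" using h(3) h_int[rule_format, OF that(2)] that(1) by auto
      also have "\<dots> \<longleftrightarrow> x \<in> X \<inter> i" using h(2) that(1) by (intro inj_on_image_mem_iff) auto
      finally show ?thesis using that(1) by simp
    qed
    have q_iso: "\<beta> (q (h x)) (q (h y)) = \<beta> (q x) (q y)" if "x \<in> X" "y \<in> X" for x y
    proof -
      have "\<beta> (h x) (h y) = 0" using X'iso h(3) that by blast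
      then show ?thesis
        using h_iso[rule_format, OF that] X(2)[OF that] split[of x y] split[of "h x" "h y"] unfolding \<gamma>_def
        by (metis add_left_cancel)
    qed
    obtain g1 where g1: "Vector_Spaces.linear (*s) (*s) g1" "\<And>x. x \<in> U \<Longrightarrow> g1 x \<in> U" "\<And>x. x \<in> L \<Longrightarrow> g1 x \<in> L"
      "\<And>x y. x \<in> U \<Longrightarrow> y \<in> U \<Longrightarrow> \<beta> (g1 x) (g1 y) = \<beta> x y" "\<And>x. x \<in> X \<Longrightarrow> g1 (p x) = p (h x)"
    proof (rule isometry_extends_along_projection[OF U nd(1) L X(1) p(1,4) h(1)])
      show "p (h x) = 0 \<longleftrightarrow> p x = 0" if "x \<in> X" for x using mem[OF that, of W] px0 by simp
      show "\<beta> (p (h x)) (p (h y)) = \<beta> (p x) (p y)" if "x \<in> X" "y \<in> X" for x y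
        using h_iso[rule_format, OF that] unfolding \<gamma>_def .
      show "p (h x) \<in> L \<longleftrightarrow> p x \<in> L" if "x \<in> X" for x using mem[OF that, of L'] by (simp add: L'_def)
    qed (rule that)
    obtain g2 where g2: "Vector_Spaces.linear (*s) (*s) g2" "\<And>x. x \<in> W \<Longrightarrow> g2 x \<in> W" "\<And>x. x \<in> M \<Longrightarrow> g2 x \<in> M"
      "\<And>x y. x \<in> W \<Longrightarrow> y \<in> W \<Longrightarrow> \<beta> (g2 x) (g2 y) = \<beta> x y" "\<And>x. x \<in> X \<Longrightarrow> g2 (q x) = q (h x)"
    proof (rule isometry_extends_along_projection[OF W nd(2) M X(1) lin_q qW h(1)])
      show "q (h x) = 0 \<longleftrightarrow> q x = 0" if "x \<in> X" for x using mem[OF that, of U] qx0 by simp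
      show "q (h x) \<in> M \<longleftrightarrow> q x \<in> M" if "x \<in> X" for x using mem[OF that, of M'] by (simp add: M'_def)
    qed (rule q_iso, assumption+, rule that)
    interpret g1: Vector_Spaces.linear "(*s)" "(*s)" g1 by (rule g1(1))
    interpret g2: Vector_Spaces.linear "(*s)" "(*s)" g2 by (rule g2(1))
    define g where "g x = g1 (p x) + g2 (q x)" for x
    have lin: "Vector_Spaces.linear (*s) (*s) g"
      unfolding g_def by (intro linear_vecI)
        (simp_all add: p.add p.scale q.add q.scale g1.add g1.scale g2.add g2.scale vec.scale_right_distrib)
    have iso_g: "\<beta> (g x) (g y) = \<beta> x y" for x y
      using g1(4)[OF p(4) p(4)] g2(4)[OF qW qW] orth[OF g1(2)[OF p(4)] g2(2)[OF qW]]
        orth'[OF g1(2)[OF p(4)] g2(2)[OF qW]] by (simp add: g_def split[of x y])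
    have gU: "g x = g1 x" if "x \<in> U" for x using p(2)[OF that] q[OF that] by (simp add: g_def g2.zero)
    have gW: "g x = g2 x" if "x \<in> W" for x using p(3)[OF that] q'[OF that] by (simp add: g_def g1.zero)
    have "\<forall>Z\<in>{U, W, L, M}. g ` Z \<subseteq> Z"
      using gU gW g1(2,3) g2(2,3) Ls(2) Ms(2) by auto
    moreover have "g ` X = X'"
    proof -
      have "g x = h x" if "x \<in> X" for x using g1(5)[OF that] g2(5)[OF that] pq by (simp add: g_def)
      then show ?thesis using h(3) by auto
    qed
    ultimately show "\<exists>X'\<in>T. \<exists>g. Vector_Spaces.linear (*s) (*s) g \<and> (\<forall>x y. \<beta> (g x) (g y) = \<beta> x y) \<and>
      (\<forall>Z\<in>{U, W, L, M}. g ` Z \<subseteq> Z) \<and> g ` X = X'" using X' lin iso_g by blast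
  qed
qed

end

section \<open>Zariski closed sets of matrices\<close>

lemma polynomial_funs_sum:
  "(\<And>i. i \<in> I \<Longrightarrow> f i \<in> polynomial_funs) \<Longrightarrow> (\<lambda>A. \<Sum>i\<in>I. f i A) \<in> polynomial_funs"
  by (induction I rule: infinite_finite_induct)
    (auto intro: polynomial_funs.const polynomial_funs.add)

lemma polynomial_funs_prod:
  "(\<And>i. i \<in> I \<Longrightarrow> f i \<in> polynomial_funs) \<Longrightarrow> (\<lambda>A. \<Prod>i\<in>I. f i A) \<in> polynomial_funs"
  by (induction I rule: infinite_finite_induct)
    (auto intro: polynomial_funs.const polynomial_funs.mult)

lemma polynomial_funs_power: "f \<in> polynomial_funs \<Longrightarrow> (\<lambda>A. f A ^ n) \<in> polynomial_funs"
  by (induction n) (auto intro: polynomial_funs.const polynomial_funs.mult)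

lemma polynomial_funs_det:
  assumes "\<And>i j. (\<lambda>A. F A $ i $ j) \<in> polynomial_funs"
  shows "(\<lambda>A. det (F A :: complex ^ 'n ^ 'n)) \<in> polynomial_funs"
  unfolding det_def
  by (intro polynomial_funs_sum polynomial_funs.mult polynomial_funs_prod assms polynomial_funs.const)

lemma topspace_zariski [simp]: "topspace zariski = UNIV"
proof -
  have "closedin zariski (UNIV :: (complex ^ 'a ^ 'a) set)"
    unfolding closedin_zariski_iff by (intro exI[of _ "{}"]) (auto simp: zero_locus_def)
  then show ?thesis using closedin_subset by blast
qed

lemma closedin_zariski_coords:
  fixes F :: "complex ^ 'n ^ 'n \<Rightarrow> complex ^ 'm"
  assumes "\<And>i. (\<lambda>A. F A $ i) \<in> polynomial_funs"
  shows "closedin zariski {A. F A = 0}"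
  unfolding closedin_zariski_iff
proof (intro exI[of _ "range (\<lambda>i A. F A $ i)"] conjI)
  show "{A. F A = 0} = zero_locus (range (\<lambda>i A. F A $ i))"
    by (auto simp: zero_locus_def vec_eq_iff)
qed (use assms in auto)

lemma closedin_zariski_linear_condition:
  fixes q :: "complex ^ 'n \<Rightarrow> complex ^ 'n"
  assumes q: "Vector_Spaces.linear (*s) (*s) q" and S: "vec.subspace S"
  shows "closedin zariski {A. q (A *v v) \<in> S}"
proof -
  have sub0: "vec.subspace {0 :: complex ^ 'n}" by (simp add: vec.subspace_def)
  obtain p where p: "Vector_Spaces.linear (*s) (*s) p" "\<And>x. x \<in> S \<Longrightarrow> p x = x"
    "\<And>x. x \<in> {0} \<Longrightarrow> p x = 0" "\<And>x. p x \<in> S"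
    by (rule ex_linear_projection[OF S sub0]) (use vec.subspace_0[OF S] in blast, rule that)
  interpret p: Vector_Spaces.linear "(*s)" "(*s)" p by (rule p(1))
  interpret q: Vector_Spaces.linear "(*s)" "(*s)" q by (rule q)
  let ?r = "\<lambda>x. q x - p (q x)"
  have lin: "Vector_Spaces.linear (*s) (*s) ?r"
    by (intro linear_vecI) (simp_all add: p.add p.scale q.add q.scale vec.scale_right_diff_distrib)
  have "{A. q (A *v v) \<in> S} = {A. matrix ?r *v (A *v v) = 0}"
    unfolding matrix_works[OF lin] using p(2,4) by (auto, metis)
  moreover have "closedin zariski {A. matrix ?r *v (A *v v) = 0}"
  proof (rule closedin_zariski_coords)
    show "(\<lambda>A. (matrix ?r *v (A *v v)) $ i) \<in> polynomial_funs" for i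
      unfolding matrix_vector_mult_def vec_lambda_beta
      by (intro polynomial_funs_sum polynomial_funs.mult polynomial_funs.const polynomial_funs.entry)
  qed
  ultimately show ?thesis by simp
qed

text \<open>
  Polynomials are continuous, so Zariski closed sets are closed. This allows proving Zariski
  connectedness with paths.
\<close>

lemma connectedin_zariski_of_connected:
  fixes S :: "(complex ^ 'n ^ 'n) set"
  assumes "connected S"
  shows "connectedin zariski S"
proof -
  have cont: "continuous_on UNIV f" if "f \<in> polynomial_funs" for f :: "complex ^ 'n ^ 'n \<Rightarrow> complex"
    using that by (induction rule: polynomial_funs.induct) (auto intro!: continuous_intros)
  have *: "closed C" if C: "closedin zariski C" for C :: "(complex ^ 'n ^ 'n) set"
  proof -
    obtain F where F: "F \<subseteq> polynomial_funs" "C = zero_locus F" using C unfolding closedin_zariski_iff by blast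
    have "C = (\<Inter>f\<in>F. {A. f A = 0})" unfolding F(2) zero_locus_def by blast
    moreover have "closed {A. f A = 0}" if "f \<in> F" for f
      using cont F(1) that by (intro closed_Collect_eq) auto
    ultimately show ?thesis by auto
  qed
  have "\<not> (\<exists>E1 E2. closedin zariski E1 \<and> closedin zariski E2 \<and>
      S \<subseteq> E1 \<union> E2 \<and> E1 \<inter> E2 \<inter> S = {} \<and> E1 \<inter> S \<noteq> {} \<and> E2 \<inter> S \<noteq> {})"
  proof
    assume "\<exists>E1 E2. closedin zariski E1 \<and> closedin zariski E2 \<and>
      S \<subseteq> E1 \<union> E2 \<and> E1 \<inter> E2 \<inter> S = {} \<and> E1 \<inter> S \<noteq> {} \<and> E2 \<inter> S \<noteq> {}"
    then obtain E1 E2 where E: "closedin zariski E1" "closedin zariski E2" "S \<subseteq> E1 \<union> E2"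
      "E1 \<inter> E2 \<inter> S = {}" "E1 \<inter> S \<noteq> {}" "E2 \<inter> S \<noteq> {}" by (elim exE conjE)
    show False using connected_closedD[OF assms E(4,3) *[OF E(1)] *[OF E(2)]] E(5,6) by blast
  qed
  then show ?thesis unfolding connectedin_closedin by simp
qed

text \<open>
  Finitely many closed sets that are disjoint on a connected set and cover it are also relatively open
  there, so one of them is everything.
\<close>

lemma connectedin_zariski_finite_cover:
  assumes H: "connectedin zariski H" and F: "finite F" "\<And>c. c \<in> F \<Longrightarrow> closedin zariski (Z c)"
    and cover: "H \<subseteq> (\<Union>c\<in>F. Z c)" and disj: "\<And>c c' h. h \<in> H \<Longrightarrow> h \<in> Z c \<Longrightarrow> h \<in> Z c' \<Longrightarrow> c = c'"
    and c: "c \<in> F" "h \<in> H" "h \<in> Z c"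
  shows "H \<subseteq> Z c"
proof (rule ccontr)
  assume "\<not> H \<subseteq> Z c"
  let ?E = "\<Union>c'\<in>F - {c}. Z c'"
  have "closedin zariski (Z c)" using F c by blast
  moreover have "closedin zariski ?E" using F by (intro closedin_Union) auto
  moreover have "H \<subseteq> Z c \<union> ?E" using cover by blast
  moreover have "Z c \<inter> ?E \<inter> H = {}" using disj by blast
  moreover have "Z c \<inter> H \<noteq> {}" using c by blast
  moreover have "?E \<inter> H \<noteq> {}" using cover \<open>\<not> H \<subseteq> Z c\<close> by blast
  ultimately show False using H unfolding connectedin_closedin by metis
qed

section \<open>The general linear group and its derived subgroups\<close>

definition GL :: "(complex ^ 'n ^ 'n) monoid" where
  "GL = \<lparr>carrier = {A. invertible A}, mult = (**), one = mat 1\<rparr>"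

lemma GL_simps [simp]:
  "carrier GL = {A. invertible A}" "x \<otimes>\<^bsub>GL\<^esub> y = x ** y" "\<one>\<^bsub>GL\<^esub> = mat 1"
  by (simp_all add: GL_def)

lemma invertible_mat_1: "invertible (mat 1 :: complex ^ 'n ^ 'n)"
  unfolding invertible_def by (intro exI[of _ "mat 1"]) simp

lemma matrix_inv_mult:
  fixes A :: "complex ^ 'n ^ 'n"
  assumes "invertible A"
  shows "A ** matrix_inv A = mat 1" "matrix_inv A ** A = mat 1" "invertible (matrix_inv A)"
proof -
  have *: "\<exists>B. A ** B = mat 1 \<and> B ** A = mat 1" using assms unfolding invertible_def .
  have **: "A ** matrix_inv A = mat 1 \<and> matrix_inv A ** A = mat 1"
    unfolding matrix_inv_def by (rule someI_ex[OF *])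
  then show "A ** matrix_inv A = mat 1" "matrix_inv A ** A = mat 1" by auto
  then show "invertible (matrix_inv A)" unfolding invertible_def by blast
qed

lemma group_GL: "group GL"
proof (rule groupI)
  fix x :: "complex ^ 'a ^ 'a" assume "x \<in> carrier GL"
  then have "matrix_inv x \<in> carrier GL" "matrix_inv x \<otimes>\<^bsub>GL\<^esub> x = \<one>\<^bsub>GL\<^esub>"
    using matrix_inv_mult[of x] by auto
  then show "\<exists>y\<in>carrier GL. y \<otimes>\<^bsub>GL\<^esub> x = \<one>\<^bsub>GL\<^esub>" by blast
qed (auto simp: invertible_mult matrix_mul_assoc invertible_mat_1)

interpretation GL: group GL by (rule group_GL)

lemma inv_GL: "invertible A \<Longrightarrow> inv\<^bsub>GL\<^esub> A = matrix_inv A"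
  by (rule GL.inv_equality) (auto simp: matrix_inv_mult)

text \<open>
  The coordinate ring of the general linear group: polynomials divided by powers of the determinant.
  The values at singular matrices are arbitrary.
\<close>

definition regular_fun :: "(complex ^ 'n ^ 'n \<Rightarrow> complex) \<Rightarrow> bool" where
  "regular_fun f \<longleftrightarrow> (\<exists>q\<in>polynomial_funs. \<exists>N. \<forall>A. invertible A \<longrightarrow> q A = det A ^ N * f A)"

lemma regular_fun_polynomial: "f \<in> polynomial_funs \<Longrightarrow> regular_fun f"
  unfolding regular_fun_def by (intro bexI[of _ f] exI[of _ 0]) auto

lemma polynomial_funs_det_id: "det \<in> polynomial_funs"
  by (rule polynomial_funs_det[of "\<lambda>A. A", OF polynomial_funs.entry])

lemma regular_fun_add:
  assumes "regular_fun f" "regular_fun g"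
  shows "regular_fun (\<lambda>A. f A + g A)"
proof -
  obtain p M q N where pq: "p \<in> polynomial_funs" "\<And>A. invertible A \<Longrightarrow> p A = det A ^ M * f A"
    "q \<in> polynomial_funs" "\<And>A. invertible A \<Longrightarrow> q A = det A ^ N * g A"
    using assms unfolding regular_fun_def by metis
  show ?thesis
    unfolding regular_fun_def
  proof (intro bexI[of _ "\<lambda>A. det A ^ N * p A + det A ^ M * q A"] exI[of _ "M + N"] allI impI)
    show "(\<lambda>A. det A ^ N * p A + det A ^ M * q A) \<in> polynomial_funs"
      by (intro polynomial_funs.add polynomial_funs.mult polynomial_funs_power polynomial_funs_det_id pq)
  qed (simp add: pq power_add algebra_simps)
qed

lemma regular_fun_mult:
  assumes "regular_fun f" "regular_fun g"
  shows "regular_fun (\<lambda>A. f A * g A)"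
proof -
  obtain p M q N where pq: "p \<in> polynomial_funs" "\<And>A. invertible A \<Longrightarrow> p A = det A ^ M * f A"
    "q \<in> polynomial_funs" "\<And>A. invertible A \<Longrightarrow> q A = det A ^ N * g A"
    using assms unfolding regular_fun_def by metis
  show ?thesis
    unfolding regular_fun_def
  proof (intro bexI[of _ "\<lambda>A. p A * q A"] exI[of _ "M + N"] allI impI)
    show "(\<lambda>A. p A * q A) \<in> polynomial_funs"
      by (intro polynomial_funs.mult pq)
  qed (simp add: pq power_add algebra_simps)
qed

lemma regular_fun_const: "regular_fun (\<lambda>A. c)"
  by (rule regular_fun_polynomial[OF polynomial_funs.const])

lemma regular_fun_sum: "(\<And>i. i \<in> I \<Longrightarrow> regular_fun (f i)) \<Longrightarrow> regular_fun (\<lambda>A. \<Sum>i\<in>I. f i A)"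
  by (induction I rule: infinite_finite_induct) (auto intro: regular_fun_const regular_fun_add)

text \<open>
  By Cramer's rule the entry of the inverse, multiplied by the determinant, is the determinant of the
  matrix with one column replaced by a basis vector.
\<close>

lemma regular_fun_inverse_entry: "regular_fun (\<lambda>A. matrix_inv A $ i $ j)"
proof -
  let ?q = "\<lambda>A::complex ^ 'a ^ 'a. det (\<chi> r c. if c = i then axis j 1 $ r else A $ r $ c)"
  have "?q A = det A ^ 1 * matrix_inv A $ i $ j" if A: "invertible A" for A :: "complex ^ 'a ^ 'a"
  proof -
    let ?x = "matrix_inv A *v axis j 1"
    have Ax: "A *v ?x = axis j 1" using A by (simp add: matrix_vector_mul_assoc matrix_inv_mult)
    have "?q A = ?x $ i * det A" using cramer_lemma[of i A ?x] unfolding Ax .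
    moreover have "?x $ i = matrix_inv A $ i $ j"
      by (simp add: matrix_vector_mult_def axis_def if_distrib[of "\<lambda>x. _ * x"] cong: if_cong)
    ultimately show ?thesis by simp
  qed
  moreover have "?q \<in> polynomial_funs"
  proof (rule polynomial_funs_det)
    show "(\<lambda>A. (\<chi> r c. if c = i then axis j 1 $ r else A $ r $ c) $ r $ c) \<in> polynomial_funs" for r c
      by (cases "c = i") (auto intro: polynomial_funs.const polynomial_funs.entry)
  qed
  ultimately show ?thesis
    unfolding regular_fun_def by (intro bexI[of _ ?q] exI[of _ 1] allI impI)
qed

lemma regular_fun_compose:
  fixes F :: "complex ^ 'n ^ 'n \<Rightarrow> complex ^ 'n ^ 'n"
  assumes "\<And>i j. regular_fun (\<lambda>A. F A $ i $ j)" "p \<in> polynomial_funs"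
  shows "regular_fun (\<lambda>A. p (F A))"
  using assms(2)
  by (induction rule: polynomial_funs.induct) (auto intro: regular_fun_const assms(1) regular_fun_add regular_fun_mult)

lemma continuous_map_zariski_regular:
  fixes F :: "complex ^ 'n ^ 'n \<Rightarrow> complex ^ 'n ^ 'n"
  assumes F: "\<And>i j. regular_fun (\<lambda>A. F A $ i $ j)"
  shows "continuous_map (subtopology zariski (carrier GL)) zariski F"
  unfolding continuous_map_closedin
proof (intro conjI allI impI)
  fix C :: "(complex ^ 'n ^ 'n) set"
  assume "closedin zariski C"
  then obtain P where P: "P \<subseteq> polynomial_funs" "C = zero_locus P" unfolding closedin_zariski_iff by blast
  have "\<exists>q\<in>polynomial_funs. \<exists>N. \<forall>A. invertible A \<longrightarrow> q A = det A ^ N * p (F A)" if "p \<in> P" for p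
    using regular_fun_compose[OF F] P(1) that unfolding regular_fun_def by blast
  then obtain q N where q: "\<And>p. p \<in> P \<Longrightarrow> q p \<in> polynomial_funs"
    "\<And>p A. p \<in> P \<Longrightarrow> invertible A \<Longrightarrow> q p A = det A ^ N p * p (F A)" by metis
  have "{x \<in> topspace (subtopology zariski (carrier GL)). F x \<in> C} = zero_locus (q ` P) \<inter> carrier GL"
    using q(2) P(2) by (auto simp: zero_locus_def invertible_det_nz)
  moreover have "closedin zariski (zero_locus (q ` P))"
    unfolding closedin_zariski_iff using q(1) by blast
  ultimately show "closedin (subtopology zariski (carrier GL)) {x \<in> topspace (subtopology zariski (carrier GL)). F x \<in> C}"
    unfolding closedin_subtopology by blast
qed auto

lemma connectedin_zariski_image:
  fixes F :: "complex ^ 'n ^ 'n \<Rightarrow> complex ^ 'n ^ 'n"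
  assumes "\<And>i j. regular_fun (\<lambda>A. F A $ i $ j)" "connectedin zariski S" "S \<subseteq> carrier GL"
  shows "connectedin zariski (F ` S)"
  using assms
  by (intro connectedin_continuous_map_image[OF continuous_map_zariski_regular]) (auto simp: connectedin_subtopology)

text \<open>
  The commutators with a fixed second factor form the image of \<open>H\<close> under a regular map,
  hence a connected set that contains 1. Products of commutators are reached by joining translates of
  such sets, so every element of the derived subgroup lies in a connected subset of it that contains
  1.
\<close>

lemma connectedin_derived:
  fixes H :: "(complex ^ 'n ^ 'n) set"
  assumes H: "subgroup H GL" and conn: "connectedin zariski H"
  shows "connectedin zariski (derived GL H)"
proof -
  interpret H: subgroup H GL by (rule H)
  have Hinv: "invertible h" if "h \<in> H" for h using H.subset that by auto
  let ?N = "derived GL H"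
  have subN: "subgroup ?N GL" using H.subset by (rule GL.derived_is_subgroup)
  interpret N: subgroup ?N GL by (rule subN)
  let ?c = "\<lambda>h2 h1. h1 ** h2 ** matrix_inv h1 ** matrix_inv h2"
  have comm: "?c h2 h1 \<in> ?N" if "h1 \<in> H" "h2 \<in> H" for h1 h2
  proof -
    have "?c h2 h1 = h1 \<otimes>\<^bsub>GL\<^esub> h2 \<otimes>\<^bsub>GL\<^esub> inv\<^bsub>GL\<^esub> h1 \<otimes>\<^bsub>GL\<^esub> inv\<^bsub>GL\<^esub> h2"
      using that Hinv by (simp add: inv_GL)
    then show ?thesis using that unfolding derived_def by (intro generate.incl) blast
  qed
  define J where "J n \<longleftrightarrow> (\<exists>S. connectedin zariski S \<and> S \<subseteq> ?N \<and> mat 1 \<in> S \<and> n \<in> S)" for n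
  have J_comm: "J (?c h2 h1)" if h: "h1 \<in> H" "h2 \<in> H" for h1 h2
    unfolding J_def
  proof (intro exI[of _ "?c h2 ` H"] conjI)
    have "regular_fun (\<lambda>A. ?c h2 A $ i $ j)" for i j
      unfolding matrix_matrix_mult_def vec_lambda_beta
      by (intro regular_fun_sum regular_fun_mult regular_fun_const regular_fun_inverse_entry
          regular_fun_polynomial[OF polynomial_funs.entry])
    then show "connectedin zariski (?c h2 ` H)" using conn H.subset by (intro connectedin_zariski_image) auto
    show "?c h2 ` H \<subseteq> ?N" using comm h(2) by blast
    have one: "mat 1 \<in> H" using H.one_closed by (simp only: GL_simps)
    have "matrix_inv (mat 1 :: complex ^ 'n ^ 'n) = mat 1"
      using matrix_inv_mult(1)[OF Hinv[OF one]] by (simp only: matrix_mul_lid)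
    then have "?c h2 (mat 1) = mat 1"
      by (simp only: matrix_mul_lid matrix_mul_rid matrix_inv_mult(1)[OF Hinv[OF h(2)]])
    then show "mat 1 \<in> ?c h2 ` H" using one by (rule image_eqI[OF sym])
  qed (use h in auto)
  have J_all: "J n" if "n \<in> generate GL (derived_set GL H)" for n
    using that
  proof (induction rule: generate.induct)
    case one
    show ?case unfolding J_def by (intro exI[of _ "{mat 1}"]) (use N.one_closed in auto)
  next
    case (incl h)
    then show ?case using J_comm Hinv by (auto simp: inv_GL)
  next
    case (inv h)
    then obtain h1 h2 where h: "h1 \<in> H" "h2 \<in> H"
      "h = h1 \<otimes>\<^bsub>GL\<^esub> h2 \<otimes>\<^bsub>GL\<^esub> inv\<^bsub>GL\<^esub> h1 \<otimes>\<^bsub>GL\<^esub> inv\<^bsub>GL\<^esub> h2" by blast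
    have c: "h1 \<in> carrier GL" "h2 \<in> carrier GL" using h(1,2) H.subset by blast+
    have "inv\<^bsub>GL\<^esub> h = h2 \<otimes>\<^bsub>GL\<^esub> h1 \<otimes>\<^bsub>GL\<^esub> inv\<^bsub>GL\<^esub> h2 \<otimes>\<^bsub>GL\<^esub> inv\<^bsub>GL\<^esub> h1"
      unfolding h(3) using c by (simp only: GL.inv_mult_group GL.inv_closed GL.m_closed GL.inv_inv GL.m_assoc)
    then have "inv\<^bsub>GL\<^esub> h = ?c h1 h2" using h(1,2) Hinv by (simp add: inv_GL)
    then show ?case using J_comm h(1,2) by simp
  next
    case (eng n m)
    obtain S T where S: "connectedin zariski S" "S \<subseteq> ?N" "mat 1 \<in> S" "n \<in> S"
      and T: "connectedin zariski T" "T \<subseteq> ?N" "mat 1 \<in> T" "m \<in> T"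
      using eng.IH unfolding J_def by blast
    have NGL: "?N \<subseteq> carrier GL" by (rule N.subset)
    have "regular_fun (\<lambda>A. (n ** A) $ i $ j)" for i j
      unfolding matrix_matrix_mult_def vec_lambda_beta
      by (intro regular_fun_sum regular_fun_mult regular_fun_const regular_fun_polynomial[OF polynomial_funs.entry])
    then have nT: "connectedin zariski ((**) n ` T)" using T(1,2) NGL by (intro connectedin_zariski_image) auto
    have n1: "n \<in> (**) n ` T" using T(3) by (metis imageI matrix_mul_rid)
    have "S \<inter> (**) n ` T \<noteq> {}" using S(4) n1 by blast
    then have "connectedin zariski (S \<union> (**) n ` T)" by (rule connectedin_Un[OF S(1) nT])
    moreover have "(**) n ` T \<subseteq> ?N" using N.m_closed S(2,4) T(2) by auto
    ultimately show ?case unfolding J_def using S T by (intro exI[of _ "S \<union> (**) n ` T"]) auto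
  qed
  define \<U> where "\<U> = {S. connectedin zariski S \<and> S \<subseteq> ?N \<and> mat 1 \<in> S}"
  have "?N = \<Union>\<U>"
    using J_all unfolding J_def \<U>_def derived_def by blast
  moreover have "connectedin zariski (\<Union>\<U>)"
    by (rule connectedin_Union) (auto simp: \<U>_def)
  ultimately show ?thesis by simp
qed

section \<open>Eigenvectors in subquotients\<close>

text \<open>
  The value \<open>p(f) v\<close>, for a plain function \<open>f\<close>.
\<close>

definition poly_act :: "(complex ^ 'n \<Rightarrow> complex ^ 'n) \<Rightarrow> complex ^ 'n \<Rightarrow> complex poly \<Rightarrow> complex ^ 'n" where
  "poly_act f v p = (\<Sum>i\<le>degree p. coeff p i *s (f ^^ i) v)"

lemma poly_act_upto: "degree p \<le> N \<Longrightarrow> poly_act f v p = (\<Sum>i\<le>N. coeff p i *s (f ^^ i) v)"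
  unfolding poly_act_def by (intro sum.mono_neutral_left) (auto simp: coeff_eq_0)

lemma poly_act_add: "poly_act f v (p + q) = poly_act f v p + poly_act f v q"
proof -
  let ?N = "max (degree p) (degree q)"
  show ?thesis
    using poly_act_upto[of "p + q" ?N f v] poly_act_upto[of p ?N f v] poly_act_upto[of q ?N f v] degree_add_le_max[of p q]
    by (simp add: vec.scale_left_distrib sum.distrib)
qed

lemma poly_act_smult: "poly_act f v (smult c p) = c *s poly_act f v p"
  using poly_act_upto[of "smult c p" "degree p" f v] poly_act_upto[of p "degree p" f v]
  by (simp add: vec.scale_sum_right)

lemma poly_act_shift:
  assumes "Vector_Spaces.linear (*s) (*s) f"
  shows "poly_act f v (pCons 0 p) = f (poly_act f v p)"
proof -
  interpret f: Vector_Spaces.linear "(*s)" "(*s)" f by fact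
  have "poly_act f v (pCons 0 p) = (\<Sum>i\<le>Suc (degree p). coeff (pCons 0 p) i *s (f ^^ i) v)"
    by (intro poly_act_upto) (simp add: degree_pCons_le)
  also have "\<dots> = (\<Sum>i\<le>degree p. coeff p i *s (f ^^ Suc i) v)"
    by (subst sum.atMost_Suc_shift) simp
  also have "\<dots> = f (poly_act f v p)" unfolding poly_act_def by (simp add: f.sum f.scale)
  finally show ?thesis .
qed

lemma poly_act_monom: "poly_act f v (monom 1 m) = (f ^^ m) v"
proof -
  have "poly_act f v (monom 1 m) = (\<Sum>i\<le>m. (if i = m then (f ^^ i) v else 0))"
    unfolding poly_act_upto[OF degree_monom_le] by (intro sum.cong) auto
  then show ?thesis by simp
qed

text \<open>
  The iterates of \<open>v\<close> cannot all be independent of their predecessors in finite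
  dimension.
\<close>

lemma ex_annihilating_poly:
  fixes f :: "complex ^ 'n \<Rightarrow> complex ^ 'n"
  shows "\<exists>p. p \<noteq> 0 \<and> poly_act f v p = 0"
proof -
  let ?B = "\<lambda>m. (\<lambda>i. (f ^^ i) v) ` {..<m}"
  have "\<exists>m. (f ^^ m) v \<in> vec.span (?B m)"
  proof (rule ccontr)
    assume no: "\<nexists>m. (f ^^ m) v \<in> vec.span (?B m)"
    have "vec.dim (?B m) = m" for m
    proof (induction m)
      case (Suc m)
      have "?B (Suc m) = insert ((f ^^ m) v) (?B m)" by (simp add: lessThan_Suc)
      then show ?case using no Suc by (simp add: vec.dim_insert)
    qed simp
    from this[of "Suc CARD('n)"] show False
      using dim_subset_UNIV_cart_gen[of "?B (Suc CARD('n))"] by simp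
  qed
  then obtain m where m: "(f ^^ m) v \<in> vec.span (?B m)" by blast
  let ?S = "{poly_act f v p | p. \<forall>i\<ge>m. coeff p i = 0}"
  have "vec.span (?B m) \<subseteq> ?S"
  proof (rule vec.span_minimal)
    show "?B m \<subseteq> ?S"
    proof
      fix x assume "x \<in> ?B m"
      then obtain i where "i < m" "x = poly_act f v (monom 1 i)" by (auto simp: poly_act_monom)
      then show "x \<in> ?S" by (intro CollectI exI[of _ "monom 1 i"]) auto
    qed
    show "vec.subspace ?S"
      unfolding vec.subspace_def
    proof (intro conjI ballI allI)
      show "0 \<in> ?S" by (intro CollectI exI[of _ 0]) (simp add: poly_act_def)
      fix x assume "x \<in> ?S"
      then obtain p where p: "x = poly_act f v p" "\<forall>i\<ge>m. coeff p i = 0" by blast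
      show "c *s x \<in> ?S" for c
        by (intro CollectI exI[of _ "smult c p"]) (use p in \<open>auto simp: poly_act_smult\<close>)
      fix y assume "y \<in> ?S"
      then obtain q where q: "y = poly_act f v q" "\<forall>i\<ge>m. coeff q i = 0" by blast
      show "x + y \<in> ?S"
        by (intro CollectI exI[of _ "p + q"]) (use p q in \<open>auto simp: poly_act_add\<close>)
    qed
  qed
  with m obtain p where p: "(f ^^ m) v = poly_act f v p" "\<forall>i\<ge>m. coeff p i = 0" by blast
  let ?q = "monom 1 m + smult (-1) p"
  have "coeff ?q m = 1" using p(2) by simp
  then have "?q \<noteq> 0" by (metis coeff_0 zero_neq_one)
  moreover have "poly_act f v ?q = 0"
    by (simp only: poly_act_add poly_act_smult poly_act_monom p(1)) simp
  ultimately show ?thesis by blast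
qed

text \<open>
  An eigenvector of \<open>f\<close> on the quotient \<open>C / A\<close>, stated without quotient
  spaces. Among the nonzero polynomials in \<open>f\<close> that send \<open>v\<close> into
  \<open>A\<close> take one of least degree and split off a root \<open>r\<close>; the cofactor
  produces the eigenvector.
\<close>

lemma ex_eigenvector_mod:
  fixes f :: "complex ^ 'n \<Rightarrow> complex ^ 'n"
  assumes f: "Vector_Spaces.linear (*s) (*s) f" and A: "vec.subspace A" and C: "vec.subspace C"
    and stable: "\<And>x. x \<in> C \<Longrightarrow> f x \<in> C" and v: "v \<in> C" "v \<notin> A"
  shows "\<exists>w c. w \<in> C \<and> w \<notin> A \<and> f w - c *s w \<in> A"
proof -
  let ?P = "\<lambda>p. p \<noteq> 0 \<and> poly_act f v p \<in> A"
  obtain p0 where "?P p0" using ex_annihilating_poly[of f v] vec.subspace_0[OF A] by metis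
  then obtain p where p: "?P p" "\<And>q. ?P q \<Longrightarrow> degree p \<le> degree q"
    using ex_has_least_nat[of ?P p0 degree] by blast
  have "degree p \<noteq> 0"
  proof
    assume "degree p = 0"
    then obtain c where c: "p = [:c:]" by (rule degree_eq_zeroE)
    then have "c \<noteq> 0" "c *s v \<in> A" using p(1) by (auto simp: poly_act_def)
    then show False using vec.subspace_scale[OF A, of "c *s v" "1 / c"] v(2) by simp
  qed
  then obtain r where "poly p r = 0"
    using fundamental_theorem_of_algebra[of p] by (auto simp: constant_degree)
  then obtain s where s: "p = [:-r, 1:] * s" by (metis poly_eq_0_iff_dvd dvdE)
  have s0: "s \<noteq> 0" using p(1) s by auto
  have "degree p = Suc (degree s)" unfolding s using s0 by (subst degree_mult_eq) auto
  then have sA: "poly_act f v s \<notin> A" using p(2)[of s] s0 by auto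
  have "(f ^^ i) v \<in> C" for i by (induction i) (use v(1) stable in auto)
  then have sC: "poly_act f v s \<in> C"
    unfolding poly_act_def using C by (intro vec.subspace_sum vec.subspace_scale)
  have "p = smult (-r) s + pCons 0 s" unfolding s by simp
  then have "poly_act f v p = (-r) *s poly_act f v s + f (poly_act f v s)"
    by (simp only: poly_act_add poly_act_smult poly_act_shift[OF f])
  then have "f (poly_act f v s) - r *s poly_act f v s \<in> A" using p(1) by simp
  then show ?thesis using sA sC by blast
qed

lemma eigenvectors_mod_independent:
  fixes f :: "complex ^ 'n \<Rightarrow> complex ^ 'n"
  assumes f: "Vector_Spaces.linear (*s) (*s) f" and A: "vec.subspace A"
    and stable: "\<And>x. x \<in> A \<Longrightarrow> f x \<in> A" and "finite F"
    and w: "\<And>c. c \<in> F \<Longrightarrow> w c \<notin> A \<and> f (w c) - c *s w c \<in> A" and "(\<Sum>c\<in>F. a c *s w c) \<in> A"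
  shows "\<forall>c\<in>F. a c = 0"
  using \<open>finite F\<close> w \<open>(\<Sum>c\<in>F. a c *s w c) \<in> A\<close>
proof (induction F arbitrary: a rule: finite_induct)
  case (insert c0 F)
  interpret f: Vector_Spaces.linear "(*s)" "(*s)" f by fact
  let ?s = "\<Sum>c\<in>insert c0 F. a c *s w c"
  have "f ?s - c0 *s ?s = (\<Sum>c\<in>insert c0 F. a c *s (f (w c) - c0 *s w c))"
    by (simp add: f.sum f.scale vec.scale_sum_right sum_subtractf vec.scale_right_diff_distrib mult.commute)
  also have "\<dots> = (\<Sum>c\<in>insert c0 F. a c *s (f (w c) - c *s w c) + (a c * (c - c0)) *s w c)"
    by (intro sum.cong refl) (simp add: vec.scale_right_diff_distrib vec.scale_left_diff_distrib algebra_simps)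
  also have "\<dots> = (\<Sum>c\<in>insert c0 F. a c *s (f (w c) - c *s w c)) + (\<Sum>c\<in>F. (a c * (c - c0)) *s w c)"
    using insert.hyps by (simp add: sum.distrib)
  finally have eq: "(\<Sum>c\<in>F. (a c * (c - c0)) *s w c) =
    (f ?s - c0 *s ?s) - (\<Sum>c\<in>insert c0 F. a c *s (f (w c) - c *s w c))" by simp
  have "f ?s - c0 *s ?s \<in> A"
    using insert.prems(2) stable A by (intro vec.subspace_diff vec.subspace_scale)
  moreover have "(\<Sum>c\<in>insert c0 F. a c *s (f (w c) - c *s w c)) \<in> A"
    using insert.prems(1) A by (intro vec.subspace_sum vec.subspace_scale) auto
  ultimately have "(\<Sum>c\<in>F. (a c * (c - c0)) *s w c) \<in> A"
    unfolding eq by (rule vec.subspace_diff[OF A])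
  from insert.IH[OF _ this] insert.prems(1) have "\<forall>c\<in>F. a c * (c - c0) = 0" by blast
  then have F0: "\<forall>c\<in>F. a c = 0" using insert.hyps(2) by auto
  then have "a c0 *s w c0 \<in> A" using insert.prems(2) insert.hyps by simp
  moreover have "w c0 \<notin> A" using insert.prems(1) by blast
  ultimately have "a c0 = 0"
    using vec.subspace_scale[OF A, of "a c0 *s w c0" "1 / a c0"] by (cases "a c0 = 0") auto
  then show ?case using F0 by simp
qed simp

text \<open>
  The finiteness makes an eigenvalue that varies over a connected group constant.
\<close>

lemma finite_eigenvalues_mod:
  fixes f :: "complex ^ 'n \<Rightarrow> complex ^ 'n"
  assumes f: "Vector_Spaces.linear (*s) (*s) f" and A: "vec.subspace A" "\<And>x. x \<in> A \<Longrightarrow> f x \<in> A"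
  shows "finite {c. \<exists>w. w \<notin> A \<and> f w - c *s w \<in> A}"
proof (rule ccontr)
  assume "infinite {c. \<exists>w. w \<notin> A \<and> f w - c *s w \<in> A}"
  from infinite_arbitrarily_large[OF this, of "Suc CARD('n)"]
  obtain F where F: "F \<subseteq> {c. \<exists>w. w \<notin> A \<and> f w - c *s w \<in> A}" "finite F" "card F = Suc CARD('n)"
    by (elim exE conjE)
  then have "\<forall>c\<in>F. \<exists>w. w \<notin> A \<and> f w - c *s w \<in> A" by blast
  then obtain w where w: "\<And>c. c \<in> F \<Longrightarrow> w c \<notin> A \<and> f (w c) - c *s w c \<in> A" by metis
  have ind: "\<forall>c\<in>F. a c = 0" if "(\<Sum>c\<in>F. a c *s w c) \<in> A" for a
    by (rule eigenvectors_mod_independent[OF f A F(2) w that])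
  have inj: "inj_on w F"
  proof (rule inj_onI, rule ccontr)
    fix c c' assume c: "c \<in> F" "c' \<in> F" "w c = w c'" "c \<noteq> c'"
    let ?a = "\<lambda>x. if x = c then 1 else if x = c' then -1 else (0::complex)"
    have "(\<Sum>x\<in>F. ?a x *s w x) = (\<Sum>x\<in>{c, c'}. ?a x *s w x)"
      using F(2) c by (intro sum.mono_neutral_right) auto
    also have "\<dots> = 0" using c by simp
    finally have "?a c = 0" using ind[of ?a] c(1) vec.subspace_0[OF A(1)] by auto
    then show False by simp
  qed
  have "vec.independent (w ` F)"
  proof (rule vec.independent_if_scalars_zero)
    fix g x assume g: "(\<Sum>x\<in>w ` F. g x *s x) = 0" and x: "x \<in> w ` F"
    have "(\<Sum>c\<in>F. g (w c) *s w c) = 0" using g by (simp add: sum.reindex[OF inj])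
    then show "g x = 0" using ind[of "\<lambda>c. g (w c)"] x vec.subspace_0[OF A(1)] by auto
  qed (use F in simp)
  then have "card (w ` F) = vec.dim (vec.span (w ` F))" by (rule vec.dim_span_eq_card_independent[symmetric])
  also have "\<dots> \<le> CARD('n)" by (rule dim_subset_UNIV_cart_gen)
  finally show False using card_image[OF inj] F(3) by simp
qed

section \<open>The Lie--Kolchin theorem\<close>

text \<open>
  The sets of \<open>h \<in> H\<close> for which \<open>h v\<close> has a given eigenvalue are closed,
  disjoint, cover \<open>H\<close>, and only finitely many are nonempty.
\<close>

lemma eigenvalue_constant:
  fixes H :: "(complex ^ 'n ^ 'n) set"
  assumes H: "connectedin zariski H" "mat 1 \<in> H" and A: "vec.subspace A" "\<And>x. x \<in> A \<Longrightarrow> n *v x \<in> A"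
    and v: "\<And>h. h \<in> H \<Longrightarrow> h *v v \<notin> A" "\<And>h. h \<in> H \<Longrightarrow> \<exists>c. n *v (h *v v) - c *s (h *v v) \<in> A"
    and c: "n *v v - c *s v \<in> A" and h: "h \<in> H"
  shows "n *v (h *v v) - c *s (h *v v) \<in> A"
proof -
  let ?Z = "\<lambda>c. {h. n *v (h *v v) - c *s (h *v v) \<in> A}"
  let ?F = "{c. \<exists>w. w \<notin> A \<and> n *v w - c *s w \<in> A}"
  have "H \<subseteq> ?Z c"
  proof (rule connectedin_zariski_finite_cover[OF H(1), of ?F])
    show "finite ?F" using A by (intro finite_eigenvalues_mod matrix_vector_mul_linear_gen)
    show "closedin zariski (?Z c)" for c
    proof (rule closedin_zariski_linear_condition[OF _ A(1)])
      show "Vector_Spaces.linear (*s) (*s) (\<lambda>x. n *v x - c *s x)"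
        by (intro linear_vecI) (simp_all add: vec.add vec.scale vec.scale_right_distrib vec.scale_right_diff_distrib mult.commute)
    qed
    show "H \<subseteq> (\<Union>c\<in>?F. ?Z c)" using v by blast
    show "c = c'" if "h \<in> H" "h \<in> ?Z c" "h \<in> ?Z c'" for c c' h
    proof (rule ccontr)
      assume "c \<noteq> c'"
      have "n *v (h *v v) - c *s (h *v v) \<in> A" "n *v (h *v v) - c' *s (h *v v) \<in> A"
        using that(2,3) by simp_all
      from vec.subspace_diff[OF A(1) this(2,1)]
      have "(n *v (h *v v) - c' *s (h *v v)) - (n *v (h *v v) - c *s (h *v v)) \<in> A" .
      then have "(c - c') *s (h *v v) \<in> A" by (simp add: vec.scale_left_diff_distrib)
      from vec.subspace_scale[OF A(1) this, of "1 / (c - c')"]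
      have "(1 / (c - c') * (c - c')) *s (h *v v) \<in> A" by (simp only: vec.scale_scale)
      moreover have "1 / (c - c') * (c - c') = 1" using \<open>c \<noteq> c'\<close> by simp
      ultimately show False using v(1)[OF that(1)] by (simp only: vec.scale_one)
    qed
    show "c \<in> ?F" using v(1)[OF H(2)] c by auto
    show "mat 1 \<in> ?Z c" using c by simp
  qed (rule H(2))
  then show ?thesis using h by blast
qed

text \<open>
  The theorem for the quotient \<open>C / A\<close>. The induction is on the derived length, and
  \<open>C\<close> is replaced by a minimal stable subspace \<open>D\<close> that properly contains
  \<open>A\<close>. The derived subgroup \<open>N\<close> has a common eigenvector in \<open>D /
  A\<close>. Since \<open>H\<close> permutes the eigenvectors of the normal subgroup \<open>N\<close>
  and is connected, their eigencharacter is constant on \<open>H\<close>-orbits, so the eigenspace is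
  stable under \<open>H\<close> and equals \<open>D\<close> by minimality: \<open>N\<close> acts on
  \<open>D / A\<close> by scalars. An eigenspace of a single \<open>k \<in> H\<close> is then mapped
  by \<open>H\<close> to eigenspaces of \<open>k\<close>, since \<open>k\<close> commutes with
  \<open>H\<close> up to these scalars, and the same argument shows that \<open>k\<close> acts by a
  scalar.
\<close>

theorem lie_kolchin:
  fixes H :: "(complex ^ 'n ^ 'n) set"
  assumes "subgroup H GL" "connectedin zariski H" "(derived GL ^^ m) H = {mat 1}"
    and "vec.subspace A" "vec.subspace C" "A \<subset> C"
    and "\<And>h x. h \<in> H \<Longrightarrow> x \<in> A \<Longrightarrow> h *v x \<in> A" "\<And>h x. h \<in> H \<Longrightarrow> x \<in> C \<Longrightarrow> h *v x \<in> C"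
  shows "\<exists>v\<in>C. v \<notin> A \<and> (\<forall>h\<in>H. \<exists>c. h *v v - c *s v \<in> A)"
  using assms
proof (induction m arbitrary: H A C)
  case 0
  then obtain v where v: "v \<in> C" "v \<notin> A" by blast
  have "\<exists>c. h *v v - c *s v \<in> A" if "h \<in> H" for h
    using that 0 vec.subspace_0[of A] by (intro exI[of _ 1]) auto
  then show ?case using v by blast
next
  case (Suc m)
  note H = Suc.prems(1) and conn = Suc.prems(2) and A = Suc.prems(4,7) and C = Suc.prems(5,8) and AC = Suc.prems(6)
  interpret H: subgroup H GL by (rule H)
  let ?N = "derived GL H"
  have Hinv: "invertible h" if "h \<in> H" for h using H.subset that by auto
  have one: "mat 1 \<in> H" using H.one_closed by (simp only: GL_simps)
  have minv: "matrix_inv h \<in> H" if "h \<in> H" for h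
    using H.m_inv_closed[OF that] inv_GL[OF Hinv[OF that]] by simp
  have mult: "g ** h \<in> H" if "g \<in> H" "h \<in> H" for g h using H.m_closed[OF that] by simp
  have subN: "subgroup ?N GL" using H.subset by (rule GL.derived_is_subgroup)
  have NH: "?N \<subseteq> H" using H by (intro GL.derived_incl) auto
  have connN: "connectedin zariski ?N" using H conn by (rule connectedin_derived)
  have derN: "(derived GL ^^ m) ?N = {mat 1}" using Suc.prems(3) by (simp add: funpow_swap1)
  have conj: "matrix_inv h ** n ** h \<in> ?N" if "n \<in> ?N" "h \<in> H" for n h
  proof -
    have "inv\<^bsub>GL\<lparr>carrier := H\<rparr>\<^esub> h \<otimes>\<^bsub>GL\<lparr>carrier := H\<rparr>\<^esub> n \<otimes>\<^bsub>GL\<lparr>carrier := H\<rparr>\<^esub> h \<in> ?N"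
      using normal.inv_op_closed1[OF GL.derived_subgroup_is_normal[OF H]] that by simp
    then show ?thesis using GL.m_inv_consistent[OF H that(2)] inv_GL[OF Hinv[OF that(2)]] by simp
  qed
  have comm: "matrix_inv k ** matrix_inv h ** k ** h \<in> ?N" if "k \<in> H" "h \<in> H" for k h
  proof -
    have c: "k \<in> carrier GL" "h \<in> carrier GL" using that H.subset by blast+
    have "inv\<^bsub>GL\<^esub> k \<otimes>\<^bsub>GL\<^esub> inv\<^bsub>GL\<^esub> h \<otimes>\<^bsub>GL\<^esub> inv\<^bsub>GL\<^esub> (inv\<^bsub>GL\<^esub> k) \<otimes>\<^bsub>GL\<^esub> inv\<^bsub>GL\<^esub> (inv\<^bsub>GL\<^esub> h) \<in> ?N"
      unfolding derived_def using that by (intro generate.incl) blast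
    then have "inv\<^bsub>GL\<^esub> k \<otimes>\<^bsub>GL\<^esub> inv\<^bsub>GL\<^esub> h \<otimes>\<^bsub>GL\<^esub> k \<otimes>\<^bsub>GL\<^esub> h \<in> ?N" by (simp only: GL.inv_inv[OF c(1)] GL.inv_inv[OF c(2)])
    then show ?thesis using inv_GL[OF Hinv[OF that(1)]] inv_GL[OF Hinv[OF that(2)]] by simp
  qed
  \<comment> \<open>A minimal stable subspace above \<open>A\<close>, so that \<open>D / A\<close> is irreducible.\<close>
  let ?P = "\<lambda>S. vec.subspace S \<and> A \<subset> S \<and> S \<subseteq> C \<and> (\<forall>h\<in>H. \<forall>x\<in>S. h *v x \<in> S)"
  have "?P C" using C AC by blast
  from ex_has_least_nat[of ?P, OF this, of vec.dim]
  obtain D where D: "?P D" "\<forall>S. ?P S \<longrightarrow> vec.dim D \<le> vec.dim S" by blast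
  have Ds: "vec.subspace D" "A \<subset> D" "D \<subseteq> C" and Dst: "\<And>h x. h \<in> H \<Longrightarrow> x \<in> D \<Longrightarrow> h *v x \<in> D"
    using D(1) by auto
  have min: "S = D" if "vec.subspace S" "A \<subset> S" "S \<subseteq> D" "\<And>h x. h \<in> H \<Longrightarrow> x \<in> S \<Longrightarrow> h *v x \<in> S" for S
  proof -
    have "?P S" using that Ds(3) by blast
    then have "vec.dim D \<le> vec.dim S" using D(2) by blast
    then show ?thesis using that(1,3) Ds(1) by (intro vec.subspace_dim_equal)
  qed
  have notA: "h *v v \<notin> A" if "h \<in> H" "v \<notin> A" for h v
  proof
    assume "h *v v \<in> A"
    then have "matrix_inv h *v (h *v v) \<in> A" using A(2) minv that(1) by blast
    then show False using that matrix_inv_mult(2)[OF Hinv[OF that(1)]] by (simp add: matrix_vector_mul_assoc)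
  qed
  have "\<exists>v\<in>D. v \<notin> A \<and> (\<forall>h\<in>?N. \<exists>c. h *v v - c *s v \<in> A)"
    using NH A(2) Dst by (intro Suc.IH[OF subN connN derN A(1) Ds(1,2)]) blast+
  then obtain v0 where v0: "v0 \<in> D" "v0 \<notin> A" "\<forall>n\<in>?N. \<exists>c. n *v v0 - c *s v0 \<in> A" by blast
  from bchoice[OF v0(3)] obtain \<kappa> where \<kappa>: "\<forall>n\<in>?N. n *v v0 - \<kappa> n *s v0 \<in> A" by blast
  have linear_mod: "vec.subspace {v \<in> D. n *v v - c *s v \<in> A}" for n c
    unfolding vec.subspace_def
  proof (intro conjI ballI allI)
    show "0 \<in> {v \<in> D. n *v v - c *s v \<in> A}"
      using vec.subspace_0[OF A(1)] vec.subspace_0[OF Ds(1)] by simp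
    fix x assume x: "x \<in> {v \<in> D. n *v v - c *s v \<in> A}"
    show "k *s x \<in> {v \<in> D. n *v v - c *s v \<in> A}" for k
    proof -
      have "n *v (k *s x) - c *s (k *s x) = k *s (n *v x - c *s x)"
        by (simp add: vec.scale vec.scale_right_diff_distrib mult.commute)
      moreover have "k *s (n *v x - c *s x) \<in> A" using x by (intro vec.subspace_scale[OF A(1)]) simp
      ultimately have "n *v (k *s x) - c *s (k *s x) \<in> A" by (simp only:)
      then show ?thesis using x vec.subspace_scale[OF Ds(1)] by blast
    qed
    fix y assume y: "y \<in> {v \<in> D. n *v v - c *s v \<in> A}"
    have "n *v (x + y) - c *s (x + y) = (n *v x - c *s x) + (n *v y - c *s y)"
      by (simp add: vec.add vec.scale_right_distrib)
    moreover have "(n *v x - c *s x) + (n *v y - c *s y) \<in> A" using x y by (intro vec.subspace_add[OF A(1)]) simp_all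
    ultimately have "n *v (x + y) - c *s (x + y) \<in> A" by (simp only:)
    then show "x + y \<in> {v \<in> D. n *v v - c *s v \<in> A}"
      using x y vec.subspace_add[OF Ds(1)] by blast
  qed
  let ?E = "{v \<in> D. \<forall>n\<in>?N. n *v v - \<kappa> n *s v \<in> A}"
  have NA: "n *v x \<in> A" if "n \<in> ?N" "x \<in> A" for n x using that NH A(2) by blast
  have "?E = D"
  proof (rule min)
    have "?E = D \<inter> (\<Inter>n\<in>?N. {v \<in> D. n *v v - \<kappa> n *s v \<in> A})" by blast
    then show "vec.subspace ?E" using linear_mod Ds(1) by (auto intro!: vec.subspace_inter vec.subspace_Inter)
    have "A \<subseteq> ?E" using Ds(2) NA A(1) by (auto intro: vec.subspace_diff vec.subspace_scale)
    moreover have "v0 \<in> ?E" using v0(1) \<kappa> by blast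
    ultimately show "A \<subset> ?E" using v0(2) by blast
    show "h *v v \<in> ?E" if h: "h \<in> H" and v: "v \<in> ?E" for h v
    proof (cases "v \<in> A")
      case True
      then show ?thesis using \<open>A \<subseteq> ?E\<close> A(2) h by blast
    next
      case False
      have "n *v (h *v v) - \<kappa> n *s (h *v v) \<in> A" if n: "n \<in> ?N" for n
      proof (rule eigenvalue_constant[OF conn one A(1) NA[OF n]])
        show "\<exists>c. n *v (h' *v v) - c *s (h' *v v) \<in> A" if h': "h' \<in> H" for h'
        proof
          let ?m = "matrix_inv h' ** n ** h'"
          have "h' ** ?m = n ** h'"
            using matrix_inv_mult(1)[OF Hinv[OF h']] by (simp add: matrix_mul_assoc)
          then have "n *v (h' *v v) = h' *v (?m *v v)" by (simp add: matrix_vector_mul_assoc)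
          then have "n *v (h' *v v) - \<kappa> ?m *s (h' *v v) = h' *v (?m *v v - \<kappa> ?m *s v)"
            by (simp only: vec.diff vec.scale)
          moreover have "?m *v v - \<kappa> ?m *s v \<in> A" using v conj[OF n h'] by blast
          ultimately show "n *v (h' *v v) - \<kappa> ?m *s (h' *v v) \<in> A" using A(2)[OF h'] by simp
        qed
      qed (use notA False v n h in auto)
      then show ?thesis using Dst h v by blast
    qed
  qed blast
  \<comment> \<open>The derived subgroup acts on \<open>D / A\<close> by the scalars \<open>\<kappa>\<close>.\<close>
  then have scalar: "n *v v - \<kappa> n *s v \<in> A" if "n \<in> ?N" "v \<in> D" for n v using that by blast
  have "\<exists>c. k *v v0 - c *s v0 \<in> A" if k: "k \<in> H" for k
  proof -
    have "\<exists>w c. w \<in> D \<and> w \<notin> A \<and> k *v w - c *s w \<in> A"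
      by (rule ex_eigenvector_mod[OF matrix_vector_mul_linear_gen A(1) Ds(1) Dst[OF k] v0(1,2)])
    then obtain w c where w: "w \<in> D" "w \<notin> A" "k *v w - c *s w \<in> A" by blast
    let ?E = "{v \<in> D. k *v v - c *s v \<in> A}"
    have "?E = D"
    proof (rule min)
      show "vec.subspace ?E" by (rule linear_mod)
      have "A \<subseteq> ?E" using Ds(2) A k by (auto intro: vec.subspace_diff vec.subspace_scale)
      then show "A \<subset> ?E" using w by blast
      show "h *v v \<in> ?E" if h: "h \<in> H" and v: "v \<in> ?E" for h v
      proof (cases "v \<in> A")
        case True
        then show ?thesis using \<open>A \<subseteq> ?E\<close> A(2) h by blast
      next
        case False
        have "k *v (h *v v) - c *s (h *v v) \<in> A"
        proof (rule eigenvalue_constant[OF conn one A(1) A(2)[OF k]])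
          show "\<exists>d. k *v (h' *v v) - d *s (h' *v v) \<in> A" if h': "h' \<in> H" for h'
          proof
            \<comment> \<open>From \<open>k h' = h' k n\<close> with a commutator \<open>n\<close> that acts by
              the scalar \<open>\<kappa> n\<close>.\<close>
            let ?n = "matrix_inv k ** matrix_inv h' ** k ** h'"
            have "h' ** k ** ?n = h' ** (k ** matrix_inv k) ** matrix_inv h' ** k ** h'"
              by (simp only: matrix_mul_assoc)
            also have "\<dots> = k ** h'"
              by (simp only: matrix_inv_mult(1)[OF Hinv[OF k]] matrix_inv_mult(1)[OF Hinv[OF h']] matrix_mul_rid matrix_mul_lid)
            finally have "k *v (h' *v v) = h' *v (k *v (?n *v v))" by (simp add: matrix_vector_mul_assoc matrix_mul_assoc)
            then have "k *v (h' *v v) - (\<kappa> ?n * c) *s (h' *v v) =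
              h' *v (k *v (?n *v v - \<kappa> ?n *s v)) + \<kappa> ?n *s (h' *v (k *v v - c *s v))"
              by (simp add: vec.diff vec.scale vec.scale_right_diff_distrib)
            moreover have "?n *v v - \<kappa> ?n *s v \<in> A" using v scalar[OF comm[OF k h']] by blast
            moreover have "k *v v - c *s v \<in> A" using v by blast
            ultimately show "k *v (h' *v v) - (\<kappa> ?n * c) *s (h' *v v) \<in> A"
              by (simp only:) (intro vec.subspace_add[OF A(1)] vec.subspace_scale[OF A(1)] A(2)[OF h'] A(2)[OF k])
          qed
        qed (use notA False v k h in auto)
        then show ?thesis using Dst h v by blast
      qed
    qed blast
    then show ?thesis using v0(1) by blast
  qed
  then show ?case using v0 Ds(3) by blast
qed

section \<open>Stable chains\<close>

definition stable_chain :: "(complex ^ 'n ^ 'n) set \<Rightarrow> nat \<Rightarrow> (nat \<Rightarrow> (complex ^ 'n) set) \<Rightarrow> bool" where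
  "stable_chain H r F \<longleftrightarrow> slow_chain r F \<and> (\<forall>i\<le>r. \<forall>h\<in>H. \<forall>x\<in>F i. h *v x \<in> F i)"

lemma span_insertE:
  assumes "vec.subspace A" "x \<in> vec.span (insert v A)"
  obtains a k where "a \<in> A" "x = a + k *s v"
proof -
  have "vec.span A = A" using assms(1) by (rule vec.span_eq_iff[THEN iffD2])
  with assms(2) obtain k where "x - k *s v \<in> A" unfolding vec.span_insert by blast
  then show ?thesis using that[of "x - k *s v" k] by simp
qed

text \<open>
  The new chain is \<open>F\<close> shifted by one, with \<open>A\<close> at the bottom.
\<close>

lemma stable_chain_Cons:
  assumes A: "vec.subspace A" "\<And>h x. h \<in> H \<Longrightarrow> x \<in> A \<Longrightarrow> h *v x \<in> A"
    and F: "stable_chain H r F" "F 0 = vec.span (insert v A)"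
  shows "stable_chain H (Suc r) (\<lambda>i. case i of 0 \<Rightarrow> A | Suc j \<Rightarrow> F j)"
proof -
  have slow: "slow_chain r F" and st: "\<And>i h x. i \<le> r \<Longrightarrow> h \<in> H \<Longrightarrow> x \<in> F i \<Longrightarrow> h *v x \<in> F i"
    using F(1) unfolding stable_chain_def by auto
  have step: "\<exists>c. y - c *s x \<in> A" if x: "x \<in> F 0" "x \<notin> A" and y: "y \<in> F 0" for x y
  proof -
    obtain a k where ak: "a \<in> A" "x = a + k *s v" using x(1) F(2) A(1) span_insertE by blast
    obtain b m where bm: "b \<in> A" "y = b + m *s v" using y F(2) A(1) span_insertE by blast
    have "k \<noteq> 0" using ak x(2) by auto
    then have "y - (m / k) *s x = b - (m / k) *s a" by (simp add: ak(2) bm(2) vec.scale_right_distrib)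
    then have "y - (m / k) *s x \<in> A" using A(1) ak(1) bm(1) by (simp add: vec.subspace_diff vec.subspace_scale)
    then show ?thesis by blast
  qed
  have A0: "A \<subseteq> F 0" unfolding F(2) using vec.span_superset by blast
  show ?thesis
    unfolding stable_chain_def slow_chain_def
  proof (intro conjI allI impI ballI)
    fix i assume i: "i \<le> Suc r"
    show "vec.subspace (case i of 0 \<Rightarrow> A | Suc j \<Rightarrow> F j)"
      using A slow i unfolding slow_chain_def by (auto split: nat.split)
    fix h x assume "h \<in> H" "x \<in> (case i of 0 \<Rightarrow> A | Suc j \<Rightarrow> F j)"
    then show "h *v x \<in> (case i of 0 \<Rightarrow> A | Suc j \<Rightarrow> F j)"
      using A st i by (cases i) auto
  next
    fix i assume i: "i < Suc r"
    show "(case i of 0 \<Rightarrow> A | Suc j \<Rightarrow> F j) \<subseteq> (case Suc i of 0 \<Rightarrow> A | Suc j \<Rightarrow> F j)"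
      using A0 slow i unfolding slow_chain_def by (cases i) auto
    fix x y
    assume "x \<in> (case Suc i of 0 \<Rightarrow> A | Suc j \<Rightarrow> F j)" "y \<in> (case Suc i of 0 \<Rightarrow> A | Suc j \<Rightarrow> F j)"
      "x \<notin> (case i of 0 \<Rightarrow> A | Suc j \<Rightarrow> F j)"
    then show "\<exists>c. y - c *s x \<in> (case i of 0 \<Rightarrow> A | Suc j \<Rightarrow> F j)"
      using step slow i unfolding slow_chain_def by (cases i) auto
  qed
qed

locale solvable_connected =
  fixes H :: "(complex ^ 'n ^ 'n) set" and m :: nat
  assumes subgroup_GL: "subgroup H GL" and connected: "connectedin zariski H"
    and solvable: "(derived GL ^^ m) H = {mat 1}"
begin

lemma stable_extension:
  assumes A: "vec.subspace A" "\<And>h x. h \<in> H \<Longrightarrow> x \<in> A \<Longrightarrow> h *v x \<in> A"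
    and C: "vec.subspace C" "\<And>h x. h \<in> H \<Longrightarrow> x \<in> C \<Longrightarrow> h *v x \<in> C" and AC: "A \<subset> C"
  obtains v where "v \<in> C" "v \<notin> A" "\<And>h x. h \<in> H \<Longrightarrow> x \<in> vec.span (insert v A) \<Longrightarrow> h *v x \<in> vec.span (insert v A)"
    "vec.dim (vec.span (insert v A)) = Suc (vec.dim A)"
proof -
  obtain v where v: "v \<in> C" "v \<notin> A" "\<forall>h\<in>H. \<exists>c. h *v v - c *s v \<in> A"
    using lie_kolchin[OF subgroup_GL connected solvable A(1) C(1) AC A(2) C(2)] by blast
  show ?thesis
  proof (rule that[OF v(1,2)])
    fix h x assume h: "h \<in> H" and x: "x \<in> vec.span (insert v A)"
    obtain a k where ak: "a \<in> A" "x = a + k *s v" using x A(1) span_insertE by blast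
    obtain c where c: "h *v v - c *s v \<in> A" using v(3) h by blast
    have "h *v x = h *v a + k *s (h *v v - c *s v) + (k * c) *s v"
      by (simp add: ak(2) vec.add vec.scale vec.scale_right_diff_distrib)
    also have "\<dots> \<in> vec.span (insert v A)"
      using A(2)[OF h ak(1)] c by (intro vec.span_add vec.span_scale) (auto intro: vec.span_base)
    finally show "h *v x \<in> vec.span (insert v A)" .
  next
    show "vec.dim (vec.span (insert v A)) = Suc (vec.dim A)"
    proof -
      have "v \<notin> vec.span A" unfolding vec.span_eq_iff[THEN iffD2, OF A(1)] by (rule v(2))
      then show ?thesis by (simp add: vec.dim_insert)
    qed
  qed
qed

lemma ex_stable_chain:
  assumes "vec.subspace A" "\<And>h x. h \<in> H \<Longrightarrow> x \<in> A \<Longrightarrow> h *v x \<in> A"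
    and C: "vec.subspace C" "\<And>h x. h \<in> H \<Longrightarrow> x \<in> C \<Longrightarrow> h *v x \<in> C" and "A \<subseteq> C"
  shows "\<exists>r F. stable_chain H r F \<and> F 0 = A \<and> F r = C"
  using assms(1,2) \<open>A \<subseteq> C\<close>
proof (induction "vec.dim C - vec.dim A" arbitrary: A rule: less_induct)
  case less
  note A = less.prems(1,2)
  show ?case
  proof (cases "A = C")
    case True
    then show ?thesis
      using A by (intro exI[of _ 0] exI[of _ "\<lambda>_. A"]) (auto simp: stable_chain_def slow_chain_def)
  next
    case False
    then have "A \<subset> C" using less.prems(3) by blast
    then obtain v where v: "v \<in> C" "v \<notin> A"
      "\<And>h x. h \<in> H \<Longrightarrow> x \<in> vec.span (insert v A) \<Longrightarrow> h *v x \<in> vec.span (insert v A)"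
      "vec.dim (vec.span (insert v A)) = Suc (vec.dim A)"
      using stable_extension[OF A C] by blast
    have sub: "vec.span (insert v A) \<subseteq> C" using v(1) less.prems(3) C(1) by (intro vec.span_minimal) auto
    then have "vec.dim C - vec.dim (vec.span (insert v A)) < vec.dim C - vec.dim A"
      using vec.dim_subset[OF sub] v(4) by simp
    from less.hyps[OF this vec.subspace_span v(3) sub]
    obtain r F where F: "stable_chain H r F" "F 0 = vec.span (insert v A)" "F r = C" by blast
    then show ?thesis
      using stable_chain_Cons[OF A F(1,2)] by (intro exI[of _ "Suc r"]) auto
  qed
qed

end

text \<open>
  An isotropic stable subspace that is not its own orthogonal complement in \<open>U\<close> can be
  enlarged inside of this complement, which is stable too.
\<close>

lemma (in alternating) ex_stable_isotropic_chain:
  assumes "solvable_connected H m" and U: "vec.subspace U" "\<And>h x. h \<in> H \<Longrightarrow> x \<in> U \<Longrightarrow> h *v x \<in> U"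
    and iso: "\<And>h x y. h \<in> H \<Longrightarrow> \<beta> (h *v x) (h *v y) = \<beta> x y"
    and "vec.subspace A" "\<And>h x. h \<in> H \<Longrightarrow> x \<in> A \<Longrightarrow> h *v x \<in> A" "A \<subseteq> U" "\<And>x y. x \<in> A \<Longrightarrow> y \<in> A \<Longrightarrow> \<beta> x y = 0"
  shows "\<exists>r F. stable_chain H r F \<and> F 0 = A \<and> lagrangian_of U (F r)"
  using assms(5-8)
proof (induction "vec.dim U - vec.dim A" arbitrary: A rule: less_induct)
  case less
  interpret solvable_connected H m by (rule assms(1))
  interpret H: subgroup H GL by (rule subgroup_GL)
  note A = less.prems(1,2) and AU = less.prems(3) and A0 = less.prems(4)
  let ?P = "{x \<in> U. \<forall>y\<in>A. \<beta> x y = 0}"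
  have subP: "vec.subspace ?P" using U(1) by (rule subspace_perp)
  have stP: "h *v x \<in> ?P" if h: "h \<in> H" and x: "x \<in> ?P" for h x
  proof -
    have inv: "invertible h" using H.subset h by auto
    have hi: "matrix_inv h \<in> H" using H.m_inv_closed[OF h] inv_GL[OF inv] by simp
    have "\<beta> (h *v x) y = 0" if "y \<in> A" for y
    proof -
      have "h *v (matrix_inv h *v y) = y" using matrix_inv_mult(1)[OF inv] by (simp add: matrix_vector_mul_assoc)
      then have "\<beta> (h *v x) y = \<beta> x (matrix_inv h *v y)" using iso[OF h, of x "matrix_inv h *v y"] by simp
      then show ?thesis using x A(2)[OF hi that] by simp
    qed
    then show ?thesis using U(2) h x by blast
  qed
  show ?case
  proof (cases "A = ?P")
    case True
    then show ?thesis
      using A by (intro exI[of _ 0] exI[of _ "\<lambda>_. A"]) (auto simp: stable_chain_def slow_chain_def lagrangian_of_def)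
  next
    case False
    then have "A \<subset> ?P" using AU A0 by blast
    then obtain v where v: "v \<in> ?P" "v \<notin> A"
      "\<And>h x. h \<in> H \<Longrightarrow> x \<in> vec.span (insert v A) \<Longrightarrow> h *v x \<in> vec.span (insert v A)"
      "vec.dim (vec.span (insert v A)) = Suc (vec.dim A)"
      using stable_extension[OF A subP stP] by blast
    have sub: "vec.span (insert v A) \<subseteq> U" using v(1) AU U(1) by (intro vec.span_minimal) auto
    have d: "vec.dim U - vec.dim (vec.span (insert v A)) < vec.dim U - vec.dim A"
      using vec.dim_subset[OF sub] v(4) by simp
    have "\<beta> x y = 0" if xy: "x \<in> vec.span (insert v A)" "y \<in> vec.span (insert v A)" for x y
    proof -
      obtain a k where ak: "a \<in> A" "x = a + k *s v" using xy(1) A(1) span_insertE by blast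
      obtain b l where bl: "b \<in> A" "y = b + l *s v" using xy(2) A(1) span_insertE by blast
      have "\<beta> v b = 0" "\<beta> a v = 0" using v(1) ak(1) bl(1) skew[of a v] by auto
      then show ?thesis using A0[OF ak(1) bl(1)] by (simp add: ak(2) bl(2))
    qed
    from less.hyps[OF d vec.subspace_span v(3) sub this]
    obtain r F where F: "stable_chain H r F" "F 0 = vec.span (insert v A)" "lagrangian_of U (F r)" by blast
    then show ?thesis
      using stable_chain_Cons[OF A F(1,2)] by (intro exI[of _ "Suc r"]) auto
  qed
qed

section \<open>Stabilizers of complete flags are solvable\<close>

text \<open>
  An injective map of a finite-dimensional space into itself is onto.
\<close>

lemma stable_inverse:
  fixes g :: "complex ^ 'n ^ 'n"
  assumes S: "vec.subspace S" and g: "invertible g" "\<And>x. x \<in> S \<Longrightarrow> g *v x \<in> S" and x: "x \<in> S"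
  shows "matrix_inv g *v x \<in> S"
proof -
  have inj: "inj_on ((*v) g) (vec.span S)"
  proof (rule inj_onI)
    fix x y assume "g *v x = g *v y"
    then have "matrix_inv g *v (g *v x) = matrix_inv g *v (g *v y)" by simp
    then show "x = y" by (simp add: matrix_vector_mul_assoc matrix_inv_mult(2)[OF g(1)])
  qed
  have d: "vec.dim ((*v) g ` S) = vec.dim S"
    by (rule vec.dim_image_eq[OF matrix_vector_mul_linear_gen inj])
  have "(*v) g ` S = S"
    using g(2) S d by (intro vec.subspace_dim_equal vec.subspace_image) auto
  then obtain y where "y \<in> S" "x = g *v y" using x by blast
  then show ?thesis by (simp add: matrix_vector_mul_assoc matrix_inv_mult(2)[OF g(1)])
qed

text \<open>
  The stabilizer of the flag \<open>E\<close>, for \<open>k = 0\<close>, and its subgroup of elements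
  that induce the identity on \<open>E i / E (i - k)\<close> for all \<open>i\<close>. For \<open>i
  \<le> k\<close> the truncated subtraction gives \<open>E 0\<close>, so that elements of level
  \<open>N\<close> are the identity on \<open>E N\<close> if \<open>E 0 = {0}\<close>.
\<close>

definition flag_level :: "nat \<Rightarrow> (nat \<Rightarrow> (complex ^ 'n) set) \<Rightarrow> nat \<Rightarrow> (complex ^ 'n ^ 'n) set" where
  "flag_level N E k = {g. invertible g \<and> (\<forall>i\<le>N. \<forall>x\<in>E i. g *v x \<in> E i) \<and> (\<forall>i\<le>N. \<forall>x\<in>E i. g *v x - x \<in> E (i - k))}"

lemma subgroup_flag_level:
  assumes E: "slow_chain N E"
  shows "subgroup (flag_level N E k) GL"
proof (rule GL.subgroupI)
  have sub: "vec.subspace (E i)" if "i \<le> N" for i using E that unfolding slow_chain_def by blast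
  have "0 \<in> E (i - k)" if "i \<le> N" for i using vec.subspace_0[OF sub[of "i - k"]] that by simp
  then have "mat 1 \<in> flag_level N E k"
    unfolding flag_level_def using invertible_mat_1 by auto
  then show "flag_level N E k \<noteq> {}" by blast
  show "flag_level N E k \<subseteq> carrier GL" by (auto simp: flag_level_def)
  fix g assume g: "g \<in> flag_level N E k"
  then have gi: "invertible g" by (simp add: flag_level_def)
  have inv: "matrix_inv g *v x \<in> E i" if "i \<le> N" "x \<in> E i" for i x
    using g that by (intro stable_inverse[OF sub[OF that(1)] gi]) (auto simp: flag_level_def)
  have "matrix_inv g *v x - x \<in> E (i - k)" if "i \<le> N" "x \<in> E i" for i x
  proof -
    have le: "i - k \<le> N" using that(1) by simp
    have "g *v x - x \<in> E (i - k)" using g that unfolding flag_level_def by blast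
    from inv[OF le this] have "matrix_inv g *v (g *v x) - matrix_inv g *v x \<in> E (i - k)" by (simp only: vec.diff)
    then have "x - matrix_inv g *v x \<in> E (i - k)"
      by (simp only: matrix_vector_mul_assoc matrix_inv_mult(2)[OF gi] matrix_vector_mul_lid)
    from vec.subspace_neg[OF sub[OF le] this] show ?thesis by simp
  qed
  then show "inv\<^bsub>GL\<^esub> g \<in> flag_level N E k"
    using inv matrix_inv_mult(3)[OF gi] by (simp add: inv_GL[OF gi] flag_level_def)
  fix h assume h: "h \<in> flag_level N E k"
  have hi: "invertible h" using h by (simp add: flag_level_def)
  have gst: "g *v x \<in> E i" if "i \<le> N" "x \<in> E i" for i x using g that unfolding flag_level_def by blast
  have hst: "h *v x \<in> E i" if "i \<le> N" "x \<in> E i" for i x using h that unfolding flag_level_def by blast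
  have "g *v (h *v x) - x \<in> E (i - k)" if ix: "i \<le> N" "x \<in> E i" for i x
  proof -
    have "g *v (h *v x) - h *v x \<in> E (i - k)" using g hst[OF ix] ix(1) unfolding flag_level_def by blast
    moreover have "h *v x - x \<in> E (i - k)" using h ix unfolding flag_level_def by blast
    ultimately have "(g *v (h *v x) - h *v x) + (h *v x - x) \<in> E (i - k)"
      using ix(1) by (intro vec.subspace_add[OF sub]) auto
    then show ?thesis by simp
  qed
  then show "g \<otimes>\<^bsub>GL\<^esub> h \<in> flag_level N E k"
    using gst hst gi hi by (simp add: flag_level_def invertible_mult matrix_vector_mul_assoc[symmetric])
qed

text \<open>
  For \<open>k = 0\<close> the two maps commute on \<open>E i / E (i - 1)\<close>, where they act by
  scalars. For larger \<open>k\<close> the commutator of \<open>g\<close> and \<open>h\<close> is that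
  of \<open>g - 1\<close> and \<open>h - 1\<close>, which lower the index by \<open>2 k \<ge> k +
  1\<close>.
\<close>

lemma flag_level_commutator:
  assumes E: "slow_chain N E" and g: "g \<in> flag_level N E k" and h: "h \<in> flag_level N E k" and E0: "E 0 = {0}"
    and x: "i \<le> N" "x \<in> E i"
  shows "g *v (h *v x) - h *v (g *v x) \<in> E (i - Suc k)"
proof -
  have sub: "vec.subspace (E i)" if "i \<le> N" for i using E that unfolding slow_chain_def by blast
  have gst: "g *v x \<in> E i" if "i \<le> N" "x \<in> E i" for i x using g that unfolding flag_level_def by blast
  have hst: "h *v x \<in> E i" if "i \<le> N" "x \<in> E i" for i x using h that unfolding flag_level_def by blast
  have gl: "g *v x - x \<in> E (i - k)" if "i \<le> N" "x \<in> E i" for i x using g that unfolding flag_level_def by blast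
  have hl: "h *v x - x \<in> E (i - k)" if "i \<le> N" "x \<in> E i" for i x using h that unfolding flag_level_def by blast
  show ?thesis
  proof (cases k)
    case 0
    show ?thesis
    proof (cases "i = 0")
      case True
      then show ?thesis using x E0 by simp
    next
      case False
      then have i: "1 \<le> i" "i - 1 \<le> N" using x(1) by auto
      have subj: "vec.subspace (E (i - 1))" using sub i by blast
      have "g *v (h *v x) - h *v (g *v x) \<in> E (i - 1)"
      proof (cases "x \<in> E (i - 1)")
        case True
        then show ?thesis using gst hst i(2) by (intro vec.subspace_diff[OF subj]) auto
      next
        case False
        obtain c where c: "g *v x - c *s x \<in> E (i - 1)"
          using slow_chain_step[OF E i(1) x(1,2) False gst[OF x]] by blast
        obtain d where d: "h *v x - d *s x \<in> E (i - 1)"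
          using slow_chain_step[OF E i(1) x(1,2) False hst[OF x]] by blast
        have "g *v (h *v x) - h *v (g *v x) = g *v (h *v x - d *s x) + d *s (g *v x - c *s x)
          - h *v (g *v x - c *s x) - c *s (h *v x - d *s x)"
          by (simp add: vec.diff vec.scale vec.scale_right_diff_distrib mult.commute)
        also have "\<dots> \<in> E (i - 1)"
          by (rule vec.subspace_diff[OF subj vec.subspace_diff[OF subj vec.subspace_add[OF subj
                gst[OF i(2) d] vec.subspace_scale[OF subj c]] hst[OF i(2) c]] vec.subspace_scale[OF subj d]])
        finally show ?thesis .
      qed
      then show ?thesis using 0 by simp
    qed
  next
    case (Suc k')
    let ?a = "g *v x - x" and ?b = "h *v x - x"
    have le: "i - k \<le> N" "i - Suc k \<le> N" using x(1) by auto
    have "g *v ?b - ?b \<in> E (i - k - k)" "h *v ?a - ?a \<in> E (i - k - k)"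
      using gl[OF le(1) hl[OF x]] hl[OF le(1) gl[OF x]] .
    moreover have "E (i - k - k) \<subseteq> E (i - Suc k)" using Suc x(1) by (intro slow_chain_mono[OF E]) auto
    ultimately have "g *v ?b - ?b \<in> E (i - Suc k)" "h *v ?a - ?a \<in> E (i - Suc k)" by blast+
    from vec.subspace_diff[OF sub[OF le(2)] this]
    have "(g *v ?b - ?b) - (h *v ?a - ?a) \<in> E (i - Suc k)" .
    moreover have "(g *v ?b - ?b) - (h *v ?a - ?a) = g *v (h *v x) - h *v (g *v x)"
      by (simp add: vec.diff)
    ultimately show ?thesis by simp
  qed
qed

lemma derived_flag_level:
  assumes E: "slow_chain N E" "E 0 = {0}"
  shows "derived GL (flag_level N E k) \<subseteq> flag_level N E (Suc k)"
  unfolding derived_def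
proof (rule GL.generate_subgroup_incl[OF _ subgroup_flag_level[OF E(1)]])
  have sub: "vec.subspace (E i)" if "i \<le> N" for i using E that unfolding slow_chain_def by blast
  interpret S: subgroup "flag_level N E k" GL using E(1) by (rule subgroup_flag_level)
  show "derived_set GL (flag_level N E k) \<subseteq> flag_level N E (Suc k)"
  proof
    fix c assume "c \<in> derived_set GL (flag_level N E k)"
    then obtain g h where gh: "g \<in> flag_level N E k" "h \<in> flag_level N E k"
      "c = g \<otimes>\<^bsub>GL\<^esub> h \<otimes>\<^bsub>GL\<^esub> inv\<^bsub>GL\<^esub> g \<otimes>\<^bsub>GL\<^esub> inv\<^bsub>GL\<^esub> h" by blast
    have cS: "c \<in> flag_level N E k" unfolding gh(3) using gh(1,2) by (intro S.m_closed S.m_inv_closed)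
    have inv: "invertible g" "invertible h" using gh(1,2) by (auto simp: flag_level_def)
    have c: "c = g ** h ** matrix_inv g ** matrix_inv h" unfolding gh(3) by (simp add: inv_GL inv)
    have "c *v x - x \<in> E (i - Suc k)" if "i \<le> N" "x \<in> E i" for i x
    proof -
      let ?y = "matrix_inv g *v (matrix_inv h *v x)"
      have "?y \<in> E i"
        using gh(1,2) that by (intro stable_inverse[OF sub[OF that(1)]] inv) (auto simp: flag_level_def)
      from flag_level_commutator[OF E(1) gh(1,2) E(2) that(1) this]
      have "g *v (h *v ?y) - h *v (g *v ?y) \<in> E (i - Suc k)" .
      moreover have "g *v (h *v ?y) = c *v x" unfolding c by (simp add: matrix_vector_mul_assoc matrix_mul_assoc)
      moreover have "h *v (g *v ?y) = x"
      proof -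
        have "h *v (g *v ?y) = h *v ((g ** matrix_inv g) *v (matrix_inv h *v x))" by (simp only: matrix_vector_mul_assoc matrix_mul_assoc)
        also have "\<dots> = (h ** matrix_inv h) *v x"
          unfolding matrix_inv_mult(1)[OF inv(1)] matrix_vector_mul_lid by (rule matrix_vector_mul_assoc)
        also have "\<dots> = x" unfolding matrix_inv_mult(1)[OF inv(2)] by (rule matrix_vector_mul_lid)
        finally show ?thesis .
      qed
      ultimately show ?thesis by simp
    qed
    then show "c \<in> flag_level N E (Suc k)" using cS unfolding flag_level_def by blast
  qed
qed

lemma flag_stabilizer_solvable:
  fixes T :: "(complex ^ 'n ^ 'n) set"
  assumes E: "slow_chain N E" "E 0 = {0}" "E N = UNIV" and T: "subgroup T GL"
    and st: "\<And>g i x. g \<in> T \<Longrightarrow> i \<le> N \<Longrightarrow> x \<in> E i \<Longrightarrow> g *v x \<in> E i"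
  shows "\<exists>n. (derived GL ^^ n) T = {mat 1}"
proof -
  interpret T: subgroup T GL by (rule T)
  have sub: "vec.subspace (E i)" if "i \<le> N" for i using E that unfolding slow_chain_def by blast
  have "(derived GL ^^ k) T \<subseteq> flag_level N E k" for k
  proof (induction k)
    case 0
    show ?case using T.subset st sub by (auto simp: flag_level_def intro: vec.subspace_diff)
  next
    case (Suc k)
    have "(derived GL ^^ Suc k) T \<subseteq> derived GL (flag_level N E k)"
      using GL.mono_derived[OF Suc] by simp
    then show ?case using derived_flag_level[OF E(1,2), of k] by blast
  qed
  then have "(derived GL ^^ N) T \<subseteq> flag_level N E N" .
  also have "flag_level N E N \<subseteq> {mat 1}"
  proof
    fix g assume "g \<in> flag_level N E N"
    then have "g *v x - x \<in> E (N - N)" for x using E(3) unfolding flag_level_def by blast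
    then have "g *v x = mat 1 *v x" for x using E(2) by simp
    then show "g \<in> {mat 1}" by (simp add: matrix_eq)
  qed
  finally have "(derived GL ^^ N) T \<subseteq> {mat 1}" .
  moreover have "mat 1 \<in> (derived GL ^^ N) T"
    using subgroup.one_closed[OF GL.exp_of_derived_is_subgroup[OF T]] by (simp only: GL_simps)
  ultimately show ?thesis by blast
qed

section \<open>Stabilizers of complete flags are connected\<close>

context alternating
begin

text \<open>
  The stabilizers of all members of a family in the symplectic group. Mapping each member into itself
  suffices by \<open>stable_inverse\<close>.
\<close>

definition isometries :: "(complex ^ 'd) set set \<Rightarrow> (complex ^ 'd ^ 'd) set" where
  "isometries \<Y> = {A. invertible A \<and> (\<forall>x y. \<beta> (A *v x) (A *v y) = \<beta> x y) \<and> (\<forall>Y\<in>\<Y>. \<forall>y\<in>Y. A *v y \<in> Y)}"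

text \<open>
  Connected sets replace paths here, as their union along a common point needs no reparametrization.
\<close>

definition joined_to_one :: "(complex ^ 'd) set set \<Rightarrow> complex ^ 'd ^ 'd \<Rightarrow> bool" where
  "joined_to_one \<Y> g \<longleftrightarrow> (\<exists>S. connectedin zariski S \<and> S \<subseteq> isometries \<Y> \<and> mat 1 \<in> S \<and> g \<in> S)"

lemma isometry_in_isometries:
  assumes nd: "nondegenerate_on \<beta> UNIV" and lin: "Vector_Spaces.linear (*s) (*s) L"
    and iso: "\<And>x y. \<beta> (L x) (L y) = \<beta> x y" and Y: "\<And>Y y. Y \<in> \<Y> \<Longrightarrow> y \<in> Y \<Longrightarrow> L y \<in> Y"
  shows "matrix L \<in> isometries \<Y>"
proof -
  have L: "matrix L *v x = L x" for x by (rule matrix_works[OF lin])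
  interpret l: Vector_Spaces.linear "(*s)" "(*s)" L by (rule lin)
  have "inj ((*v) (matrix L))"
  proof (rule injI)
    fix x y assume "matrix L *v x = matrix L *v y"
    then have "L (x - y) = 0" by (simp add: L l.diff)
    then have "\<beta> (x - y) z = 0" for z using iso[of "x - y" z] by simp
    then have "x - y = 0" using nd unfolding nondegenerate_on_def by blast
    then show "x = y" by simp
  qed
  then have "invertible (matrix L)"
    by (simp add: invertible_left_inverse matrix_left_invertible_injective)
  then show ?thesis unfolding isometries_def using iso Y by (simp add: L)
qed

lemma joined_to_one_path:
  assumes g: "joined_to_one \<Y> (M 0)" and M: "continuous_on {0..1::real} M" "\<And>t. t \<in> {0..1} \<Longrightarrow> M t \<in> isometries \<Y>"
  shows "joined_to_one \<Y> (M 1)"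
proof -
  obtain S where S: "connectedin zariski S" "S \<subseteq> isometries \<Y>" "mat 1 \<in> S" "M 0 \<in> S"
    using g unfolding joined_to_one_def by blast
  have "connected (M ` {0..1})" using M(1) by (intro connected_continuous_image) auto
  then have C: "connectedin zariski (M ` {0..1})" by (rule connectedin_zariski_of_connected)
  have ends: "M 0 \<in> M ` {0..1}" "M 1 \<in> M ` {0..1}" by auto
  have "S \<inter> M ` {0..1} \<noteq> {}" using S(4) ends by blast
  then have "connectedin zariski (S \<union> M ` {0..1})" by (rule connectedin_Un[OF S(1) C])
  moreover have "M ` {0..1} \<subseteq> isometries \<Y>" using M(2) by blast
  ultimately show ?thesis unfolding joined_to_one_def using S ends by (intro exI[of _ "S \<union> M ` {0..1}"]) blast
qed

text \<open>
  Let \<open>g\<close> scale \<open>e\<close> by \<open>\<tau>\<close>. With respect to the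
  decomposition into \<open>e\<close>, its partner \<open>f\<close> and the orthogonal complement of
  both, \<open>g\<close> consists of a Levi part, given by \<open>\<tau>\<close> and an isometry
  \<open>X\<close> of the complement, and of a unipotent part, given by \<open>\<alpha>\<close>,
  \<open>R\<close> and \<open>c0\<close>. Scaling the unipotent part by \<open>t\<close>, and its
  central entry by \<open>t\<^sup>2\<close>, leads from \<open>g\<close> to the Levi part, and then
  \<open>\<tau>\<close> can be moved to 1. What is left fixes \<open>e\<close> and \<open>f\<close>.
  The paths stay inside of the stabilizer because the plane of \<open>e\<close> and \<open>f\<close>
  is adapted to all members of the family.
\<close>

lemma joined_to_one_torus_step:
  assumes nd: "nondegenerate_on \<beta> UNIV" and sub: "\<And>Y. Y \<in> \<Y> \<Longrightarrow> vec.subspace Y"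
    and ef: "\<beta> e f = 1" and split: "\<And>Y y. Y \<in> \<Y> \<Longrightarrow> y \<in> Y \<Longrightarrow> (\<beta> y f = 0 \<or> e \<in> Y) \<and> (\<beta> e y = 0 \<or> f \<in> Y)"
    and g: "g \<in> isometries \<Y>" and ge: "g *v e = \<tau> *s e"
  obtains g1 where "g1 \<in> isometries \<Y>" "joined_to_one \<Y> g1 \<Longrightarrow> joined_to_one \<Y> g" "g1 *v e = e" "g1 *v f = f"
    "\<And>z. g *v z = z \<Longrightarrow> \<beta> e z = 0 \<Longrightarrow> \<beta> z f = 0 \<Longrightarrow> g1 *v z = z"
proof -
  have iso: "\<beta> (g *v x) (g *v y) = \<beta> x y" for x y using g by (simp add: isometries_def)
  have gY: "g *v y \<in> Y" if "Y \<in> \<Y>" "y \<in> Y" for Y y using g that unfolding isometries_def by blast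
  have \<tau>: "\<tau> \<noteq> 0" using iso[of e f] ef by (auto simp: ge)
  define \<rho> where "\<rho> x = x - \<beta> x f *s e - \<beta> e x *s f" for x
  have \<rho>_add: "\<rho> (x + y) = \<rho> x + \<rho> y" and \<rho>_scale: "\<rho> (c *s x) = c *s \<rho> x" for x y c
    by (simp_all add: \<rho>_def vec.scale_left_distrib vec.scale_right_distrib vec.scale_right_diff_distrib)
  have \<rho>_dec: "x = \<rho> x + \<beta> x f *s e + \<beta> e x *s f" for x by (simp add: \<rho>_def)
  have fe: "\<beta> f e = -1" using ef skew[of f e] by simp
  have \<rho>_orth: "\<beta> e (\<rho> x) = 0" "\<beta> (\<rho> x) f = 0" "\<beta> (\<rho> x) e = 0" "\<beta> f (\<rho> x) = 0" for x
    using ef fe skew[of x e] skew[of f x] by (simp_all add: \<rho>_def)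
  have split_\<beta>: "\<beta> x y = \<beta> x f * \<beta> e y - \<beta> e x * \<beta> y f + \<beta> (\<rho> x) (\<rho> y)" for x y
  proof -
    have "\<beta> x y = \<beta> (\<rho> x + \<beta> x f *s e + \<beta> e x *s f) (\<rho> y + \<beta> y f *s e + \<beta> e y *s f)"
      by (simp only: \<rho>_dec[of x, symmetric] \<rho>_dec[of y, symmetric])
    then show ?thesis using ef fe \<rho>_orth[of x] \<rho>_orth[of y] by simp
  qed
  have ge': "\<beta> e (g *v x) = \<beta> e x / \<tau>" for x using iso[of e x] \<tau> by (simp add: ge field_simps)
  define X where "X x = \<rho> (g *v \<rho> x)" for x
  define \<alpha> where "\<alpha> x = \<beta> (g *v \<rho> x) f" for x
  define R where "R = \<rho> (g *v f)"
  define c0 where "c0 = \<beta> (g *v f) f"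
  have g\<rho>: "g *v \<rho> x = X x + \<alpha> x *s e" for x
  proof -
    have "g *v \<rho> x = \<rho> (g *v \<rho> x) + \<beta> (g *v \<rho> x) f *s e + \<beta> e (g *v \<rho> x) *s f" by (rule \<rho>_dec)
    also have "\<dots> = X x + \<alpha> x *s e" unfolding ge' by (simp add: X_def \<alpha>_def \<rho>_orth)
    finally show ?thesis .
  qed
  have gf: "g *v f = R + c0 *s e + (1 / \<tau>) *s f"
  proof -
    have "g *v f = \<rho> (g *v f) + \<beta> (g *v f) f *s e + \<beta> e (g *v f) *s f" by (rule \<rho>_dec)
    also have "\<dots> = R + c0 *s e + (1 / \<tau>) *s f" unfolding ge' by (simp add: R_def c0_def ef)
    finally show ?thesis .
  qed
  have o: "\<beta> e (X x) = 0" "\<beta> (X x) f = 0" "\<beta> (X x) e = 0" "\<beta> f (X x) = 0"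
    "\<beta> e R = 0" "\<beta> R f = 0" "\<beta> R e = 0" "\<beta> f R = 0" for x
    unfolding X_def R_def by (rule \<rho>_orth)+
  have XX: "\<beta> (X x) (X y) = \<beta> (\<rho> x) (\<rho> y)" for x y
    using iso[of "\<rho> x" "\<rho> y"] by (simp add: g\<rho> o)
  have XR: "\<beta> (X x) R = - \<alpha> x / \<tau>" for x
  proof -
    have "\<beta> (X x) R + \<alpha> x / \<tau> = \<beta> (g *v \<rho> x) (g *v f)" using ef by (simp add: g\<rho> gf o)
    also have "\<dots> = 0" unfolding iso by (rule \<rho>_orth)
    finally show ?thesis by (simp add: add_eq_0_iff)
  qed
  have RX: "\<beta> R (X x) = \<alpha> x / \<tau>" for x using XR[of x] skew[of R "X x"] by simp
  have linX: "X (x + y) = X x + X y" "X (c *s x) = c *s X x" "\<alpha> (x + y) = \<alpha> x + \<alpha> y" "\<alpha> (c *s x) = c * \<alpha> x" for x y c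
    by (simp_all add: X_def \<alpha>_def \<rho>_add \<rho>_scale vec.add vec.scale)
  \<comment> \<open>The path: \<open>G \<tau> 1\<close> is \<open>g\<close>, \<open>G \<tau> 0\<close> is its Levi
    part, and \<open>G 1 0\<close> fixes \<open>e\<close> and \<open>f\<close>. It is an isometry
    for \<open>c = \<tau>\<close> or \<open>t = 0\<close>.\<close>
  define G where "G c t x = X x + (\<beta> x f * c + t * \<alpha> x + t * t * \<beta> e x * c0) *s e + (t * \<beta> e x) *s R + (\<beta> e x / c) *s f"
    for c t :: complex and x
  have linG: "Vector_Spaces.linear (*s) (*s) (G c t)" for c t
    unfolding G_def by (intro linear_vecI)
      (simp_all add: linX vec.scale_left_distrib vec.scale_right_distrib algebra_simps add_divide_distrib)
  have isoG: "\<beta> (G c t x) (G c t y) = \<beta> x y" if "c \<noteq> 0" "t = 0 \<or> c = \<tau>" for c t x y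
  proof -
    have "\<beta> (G c t x) (G c t y) = \<beta> (X x) (X y) + t * \<beta> e y * \<beta> (X x) R + t * \<beta> e x * \<beta> R (X y)
      + (\<beta> x f * c + t * \<alpha> x + t * t * \<beta> e x * c0) * (\<beta> e y / c) - (\<beta> e x / c) * (\<beta> y f * c + t * \<alpha> y + t * t * \<beta> e y * c0)"
      unfolding G_def using ef fe o by (simp add: algebra_simps)
    also have "\<dots> = \<beta> x f * \<beta> e y - \<beta> e x * \<beta> y f + \<beta> (\<rho> x) (\<rho> y)"
      using that \<tau> unfolding XX XR RX by (auto simp: field_simps)
    finally show ?thesis using split_\<beta>[of x y] by simp
  qed
  have GY: "G c t y \<in> Y" if Y: "Y \<in> \<Y>" "y \<in> Y" for c t Y y
  proof -
    note s = sub[OF Y(1)]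
    have terms: "\<beta> z f *s e \<in> Y" "\<beta> e z *s f \<in> Y" if "z \<in> Y" for z
      using split[OF Y(1) that] s vec.subspace_0[OF s] by (auto intro: vec.subspace_scale)
    have \<rho>Y: "\<rho> z \<in> Y" if "z \<in> Y" for z
      unfolding \<rho>_def using that terms[OF that] by (intro vec.subspace_diff[OF s])
    have g\<rho>Y: "g *v \<rho> y \<in> Y" by (rule gY[OF Y(1) \<rho>Y[OF Y(2)]])
    have 1: "X y \<in> Y" "\<alpha> y *s e \<in> Y" unfolding X_def \<alpha>_def using \<rho>Y[OF g\<rho>Y] terms(1)[OF g\<rho>Y] .
    have 2: "\<beta> e y *s R \<in> Y \<and> (\<beta> e y * c0) *s e \<in> Y"
    proof (cases "\<beta> e y = 0")
      case True
      then show ?thesis using vec.subspace_0[OF s] by simp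
    next
      case False
      then have "f \<in> Y" using split[OF Y] by blast
      then have gfY: "g *v f \<in> Y" by (rule gY[OF Y(1)])
      have "\<beta> e y *s (c0 *s e) \<in> Y" unfolding c0_def by (intro vec.subspace_scale[OF s] terms(1)[OF gfY])
      moreover have "\<beta> e y *s R \<in> Y" unfolding R_def by (intro vec.subspace_scale[OF s] \<rho>Y[OF gfY])
      ultimately show ?thesis by simp
    qed
    have "G c t y = X y + c *s (\<beta> y f *s e) + t *s (\<alpha> y *s e) + (t * t) *s ((\<beta> e y * c0) *s e)
      + t *s (\<beta> e y *s R) + (1 / c) *s (\<beta> e y *s f)"
      by (simp add: G_def vec.scale_left_distrib algebra_simps)
    also have "\<dots> \<in> Y"
      by (rule vec.subspace_add[OF s vec.subspace_add[OF s vec.subspace_add[OF s vec.subspace_add[OF s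
              vec.subspace_add[OF s 1(1) vec.subspace_scale[OF s terms(1)[OF Y(2)]]] vec.subspace_scale[OF s 1(2)]]
              vec.subspace_scale[OF s 2[THEN conjunct2]]] vec.subspace_scale[OF s 2[THEN conjunct1]]]
            vec.subspace_scale[OF s terms(2)[OF Y(2)]]])
    finally show ?thesis .
  qed
  have mem: "matrix (G c t) \<in> isometries \<Y>" if "c \<noteq> 0" "t = 0 \<or> c = \<tau>" for c t
    using nd linG isoG[OF that] GY by (rule isometry_in_isometries)
  \<comment> \<open>A path from 1 to \<open>\<tau>\<close> that avoids 0.\<close>
  let ?c = "\<lambda>s::real. exp (of_real s * Ln \<tau>)"
  have cont1: "continuous_on {0..1} (\<lambda>s. matrix (G (?c s) 0))"
    unfolding matrix_def G_def
    by (intro continuous_on_vec_lambda) (simp, intro continuous_intros, auto)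
  have cont2: "continuous_on {0..1} (\<lambda>t::real. matrix (G \<tau> (of_real t)))"
    unfolding matrix_def G_def
    by (intro continuous_on_vec_lambda) (simp, intro continuous_intros)
  have G1: "matrix (G \<tau> 1) = g"
  proof -
    have "G \<tau> 1 x = g *v x" for x
    proof -
      have "g *v x = g *v (\<rho> x) + \<beta> x f *s (g *v e) + \<beta> e x *s (g *v f)"
      proof -
        have "g *v x = g *v (\<rho> x + \<beta> x f *s e + \<beta> e x *s f)" by (simp only: \<rho>_dec[of x, symmetric])
        then show ?thesis by (simp only: vec.add vec.scale)
      qed
      also have "\<dots> = G \<tau> 1 x"
        unfolding g\<rho> gf ge by (simp add: G_def vec.scale_left_distrib vec.scale_right_distrib algebra_simps)
      finally show ?thesis by simp
    qed
    then show ?thesis by (simp add: matrix_eq matrix_works[OF linG])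
  qed
  show ?thesis
  proof (rule that)
    show "matrix (G 1 0) \<in> isometries \<Y>" by (rule mem) auto
    show "joined_to_one \<Y> g" if "joined_to_one \<Y> (matrix (G 1 0))"
    proof -
      have "joined_to_one \<Y> (matrix (G (?c 1) 0))"
        by (rule joined_to_one_path[OF _ cont1]) (use that mem in auto)
      then have "joined_to_one \<Y> (matrix (G \<tau> (of_real 0)))" using \<tau> by simp
      then have "joined_to_one \<Y> (matrix (G \<tau> (of_real 1)))"
        by (rule joined_to_one_path[OF _ cont2]) (use mem \<tau> in auto)
      then show ?thesis using G1 by simp
    qed
    have \<rho>e: "\<rho> e = 0" "\<rho> f = 0" using ef by (simp_all add: \<rho>_def)
    have X0: "X e = 0" "X f = 0" by (simp_all add: X_def \<rho>e) (simp_all add: \<rho>_def)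
    show "matrix (G 1 0) *v e = e" "matrix (G 1 0) *v f = f"
      unfolding matrix_works[OF linG] G_def using X0 ef by simp_all
    fix z assume z: "g *v z = z" "\<beta> e z = 0" "\<beta> z f = 0"
    then have "\<rho> z = z" by (simp add: \<rho>_def)
    then have "X z = z" using z by (simp add: X_def)
    then show "matrix (G 1 0) *v z = z" unfolding matrix_works[OF linG] G_def using z by simp
  qed
qed

text \<open>
  Induction on the part \<open>V\<close> of the space outside of which \<open>g\<close> is the
  identity. The predicate \<open>\<G>\<close> stands for the structure that is inherited by orthogonal
  complements and supplies the next adapted pair, whose first vector must be an eigenvector of every
  \<open>g\<close> in question.
\<close>

lemma joined_to_one_by_peeling:
  assumes nd: "nondegenerate_on \<beta> UNIV" and sub: "\<And>Y. Y \<in> \<Y> \<Longrightarrow> vec.subspace Y"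
    and \<G>_sub: "\<And>V. \<G> V \<Longrightarrow> vec.subspace V"
    and step: "\<And>V. \<G> V \<Longrightarrow> V \<noteq> {0} \<Longrightarrow> \<exists>e f. e \<in> V \<and> f \<in> V \<and> \<beta> e f = 1 \<and>
      (\<forall>Y\<in>\<Y>. \<forall>y\<in>Y. (\<beta> y f = 0 \<or> e \<in> Y) \<and> (\<beta> e y = 0 \<or> f \<in> Y)) \<and>
      (\<forall>g\<in>isometries \<Y>. (\<forall>x\<in>V. g *v x \<in> V) \<longrightarrow> (\<exists>\<tau>. g *v e = \<tau> *s e)) \<and>
      \<G> (orth_rest V (\<lambda>x. \<beta> x f *s e + \<beta> e x *s f))"
    and "\<G> V" "g \<in> isometries \<Y>" "\<And>z. (\<forall>v\<in>V. \<beta> v z = 0) \<Longrightarrow> g *v z = z"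
  shows "joined_to_one \<Y> g"
  using assms(5-7)
proof (induction "vec.dim V" arbitrary: V g rule: less_induct)
  case less
  note V = \<G>_sub[OF less.prems(1)] and g = less.prems(2) and fixed = less.prems(3)
  have iso: "\<beta> (g *v x) (g *v y) = \<beta> x y" for x y using g by (simp add: isometries_def)
  show ?case
  proof (cases "V = {0}")
    case True
    then have "g *v z = mat 1 *v z" for z using fixed[of z] by simp
    then have "g = mat 1" by (simp add: matrix_eq)
    then show ?thesis
      unfolding joined_to_one_def using g by (intro exI[of _ "{mat 1}"]) auto
  next
    case False
    from step[OF less.prems(1) False] obtain e f where ef: "e \<in> V" "f \<in> V" "\<beta> e f = 1"
      and split: "\<forall>Y\<in>\<Y>. \<forall>y\<in>Y. (\<beta> y f = 0 \<or> e \<in> Y) \<and> (\<beta> e y = 0 \<or> f \<in> Y)"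
      and eig: "\<forall>g\<in>isometries \<Y>. (\<forall>x\<in>V. g *v x \<in> V) \<longrightarrow> (\<exists>\<tau>. g *v e = \<tau> *s e)"
      and rest: "\<G> (orth_rest V (\<lambda>x. \<beta> x f *s e + \<beta> e x *s f))" by (elim exE conjE)
    \<comment> \<open>As \<open>g\<close> is the identity on the complement of \<open>V\<close>, it preserves
      \<open>V\<close>.\<close>
    have "g *v x \<in> V" if x: "x \<in> V" for x
    proof (rule ccontr)
      assume nV: "g *v x \<notin> V"
      obtain p where p: "p \<in> UNIV" "\<beta> (g *v x) p = 1" "\<And>s. s \<in> V \<Longrightarrow> \<beta> s p = 0"
        by (rule separating_vector[OF V vec.subspace_UNIV subset_UNIV nd UNIV_I nV]) (rule that)
      then have "g *v p = p" using fixed by blast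
      then have "\<beta> x p = 1" using p(2) iso[of x p] by simp
      then show False using p(3)[OF x] by simp
    qed
    then obtain \<tau> where \<tau>: "g *v e = \<tau> *s e" using eig g by blast
    let ?\<pi> = "\<lambda>x. \<beta> x f *s e + \<beta> e x *s f"
    have pi: "orth_projection {e, f} ?\<pi>" using ef(3) by (rule orth_projection_pair)
    have dim: "vec.dim (orth_rest V ?\<pi>) < vec.dim V" using ef by (intro dim_orth_rest[OF V pi]) auto
    have split': "\<And>Y y. Y \<in> \<Y> \<Longrightarrow> y \<in> Y \<Longrightarrow> (\<beta> y f = 0 \<or> e \<in> Y) \<and> (\<beta> e y = 0 \<or> f \<in> Y)" using split by blast
    obtain g1 where g1: "g1 \<in> isometries \<Y>" "joined_to_one \<Y> g1 \<Longrightarrow> joined_to_one \<Y> g" "g1 *v e = e" "g1 *v f = f"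
      "\<And>z. g *v z = z \<Longrightarrow> \<beta> e z = 0 \<Longrightarrow> \<beta> z f = 0 \<Longrightarrow> g1 *v z = z"
      by (rule joined_to_one_torus_step[OF nd sub ef(3) split' g \<tau>]) (assumption+, rule that)
    have "g1 *v z = z" if z: "\<forall>v\<in>orth_rest V ?\<pi>. \<beta> v z = 0" for z
    proof -
      \<comment> \<open>The part of \<open>z\<close> orthogonal to \<open>e\<close> and \<open>f\<close> is
        orthogonal to all of \<open>V\<close>, and there \<open>g1\<close> agrees with
        \<open>g\<close>.\<close>
      let ?z = "z - ?\<pi> z"
      have oz: "\<beta> e ?z = 0" "\<beta> ?z f = 0" using ef(3) by simp_all
      have "\<beta> v ?z = 0" if v: "v \<in> V" for v
      proof -
        have "?\<pi> v \<in> V" using V v ef by (intro vec.subspace_add vec.subspace_scale)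
        then have "v - ?\<pi> v \<in> orth_rest V ?\<pi>"
          using V v orth_projection_idem(2)[OF pi, of v] unfolding orth_rest_def by (simp add: vec.subspace_diff)
        then have "\<beta> (v - ?\<pi> v) z = 0" using z by blast
        moreover have "?\<pi> (v - ?\<pi> v) = 0" by (rule orth_projection_idem(2)[OF pi])
        ultimately have "\<beta> (v - ?\<pi> v) ?z = 0" using orth_projection_splits(2)[OF pi, of "v - ?\<pi> v" z] by simp
        moreover have "\<beta> (?\<pi> v) ?z = 0"
          using oz skew[of f ?z] by (simp only: add_left scale_left) simp
        ultimately have "\<beta> ((v - ?\<pi> v) + ?\<pi> v) ?z = 0" by (simp only: add_left) simp
        then show ?thesis by (simp only: diff_add_cancel)
      qed
      then have "g1 *v ?z = ?z" using oz fixed by (intro g1(5)) blast+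
      moreover have "g1 *v ?\<pi> z = ?\<pi> z" using g1(3,4) by (simp only: vec.add vec.scale)
      ultimately have "g1 *v (?z + ?\<pi> z) = ?z + ?\<pi> z" by (simp only: vec.add)
      then show ?thesis by (simp only: diff_add_cancel)
    qed
    from less.hyps[OF dim rest g1(1) this] show ?thesis by (rule g1(2))
  qed
qed

lemma connectedin_isometries:
  assumes "\<And>g. g \<in> isometries \<Y> \<Longrightarrow> joined_to_one \<Y> g"
  shows "connectedin zariski (isometries \<Y>)"
proof -
  define \<U> where "\<U> = {S. connectedin zariski S \<and> S \<subseteq> isometries \<Y> \<and> mat 1 \<in> S}"
  have "isometries \<Y> = \<Union>\<U>"
    using assms unfolding joined_to_one_def \<U>_def by blast
  moreover have "connectedin zariski (\<Union>\<U>)"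
    by (rule connectedin_Union) (auto simp: \<U>_def)
  ultimately show ?thesis by simp
qed

text \<open>
  The first nonzero intersection of the chain with \<open>V\<close> is a line. A map that stabilizes
  \<open>V\<close> and the chain scales it.
\<close>

lemma slow_chain_Int_eigenline:
  assumes F: "slow_chain r F" "F 0 = {0}" and V: "vec.subspace V" and nz: "F r \<inter> V \<noteq> {0}"
  obtains i e where "i \<le> r" "e \<in> F i" "e \<in> V" "e \<noteq> 0" "\<And>y. y \<in> F i \<Longrightarrow> y \<in> V \<Longrightarrow> \<exists>c. y = c *s e"
proof -
  have FV: "slow_chain r (\<lambda>i. F i \<inter> V)" using F(1) V by (rule slow_chain_Int)
  define i where "i = (LEAST i. F i \<inter> V \<noteq> {0})"
  have i: "F i \<inter> V \<noteq> {0}" "i \<le> r"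
    unfolding i_def using LeastI[of "\<lambda>i. F i \<inter> V \<noteq> {0}" r] Least_le[of "\<lambda>i. F i \<inter> V \<noteq> {0}" r] nz by auto
  have i1: "1 \<le> i" using i(1) F(2) vec.subspace_0[OF V] by (cases i) auto
  have Fi1: "F (i - 1) \<inter> V = {0}"
    using not_less_Least[of "i - 1" "\<lambda>i. F i \<inter> V \<noteq> {0}"] i1 unfolding i_def by auto
  have "vec.subspace (F i \<inter> V)" using FV i(2) unfolding slow_chain_def by blast
  then obtain e where e: "e \<in> F i" "e \<in> V" "e \<noteq> 0" using i(1) vec.subspace_0 by blast
  show ?thesis
  proof (rule that[OF i(2) e])
    fix y assume y: "y \<in> F i" "y \<in> V"
    have "e \<in> F i \<inter> V" "e \<notin> F (i - 1) \<inter> V" "y \<in> F i \<inter> V" using e y Fi1 by auto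
    from slow_chain_step[OF FV i1 i(2) this] obtain c where "y - c *s e \<in> F (i - 1) \<inter> V" by blast
    then have "y - c *s e = 0" unfolding Fi1 by blast
    then show "\<exists>c. y = c *s e" by auto
  qed
qed

text \<open>
  The pair is chosen inside of \<open>V\<close> but adapted to the flags of the whole space. This
  works because a partner of \<open>e\<close> in the flag on \<open>V\<close> is in an opposite
  position in the big flag too.
\<close>

lemma orthogonal_chains_torus_pair:
  assumes A: "orthogonal_chains UNIV r F s H" and slow: "slow_chain r F"
    and C: "orthogonal_chains V r (\<lambda>i. F i \<inter> V) s (\<lambda>i. H i \<inter> V)" and nz: "F r \<inter> V \<noteq> {0}"
  shows "\<exists>e f. e \<in> V \<and> f \<in> V \<and> \<beta> e f = 1 \<and>
      (\<forall>Y\<in>F ` {..r} \<union> H ` {..s}. \<forall>y\<in>Y. (\<beta> y f = 0 \<or> e \<in> Y) \<and> (\<beta> e y = 0 \<or> f \<in> Y)) \<and>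
      (\<forall>g\<in>isometries (F ` {..r} \<union> H ` {..s}). (\<forall>x\<in>V. g *v x \<in> V) \<longrightarrow> (\<exists>\<tau>. g *v e = \<tau> *s e)) \<and>
      orthogonal_chains (orth_rest V (\<lambda>x. \<beta> x f *s e + \<beta> e x *s f)) r
        (\<lambda>i. F i \<inter> orth_rest V (\<lambda>x. \<beta> x f *s e + \<beta> e x *s f)) s
        (\<lambda>i. H i \<inter> orth_rest V (\<lambda>x. \<beta> x f *s e + \<beta> e x *s f))"
proof -
  have ch: "selfdual_chain r F" "selfdual_chain s H" and orth: "\<And>u w. u \<in> F r \<Longrightarrow> w \<in> H s \<Longrightarrow> \<beta> u w = 0"
    using A unfolding orthogonal_chains_def by auto
  have V: "vec.subspace V" and chV: "selfdual_chain r (\<lambda>i. F i \<inter> V)" "selfdual_chain s (\<lambda>i. H i \<inter> V)"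
    using C unfolding orthogonal_chains_def by auto
  have F0: "F 0 = {0}" using ch(1) by (simp add: selfdual_chain_def)
  obtain i e where e: "i \<le> r" "e \<in> F i" "e \<in> V" "e \<noteq> 0" "\<And>y. y \<in> F i \<Longrightarrow> y \<in> V \<Longrightarrow> \<exists>c. y = c *s e"
    by (rule slow_chain_Int_eigenline[OF slow F0 V nz]) (rule that)
  have er: "e \<in> F r" using slow_chain_mono[OF slow e(1)] e(2) by blast
  then have eV: "e \<in> F r \<inter> V" using e(3) by blast
  obtain i' f where i': "1 \<le> i'" "i' \<le> r" "e \<in> F i' \<inter> V" "f \<in> F (r + 1 - i') \<inter> V" and ef: "\<beta> e f = 1"
    using selfdual_chain_partner[OF chV(1) eV e(4)] by metis
  have fr: "f \<in> F r" using selfdual_chain_partner_top[OF ch(1) i'(1)] i'(4) by blast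
  let ?\<pi> = "\<lambda>x. \<beta> x f *s e + \<beta> e x *s f"
  have pi: "orth_projection {e, f} ?\<pi>" using ef by (rule orth_projection_pair)
  have split: "(\<beta> y f = 0 \<or> e \<in> F j) \<and> (\<beta> e y = 0 \<or> f \<in> F j)" if "j \<le> r" "y \<in> F j" for j y
    using selfdual_chain_split[OF ch(1) i'(1,2) _ _ that, of e f] i'(3,4) by blast
  have zero: "\<beta> y f = 0 \<and> \<beta> e y = 0" if "j \<le> s" "y \<in> H j" for j y
  proof -
    have "y \<in> H s" using selfdual_chain_mono[OF ch(2) that(1)] that(2) by auto
    then show ?thesis using orth[OF fr, of y] orth[OF er, of y] skew[of y f] by simp
  qed
  have "orthogonal_chains (orth_rest V ?\<pi>) r (\<lambda>i. F i \<inter> V \<inter> orth_rest V ?\<pi>) s (\<lambda>i. H i \<inter> V \<inter> orth_rest V ?\<pi>)"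
  proof (rule orthogonal_chains_restrict[OF C pi])
    show "{e, f} \<subseteq> F r \<inter> V \<union> H s \<inter> V" using er fr i'(3,4) by blast
    have subF: "vec.subspace (F j \<inter> V)" if "j \<le> r" for j using chV(1) that unfolding selfdual_chain_def by blast
    show "?\<pi> y \<in> F j \<inter> V" if "j \<le> r" "y \<in> F j \<inter> V" for j y
    proof -
      have "\<beta> y f = 0 \<or> e \<in> F j \<inter> V" "\<beta> e y = 0 \<or> f \<in> F j \<inter> V"
        using split[of j y] that e(3) i'(4) by blast+
      then have "\<beta> y f *s e \<in> F j \<inter> V" "\<beta> e y *s f \<in> F j \<inter> V"
        using vec.subspace_scale[OF subF[OF that(1)]] vec.subspace_0[OF subF[OF that(1)]]
        by (metis vec.scale_zero_left)+
      then show ?thesis by (rule vec.subspace_add[OF subF[OF that(1)]])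
    qed
    have subH: "vec.subspace (H j \<inter> V)" if "j \<le> s" for j using chV(2) that unfolding selfdual_chain_def by blast
    show "?\<pi> y \<in> H j \<inter> V" if "j \<le> s" "y \<in> H j \<inter> V" for j y
      using zero[of j y] that vec.subspace_0[OF subH[OF that(1)]] by simp
  qed
  moreover have "X \<inter> V \<inter> orth_rest V ?\<pi> = X \<inter> orth_rest V ?\<pi>" for X by (auto simp: orth_rest_def)
  ultimately have rest: "orthogonal_chains (orth_rest V ?\<pi>) r (\<lambda>i. F i \<inter> orth_rest V ?\<pi>) s (\<lambda>i. H i \<inter> orth_rest V ?\<pi>)"
    by simp
  have eig: "\<exists>\<tau>. g *v e = \<tau> *s e" if "g \<in> isometries (F ` {..r} \<union> H ` {..s})" "\<forall>x\<in>V. g *v x \<in> V" for g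
  proof (rule e(5))
    show "g *v e \<in> V" using that(2) e(3) by blast
    show "g *v e \<in> F i" using that(1) e(1,2) unfolding isometries_def by blast
  qed
  have "\<forall>Y\<in>F ` {..r} \<union> H ` {..s}. \<forall>y\<in>Y. (\<beta> y f = 0 \<or> e \<in> Y) \<and> (\<beta> e y = 0 \<or> f \<in> Y)"
    using split zero by blast
  then show ?thesis
    using e(3) i'(4) ef rest eig by (intro exI[of _ e] exI[of _ f] conjI) auto
qed

lemma connectedin_isometries_orthogonal_chains:
  assumes A: "orthogonal_chains UNIV r F s H" and slow: "slow_chain r F" "slow_chain s H"
  shows "connectedin zariski (isometries (F ` {..r} \<union> H ` {..s}))"
proof (rule connectedin_isometries)
  let ?\<G> = "\<lambda>V. orthogonal_chains V r (\<lambda>i. F i \<inter> V) s (\<lambda>i. H i \<inter> V)"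
  have nd: "nondegenerate_on \<beta> UNIV" using A unfolding orthogonal_chains_def by blast
  fix g assume g: "g \<in> isometries (F ` {..r} \<union> H ` {..s})"
  show "joined_to_one (F ` {..r} \<union> H ` {..s}) g"
  proof (rule joined_to_one_by_peeling[OF nd, of _ ?\<G> UNIV])
    show "vec.subspace Y" if "Y \<in> F ` {..r} \<union> H ` {..s}" for Y
      using that slow unfolding slow_chain_def by auto
    show "vec.subspace V" if "?\<G> V" for V using that unfolding orthogonal_chains_def by blast
    show "?\<G> UNIV" using A by simp
    show "g *v z = z" if "\<forall>v\<in>UNIV. \<beta> v z = 0" for z
    proof -
      have "\<forall>v\<in>UNIV. \<beta> z v = 0" using that skew[of z] by simp
      then have "z = 0" using nd unfolding nondegenerate_on_def by blast
      then show ?thesis by simp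
    qed
    fix V assume V: "?\<G> V" "V \<noteq> {0}"
    show "\<exists>e f. e \<in> V \<and> f \<in> V \<and> \<beta> e f = 1 \<and>
      (\<forall>Y\<in>F ` {..r} \<union> H ` {..s}. \<forall>y\<in>Y. (\<beta> y f = 0 \<or> e \<in> Y) \<and> (\<beta> e y = 0 \<or> f \<in> Y)) \<and>
      (\<forall>g\<in>isometries (F ` {..r} \<union> H ` {..s}). (\<forall>x\<in>V. g *v x \<in> V) \<longrightarrow> (\<exists>\<tau>. g *v e = \<tau> *s e)) \<and>
      ?\<G> (orth_rest V (\<lambda>x. \<beta> x f *s e + \<beta> e x *s f))"
    proof (cases "F r \<inter> V = {0}")
      case False
      then show ?thesis using A slow(1) V(1) by (intro orthogonal_chains_torus_pair)
    next
      case True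
      have "H s \<inter> V \<noteq> {0}"
      proof
        assume H0: "H s \<inter> V = {0}"
        obtain x where x: "x \<in> V" "x \<noteq> 0" using V vec.subspace_0 unfolding orthogonal_chains_def by blast
        then obtain u w where "u \<in> F r \<inter> V" "w \<in> H s \<inter> V" "x = u + w"
          using V(1) unfolding orthogonal_chains_def by blast
        then show False using True H0 x(2) by simp
      qed
      from orthogonal_chains_torus_pair[OF orthogonal_chains_sym[OF A] slow(2) orthogonal_chains_sym[OF V(1)] this]
      obtain e f where *: "e \<in> V" "f \<in> V" "\<beta> e f = 1"
        "\<forall>Y\<in>H ` {..s} \<union> F ` {..r}. \<forall>y\<in>Y. (\<beta> y f = 0 \<or> e \<in> Y) \<and> (\<beta> e y = 0 \<or> f \<in> Y)"
        "\<forall>g\<in>isometries (H ` {..s} \<union> F ` {..r}). (\<forall>x\<in>V. g *v x \<in> V) \<longrightarrow> (\<exists>\<tau>. g *v e = \<tau> *s e)"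
        "orthogonal_chains (orth_rest V (\<lambda>x. \<beta> x f *s e + \<beta> e x *s f)) s
          (\<lambda>i. H i \<inter> orth_rest V (\<lambda>x. \<beta> x f *s e + \<beta> e x *s f)) r
          (\<lambda>i. F i \<inter> orth_rest V (\<lambda>x. \<beta> x f *s e + \<beta> e x *s f))"
        by (elim exE conjE)
      show ?thesis
        using * orthogonal_chains_sym[OF *(6)]
        by (intro exI[of _ e] exI[of _ f] conjI) (simp_all only: Un_commute[of "F ` {..r}" "H ` {..s}"])
    qed
  qed (rule g)
qed

text \<open>
  In contrast to self-dual flags, a partner in \<open>W \<inter> V\<close> of a vector of
  \<open>V\<close> is adapted at first only to the members of the flag cut down to \<open>V\<close>.
  The second half of the invariant \<open>\<G>\<close> says that every member of the flag is the sum
  of its trace on \<open>V\<close> and of vectors orthogonal to \<open>V\<close>, so that the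
  orthogonality to \<open>F (i - 1) \<inter> V\<close> extends to \<open>F (i - 1)\<close>.
\<close>

lemma connectedin_isometries_polarized_chain:
  assumes A: "polarized_chain UNIV W r F"
  shows "connectedin zariski (isometries (insert W (F ` {..r})))"
proof (rule connectedin_isometries)
  let ?\<G> = "\<lambda>V. polarized_chain V (W \<inter> V) r (\<lambda>i. F i \<inter> V) \<and>
    (\<forall>j\<le>r. \<forall>y\<in>F j. \<exists>z\<in>F j \<inter> V. \<forall>v\<in>V. \<beta> (y - z) v = 0)"
    and ?Y = "insert W (F ` {..r})"
  note DA = polarized_chainD[OF A]
  fix g assume g: "g \<in> isometries ?Y"
  show "joined_to_one ?Y g"
  proof (rule joined_to_one_by_peeling[OF DA(2), of _ ?\<G> UNIV])
    show "vec.subspace Y" if "Y \<in> ?Y" for Y using that DA by auto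
    show "vec.subspace V" if "?\<G> V" for V using polarized_chainD(1) that by blast
    show "?\<G> UNIV"
    proof (intro conjI allI impI ballI)
      fix j y assume "y \<in> F j"
      then show "\<exists>z\<in>F j \<inter> UNIV. \<forall>v\<in>UNIV. \<beta> (y - z) v = 0" by (intro bexI[of _ y]) auto
    qed (use A in simp)
    show "g *v z = z" if "\<forall>v\<in>UNIV. \<beta> v z = 0" for z
    proof -
      have "\<forall>v\<in>UNIV. \<beta> z v = 0" using that skew[of z] by simp
      then have "z = 0" using DA(2) unfolding nondegenerate_on_def by blast
      then show ?thesis by simp
    qed
    fix V assume "?\<G> V" and V0: "V \<noteq> {0}"
    then have V: "polarized_chain V (W \<inter> V) r (\<lambda>i. F i \<inter> V)"
      and sum: "\<And>j y. j \<le> r \<Longrightarrow> y \<in> F j \<Longrightarrow> \<exists>z\<in>F j \<inter> V. \<forall>v\<in>V. \<beta> (y - z) v = 0" by auto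
    note DV = polarized_chainD[OF V]
    have nz: "F r \<inter> V \<noteq> {0}" using polarized_chain_nonzero[OF V V0] .
    obtain i e where e: "i \<le> r" "e \<in> F i" "e \<in> V" "e \<noteq> 0" "\<And>y. y \<in> F i \<Longrightarrow> y \<in> V \<Longrightarrow> \<exists>c. y = c *s e"
      by (rule slow_chain_Int_eigenline[OF DA(3,4) DV(1) nz]) (rule that)
    have er: "e \<in> F r" using DA(12)[OF e(1)] e(2) by blast
    obtain i' where i': "1 \<le> i'" "i' \<le> r" "e \<in> F i'" "e \<notin> F (i' - 1)"
      by (rule polarized_chain_position[OF A er e(4)]) (rule that)
    have "e \<in> F i' \<inter> V" "e \<notin> F (i' - 1) \<inter> V" using i' e(3) by auto
    then obtain f where f: "f \<in> W \<inter> V" "\<beta> e f = 1" "\<And>y. y \<in> F (i' - 1) \<inter> V \<Longrightarrow> \<beta> y f = 0"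
      by (rule polarized_chain_partner_at[OF V i'(1,2)]) (rule that)
    have fF: "\<beta> y f = 0" if y: "y \<in> F (i' - 1)" for y
    proof -
      have "i' - 1 \<le> r" using i'(2) by simp
      from sum[OF this y] obtain z where z: "z \<in> F (i' - 1) \<inter> V" "\<forall>v\<in>V. \<beta> (y - z) v = 0" by blast
      then have "\<beta> (y - z) f = 0" using f(1) by blast
      then show ?thesis using f(3)[OF z(1)] by simp
    qed
    let ?\<pi> = "\<lambda>x. \<beta> x f *s e + \<beta> e x *s f"
    have pi: "orth_projection {e, f} ?\<pi>" using f(2) by (rule orth_projection_pair)
    have isoF: "\<beta> e y = 0" if "j \<le> r" "y \<in> F j" for j y using DA(9)[OF er, of y] DA(12)[OF that(1)] that(2) by blast
    have splitF: "\<beta> y f = 0 \<or> e \<in> F j" if "j \<le> r" "y \<in> F j" for j y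
      using polarized_chain_split[OF A i'(1-3) fF that] .
    have split: "\<forall>Y\<in>?Y. \<forall>y\<in>Y. (\<beta> y f = 0 \<or> e \<in> Y) \<and> (\<beta> e y = 0 \<or> f \<in> Y)"
      using splitF isoF f(1) DA(10) by blast
    have eig: "\<exists>\<tau>. g *v e = \<tau> *s e" if "g \<in> isometries ?Y" "\<forall>x\<in>V. g *v x \<in> V" for g
    proof (rule e(5))
      show "g *v e \<in> V" using that(2) e(3) by blast
      show "g *v e \<in> F i" using that(1) e(1,2) unfolding isometries_def by blast
    qed
    have "polarized_chain (orth_rest V ?\<pi>) (W \<inter> V \<inter> orth_rest V ?\<pi>) r (\<lambda>i. F i \<inter> V \<inter> orth_rest V ?\<pi>)"
      by (rule polarized_chain_restrict[OF V pi]) (use er e(3) f(1) in auto)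
    moreover have "X \<inter> V \<inter> orth_rest V ?\<pi> = X \<inter> orth_rest V ?\<pi>" for X by (auto simp: orth_rest_def)
    ultimately have rest: "polarized_chain (orth_rest V ?\<pi>) (W \<inter> orth_rest V ?\<pi>) r (\<lambda>i. F i \<inter> orth_rest V ?\<pi>)"
      by simp
    have sum': "\<exists>z\<in>F j \<inter> orth_rest V ?\<pi>. \<forall>v\<in>orth_rest V ?\<pi>. \<beta> (y - z) v = 0" if j: "j \<le> r" and y: "y \<in> F j" for j y
    proof -
      obtain z where z: "z \<in> F j" "z \<in> V" "\<forall>v\<in>V. \<beta> (y - z) v = 0" using sum[OF j y] by blast
      have pz: "?\<pi> z \<in> F j"
        using splitF[OF j z(1)] isoF[OF j z(1)] vec.subspace_scale[OF DA(11)[OF j]] vec.subspace_0[OF DA(11)[OF j]] by auto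
      have pzV: "?\<pi> z \<in> V" using e(3) f(1) DV(1) by (intro vec.subspace_add vec.subspace_scale) auto
      show ?thesis
      proof (intro bexI[of _ "z - ?\<pi> z"] ballI)
        show "z - ?\<pi> z \<in> F j \<inter> orth_rest V ?\<pi>"
          using vec.subspace_diff[OF DA(11)[OF j] z(1) pz] vec.subspace_diff[OF DV(1) z(2) pzV]
            orth_projection_idem(2)[OF pi, of z] unfolding orth_rest_def by blast
        fix v assume v: "v \<in> orth_rest V ?\<pi>"
        then have vV: "v \<in> V" and v0: "?\<pi> v = 0" by (auto simp: orth_rest_def)
        have "\<beta> v (?\<pi> z) = 0" using orth_projection_splits(1)[OF pi v0] .
        then have "\<beta> (?\<pi> z) v = 0" using skew[of "?\<pi> z" v] by simp
        moreover have "\<beta> (y - z) v = 0" using z(3) vV by blast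
        moreover have "\<beta> (y - (z - ?\<pi> z)) v = \<beta> (y - z) v + \<beta> (?\<pi> z) v" by (simp only: diff_left) simp
        ultimately show "\<beta> (y - (z - ?\<pi> z)) v = 0" by simp
      qed
    qed
    have ef: "e \<in> V" "f \<in> V" using e(3) f(1) by auto
    show "\<exists>e f. e \<in> V \<and> f \<in> V \<and> \<beta> e f = 1 \<and>
      (\<forall>Y\<in>?Y. \<forall>y\<in>Y. (\<beta> y f = 0 \<or> e \<in> Y) \<and> (\<beta> e y = 0 \<or> f \<in> Y)) \<and>
      (\<forall>g\<in>isometries ?Y. (\<forall>x\<in>V. g *v x \<in> V) \<longrightarrow> (\<exists>\<tau>. g *v e = \<tau> *s e)) \<and>
      ?\<G> (orth_rest V (\<lambda>x. \<beta> x f *s e + \<beta> e x *s f))"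
    proof (rule exI[of _ e], rule exI[of _ f], intro conjI)
      show "\<forall>g\<in>isometries ?Y. (\<forall>x\<in>V. g *v x \<in> V) \<longrightarrow> (\<exists>\<tau>. g *v e = \<tau> *s e)"
        using eig by blast
      show "\<forall>j\<le>r. \<forall>y\<in>F j. \<exists>z\<in>F j \<inter> orth_rest V ?\<pi>. \<forall>v\<in>orth_rest V ?\<pi>. \<beta> (y - z) v = 0"
        using sum' by blast
    qed (rule ef f(2) split rest)+
  qed (rule g)
qed

end

section \<open>Self-dual flags from flags of a Lagrangian subspace\<close>

lemma slow_chain_append:
  assumes F: "slow_chain r F" and G: "slow_chain s G" and FG: "F r = G 0"
  shows "slow_chain (r + s) (\<lambda>i. if i \<le> r then F i else G (i - r))"
proof -
  define E where "E i = (if i \<le> r then F i else G (i - r))" for i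
  have step: "(i < r \<and> E i = F i \<and> E (Suc i) = F (Suc i)) \<or>
    (i - r < s \<and> E i = G (i - r) \<and> E (Suc i) = G (Suc (i - r)))" if "i < r + s" for i
    using that FG by (cases "i < r"; cases "i = r") (auto simp: E_def Suc_diff_le)
  have "slow_chain (r + s) E"
    unfolding slow_chain_def
  proof (intro conjI allI impI)
    show "vec.subspace (E i)" if "i \<le> r + s" for i
      using that F G unfolding slow_chain_def E_def by auto
    fix i assume "i < r + s"
    from step[OF this]
    have "E i \<subseteq> E (Suc i) \<and> (\<forall>x\<in>E (Suc i). \<forall>y\<in>E (Suc i). x \<notin> E i \<longrightarrow> (\<exists>c. y - c *s x \<in> E i))"
    proof (elim disjE conjE)
      assume i: "i < r" and e: "E i = F i" "E (Suc i) = F (Suc i)"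
      show ?thesis unfolding e using F i unfolding slow_chain_def by blast
    next
      assume i: "i - r < s" and e: "E i = G (i - r)" "E (Suc i) = G (Suc (i - r))"
      show ?thesis unfolding e using G i unfolding slow_chain_def by blast
    qed
    then show "E i \<subseteq> E (Suc i)"
      "\<forall>x\<in>E (Suc i). \<forall>y\<in>E (Suc i). x \<notin> E i \<longrightarrow> (\<exists>c. y - c *s x \<in> E i)" by (rule conjunct1, rule conjunct2)
  qed
  then show ?thesis unfolding E_def .
qed

lemma slow_chain_sum:
  assumes U: "vec.subspace U" and H: "slow_chain s H"
  shows "slow_chain s (\<lambda>j. {u + h | u h. u \<in> U \<and> h \<in> H j})"
  unfolding slow_chain_def
proof (intro conjI allI impI ballI)
  show "vec.subspace {u + h | u h. u \<in> U \<and> h \<in> H i}" if "i \<le> s" for i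
    using U H that unfolding slow_chain_def by (intro vec.subspace_sums) auto
  fix i assume i: "i < s"
  show "{u + h | u h. u \<in> U \<and> h \<in> H i} \<subseteq> {u + h | u h. u \<in> U \<and> h \<in> H (Suc i)}"
    using H i unfolding slow_chain_def by blast
  fix x y
  assume x: "x \<in> {u + h | u h. u \<in> U \<and> h \<in> H (Suc i)}" and y: "y \<in> {u + h | u h. u \<in> U \<and> h \<in> H (Suc i)}"
    and nx: "x \<notin> {u + h | u h. u \<in> U \<and> h \<in> H i}"
  obtain u h where uh: "u \<in> U" "h \<in> H (Suc i)" "x = u + h" using x by blast
  obtain u' h' where uh': "u' \<in> U" "h' \<in> H (Suc i)" "y = u' + h'" using y by blast
  have "h \<notin> H i" using nx uh by blast
  then obtain c where c: "h' - c *s h \<in> H i" using H i uh(2) uh'(2) unfolding slow_chain_def by blast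
  have "y - c *s x = (u' - c *s u) + (h' - c *s h)" by (simp add: uh(3) uh'(3) vec.scale_right_distrib)
  moreover have "u' - c *s u \<in> U" using U uh(1) uh'(1) by (intro vec.subspace_diff vec.subspace_scale)
  ultimately show "\<exists>c. y - c *s x \<in> {u + h | u h. u \<in> U \<and> h \<in> H i}" using c by blast
qed

context alternating
begin

text \<open>
  The orthogonal complements in \<open>U\<close> of the members of \<open>F\<close>, numbered in such
  a way that the chain increases.
\<close>

definition perp_chain :: "(complex ^ 'd) set \<Rightarrow> nat \<Rightarrow> (nat \<Rightarrow> (complex ^ 'd) set) \<Rightarrow> nat \<Rightarrow> (complex ^ 'd) set" where
  "perp_chain U r F j = {x \<in> U. \<forall>y\<in>F (r - j). \<beta> x y = 0}"

text \<open>
  Dually to the steps of \<open>F\<close>, one linear condition \<open>\<beta> x u = 0\<close>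
  distinguishes consecutive complements.
\<close>

lemma slow_chain_perp:
  assumes F: "slow_chain r F" and U: "vec.subspace U"
  shows "slow_chain r (perp_chain U r F)"
  unfolding slow_chain_def
proof (intro conjI allI impI ballI)
  show "vec.subspace (perp_chain U r F i)" for i unfolding perp_chain_def using U by (rule subspace_perp)
  fix i assume i: "i < r"
  then have Suc: "Suc (r - Suc i) = r - i" "r - Suc i < r" by auto
  have "F (r - Suc i) \<subseteq> F (r - i)" using F Suc unfolding slow_chain_def by metis
  then show "perp_chain U r F i \<subseteq> perp_chain U r F (Suc i)" unfolding perp_chain_def by blast
  fix x y assume x: "x \<in> perp_chain U r F (Suc i)" and y: "y \<in> perp_chain U r F (Suc i)"
    and nx: "x \<notin> perp_chain U r F i"
  obtain u where u: "u \<in> F (r - i)" "\<beta> x u \<noteq> 0" using x nx unfolding perp_chain_def by blast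
  have "u \<notin> F (r - Suc i)" using u(2) x unfolding perp_chain_def by blast
  then have step: "\<exists>d. z - d *s u \<in> F (r - Suc i)" if "z \<in> F (r - i)" for z
    using F Suc u(1) that unfolding slow_chain_def by metis
  let ?c = "\<beta> y u / \<beta> x u"
  have "\<beta> (y - ?c *s x) z = 0" if z: "z \<in> F (r - i)" for z
  proof -
    obtain d where d: "z - d *s u \<in> F (r - Suc i)" using step[OF z] by blast
    have "\<beta> x (z - d *s u) = 0" "\<beta> y (z - d *s u) = 0" using x y d unfolding perp_chain_def by blast+
    then have "\<beta> x z = d * \<beta> x u" "\<beta> y z = d * \<beta> y u" by simp_all
    then show ?thesis using u(2) by simp
  qed
  moreover have "y - ?c *s x \<in> U"
    using x y U unfolding perp_chain_def by (auto intro: vec.subspace_diff vec.subspace_scale)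
  ultimately show "\<exists>c. y - c *s x \<in> perp_chain U r F i" unfolding perp_chain_def by blast
qed

lemma perp_perp:
  assumes U: "vec.subspace U" "nondegenerate_on \<beta> U" and S: "vec.subspace S" "S \<subseteq> U"
  shows "{x \<in> U. \<forall>y\<in>{z \<in> U. \<forall>s\<in>S. \<beta> z s = 0}. \<beta> x y = 0} = S"
proof (intro subset_antisym subsetI)
  fix x assume x: "x \<in> {x \<in> U. \<forall>y\<in>{z \<in> U. \<forall>s\<in>S. \<beta> z s = 0}. \<beta> x y = 0}"
  show "x \<in> S"
  proof (rule ccontr)
    assume nx: "x \<notin> S"
    have xU: "x \<in> U" using x by blast
    obtain p where p: "p \<in> U" "\<beta> x p = 1" "\<And>s. s \<in> S \<Longrightarrow> \<beta> s p = 0"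
      by (rule separating_vector[OF S(1) U(1) S(2) U(2) xU nx]) (rule that)
    then have "p \<in> {z \<in> U. \<forall>s\<in>S. \<beta> z s = 0}" using skew[of p] by auto
    then have "\<beta> x p = 0" using x by blast
    then show False using p(2) by simp
  qed
next
  fix x assume "x \<in> S"
  moreover have "\<beta> x y = 0" if "y \<in> {z \<in> U. \<forall>s\<in>S. \<beta> z s = 0}" for y
    using that \<open>x \<in> S\<close> skew[of x y] by auto
  ultimately show "x \<in> {x \<in> U. \<forall>y\<in>{z \<in> U. \<forall>s\<in>S. \<beta> z s = 0}. \<beta> x y = 0}" using S(2) by blast
qed

text \<open>
  A flag of a Lagrangian subspace, continued by the orthogonal complements of its members, is self-
  dual.
\<close>

lemma selfdual_chain_reflect:
  assumes U: "vec.subspace U" "nondegenerate_on \<beta> U" and F: "slow_chain m F" "F 0 = {0}" and L: "lagrangian_of U (F m)"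
  defines "E \<equiv> \<lambda>i. if i \<le> m then F i else perp_chain U m F (i - m)"
  shows "slow_chain (m + m) E" "selfdual_chain (m + m) E" "E (m + m) = U"
proof -
  have FU: "F i \<subseteq> U" if "i \<le> m" for i
    using slow_chain_mono[OF F(1) that] L unfolding lagrangian_of_def by blast
  have subF: "vec.subspace (F i)" if "i \<le> m" for i using F(1) that unfolding slow_chain_def by blast
  have Fm: "F m = perp_chain U m F 0" using L unfolding lagrangian_of_def perp_chain_def by simp
  show slow: "slow_chain (m + m) E"
    unfolding E_def by (rule slow_chain_append[OF F(1) slow_chain_perp[OF F(1) U(1)] Fm])
  have E_hi: "E i = {x \<in> U. \<forall>y\<in>F (m + m - i). \<beta> x y = 0}" if "m \<le> i" for i
    using that Fm unfolding E_def perp_chain_def by auto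
  show EU: "E (m + m) = U" using E_hi[of "m + m"] F(2) by auto
  show "selfdual_chain (m + m) E"
    unfolding selfdual_chain_def
  proof (intro conjI allI impI)
    show "E 0 = {0}" using F(2) by (simp add: E_def)
    show "E i \<subseteq> E (Suc i)" if "i < m + m" for i using slow that unfolding slow_chain_def by auto
    show "vec.subspace (E i)" if "i \<le> m + m" for i using slow that unfolding slow_chain_def by blast
    fix i assume i: "i \<le> m + m"
    show "E (m + m - i) = {x \<in> E (m + m). \<forall>y\<in>E i. \<beta> x y = 0}"
      unfolding EU
    proof (cases "i \<le> m")
      case True
      then have "E i = F i" by (simp add: E_def)
      moreover have "m + m - (m + m - i) = i" using i by simp
      ultimately show "E (m + m - i) = {x \<in> U. \<forall>y\<in>E i. \<beta> x y = 0}"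
        using E_hi[of "m + m - i"] True by simp
    next
      case False
      then have le: "m + m - i \<le> m" by simp
      then have lo: "E (m + m - i) = F (m + m - i)" by (simp add: E_def)
      have hi: "E i = {x \<in> U. \<forall>y\<in>F (m + m - i). \<beta> x y = 0}" using E_hi[of i] False by simp
      show "E (m + m - i) = {x \<in> U. \<forall>y\<in>E i. \<beta> x y = 0}"
        unfolding lo hi using perp_perp[OF U subF[OF le] FU[OF le]] by simp
    qed
  qed
qed

lemma perp_stable:
  assumes h: "invertible h" "\<And>x y. \<beta> (h *v x) (h *v y) = \<beta> x y" and U: "\<And>x. x \<in> U \<Longrightarrow> h *v x \<in> U"
    and S: "vec.subspace S" "\<And>x. x \<in> S \<Longrightarrow> h *v x \<in> S" and x: "x \<in> U" "\<forall>y\<in>S. \<beta> x y = 0"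
  shows "h *v x \<in> U \<and> (\<forall>y\<in>S. \<beta> (h *v x) y = 0)"
proof (intro conjI ballI)
  fix y assume "y \<in> S"
  then have "matrix_inv h *v y \<in> S" using S h(1) by (intro stable_inverse)
  moreover have "h *v (matrix_inv h *v y) = y" using matrix_inv_mult(1)[OF h(1)] by (simp add: matrix_vector_mul_assoc)
  ultimately show "\<beta> (h *v x) y = 0" using h(2)[of x "matrix_inv h *v y"] x(2) by simp
qed (use U x in blast)

section \<open>Borel subgroups are flag stabilizers\<close>

lemma subgroup_isometries:
  assumes "\<And>Y. Y \<in> \<Y> \<Longrightarrow> vec.subspace Y"
  shows "subgroup (isometries \<Y>) GL"
proof (rule GL.subgroupI)
  show "isometries \<Y> \<subseteq> carrier GL" by (auto simp: isometries_def)
  have "mat 1 \<in> isometries \<Y>" by (simp add: isometries_def invertible_mat_1)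
  then show "isometries \<Y> \<noteq> {}" by blast
  fix g assume g: "g \<in> isometries \<Y>"
  then have inv: "invertible g" by (simp add: isometries_def)
  have gi: "g *v (matrix_inv g *v x) = x" for x
    using matrix_inv_mult(1)[OF inv] by (simp add: matrix_vector_mul_assoc)
  have iso: "\<beta> (g *v x) (g *v y) = \<beta> x y" for x y using g by (simp add: isometries_def)
  have "\<beta> (matrix_inv g *v x) (matrix_inv g *v y) = \<beta> x y" for x y
    using iso[of "matrix_inv g *v x" "matrix_inv g *v y"] unfolding gi by (rule sym)
  moreover have "matrix_inv g *v y \<in> Y" if "Y \<in> \<Y>" "y \<in> Y" for Y y
    using assms[OF that(1)] inv _ that(2)
  proof (rule stable_inverse)
    show "g *v x \<in> Y" if "x \<in> Y" for x using g that \<open>Y \<in> \<Y>\<close> unfolding isometries_def by blast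
  qed
  ultimately show "inv\<^bsub>GL\<^esub> g \<in> isometries \<Y>"
    using matrix_inv_mult(3)[OF inv] by (simp add: inv_GL[OF inv] isometries_def)
  fix h assume "h \<in> isometries \<Y>"
  then show "g \<otimes>\<^bsub>GL\<^esub> h \<in> isometries \<Y>"
    using g by (simp add: isometries_def invertible_mult matrix_vector_mul_assoc[symmetric])
qed

lemma derived_pow_consistent:
  assumes "subgroup H GL"
  shows "(derived (GL\<lparr>carrier := H\<rparr>) ^^ n) H = (derived GL ^^ n) H"
proof (induction n)
  case (Suc n)
  have "(derived GL ^^ n) H \<subseteq> H"
    by (induction n) (use assms GL.derived_incl in auto)
  then show ?case using Suc GL.derived_consistent[OF _ assms] by simp
qed simp

lemma solvable_iff_derived_pow:
  assumes "subgroup H GL"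
  shows "solvable (GL\<lparr>carrier := H\<rparr>) \<longleftrightarrow> (\<exists>n. (derived GL ^^ n) H = {mat 1})"
proof -
  interpret G: group "GL\<lparr>carrier := H\<rparr>" using GL.subgroup_imp_group[OF assms] .
  show ?thesis
    using G.solvable_iff_trivial_derived_seq derived_pow_consistent[OF assms] by (simp add: GL_def)
qed

lemma closedin_zariski_stabilizer:
  fixes \<Y> :: "(complex ^ 'e) set set"
  assumes "\<And>Y. Y \<in> \<Y> \<Longrightarrow> vec.subspace Y"
  shows "closedin zariski {A. \<forall>Y\<in>\<Y>. \<forall>y\<in>Y. A *v y \<in> Y}"
proof -
  let ?C = "insert UNIV {{A. A *v y \<in> Y} | Y y. Y \<in> \<Y> \<and> y \<in> Y}"
  have "closedin zariski S" if "S \<in> ?C" for S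
  proof -
    have "closedin zariski UNIV" using closedin_topspace[of zariski] by simp
    moreover have "closedin zariski {A. A *v y \<in> Y}" if "Y \<in> \<Y>" for Y y
    proof -
      have "Vector_Spaces.linear (*s) (*s) (\<lambda>x :: complex ^ 'e. x)" by (intro linear_vecI) auto
      from closedin_zariski_linear_condition[OF this assms[OF that], of y] show ?thesis .
    qed
    ultimately show ?thesis using that by blast
  qed
  then have "closedin zariski (\<Inter>?C)" by (intro closedin_Inter) auto
  moreover have "\<Inter>?C = {A. \<forall>Y\<in>\<Y>. \<forall>y\<in>Y. A *v y \<in> Y}" by auto
  ultimately show ?thesis by simp
qed

text \<open>
  The stabilizer of a family of subspaces is Zariski closed, so a Borel subgroup that it contains is
  equal to it, by maximality, if it is connected and solvable.
\<close>

lemma borel_contains_isometries: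
  assumes \<K>: "\<And>Y. Y \<in> \<K> \<Longrightarrow> vec.subspace Y" and \<Y>: "\<And>Y. Y \<in> \<Y> \<Longrightarrow> vec.subspace Y" "isometries \<Y> \<subseteq> isometries \<K>"
    and B: "borel_subgroup B (GL\<lparr>carrier := isometries \<K>\<rparr>)" and BY: "B \<subseteq> isometries \<Y>"
    and conn: "connectedin zariski (isometries \<Y>)" and solv: "\<exists>n. (derived GL ^^ n) (isometries \<Y>) = {mat 1}"
  shows "isometries \<Y> \<subseteq> B"
proof -
  let ?K = "GL\<lparr>carrier := isometries \<K>\<rparr>"
  have sub: "subgroup (isometries \<K>) GL" "subgroup (isometries \<Y>) GL"
    using \<K> \<Y>(1) by (auto intro: subgroup_isometries)
  have "zariski_closed_subgroup (isometries \<Y>) ?K"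
    unfolding zariski_closed_subgroup_def
  proof
    show "subgroup (isometries \<Y>) ?K" using GL.subgroup_incl[OF sub(2,1) \<Y>(2)] .
    let ?T = "{A. \<forall>Y\<in>\<Y>. \<forall>y\<in>Y. A *v y \<in> Y}"
    have eq: "isometries \<Y> = ?T \<inter> isometries \<K>"
      using \<Y>(2) unfolding isometries_def by blast
    have "closedin zariski ?T" using \<Y>(1) by (rule closedin_zariski_stabilizer)
    then have "closedin (subtopology zariski (isometries \<K>)) (?T \<inter> isometries \<K>)"
      unfolding closedin_subtopology by blast
    then show "closedin (subtopology zariski (carrier ?K)) (isometries \<Y>)"
      unfolding eq[symmetric] by simp
  qed
  moreover have "solvable (?K\<lparr>carrier := isometries \<Y>\<rparr>)"
    using solvable_iff_derived_pow[OF sub(2)] solv by simp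
  ultimately have "connected_solvable_subgroup (isometries \<Y>) ?K"
    unfolding connected_solvable_subgroup_def using conn by blast
  then show ?thesis using B BY unfolding borel_subgroup_def by blast
qed

lemma borel_solvable_connected:
  assumes \<K>: "\<And>Y. Y \<in> \<K> \<Longrightarrow> vec.subspace Y" and B: "borel_subgroup B (GL\<lparr>carrier := isometries \<K>\<rparr>)"
  obtains n where "solvable_connected B n" "B \<subseteq> isometries \<K>"
proof -
  let ?K = "GL\<lparr>carrier := isometries \<K>\<rparr>"
  have sK: "subgroup (isometries \<K>) GL" using \<K> by (rule subgroup_isometries)
  have B1: "subgroup B ?K" "connectedin zariski B" "solvable (?K\<lparr>carrier := B\<rparr>)"
    using B unfolding borel_subgroup_def connected_solvable_subgroup_def zariski_closed_subgroup_def by auto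
  have BK: "B \<subseteq> isometries \<K>" using subgroup.subset[OF B1(1)] by simp
  have sB: "subgroup B GL" using GL.incl_subgroup[OF sK B1(1)] .
  have "\<exists>n. (derived GL ^^ n) B = {mat 1}" using B1(3) solvable_iff_derived_pow[OF sB] by simp
  then obtain n where "(derived GL ^^ n) B = {mat 1}" by blast
  with sB B1(2) have "solvable_connected B n" by (rule solvable_connected.intro)
  then show ?thesis using that BK by blast
qed

end

locale symplectic = alternating \<beta> for \<beta> :: "'d::finite form" +
  assumes nondegenerate: "nondegenerate_on \<beta> UNIV"
begin

text \<open>
  Lagrangian subspaces are given by their dimension, whereas the linear algebra uses that they are
  their own complements.
\<close>

lemma lagrangian_in_imp_of:
  assumes V: "vec.subspace V" "nondegenerate_on \<beta> V" and L: "lagrangian_in \<beta> V L"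
  shows "lagrangian_of V L"
proof -
  have L: "vec.subspace L" "\<And>x y. x \<in> L \<Longrightarrow> y \<in> L \<Longrightarrow> \<beta> x y = 0" "L \<subseteq> V" "2 * vec.dim L = vec.dim V"
    using L unfolding lagrangian_in_def isotropic_def by auto
  let ?P = "{x \<in> V. \<forall>y\<in>L. \<beta> x y = 0}"
  have "vec.dim ?P = vec.dim L" using dim_perp[OF V L(1,3)] L(4) by simp
  moreover have "L \<subseteq> ?P" using L(2,3) by blast
  ultimately have "L = ?P" using L(1) subspace_perp[OF V(1)] by (intro vec.subspace_dim_equal) auto
  then show ?thesis unfolding lagrangian_of_def using L(1) by simp
qed

text \<open>
  The solvability of the stabilizer is seen on a complete flag of the whole space, which continues
  \<open>F\<close> by the orthogonal complements of its members.
\<close>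

lemma borel_polarized_chain:
  assumes U: "lagrangian_of UNIV U" and W: "lagrangian_of UNIV W" and dec: "direct_decomposition U W"
    and B: "borel_subgroup B (GL\<lparr>carrier := isometries {U, W}\<rparr>)"
  obtains r F where "polarized_chain UNIV W r F" "isometries (insert W (F ` {..r})) \<subseteq> B"
proof -
  have sub: "vec.subspace U" "vec.subspace W" using U W unfolding lagrangian_of_def by auto
  then have subK: "\<And>Y. Y \<in> {U, W} \<Longrightarrow> vec.subspace Y" by blast
  obtain n where B1: "solvable_connected B n" and BK: "B \<subseteq> isometries {U, W}"
    by (rule borel_solvable_connected[OF subK B]) (assumption, rule that)
  have sub0: "vec.subspace {0 :: complex ^ 'd}" by (simp add: vec.subspace_def)
  have BU: "h *v x \<in> U" if "h \<in> B" "x \<in> U" for h x using BK that unfolding isometries_def by blast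
  have "\<exists>r F. stable_chain B r F \<and> F 0 = {0} \<and> F r = U"
    by (rule solvable_connected.ex_stable_chain[OF B1 sub0 _ sub(1)]) (use BU vec.subspace_0[OF sub(1)] in auto)
  then obtain r F where F: "stable_chain B r F" "F 0 = {0}" "F r = U" by blast
  then have slow: "slow_chain r F" unfolding stable_chain_def by blast
  have U0: "\<beta> x y = 0" if "x \<in> U" "y \<in> U" for x y using U that unfolding lagrangian_of_def by blast
  have W0: "\<beta> x y = 0" if "x \<in> W" "y \<in> W" for x y using W that unfolding lagrangian_of_def by blast
  have chain: "polarized_chain UNIV W r F"
    unfolding polarized_chain_def
    using nondegenerate slow F(2,3) sub dec U0 W0 unfolding direct_decomposition_def by auto
  let ?Y = "insert W (F ` {..r})"
  have subY: "vec.subspace Y" if "Y \<in> ?Y" for Y using that sub(2) slow unfolding slow_chain_def by auto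
  have UY: "U \<in> ?Y" using F(3) by auto
  have "isometries ?Y \<subseteq> B"
  proof (rule borel_contains_isometries[OF subK subY _ B])
    show "isometries ?Y \<subseteq> isometries {U, W}" using UY unfolding isometries_def by blast
    show "B \<subseteq> isometries ?Y" using BK F(1) unfolding isometries_def stable_chain_def by blast
    show "connectedin zariski (isometries ?Y)" using chain by (rule connectedin_isometries_polarized_chain)
    have LU: "lagrangian_of UNIV (F r)" using U F(3) by simp
    define E where "E i = (if i \<le> r then F i else perp_chain UNIV r F (i - r))" for i
    have E: "slow_chain (r + r) E" "E (r + r) = UNIV"
      using selfdual_chain_reflect[OF vec.subspace_UNIV nondegenerate slow F(2) LU] unfolding E_def by auto
    show "\<exists>n. (derived GL ^^ n) (isometries ?Y) = {mat 1}"
    proof (rule flag_stabilizer_solvable[OF E(1) _ E(2) subgroup_isometries[OF subY]])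
      show "E 0 = {0}" using F(2) by (simp add: E_def)
      fix g i x assume g: "g \<in> isometries ?Y" and i: "i \<le> r + r" and x: "x \<in> E i"
      have gF: "g *v x \<in> F j" if "j \<le> r" "x \<in> F j" for j x using g that unfolding isometries_def by blast
      show "g *v x \<in> E i"
      proof (cases "i \<le> r")
        case False
        let ?j = "r - (i - r)"
        have "vec.subspace (F ?j)" using slow unfolding slow_chain_def by auto
        moreover have "invertible g" "\<And>x y. \<beta> (g *v x) (g *v y) = \<beta> x y" using g by (auto simp: isometries_def)
        ultimately have "g *v x \<in> UNIV \<and> (\<forall>y\<in>F ?j. \<beta> (g *v x) y = 0)"
          using x False gF[of ?j] by (intro perp_stable) (auto simp: E_def perp_chain_def)
        then show ?thesis using False by (simp add: E_def perp_chain_def)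
      qed (use gF x in \<open>auto simp: E_def\<close>)
    qed
  qed
  with chain show ?thesis by (rule that)
qed

lemma stable_selfdual_chain:
  assumes B: "solvable_connected B n" and Biso: "\<And>h x y. h \<in> B \<Longrightarrow> \<beta> (h *v x) (h *v y) = \<beta> x y"
    and Binv: "\<And>h. h \<in> B \<Longrightarrow> invertible h"
    and U: "vec.subspace U" "nondegenerate_on \<beta> U" "\<And>h x. h \<in> B \<Longrightarrow> x \<in> U \<Longrightarrow> h *v x \<in> U"
  obtains r F where "slow_chain r F" "selfdual_chain r F" "F r = U"
    "\<And>h i x. h \<in> B \<Longrightarrow> i \<le> r \<Longrightarrow> x \<in> F i \<Longrightarrow> h *v x \<in> F i"
proof -
  have sub0: "vec.subspace {0 :: complex ^ 'd}" by (simp add: vec.subspace_def)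
  have "\<exists>r F. stable_chain B r F \<and> F 0 = {0} \<and> lagrangian_of U (F r)"
    by (rule ex_stable_isotropic_chain[OF B U(1,3) Biso sub0]) (use vec.subspace_0[OF U(1)] in auto)
  then obtain m F where F: "stable_chain B m F" "F 0 = {0}" "lagrangian_of U (F m)" by blast
  then have slow: "slow_chain m F" and st: "\<And>i h x. i \<le> m \<Longrightarrow> h \<in> B \<Longrightarrow> x \<in> F i \<Longrightarrow> h *v x \<in> F i"
    unfolding stable_chain_def by auto
  define E where "E = (\<lambda>i. if i \<le> m then F i else perp_chain U m F (i - m))"
  have E: "slow_chain (m + m) E" "selfdual_chain (m + m) E" "E (m + m) = U"
    unfolding E_def by (rule selfdual_chain_reflect[OF U(1,2) slow F(2,3)])+
  show ?thesis
  proof (rule that[OF E])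
    fix h i x assume h: "h \<in> B" and i: "i \<le> m + m" and x: "x \<in> E i"
    show "h *v x \<in> E i"
    proof (cases "i \<le> m")
      case False
      let ?j = "m - (i - m)"
      have sF: "vec.subspace (F ?j)" using slow unfolding slow_chain_def by auto
      have "h *v x \<in> U \<and> (\<forall>y\<in>F ?j. \<beta> (h *v x) y = 0)"
        using x False by (intro perp_stable[OF Binv[OF h] Biso[OF h] U(3)[OF h] sF st[OF _ h]])
          (auto simp: E_def perp_chain_def)
      then show ?thesis using False by (simp add: E_def perp_chain_def)
    qed (use st[OF _ h] x in \<open>auto simp: E_def\<close>)
  qed
qed

text \<open>
  The solvability of the stabilizer is seen on the complete flag of the whole space that runs first
  through \<open>F\<close> and then through the sums of \<open>U\<close> with the members of
  \<open>H\<close>.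
\<close>

lemma borel_orthogonal_chains:
  assumes dec: "direct_decomposition U W" and orth: "\<And>u w. u \<in> U \<Longrightarrow> w \<in> W \<Longrightarrow> \<beta> u w = 0"
    and nd: "nondegenerate_on \<beta> U" "nondegenerate_on \<beta> W"
    and B: "borel_subgroup B (GL\<lparr>carrier := isometries {U, W}\<rparr>)"
  obtains r F s H where "orthogonal_chains UNIV r F s H" "isometries (F ` {..r} \<union> H ` {..s}) \<subseteq> B"
    "\<And>i. i \<le> r \<Longrightarrow> vec.subspace (F i)" "\<And>i. i \<le> s \<Longrightarrow> vec.subspace (H i)"
proof -
  have sub: "vec.subspace U" "vec.subspace W" and sum: "\<And>v. \<exists>u\<in>U. \<exists>w\<in>W. v = u + w"
    using dec unfolding direct_decomposition_def by auto
  then have subK: "\<And>Y. Y \<in> {U, W} \<Longrightarrow> vec.subspace Y" by blast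
  obtain n where B1: "solvable_connected B n" and BK: "B \<subseteq> isometries {U, W}"
    by (rule borel_solvable_connected[OF subK B]) (assumption, rule that)
  have Biso: "\<beta> (h *v x) (h *v y) = \<beta> x y" "invertible h" if "h \<in> B" for h x y
    using subsetD[OF BK that] by (auto simp: isometries_def)
  have BU: "h *v x \<in> U" if "h \<in> B" "x \<in> U" for h x using subsetD[OF BK that(1)] that(2) by (simp add: isometries_def)
  have BW: "h *v x \<in> W" if "h \<in> B" "x \<in> W" for h x using subsetD[OF BK that(1)] that(2) by (simp add: isometries_def)
  obtain r F where F: "slow_chain r F" "selfdual_chain r F" "F r = U"
    "\<And>h i x. h \<in> B \<Longrightarrow> i \<le> r \<Longrightarrow> x \<in> F i \<Longrightarrow> h *v x \<in> F i"
    by (rule stable_selfdual_chain[OF B1 Biso(1) Biso(2) sub(1) nd(1) BU]) (assumption+, rule that)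
  obtain s H where H: "slow_chain s H" "selfdual_chain s H" "H s = W"
    "\<And>h i x. h \<in> B \<Longrightarrow> i \<le> s \<Longrightarrow> x \<in> H i \<Longrightarrow> h *v x \<in> H i"
    by (rule stable_selfdual_chain[OF B1 Biso(1) Biso(2) sub(2) nd(2) BW]) (assumption+, rule that)
  have chains: "orthogonal_chains UNIV r F s H"
    unfolding orthogonal_chains_def using nondegenerate F(2,3) H(2,3) sum orth by auto
  let ?Y = "F ` {..r} \<union> H ` {..s}"
  have subF: "vec.subspace (F i)" if "i \<le> r" for i using F(1) that unfolding slow_chain_def by auto
  have subH: "vec.subspace (H i)" if "i \<le> s" for i using H(1) that unfolding slow_chain_def by auto
  have subY: "vec.subspace Y" if "Y \<in> ?Y" for Y using that subF subH by auto
  have UWY: "U \<in> ?Y" "W \<in> ?Y" using F(3) H(3) by auto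
  have "isometries ?Y \<subseteq> B"
  proof (rule borel_contains_isometries[OF subK subY _ B])
    show "isometries ?Y \<subseteq> isometries {U, W}" using UWY unfolding isometries_def by blast
    show "B \<subseteq> isometries ?Y"
    proof
      fix h assume h: "h \<in> B"
      have "h *v y \<in> Y" if "Y \<in> ?Y" "y \<in> Y" for Y y using that F(4)[OF h] H(4)[OF h] by auto
      then show "h \<in> isometries ?Y" using Biso[OF h] by (simp add: isometries_def)
    qed
    show "connectedin zariski (isometries ?Y)"
      using chains F(1) H(1) by (rule connectedin_isometries_orthogonal_chains)
    let ?G = "\<lambda>j. {u + h | u h. u \<in> U \<and> h \<in> H j}"
    have H0: "H 0 = {0}" using H(2) unfolding selfdual_chain_def by blast
    have G0: "F r = ?G 0" unfolding F(3) H0 by auto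
    define E where "E i = (if i \<le> r then F i else ?G (i - r))" for i
    have E: "slow_chain (r + s) E"
      unfolding E_def by (rule slow_chain_append[OF F(1) slow_chain_sum[OF sub(1) H(1)] G0])
    show "\<exists>n. (derived GL ^^ n) (isometries ?Y) = {mat 1}"
    proof (rule flag_stabilizer_solvable[OF E _ _ subgroup_isometries[OF subY]])
      show "E 0 = {0}" using F(2) by (simp add: E_def selfdual_chain_def)
      have "E (r + s) = ?G s" using G0 by (cases "s = 0") (auto simp: E_def)
      also have "\<dots> = UNIV" unfolding H(3) using sum by blast
      finally show "E (r + s) = UNIV" .
      fix g i x assume g: "g \<in> isometries ?Y" and i: "i \<le> r + s" and x: "x \<in> E i"
      have gF: "g *v x \<in> F j" if "j \<le> r" "x \<in> F j" for j x using g that unfolding isometries_def by blast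
      have gH: "g *v x \<in> H j" if "j \<le> s" "x \<in> H j" for j x using g that unfolding isometries_def by blast
      show "g *v x \<in> E i"
      proof (cases "i \<le> r")
        case False
        then obtain u h where uh: "u \<in> U" "h \<in> H (i - r)" "x = u + h" using x unfolding E_def by auto
        have "g *v u \<in> U" using gF[of r u] uh(1) F(3) by simp
        moreover have "g *v h \<in> H (i - r)" using gH[of "i - r" h] uh(2) i by simp
        ultimately show ?thesis using False uh(3) by (auto simp: E_def vec.add)
      qed (use gF x in \<open>auto simp: E_def\<close>)
    qed
  qed
  with chains show ?thesis using subF subH by (rule that)
qed

section \<open>Orbits on the double flag variety\<close>

lemma subgroup_inv: "subgroup S GL \<Longrightarrow> x \<in> S \<Longrightarrow> matrix_inv x \<in> S"
  using subgroup.m_inv_closed[of S GL x] subgroup.subset[of S GL] inv_GL[of x] by auto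

lemma Sp_eq: "Sp \<beta> = GL\<lparr>carrier := isometries {}\<rparr>"
  by (simp add: Sp_def GL_def isometries_def)

lemma Sp_carrier_update: "Sp \<beta>\<lparr>carrier := K\<rparr> = GL\<lparr>carrier := K\<rparr>"
  by (simp add: Sp_def GL_def)

lemma image_eq_iff_stable:
  fixes A :: "complex ^ 'd ^ 'd"
  assumes "invertible A" "vec.subspace U"
  shows "(*v) A ` U = U \<longleftrightarrow> (\<forall>x\<in>U. A *v x \<in> U)"
proof
  assume st: "\<forall>x\<in>U. A *v x \<in> U"
  have "x \<in> (*v) A ` U" if "x \<in> U" for x
  proof
    show "x = A *v (matrix_inv A *v x)"
      using matrix_inv_mult(1)[OF assms(1)] by (simp add: matrix_vector_mul_assoc)
    show "matrix_inv A *v x \<in> U" using assms(2,1) st that by (intro stable_inverse) auto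
  qed
  then show "(*v) A ` U = U" using st by blast
qed blast

lemma stab_isometries:
  assumes "vec.subspace U"
  shows "stab (GL\<lparr>carrier := isometries \<Y>\<rparr>) U = isometries (insert U \<Y>)"
  using image_eq_iff_stable[OF _ assms] unfolding stabilizer_def isometries_def by auto

text \<open>
  The orbit of \<open>(g P, k Q)\<close> depends only on \<open>k\<^sup>-\<^sup>1 g\<close>, and it is
  denoted by \<open>\<Phi> (k\<^sup>-\<^sup>1 g)\<close>. As \<open>\<Phi>\<close> is invariant under
  \<open>Q\<close> on the left and under \<open>P\<close> on the right, \<open>\<Phi> g\<close>
  depends only on the type of the subspace \<open>g X0\<close>.
\<close>

lemma finite_orbits_of_types:
  assumes X0: "vec.subspace X0" and K: "\<And>Y. Y \<in> \<K> \<Longrightarrow> vec.subspace Y"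
    and Q: "subgroup Q (GL\<lparr>carrier := isometries \<K>\<rparr>)" and Y: "isometries \<Y> \<subseteq> Q"
    and S: "\<And>g. g \<in> isometries {} \<Longrightarrow> (*v) g ` X0 \<in> S" and fin: "finitely_many_types \<Y> S"
  shows "finite (orbits (Sp \<beta>\<lparr>carrier := isometries \<K>\<rparr>) (double_flag (Sp \<beta>) (isometries \<K>) (stab (Sp \<beta>) X0) Q)
    (diagonal_action (Sp \<beta>) (isometries \<K>) (stab (Sp \<beta>) X0) Q))"
proof -
  let ?G = "isometries {}" and ?K = "isometries \<K>"
  define P where "P = stab (Sp \<beta>) X0"
  have P_eq: "P = isometries {X0}" unfolding P_def Sp_eq by (rule stab_isometries[OF X0])
  have sG: "subgroup ?G GL" by (rule subgroup_isometries) simp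
  have sK: "subgroup ?K GL" using K by (rule subgroup_isometries)
  have sP: "subgroup P GL" unfolding P_eq using X0 by (intro subgroup_isometries) simp
  have sQ: "subgroup Q GL" using GL.incl_subgroup[OF sK Q] .
  have QK: "Q \<subseteq> ?K" using subgroup.subset[OF Q] by simp
  have KG: "?K \<subseteq> ?G" unfolding isometries_def by blast
  have Ginv: "invertible g" if "g \<in> ?G" for g using that by (simp add: isometries_def)
  have mult: "a ** b \<in> S" if "subgroup S GL" "a \<in> S" "b \<in> S" for a b S
    using subgroup.m_closed[OF that] by simp
  define coset where "coset g R = (\<lambda>h. g ** h) ` R" for g :: "complex ^ 'd ^ 'd" and R :: "(complex ^ 'd ^ 'd) set"
  have l_coset: "g <#\<^bsub>Sp \<beta>\<^esub> R = coset g R" "g <#\<^bsub>Sp \<beta>\<lparr>carrier := ?K\<rparr>\<^esub> R = coset g R" for g R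
    unfolding l_coset_def coset_def by (auto simp: Sp_def)
  have coset_mult: "coset (a ** b) R = coset a (coset b R)" for a b R
    unfolding coset_def image_image by (simp add: matrix_mul_assoc)
  have coset_self: "coset p R = R" if R: "subgroup R GL" "p \<in> R" for p R
  proof (intro subset_antisym subsetI)
    have pinv: "invertible p" using subgroup.subset[OF R(1)] R(2) by auto
    fix x assume x: "x \<in> R"
    have "x = p ** (matrix_inv p ** x)" using matrix_inv_mult(1)[OF pinv] by (simp add: matrix_mul_assoc)
    moreover have "matrix_inv p ** x \<in> R" using mult[OF R(1) subgroup_inv[OF R] x] .
    ultimately show "x \<in> coset p R" unfolding coset_def by blast
  qed (use mult[OF R(1) R(2)] in \<open>auto simp: coset_def\<close>)
  define \<Phi> where "\<Phi> g = (\<lambda>k. (coset (k ** g) P, coset k Q)) ` ?K" for g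
  have \<Phi>_Q: "\<Phi> (a ** g) = \<Phi> g" if a: "a \<in> Q" for a g
  proof -
    have aK: "a \<in> ?K" using a QK by blast
    have ainv: "invertible a" using aK KG Ginv by blast
    have bij: "(\<lambda>k. k ** a) ` ?K = ?K"
    proof (intro subset_antisym subsetI)
      fix x assume x: "x \<in> ?K"
      have "x = (x ** matrix_inv a) ** a" using matrix_inv_mult(2)[OF ainv] by (simp add: matrix_mul_assoc[symmetric])
      moreover have "x ** matrix_inv a \<in> ?K" using mult[OF sK x subgroup_inv[OF sK aK]] .
      ultimately show "x \<in> (\<lambda>k. k ** a) ` ?K" by blast
    qed (use mult[OF sK _ aK] in auto)
    have "\<Phi> g = (\<lambda>k. (coset (k ** g) P, coset k Q)) ` ((\<lambda>k. k ** a) ` ?K)" unfolding \<Phi>_def bij ..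
    also have "\<dots> = (\<lambda>k. (coset (k ** (a ** g)) P, coset k Q)) ` ?K"
      unfolding image_image by (simp add: coset_mult[of _ a Q] coset_self[OF sQ a] matrix_mul_assoc)
    finally show ?thesis unfolding \<Phi>_def ..
  qed
  have \<Phi>_P: "\<Phi> (g ** p) = \<Phi> g" if p: "p \<in> P" for g p
    unfolding \<Phi>_def by (simp add: matrix_mul_assoc coset_mult[of _ p P] coset_self[OF sP p])
  obtain T where T: "finite T" "\<And>X. X \<in> S \<Longrightarrow> \<exists>X'\<in>T. \<exists>g. Vector_Spaces.linear (*s) (*s) g \<and>
     (\<forall>x y. \<beta> (g x) (g y) = \<beta> x y) \<and> (\<forall>Z\<in>\<Y>. g ` Z \<subseteq> Z) \<and> g ` X = X'"
    using fin unfolding finitely_many_types_def by blast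
  have normal: "\<exists>t. t \<in> T \<and> (\<exists>a\<in>isometries \<Y>. (*v) (a ** g) ` X0 = t)" if g: "g \<in> ?G" for g
  proof -
    obtain t h where t: "t \<in> T" and h: "Vector_Spaces.linear (*s) (*s) h" "\<forall>x y. \<beta> (h x) (h y) = \<beta> x y"
      "\<forall>Z\<in>\<Y>. h ` Z \<subseteq> Z" "h ` ((*v) g ` X0) = t" using T(2)[OF S[OF g]] by blast
    have "matrix h \<in> isometries \<Y>"
      by (rule isometry_in_isometries[OF nondegenerate h(1)]) (use h(2,3) in \<open>simp, blast\<close>)
    moreover have "(*v) (matrix h ** g) ` X0 = t"
      using h(4) by (simp add: image_image matrix_vector_mul_assoc[symmetric] matrix_works[OF h(1)])
    ultimately show ?thesis using t by blast
  qed
  define \<tau> where "\<tau> g = (SOME t. t \<in> T \<and> (\<exists>a\<in>isometries \<Y>. (*v) (a ** g) ` X0 = t))" for g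
  have \<tau>: "\<tau> g \<in> T \<and> (\<exists>a\<in>isometries \<Y>. (*v) (a ** g) ` X0 = \<tau> g)" if "g \<in> ?G" for g
    unfolding \<tau>_def by (rule someI_ex[OF normal[OF that]])
  have \<Phi>_\<tau>: "\<Phi> g = \<Phi> g'" if g: "g \<in> ?G" "g' \<in> ?G" "\<tau> g = \<tau> g'" for g g'
  proof -
    obtain a a' where a: "a \<in> isometries \<Y>" "(*v) (a ** g) ` X0 = \<tau> g"
      "a' \<in> isometries \<Y>" "(*v) (a' ** g') ` X0 = \<tau> g"
      using \<tau>[OF g(1)] \<tau>[OF g(2)] g(3) by metis
    have aQ: "a \<in> Q" "a' \<in> Q" using a Y by auto
    have ag: "a ** g \<in> ?G" "a' ** g' \<in> ?G" using mult[OF sG] aQ QK KG g by blast+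
    let ?p = "matrix_inv (a' ** g') ** (a ** g)"
    have pG: "?p \<in> ?G" using mult[OF sG subgroup_inv[OF sG ag(2)] ag(1)] .
    have "(*v) ?p ` X0 = (*v) (matrix_inv (a' ** g')) ` ((*v) (a ** g) ` X0)"
      by (simp add: image_image matrix_vector_mul_assoc)
    also have "\<dots> = (*v) (matrix_inv (a' ** g')) ` ((*v) (a' ** g') ` X0)" using a by simp
    also have "\<dots> = X0"
      by (simp add: image_image matrix_vector_mul_assoc matrix_inv_mult(2)[OF Ginv[OF ag(2)]])
    finally have "?p \<in> P"
      using pG image_eq_iff_stable[OF Ginv[OF pG] X0] unfolding P_eq isometries_def by auto
    then have "\<Phi> ((a' ** g') ** ?p) = \<Phi> (a' ** g')" by (rule \<Phi>_P)
    moreover have "(a' ** g') ** ?p = a ** g"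
      using matrix_inv_mult(1)[OF Ginv[OF ag(2)]] by (simp add: matrix_mul_assoc)
    ultimately show ?thesis using \<Phi>_Q[OF aQ(1)] \<Phi>_Q[OF aQ(2)] by simp
  qed
  have "\<Phi> ` ?G \<subseteq> (\<lambda>t. \<Phi> (inv_into ?G \<tau> t)) ` (\<tau> ` ?G)"
  proof
    fix y assume "y \<in> \<Phi> ` ?G"
    then obtain g where g: "g \<in> ?G" "y = \<Phi> g" by blast
    have "inv_into ?G \<tau> (\<tau> g) \<in> ?G" "\<tau> (inv_into ?G \<tau> (\<tau> g)) = \<tau> g"
      using inv_into_into[OF imageI[OF g(1)]] f_inv_into_f[OF imageI[OF g(1)]] by blast+
    then have "y = \<Phi> (inv_into ?G \<tau> (\<tau> g))" using \<Phi>_\<tau>[OF _ g(1)] g(2) by simp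
    then show "y \<in> (\<lambda>t. \<Phi> (inv_into ?G \<tau> t)) ` (\<tau> ` ?G)" using g(1) by blast
  qed
  moreover have "finite (\<tau> ` ?G)" using T(1) by (rule finite_subset[rotated]) (use \<tau> in blast)
  ultimately have fin\<Phi>: "finite (\<Phi> ` ?G)" by (meson finite_imageI finite_subset)
  have "orbits (Sp \<beta>\<lparr>carrier := ?K\<rparr>) (double_flag (Sp \<beta>) ?K P Q) (diagonal_action (Sp \<beta>) ?K P Q) \<subseteq> \<Phi> ` ?G"
  proof
    fix orb assume "orb \<in> orbits (Sp \<beta>\<lparr>carrier := ?K\<rparr>) (double_flag (Sp \<beta>) ?K P Q) (diagonal_action (Sp \<beta>) ?K P Q)"
    then obtain x where x: "x \<in> double_flag (Sp \<beta>) ?K P Q"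
      "orb = orbit (Sp \<beta>\<lparr>carrier := ?K\<rparr>) (diagonal_action (Sp \<beta>) ?K P Q) x" unfolding orbits_def by blast
    have carG: "carrier (Sp \<beta>) = ?G" unfolding Sp_eq by simp
    obtain g k0 where g: "g \<in> ?G" and k0: "k0 \<in> ?K" and xg: "x = (coset g P, coset k0 Q)"
      using x(1) unfolding double_flag_def LCOSETS_def l_coset carG by auto
    have k0inv: "invertible k0" using k0 KG Ginv by blast
    have act: "diagonal_action (Sp \<beta>) ?K P Q k x = (coset (k ** g) P, coset (k ** k0) Q)" for k
      using x(1) unfolding diagonal_action_def xg by (simp add: l_coset coset_mult)
    have "orb = (\<lambda>k. (coset (k ** g) P, coset (k ** k0) Q)) ` ?K"
      unfolding x(2) orbit_def act by auto
    also have "\<dots> = (\<lambda>k. (coset (k ** (matrix_inv k0 ** g)) P, coset k Q)) ` ((\<lambda>k. k ** k0) ` ?K)"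
    proof -
      have e: "(k ** k0) ** (matrix_inv k0 ** g) = k ** g" for k
      proof -
        have "(k ** k0) ** (matrix_inv k0 ** g) = k ** (k0 ** matrix_inv k0) ** g" by (simp only: matrix_mul_assoc)
        then show ?thesis by (simp only: matrix_inv_mult(1)[OF k0inv] matrix_mul_rid)
      qed
      show ?thesis unfolding image_image e ..
    qed
    also have "(\<lambda>k. k ** k0) ` ?K = ?K"
    proof (intro subset_antisym subsetI)
      fix x assume x: "x \<in> ?K"
      have "x = (x ** matrix_inv k0) ** k0" using matrix_inv_mult(2)[OF k0inv] by (simp add: matrix_mul_assoc[symmetric])
      moreover have "x ** matrix_inv k0 \<in> ?K" using mult[OF sK x subgroup_inv[OF sK k0]] .
      ultimately show "x \<in> (\<lambda>k. k ** k0) ` ?K" by blast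
    qed (use mult[OF sK _ k0] in auto)
    finally have "orb = \<Phi> (matrix_inv k0 ** g)" unfolding \<Phi>_def .
    moreover have "matrix_inv k0 ** g \<in> ?G" using mult[OF sG] subgroup_inv[OF sK k0] KG g by blast
    ultimately show "orb \<in> \<Phi> ` ?G" by blast
  qed
  then show ?thesis using fin\<Phi> unfolding P_def by (rule finite_subset)
qed

end

section \<open>The finiteness theorem\<close>

context symplectic
begin

lemma lagrangian_of_image:
  assumes g: "g \<in> isometries {}" and L: "lagrangian_of UNIV L"
  shows "lagrangian_of UNIV ((*v) g ` L)"
proof -
  have inv: "invertible g" and iso: "\<And>x y. \<beta> (g *v x) (g *v y) = \<beta> x y" using g by (auto simp: isometries_def)
  have gi: "g *v (matrix_inv g *v x) = x" for x
    using matrix_inv_mult(1)[OF inv] by (simp add: matrix_vector_mul_assoc)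
  have "x \<in> (*v) g ` L \<longleftrightarrow> (\<forall>y\<in>(*v) g ` L. \<beta> x y = 0)" for x
  proof
    assume "x \<in> (*v) g ` L"
    then obtain z where z: "z \<in> L" "x = g *v z" by blast
    have "\<beta> z y = 0" if "y \<in> L" for y using L z(1) that unfolding lagrangian_of_def by blast
    then show "\<forall>y\<in>(*v) g ` L. \<beta> x y = 0" unfolding z(2) using iso by simp
  next
    assume "\<forall>y\<in>(*v) g ` L. \<beta> x y = 0"
    then have "\<beta> (matrix_inv g *v x) y = 0" if "y \<in> L" for y
      using that iso[of "matrix_inv g *v x" y] gi by simp
    then have "matrix_inv g *v x \<in> L" using L unfolding lagrangian_of_def by blast
    then show "x \<in> (*v) g ` L" using gi[of x] by (metis imageI)
  qed
  moreover have "vec.subspace ((*v) g ` L)"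
    using L unfolding lagrangian_of_def by (intro vec.subspace_image) auto
  ultimately show ?thesis unfolding lagrangian_of_def by blast
qed

lemma isotropic_image:
  assumes "g \<in> isometries {}" "isotropic \<beta> X"
  shows "isotropic \<beta> ((*v) g ` X)"
  using assms unfolding isotropic_def isometries_def by (auto intro: vec.subspace_image)

lemma span_singleton_image: "(*v) g ` vec.span {v} = vec.span {g *v v}"
  using vec.span_image[of g "{v}"] by simp

lemma stab_Int:
  assumes "vec.subspace U" "vec.subspace W"
  shows "stab (Sp \<beta>) U \<inter> stab (Sp \<beta>) W = isometries {U, W}"
  unfolding Sp_eq stab_isometries[OF assms(1)] stab_isometries[OF assms(2)] unfolding isometries_def by blast

lemma finitely_many_types_polarization:
  assumes U: "lagrangian_of UNIV U" and W: "lagrangian_of UNIV W" and dec: "direct_decomposition U W"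
    and Q: "parabolic_subgroup Q (GL\<lparr>carrier := isometries {U, W}\<rparr>)"
  obtains \<Y> where "isometries \<Y> \<subseteq> Q" "finitely_many_types \<Y> {L. lagrangian_of UNIV L}"
    "finitely_many_types \<Y> (range (\<lambda>v. vec.span {v}))"
proof -
  obtain B where B: "borel_subgroup B (GL\<lparr>carrier := isometries {U, W}\<rparr>)" "B \<subseteq> Q"
    using Q unfolding parabolic_subgroup_def by blast
  obtain r F where F: "polarized_chain UNIV W r F" "isometries (insert W (F ` {..r})) \<subseteq> B"
    by (rule borel_polarized_chain[OF U W dec B(1)]) (rule that)
  let ?Y = "insert W (F ` {..r})"
  note D = polarized_chainD[OF F(1)]
  have sub: "vec.subspace Z" if "Z \<in> ?Y" for Z using that D(5,11) by auto
  show ?thesis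
  proof (rule that)
    show "isometries ?Y \<subseteq> Q" using F(2) B(2) by blast
    show "finitely_many_types ?Y {L. lagrangian_of UNIV L}"
      by (rule finitely_many_types_from_normal_bases[OF _ sub])
        (auto simp: lagrangian_of_def[of _ L for L] intro: polarized_chain_lagrangian[OF F(1)])
    show "finitely_many_types ?Y (range (\<lambda>v. vec.span {v}))"
      by (rule finitely_many_types_from_normal_bases[OF _ sub]) (auto intro: polarized_chain_line[OF F(1)])
  qed
qed

lemma finitely_many_types_orthogonal_decomposition:
  assumes dec: "direct_decomposition U W" and orth: "\<And>u w. u \<in> U \<Longrightarrow> w \<in> W \<Longrightarrow> \<beta> u w = 0"
    and nd: "nondegenerate_on \<beta> U" "nondegenerate_on \<beta> W"
    and Q: "parabolic_subgroup Q (GL\<lparr>carrier := isometries {U, W}\<rparr>)"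
  obtains \<Y> where "isometries \<Y> \<subseteq> Q" "finitely_many_types \<Y> {L. lagrangian_of UNIV L}"
    "finitely_many_types \<Y> (range (\<lambda>v. vec.span {v}))"
proof -
  obtain B where B: "borel_subgroup B (GL\<lparr>carrier := isometries {U, W}\<rparr>)" "B \<subseteq> Q"
    using Q unfolding parabolic_subgroup_def by blast
  obtain r F s H where C: "orthogonal_chains UNIV r F s H" "isometries (F ` {..r} \<union> H ` {..s}) \<subseteq> B"
    and sF: "\<And>i. i \<le> r \<Longrightarrow> vec.subspace (F i)" and sH: "\<And>i. i \<le> s \<Longrightarrow> vec.subspace (H i)"
    by (rule borel_orthogonal_chains[OF dec orth nd B(1)]) (assumption+, rule that)
  let ?Y = "F ` {..r} \<union> H ` {..s}"
  have sub: "vec.subspace Z" if "Z \<in> ?Y" for Z using that sF sH by auto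
  show ?thesis
  proof (rule that)
    show "isometries ?Y \<subseteq> Q" using C(2) B(2) by blast
    show "finitely_many_types ?Y {L. lagrangian_of UNIV L}"
    proof (rule finitely_many_types_from_normal_bases[OF _ sub])
      fix L assume "L \<in> {L. lagrangian_of UNIV L}"
      then have L: "lagrangian_of UNIV L" by simp
      show "vec.subspace L" using L by (simp add: lagrangian_of_def)
      show "has_normal_basis \<beta> UNIV (insert L ?Y)" using C(1) L by (rule orthogonal_chains_lagrangian)
    qed auto
    show "finitely_many_types ?Y (range (\<lambda>v. vec.span {v}))"
      by (rule finitely_many_types_from_normal_bases[OF _ sub]) (auto intro: orthogonal_chains_line[OF C(1)])
  qed
qed

lemma finite_orbits_lagrangian_or_line:
  assumes sub: "\<And>Y. Y \<in> \<K> \<Longrightarrow> vec.subspace Y" and Q: "parabolic_subgroup Q (GL\<lparr>carrier := isometries \<K>\<rparr>)"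
    and Y: "isometries \<Y> \<subseteq> Q" "finitely_many_types \<Y> {L. lagrangian_of UNIV L}"
      "finitely_many_types \<Y> (range (\<lambda>v. vec.span {v}))"
    and P: "siegel_parabolic \<beta> P \<or> isotropic_parabolic \<beta> 1 P"
  shows "finite (orbits (Sp \<beta>\<lparr>carrier := isometries \<K>\<rparr>) (double_flag (Sp \<beta>) (isometries \<K>) P Q)
    (diagonal_action (Sp \<beta>) (isometries \<K>) P Q))"
proof -
  have sQ: "subgroup Q (GL\<lparr>carrier := isometries \<K>\<rparr>)"
    using Q unfolding parabolic_subgroup_def zariski_closed_subgroup_def by blast
  show ?thesis
    using P
  proof
    assume "siegel_parabolic \<beta> P"
    then obtain X where L: "lagrangian_in \<beta> UNIV X" and P_def: "P = stab (Sp \<beta>) X"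
      unfolding siegel_parabolic_def by (elim exE conjE)
    have X: "lagrangian_of UNIV X" using vec.subspace_UNIV nondegenerate L by (rule lagrangian_in_imp_of)
    then have sX: "vec.subspace X" by (simp add: lagrangian_of_def)
    show ?thesis
      unfolding P_def
    proof (rule finite_orbits_of_types[OF sX sub sQ Y(1) _ Y(2)])
      show "(*v) g ` X \<in> {L. lagrangian_of UNIV L}" if "g \<in> isometries {}" for g
        using lagrangian_of_image[OF that X] by simp
    qed
  next
    assume "isotropic_parabolic \<beta> 1 P"
    then obtain X where sX: "vec.subspace X" and dim: "vec.dim X = 1" and P_def: "P = stab (Sp \<beta>) X"
      unfolding isotropic_parabolic_def isotropic_def by (elim exE conjE)
    obtain B where B: "B \<subseteq> X" "X \<subseteq> vec.span B" "card B = vec.dim X"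
      by (rule vec.basis_exists[of X]) (rule that)
    obtain v where v: "B = {v}" using B(3) dim card_1_singletonE by metis
    have X: "X = vec.span {v}" using B(1,2) vec.span_minimal[OF B(1) sX] unfolding v by (intro subset_antisym)
    show ?thesis
      unfolding P_def
    proof (rule finite_orbits_of_types[OF sX sub sQ Y(1) _ Y(3)])
      show "(*v) g ` X \<in> range (\<lambda>v. vec.span {v})" for g
        unfolding X span_singleton_image by (rule rangeI)
    qed
  qed
qed

lemma finite_orbits_siegel_product:
  assumes dec: "direct_decomposition U W" and orth: "\<And>u w. u \<in> U \<Longrightarrow> w \<in> W \<Longrightarrow> \<beta> u w = 0"
    and nd: "nondegenerate_on \<beta> U" "nondegenerate_on \<beta> W"
    and P: "isotropic_parabolic \<beta> m P" and Q: "siegel_product \<beta> U W (isometries {U, W}) Q"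
  shows "finite (orbits (Sp \<beta>\<lparr>carrier := isometries {U, W}\<rparr>) (double_flag (Sp \<beta>) (isometries {U, W}) P Q)
    (diagonal_action (Sp \<beta>) (isometries {U, W}) P Q))"
proof -
  have UW: "vec.subspace U" "vec.subspace W" using dec by (auto simp: direct_decomposition_def)
  then have sub: "\<And>Y. Y \<in> {U, W} \<Longrightarrow> vec.subspace Y" by blast
  obtain X where X: "isotropic \<beta> X" "P = stab (Sp \<beta>) X" using P unfolding isotropic_parabolic_def by blast
  then have sX: "vec.subspace X" by (simp add: isotropic_def)
  obtain L M where LM: "lagrangian_in \<beta> U L" "lagrangian_in \<beta> W M"
    and Q_def: "Q = stab (Sp \<beta>\<lparr>carrier := isometries {U, W}\<rparr>) L \<inter> stab (Sp \<beta>\<lparr>carrier := isometries {U, W}\<rparr>) M"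
    using Q unfolding siegel_product_def by blast
  have L: "lagrangian_of U L" "vec.subspace L"
    using lagrangian_in_imp_of[OF UW(1) nd(1) LM(1)] by (auto simp: lagrangian_of_def)
  have M: "lagrangian_of W M" "vec.subspace M"
    using lagrangian_in_imp_of[OF UW(2) nd(2) LM(2)] by (auto simp: lagrangian_of_def)
  have Q_eq: "Q = isometries {U, W, L, M}"
    unfolding Q_def Sp_carrier_update stab_isometries[OF L(2)] stab_isometries[OF M(2)]
    unfolding isometries_def by blast
  have "subgroup (isometries {U, W}) GL" "subgroup Q GL"
    unfolding Q_eq by (rule subgroup_isometries; use UW L(2) M(2) in blast)+
  moreover have "Q \<subseteq> isometries {U, W}" unfolding Q_eq isometries_def by blast
  ultimately have sQ: "subgroup Q (GL\<lparr>carrier := isometries {U, W}\<rparr>)" using GL.subgroup_incl by blast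
  have fin: "finitely_many_types {U, W, L, M} {X. isotropic \<beta> X}"
    by (rule finitely_many_types_lagrangian_pair[OF dec orth nd L(1) M(1)])
  show ?thesis
    unfolding X(2)
    by (rule finite_orbits_of_types[OF sX sub sQ eq_refl[OF Q_eq[symmetric]] _ fin]) (use X(1) isotropic_image in auto)
qed

end

theorem proposition7p1:
  fixes \<omega> :: "complex ^ 'd \<Rightarrow> complex ^ 'd \<Rightarrow> complex"
    and n :: nat
    and K P Q :: "(complex ^ 'd ^ 'd) set"
  assumes "CARD('d) = 2 * n"
    and "symplectic_form \<omega>"
    and "((type_CI \<omega> K \<or> (\<exists>p q U W. n = p + q \<and> type_CII \<omega> p q U W K)) \<and>
            siegel_parabolic \<omega> P \<and> parabolic_subgroup Q (Sp \<omega>\<lparr>carrier := K\<rparr>)) \<or>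
         ((type_CI \<omega> K \<or> (\<exists>p q U W. n = p + q \<and> type_CII \<omega> p q U W K)) \<and>
            isotropic_parabolic \<omega> 1 P \<and> parabolic_subgroup Q (Sp \<omega>\<lparr>carrier := K\<rparr>)) \<or>
         (\<exists>p q U W m. n = p + q \<and> type_CII \<omega> p q U W K \<and>
            1 < m \<and> m < n \<and> isotropic_parabolic \<omega> m P \<and> siegel_product \<omega> U W K Q)"
  shows "finite (orbits (Sp \<omega>\<lparr>carrier := K\<rparr>) (double_flag (Sp \<omega>) K P Q)
           (diagonal_action (Sp \<omega>) K P Q))"
proof -
  interpret symplectic \<omega>
    using assms(2) unfolding symplectic_form_def by (intro symplectic.intro alternating.intro symplectic_axioms.intro) simp_all
  have lagr: "lagrangian_of UNIV U" if "lagrangian_in \<omega> UNIV U" for U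
    using vec.subspace_UNIV nondegenerate that by (rule lagrangian_in_imp_of)
  have CI_CII: ?thesis
    if K: "type_CI \<omega> K \<or> (\<exists>p q U W. n = p + q \<and> type_CII \<omega> p q U W K)"
      and P: "siegel_parabolic \<omega> P \<or> isotropic_parabolic \<omega> 1 P"
      and Q: "parabolic_subgroup Q (Sp \<omega>\<lparr>carrier := K\<rparr>)"
  proof -
    from K show ?thesis
    proof
      assume "type_CI \<omega> K"
      then obtain U W where CI: "lagrangian_in \<omega> UNIV U" "lagrangian_in \<omega> UNIV W" "direct_decomposition U W"
        "K = stab (Sp \<omega>) U \<inter> stab (Sp \<omega>) W" unfolding type_CI_def by (elim exE conjE)
      have sub: "vec.subspace U" "vec.subspace W" using CI(3) by (auto simp: direct_decomposition_def)
      have K_eq: "K = isometries {U, W}" unfolding CI(4) using sub by (rule stab_Int)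
      have Q: "parabolic_subgroup Q (GL\<lparr>carrier := isometries {U, W}\<rparr>)" using Q unfolding Sp_carrier_update K_eq .
      obtain \<Y> where Y: "isometries \<Y> \<subseteq> Q" "finitely_many_types \<Y> {L. lagrangian_of UNIV L}"
        "finitely_many_types \<Y> (range (\<lambda>v. vec.span {v}))"
        by (rule finitely_many_types_polarization[OF lagr[OF CI(1)] lagr[OF CI(2)] CI(3) Q]) (rule that)
      show ?thesis unfolding K_eq by (rule finite_orbits_lagrangian_or_line[OF _ Q Y P]) (use sub in blast)
    next
      assume "\<exists>p q U W. n = p + q \<and> type_CII \<omega> p q U W K"
      then obtain p q U W where CII: "type_CII \<omega> p q U W K" by blast
      have dec: "direct_decomposition U W" and orth: "\<And>u w. u \<in> U \<Longrightarrow> w \<in> W \<Longrightarrow> \<omega> u w = 0"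
        and nd: "nondegenerate_on \<omega> U" "nondegenerate_on \<omega> W" and K_def: "K = stab (Sp \<omega>) U \<inter> stab (Sp \<omega>) W"
        using CII unfolding type_CII_def by auto
      have sub: "vec.subspace U" "vec.subspace W" using dec by (auto simp: direct_decomposition_def)
      have K_eq: "K = isometries {U, W}" unfolding K_def using sub by (rule stab_Int)
      have Q: "parabolic_subgroup Q (GL\<lparr>carrier := isometries {U, W}\<rparr>)" using Q unfolding Sp_carrier_update K_eq .
      obtain \<Y> where Y: "isometries \<Y> \<subseteq> Q" "finitely_many_types \<Y> {L. lagrangian_of UNIV L}"
        "finitely_many_types \<Y> (range (\<lambda>v. vec.span {v}))"
        by (rule finitely_many_types_orthogonal_decomposition[OF dec _ nd Q]) (erule (1) orth, rule that)
      show ?thesis unfolding K_eq by (rule finite_orbits_lagrangian_or_line[OF _ Q Y P]) (use sub in blast)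
    qed
  qed
  have siegel: ?thesis
    if K: "type_CII \<omega> p q U W K" and P: "isotropic_parabolic \<omega> m P" and Q: "siegel_product \<omega> U W K Q" for p q U W m
  proof -
    have dec: "direct_decomposition U W" and orth: "\<And>u w. u \<in> U \<Longrightarrow> w \<in> W \<Longrightarrow> \<omega> u w = 0"
      and nd: "nondegenerate_on \<omega> U" "nondegenerate_on \<omega> W" and K_def: "K = stab (Sp \<omega>) U \<inter> stab (Sp \<omega>) W"
      using K unfolding type_CII_def by auto
    have K_eq: "K = isometries {U, W}"
      unfolding K_def by (rule stab_Int) (use dec in \<open>auto simp: direct_decomposition_def\<close>)
    show ?thesis using finite_orbits_siegel_product[OF dec orth nd P Q[unfolded K_eq]] unfolding K_eq by simp
  qed
  show ?thesis using assms(3) CI_CII siegel by (elim disjE exE conjE) blast+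
qed

end
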